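(* Let $\mathcal{I}'\subseteq\mathcal{I}$ and $\mathcal{J}'\subseteq\mathcal{J}$ be ideals of $R$ such that each of the pairs $\{\mathcal{I},\mathcal{J}\}$, $\{\mathcal{I}',\mathcal{J}\}$, $\{\mathcal{I},\mathcal{J}'\}$ is Tor-independent. Suppose $\mathcal{I}'\subseteq\mathcal{I}^2$, $\mathcal{J}'\subseteq\mathcal{J}^2$, $\mathcal{I}$ is generated by a regular sequence of $m$ elements, and $\mathcal{J}$ is generated by a regular sequence of $n$ elements. Set $F:=R/\langle\mathcal{I}',\mathcal{I}\mathcal{J},\mathcal{J}'\rangle$. Then for all $\ell\ge1$, \[\beta_{\ell}^{R}(F)=\sum_{t=1}^{\ell}\left(\beta_t^{R}(R/\mathcal{I}')\binom{n}{\ell-t}+\binom{m}{\ell-t}\beta_t^{R}(R/\mathcal{J}')\right)+\binom{m+n}{\ell+1}-\binom{m}{\ell+1}-\binom{n}{\ell+1}.\] In addition, if all the ideals are homogeneous (with $R$ standard graded), then for every internal degree $d\geq 0$, $\beta_{0,d}^R(F)=\beta_{0,d}^R\left(R/\mathcal{I}\mathcal{J}\right)$, and for $\ell>0$, \[\beta_{\ell,d}^R(F)=\beta_{\ell,d}^R\left(\frac{R}{\mathcal{I}\mathcal{J}}\right)+\sum_{i=1}^{\ell}\sum_{j=0}^d\beta_{i,j}^R\left(\frac{R}{\mathcal{I}'}\right)\beta_{\ell-i,d-j}^R\left(\frac{R}{\mathcal{J}}\right)+\sum_{i=1}^{\ell}\sum_{j=0}^d\beta_{i,j}^R\left(\frac{R}{\mathcal{I}}\right)\beta_{\ell-i,d-j}^R\left(\frac{R}{\mathcal{J}'}\right)\]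 where the last double sum is to be read with the roles of the two factors as in $\mathcal{X}\otimes_R\mathscr{T}_{\ge1}$, namely as $\sum_{i=1}^{\ell}\sum_{j=0}^d\beta_{\ell-i,d-j}^R\left(\frac{R}{\mathcal{I}}\right)\beta_{i,j}^R\left(\frac{R}{\mathcal{J}'}\right)$.
   Context: $R$ is a commutative noetherian ring that is either local with maximal ideal $\mathfrak{M}_R$ or standard graded with homogeneous maximal ideal $\mathfrak{M}_R$; in the graded case ideals are homogeneous and regular sequences consist of homogeneous elements. Ideals $\mathcal{A},\mathcal{B}$ are Tor-independent if $\operatorname{Tor}_i^R(R/\mathcal{A},R/\mathcal{B})=0$ for all $i\ge1$. $\beta_i^R(M)$ is the rank of the $i$-th module in a minimal free resolution of $M$ over $R$, and $\beta_{i,j}^R(M)$ is the number of generators of internal degree $j$ of the $i$-th module in a minimal graded free resolution. Here $\mathcal{X}$ and $\mathscr{T}_{\ge 1}$ denote the minimal free resolution of $R/\mathcal{I}$ and the part in homological degrees $\ge 1$ of the minimal free resolution of $R/\mathcal{J}'$. *)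

theory Defs
  imports "HOL-Algebra.Algebra"
begin

section \<open>Local rings, graded rings, homogeneous ideals, regular sequences\<close>

definition local_ring :: "('a, 'r) ring_scheme \<Rightarrow> 'a set \<Rightarrow> bool" where
  "local_ring R \<mm> \<longleftrightarrow> maximalideal \<mm> R \<and> (\<forall>\<nn>. maximalideal \<nn> R \<longrightarrow> \<nn> = \<mm>)"

text \<open>\<open>G d\<close> is the additive subgroup of elements of degree \<open>d\<close>, and the ring is the internal
  direct sum of these subgroups.\<close>

definition graded_ring :: "('a, 'r) ring_scheme \<Rightarrow> (nat \<Rightarrow> 'a set) \<Rightarrow> bool" where
  "graded_ring R G \<longleftrightarrow>
     (\<forall>d. additive_subgroup (G d) R) \<and>
     \<one>\<^bsub>R\<^esub> \<in> G 0 \<and>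
     (\<forall>d e. \<forall>x \<in> G d. \<forall>y \<in> G e. x \<otimes>\<^bsub>R\<^esub> y \<in> G (d + e)) \<and>
     (\<forall>x \<in> carrier R. \<exists>!c. (\<forall>d. c d \<in> G d) \<and> finite {d. c d \<noteq> \<zero>\<^bsub>R\<^esub>} \<and>
        x = finsum R c {d. c d \<noteq> \<zero>\<^bsub>R\<^esub>})"

definition homogeneous_elements :: "(nat \<Rightarrow> 'a set) \<Rightarrow> 'a set" where
  "homogeneous_elements G = (\<Union>d. G d)"

definition homogeneous_ideal ::
    "('a, 'r) ring_scheme \<Rightarrow> (nat \<Rightarrow> 'a set) \<Rightarrow> 'a set \<Rightarrow> bool" where
  "homogeneous_ideal R G A \<longleftrightarrow> ideal A R \<and> A = Idl\<^bsub>R\<^esub> (A \<inter> homogeneous_elements G)"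

text \<open>The ring is generated by its elements of degree one as an algebra over its subring of
  degree zero, and \<open>\<mm>\<close> is its only homogeneous maximal ideal. The subring of degree zero need
  not be a field; if it is, \<open>\<mm>\<close> is the irrelevant ideal.\<close>

definition standard_graded_ring ::
    "('a, 'r) ring_scheme \<Rightarrow> (nat \<Rightarrow> 'a set) \<Rightarrow> 'a set \<Rightarrow> bool" where
  "standard_graded_ring R G \<mm> \<longleftrightarrow>
     graded_ring R G \<and>
     generate_ring R (G 0 \<union> G 1) = carrier R \<and>
     maximalideal \<mm> R \<and> homogeneous_ideal R G \<mm> \<and>
     (\<forall>\<nn>. maximalideal \<nn> R \<and> homogeneous_ideal R G \<nn> \<longrightarrow> \<nn> = \<mm>)"

text \<open>Each entry is a non-zero-divisor modulo the ideal generated by its predecessors, and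
  the residue ring modulo the whole sequence is non-zero.\<close>

definition regular_sequence :: "('a, 'r) ring_scheme \<Rightarrow> 'a list \<Rightarrow> bool" where
  "regular_sequence R xs \<longleftrightarrow>
     set xs \<subseteq> carrier R \<and>
     (\<forall>i < length xs. \<forall>r \<in> carrier R.
        xs ! i \<otimes>\<^bsub>R\<^esub> r \<in> Idl\<^bsub>R\<^esub> (set (take i xs)) \<longrightarrow> r \<in> Idl\<^bsub>R\<^esub> (set (take i xs))) \<and>
     Idl\<^bsub>R\<^esub> (set xs) \<noteq> carrier R"

text \<open>The set \<open>H\<close> restricts the elements allowed in the sequence: it is the whole carrier in
  the local case and the set of homogeneous elements in the graded case.\<close>

definition generated_by_regular_sequence ::
    "('a, 'r) ring_scheme \<Rightarrow> 'a set \<Rightarrow> 'a set \<Rightarrow> nat \<Rightarrow> bool" where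
  "generated_by_regular_sequence R H A n \<longleftrightarrow>
     (\<exists>xs. length xs = n \<and> set xs \<subseteq> H \<and> regular_sequence R xs \<and> A = Idl\<^bsub>R\<^esub> (set xs))"


section \<open>Modules\<close>

definition quot_module :: "('a, 'r) ring_scheme \<Rightarrow> 'a set \<Rightarrow> ('a, 'a set) module" where
  "quot_module R A =
     \<lparr>carrier = carrier (R Quot A), monoid.mult = monoid.mult (R Quot A),
      one = \<one>\<^bsub>R Quot A\<^esub>, ring.zero = \<zero>\<^bsub>R Quot A\<^esub>, add = ring.add (R Quot A),
      smult = (\<lambda>r C. (A +>\<^bsub>R\<^esub> r) \<otimes>\<^bsub>R Quot A\<^esub> C)\<rparr>"

definition self_module :: "('a, 'r) ring_scheme \<Rightarrow> ('a, 'a) module" where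
  "self_module R =
     \<lparr>carrier = carrier R, monoid.mult = monoid.mult R, one = \<one>\<^bsub>R\<^esub>,
      ring.zero = \<zero>\<^bsub>R\<^esub>, add = ring.add R, smult = monoid.mult R\<rparr>"

text \<open>The direct sum of \<open>n\<close> copies of a module. The fields \<^const>\<open>monoid.mult\<close> and \<^const>\<open>one\<close>
  play no role for modules.\<close>

definition power_module :: "('a, 'b, 'm) module_scheme \<Rightarrow> nat \<Rightarrow> ('a, nat \<Rightarrow> 'b) module" where
  "power_module N n =
     \<lparr>carrier = {..<n} \<rightarrow>\<^sub>E carrier N, monoid.mult = undefined, one = undefined,
      ring.zero = (\<lambda>k\<in>{..<n}. \<zero>\<^bsub>N\<^esub>),
      add = (\<lambda>v w. \<lambda>k\<in>{..<n}. v k \<oplus>\<^bsub>N\<^esub> w k),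
      smult = (\<lambda>r v. \<lambda>k\<in>{..<n}. r \<odot>\<^bsub>N\<^esub> v k)\<rparr>"

abbreviation free_module :: "('a, 'r) ring_scheme \<Rightarrow> nat \<Rightarrow> ('a, nat \<Rightarrow> 'a) module" where
  "free_module R n \<equiv> power_module (self_module R) n"

text \<open>The map from the \<open>q\<close>-th to the \<open>p\<close>-th power of \<open>N\<close> given by the \<open>p \<times> q\<close> matrix \<open>A\<close> of
  ring elements.\<close>

definition matrix_map ::
    "('a, 'b, 'm) module_scheme \<Rightarrow> nat \<Rightarrow> nat \<Rightarrow> (nat \<Rightarrow> nat \<Rightarrow> 'a) \<Rightarrow> (nat \<Rightarrow> 'b) \<Rightarrow> nat \<Rightarrow> 'b"
  where
  "matrix_map N p q A v = (\<lambda>k\<in>{..<p}. \<Oplus>\<^bsub>N\<^esub>l\<in>{..<q}. A k l \<odot>\<^bsub>N\<^esub> v l)"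


section \<open>Free resolutions\<close>

text \<open>The \<open>i\<close>-th module of a resolution is \<open>free_module R (rank F i)\<close>. The map from the module
  with index \<open>Suc i\<close> to the one with index \<open>i\<close> has the matrix \<open>diff F i\<close>, and the augmentation
  sends the \<open>k\<close>-th basis vector of the \<open>0\<close>-th module to \<open>aug F k\<close>. All modules have finite rank;
  over a noetherian ring every finitely generated module has such a resolution.\<close>

record ('a, 'b) free_res =
  rank :: "nat \<Rightarrow> nat"
  diff :: "nat \<Rightarrow> nat \<Rightarrow> nat \<Rightarrow> 'a"
  aug :: "nat \<Rightarrow> 'b"

definition diff_map ::
    "('a, 'c, 'm) module_scheme \<Rightarrow> ('a, 'b, 'f) free_res_scheme \<Rightarrow> nat \<Rightarrow> (nat \<Rightarrow> 'c) \<Rightarrow> nat \<Rightarrow> 'c"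
  where
  "diff_map N F i = matrix_map N (rank F i) (rank F (Suc i)) (diff F i)"

definition aug_map ::
    "('a, 'b, 'm) module_scheme \<Rightarrow> ('a, 'b, 'f) free_res_scheme \<Rightarrow> (nat \<Rightarrow> 'a) \<Rightarrow> 'b" where
  "aug_map M F v = (\<Oplus>\<^bsub>M\<^esub>k\<in>{..<rank F 0}. v k \<odot>\<^bsub>M\<^esub> aug F k)"

definition free_resolution ::
    "('a, 'r) ring_scheme \<Rightarrow> ('a, 'b, 'm) module_scheme \<Rightarrow> ('a, 'b, 'f) free_res_scheme \<Rightarrow> bool"
  where
  "free_resolution R M F \<longleftrightarrow>
     (\<forall>i. \<forall>k < rank F i. \<forall>l < rank F (Suc i). diff F i k l \<in> carrier R) \<and>
     (\<forall>k < rank F 0. aug F k \<in> carrier M) \<and>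
     aug_map M F ` carrier (free_module R (rank F 0)) = carrier M \<and>
     {v \<in> carrier (free_module R (rank F 0)). aug_map M F v = \<zero>\<^bsub>M\<^esub>} =
       diff_map (self_module R) F 0 ` carrier (free_module R (rank F 1)) \<and>
     (\<forall>i. {v \<in> carrier (free_module R (rank F (Suc i))).
             diff_map (self_module R) F i v = \<zero>\<^bsub>free_module R (rank F i)\<^esub>} =
          diff_map (self_module R) F (Suc i) ` carrier (free_module R (rank F (Suc (Suc i)))))"

text \<open>Minimality: every differential maps into \<open>\<mm>\<close> times its target, that is, its matrix has
  entries in \<open>\<mm>\<close>. This determines the ranks, also over a graded ring that is not local, because
  the differentials vanish after tensoring with the residue field of \<open>\<mm>\<close>.\<close>

definition minimal_free_resolution ::
    "('a, 'r) ring_scheme \<Rightarrow> 'a set \<Rightarrow> ('a, 'b, 'm) module_scheme \<Rightarrow>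
     ('a, 'b, 'f) free_res_scheme \<Rightarrow> bool" where
  "minimal_free_resolution R \<mm> M F \<longleftrightarrow>
     free_resolution R M F \<and>
     (\<forall>i. \<forall>k < rank F i. \<forall>l < rank F (Suc i). diff F i k l \<in> \<mm>)"

definition betti ::
    "('a, 'r) ring_scheme \<Rightarrow> 'a set \<Rightarrow> ('a, 'b, 'm) module_scheme \<Rightarrow> nat \<Rightarrow> nat" where
  "betti R \<mm> M i =
     rank (SOME F :: ('a, 'b) free_res. minimal_free_resolution R \<mm> M F) i"


section \<open>Graded free resolutions\<close>

definition quot_grading ::
    "('a, 'r) ring_scheme \<Rightarrow> (nat \<Rightarrow> 'a set) \<Rightarrow> 'a set \<Rightarrow> nat \<Rightarrow> 'a set set" where
  "quot_grading R G A d = (\<lambda>x. A +>\<^bsub>R\<^esub> x) ` G d"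

text \<open>\<open>shift F i k\<close> is the internal degree of the \<open>k\<close>-th basis vector of the \<open>i\<close>-th module.\<close>

record ('a, 'b) graded_free_res = "('a, 'b) free_res" +
  shift :: "nat \<Rightarrow> nat \<Rightarrow> nat"

text \<open>The family \<open>Mg\<close> is the grading of \<open>M\<close>. That all maps preserve degrees means that the matrix
  entry from a generator of degree \<open>b\<close> to one of degree \<open>a\<close> is homogeneous of degree \<open>b - a\<close>, hence
  zero if \<open>b < a\<close>.\<close>

definition graded_free_resolution ::
    "('a, 'r) ring_scheme \<Rightarrow> (nat \<Rightarrow> 'a set) \<Rightarrow> ('a, 'b, 'm) module_scheme \<Rightarrow> (nat \<Rightarrow> 'b set) \<Rightarrow>
     ('a, 'b, 'f) graded_free_res_scheme \<Rightarrow> bool" where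
  "graded_free_resolution R G M Mg F \<longleftrightarrow>
     free_resolution R M F \<and>
     (\<forall>k < rank F 0. aug F k \<in> Mg (shift F 0 k)) \<and>
     (\<forall>i. \<forall>k < rank F i. \<forall>l < rank F (Suc i).
        diff F i k l \<in> (if shift F i k \<le> shift F (Suc i) l
                        then G (shift F (Suc i) l - shift F i k) else {\<zero>\<^bsub>R\<^esub>}))"

definition graded_betti ::
    "('a, 'r) ring_scheme \<Rightarrow> (nat \<Rightarrow> 'a set) \<Rightarrow> 'a set \<Rightarrow> ('a, 'b, 'm) module_scheme \<Rightarrow>
     (nat \<Rightarrow> 'b set) \<Rightarrow> nat \<Rightarrow> nat \<Rightarrow> nat" where
  "graded_betti R G \<mm> M Mg i j =
     (let F = (SOME F :: ('a, 'b) graded_free_res.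
                 graded_free_resolution R G M Mg F \<and> minimal_free_resolution R \<mm> M F)
      in card {k. k < rank F i \<and> shift F i k = j})"


section \<open>Tor\<close>

text \<open>The tensor product of a free module of rank \<open>b\<close> with \<open>N\<close> is the \<open>b\<close>-th power of \<open>N\<close>, so
  tensoring a free resolution \<open>F\<close> with \<open>N\<close> gives the complex with modules
  \<open>power_module N (rank F i)\<close> and the differentials of \<open>F\<close> read as matrices acting on \<open>N\<close>.\<close>

definition tensor_cycles ::
    "('a, 'c, 'n) module_scheme \<Rightarrow> ('a, 'b, 'f) free_res_scheme \<Rightarrow> nat \<Rightarrow> (nat \<Rightarrow> 'c) set" where
  "tensor_cycles N F i =
     (case i of
        0 \<Rightarrow> carrier (power_module N (rank F 0))
      | Suc j \<Rightarrow> {v \<in> carrier (power_module N (rank F (Suc j))).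
                   diff_map N F j v = \<zero>\<^bsub>power_module N (rank F j)\<^esub>})"

definition tensor_boundaries ::
    "('a, 'c, 'n) module_scheme \<Rightarrow> ('a, 'b, 'f) free_res_scheme \<Rightarrow> nat \<Rightarrow> (nat \<Rightarrow> 'c) set" where
  "tensor_boundaries N F i = diff_map N F i ` carrier (power_module N (rank F (Suc i)))"

text \<open>Only the additive group of the Tor module is recorded.\<close>

definition Tor ::
    "('a, 'r) ring_scheme \<Rightarrow> ('a, 'b, 'm) module_scheme \<Rightarrow> ('a, 'c, 'n) module_scheme \<Rightarrow> nat \<Rightarrow>
     (nat \<Rightarrow> 'c) set monoid" where
  "Tor R M N i =
     (let F = (SOME F :: ('a, 'b) free_res. free_resolution R M F)
      in (add_monoid (power_module N (rank F i))) \<lparr>carrier := tensor_cycles N F i\<rparr>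
           Mod tensor_boundaries N F i)"

definition tor_independent :: "('a, 'r) ring_scheme \<Rightarrow> 'a set \<Rightarrow> 'a set \<Rightarrow> bool" where
  "tor_independent R A B \<longleftrightarrow>
     (\<forall>i \<ge> 1. trivial_group (Tor R (quot_module R A) (quot_module R B) i))"

end

theory Submission imports Defs begin

text \<open>
  Write \<open>Z\<close> and \<open>Y\<close> for the Koszul complexes that resolve \<open>R/I\<close> and \<open>R/J\<close>, and \<open>S\<close> and \<open>T\<close> for minimal
  free resolutions of \<open>R/I'\<close> and \<open>R/J'\<close>. A minimal free resolution of \<open>F = R/(I' + IJ + J')\<close> is built
  from them by attaching three pieces to the complex that has only \<open>R\<close> in degree \<open>0\<close>:
  \<open>W = Z\<^sub>\<ge>\<^sub>1 \<otimes> Y\<^sub>\<ge>\<^sub>1\<close> with degrees lowered by one, \<open>U = S\<^sub>\<ge>\<^sub>1 \<otimes> Y\<close> and \<open>V = T\<^sub>\<ge>\<^sub>1 \<otimes> Z\<close>. Counting bases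
  gives the graded formula at once, and Vandermonde's identity evaluates the contribution of \<open>W\<close> to the
  ungraded one.

  \<^bold>\<open>Exactness.\<close> Tor-independence says that \<open>Z \<otimes> Y\<close>, \<open>S \<otimes> Y\<close> and \<open>T \<otimes> Z\<close> are exact in positive
  degrees (\<open>tensor_exact\<close>). Truncating, \<open>W\<close> resolves \<open>I \<otimes> J \<cong> IJ\<close>, \<open>U\<close> resolves \<open>I'/I'J\<close> and \<open>V\<close> resolves
  \<open>J'/J'I\<close> (\<open>tens_trunc2_exact\<close>, \<open>tens_trunc_exact\<close>). An attachment keeps the complex exact if it
  is injective on the homology of the attached piece (\<open>cone_cyc_res\<close>). Attaching \<open>W\<close> gives a
  resolution of \<open>R/IJ\<close>. Attaching \<open>U\<close> then works because an element of \<open>I'\<close> that lies in \<open>IJ\<close> lies in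
  \<open>I' \<inter> J = I'J\<close>, and attaching \<open>V\<close> because an element of \<open>J'\<close> that lies in \<open>I' + IJ\<close> lies
  in \<open>J' \<inter> I = J'I\<close> (\<open>PU_res\<close>, \<open>P_res\<close>).

  \<^bold>\<open>Minimality.\<close> The attaching maps are made from the differentials of \<open>Z\<close>, \<open>Y\<close>, \<open>S\<close>, \<open>T\<close> and from comparison
  maps \<open>\<phi>: S \<rightarrow> Z\<close> and \<open>\<psi>: T \<rightarrow> Y\<close>. So it is enough that \<open>\<phi>\<close> and \<open>\<psi>\<close> vanish modulo the maximal ideal
  in positive degrees, and this is where \<open>I' \<subseteq> I\<^sup>2\<close> and \<open>J' \<subseteq> J\<^sup>2\<close> enter (\<open>koszul_comparison_minimal\<close>). Since
  \<open>I' \<subseteq> I\<^sup>2\<close>, the map \<open>\<phi>\<close> carries \<open>S\<^sub>1\<close> into \<open>I Z\<^sub>1\<close>. A contraction \<open>\<iota>\<close> of the Koszul complex anticommutes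
  with its differential, so \<open>\<iota> \<phi>\<close> is up to sign a chain map on \<open>S\<^sub>\<ge>\<^sub>1\<close> that induces zero on \<open>H\<^sub>0\<close>; it is null
  homotopic, and a null homotopic map between complexes with differentials in the maximal ideal vanishes
  modulo that ideal. Every basis coordinate of positive degree is seen by some contraction.

  \<^bold>\<open>Independence of choices.\<close> Betti numbers and Tor are defined by a resolution chosen arbitrarily. Two graded
  resolutions of one module are homotopy equivalent (\<open>comparison\<close>, \<open>homotopy\<close>). Hence the ranks of minimal
  ones agree in every internal degree (\<open>minimal_rank_le\<close>), and the vanishing of Tor can be read off
  from any resolution (\<open>exact_modulo_transfer\<close>).

  \<^bold>\<open>Encoding.\<close> A ring given as a record is awkward for matrix calculations, so they take place in a type
  of class \<open>comm_ring_1\<close> that maps onto \<open>R\<close>, modulo the kernel \<open>N\<close> of that map (\<open>ring_cover\<close>): an equation in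
  \<open>R\<close> becomes a congruence \<open>x - y \<in> N\<close>. The local case is the graded case for the grading
  that is concentrated in degree zero (\<open>trivial_grading\<close>).
\<close>

section \<open>Ideals, linear functionals and complexes with a basis\<close>

definition is_ideal :: "'s::comm_ring_1 set \<Rightarrow> bool" where
  "is_ideal A \<longleftrightarrow> 0 \<in> A \<and> (\<forall>x\<in>A. \<forall>y\<in>A. x + y \<in> A) \<and> (\<forall>r. \<forall>x\<in>A. r * x \<in> A)"

lemma is_ideal_zero: "is_ideal A \<Longrightarrow> 0 \<in> A"
  and is_ideal_add: "is_ideal A \<Longrightarrow> x \<in> A \<Longrightarrow> y \<in> A \<Longrightarrow> x + y \<in> A"
  and is_ideal_mult: "is_ideal A \<Longrightarrow> x \<in> A \<Longrightarrow> r * x \<in> A"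
  by (auto simp: is_ideal_def)

lemma is_ideal_mult_right: "is_ideal A \<Longrightarrow> x \<in> A \<Longrightarrow> x * r \<in> A"
  using is_ideal_mult[of A x r] by (simp add: mult.commute)

lemma is_ideal_minus: "is_ideal A \<Longrightarrow> x \<in> A \<Longrightarrow> - x \<in> A"
  using is_ideal_mult[of A x "-1"] by simp

lemma is_ideal_diff: "is_ideal A \<Longrightarrow> x \<in> A \<Longrightarrow> y \<in> A \<Longrightarrow> x - y \<in> A"
  using is_ideal_add[of A x "- y"] is_ideal_minus[of A y] by simp

lemma is_ideal_sum: "is_ideal A \<Longrightarrow> (\<And>i. i \<in> K \<Longrightarrow> f i \<in> A) \<Longrightarrow> sum f K \<in> A"
  by (induction K rule: infinite_finite_induct) (auto simp: is_ideal_zero is_ideal_add)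

lemmas ideal_rules = is_ideal_zero is_ideal_add is_ideal_mult is_ideal_mult_right
  is_ideal_minus is_ideal_diff is_ideal_sum

lemma ideal_cong_trans:
  "is_ideal A \<Longrightarrow> x - y \<in> A \<Longrightarrow> y - z \<in> A \<Longrightarrow> x - z \<in> A"
  using is_ideal_add[of A "x - y" "y - z"] by simp

lemma ideal_cong_sym: "is_ideal A \<Longrightarrow> x - y \<in> A \<Longrightarrow> y - x \<in> A"
  using is_ideal_minus[of A "x - y"] by simp

lemma ideal_cong_mem: "is_ideal A \<Longrightarrow> x - y \<in> A \<Longrightarrow> y \<in> A \<Longrightarrow> x \<in> A"
  using is_ideal_add[of A "x - y" y] by simp

definition unitv :: "'i \<Rightarrow> 'i \<Rightarrow> 's::comm_ring_1" where
  "unitv l = (\<lambda>k. if k = l then 1 else 0)"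

text \<open>A complex is given below by an operator on all functions on its basis, without a separate space
  for each degree. Each coordinate of the operator is a linear functional that reads only the finitely many
  coordinates in a set \<open>Z\<close>; this locality carries the information about degrees and makes \<open>lin_on_expand\<close>
  available, while compositions need no matrix products.\<close>

definition lin_on :: "'i set \<Rightarrow> (('i \<Rightarrow> 's::comm_ring_1) \<Rightarrow> 's) \<Rightarrow> bool" where
  "lin_on Z f \<longleftrightarrow> finite Z \<and> (\<forall>c v w. f (\<lambda>l. c * v l + w l) = c * f v + f w)
     \<and> (\<forall>v w. (\<forall>l\<in>Z. v l = w l) \<longrightarrow> f v = f w)"

lemma lin_on_lin: "lin_on Z f \<Longrightarrow> f (\<lambda>l. c * v l + w l) = c * f v + f w"
  and lin_on_local: "lin_on Z f \<Longrightarrow> (\<And>l. l \<in> Z \<Longrightarrow> v l = w l) \<Longrightarrow> f v = f w"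
  and lin_on_finite: "lin_on Z f \<Longrightarrow> finite Z"
  by (auto simp: lin_on_def)

lemma lin_on_zero: "lin_on Z f \<Longrightarrow> f (\<lambda>l. 0) = 0"
  using lin_on_lin[of Z f 1 "\<lambda>l. 0" "\<lambda>l. 0"] by simp

lemma lin_on_add: "lin_on Z f \<Longrightarrow> f (\<lambda>l. v l + w l) = f v + f w"
  using lin_on_lin[of Z f 1 v w] by simp

lemma lin_on_scale: "lin_on Z f \<Longrightarrow> f (\<lambda>l. c * v l) = c * f v"
  using lin_on_lin[of Z f c v "\<lambda>l. 0"] by (simp add: lin_on_zero)

lemma lin_on_diff: "lin_on Z f \<Longrightarrow> f (\<lambda>l. v l - w l) = f v - f w"
  using lin_on_lin[of Z f "-1" w v] by simp

lemma lin_on_minus: "lin_on Z f \<Longrightarrow> f (\<lambda>l. - v l) = - f v"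
  using lin_on_scale[of Z f "-1" v] by simp

lemma lin_on_sum: "lin_on Z f \<Longrightarrow> f (\<lambda>l. \<Sum>i\<in>K. g i l) = (\<Sum>i\<in>K. f (g i))"
  by (induction K rule: infinite_finite_induct)
     (auto simp: lin_on_zero lin_on_add[of Z f "g _" "\<lambda>l. \<Sum>i\<in>_. g i l"])

lemma lin_on_expand: assumes "lin_on Z f" shows "f v = (\<Sum>l\<in>Z. v l * f (unitv l))"
proof -
  have "f v = f (\<lambda>k. \<Sum>l\<in>Z. v l * unitv l k)"
    using lin_on_finite[OF assms] by (intro lin_on_local[OF assms]) (simp add: unitv_def if_distrib sum.delta cong: if_cong)
  also have "\<dots> = (\<Sum>l\<in>Z. v l * f (unitv l))"
    by (simp add: lin_on_sum[OF assms] lin_on_scale[OF assms])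
  finally show ?thesis .
qed

lemma lin_on_ideal: assumes "lin_on Z f" "is_ideal A" "\<And>l. l \<in> Z \<Longrightarrow> v l \<in> A" shows "f v \<in> A"
  by (subst lin_on_expand[OF assms(1)]) (auto intro!: ideal_rules assms)

lemma lin_on_cong_ideal:
  assumes "lin_on Z f" "is_ideal A" "\<And>l. l \<in> Z \<Longrightarrow> v l - w l \<in> A" shows "f v - f w \<in> A"
  using lin_on_ideal[OF assms(1,2), of "\<lambda>l. v l - w l"] assms(3) by (simp add: lin_on_diff[OF assms(1)])

text \<open>Functionals of different variables commute because both are finite linear combinations of
  coordinates. This is the commutation of the two differentials of a tensor product.\<close>

lemma lin_on_swap:
  assumes "lin_on Z f" "lin_on Z' g"
  shows "f (\<lambda>i. g (\<lambda>j. v i j)) = g (\<lambda>j. f (\<lambda>i. v i j))"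
proof -
  have "f (\<lambda>i. g (\<lambda>j. v i j)) = (\<Sum>i\<in>Z. (\<Sum>j\<in>Z'. v i j * g (unitv j)) * f (unitv i))"
    by (subst lin_on_expand[OF assms(1)], subst lin_on_expand[OF assms(2)]) (rule refl)
  also have "\<dots> = (\<Sum>j\<in>Z'. (\<Sum>i\<in>Z. v i j * f (unitv i)) * g (unitv j))"
    by (simp add: sum_distrib_right) (subst sum.swap, simp add: mult_ac)
  also have "\<dots> = g (\<lambda>j. f (\<lambda>i. v i j))"
    by (subst (2) lin_on_expand[OF assms(2)], subst (2) lin_on_expand[OF assms(1)]) (rule refl)
  finally show ?thesis .
qed

lemma lin_on_comp:
  assumes "lin_on Z f" "\<And>i. i \<in> Z \<Longrightarrow> lin_on Z' (\<lambda>v. h v i)" "finite Z'"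
  shows "lin_on Z' (\<lambda>v. f (h v))"
proof -
  have "f (h (\<lambda>l. c * v l + w l)) = c * f (h v) + f (h w)" for c v w
    unfolding lin_on_lin[OF assms(1), symmetric]
    by (intro lin_on_local[OF assms(1)] lin_on_lin[OF assms(2)])
  moreover have "f (h v) = f (h w)" if "\<forall>l\<in>Z'. v l = w l" for v w
    using that by (intro lin_on_local[OF assms(1)] lin_on_local[OF assms(2)]) auto
  ultimately show ?thesis using assms(3) by (simp add: lin_on_def)
qed

lemma lin_on_coord: "finite Z \<Longrightarrow> l \<in> Z \<Longrightarrow> lin_on Z (\<lambda>v. v l)"
  by (auto simp: lin_on_def)

lemma lin_on_zero_fun: "finite Z \<Longrightarrow> lin_on Z (\<lambda>v. 0)"
  by (auto simp: lin_on_def)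

lemma lin_on_plus: "lin_on Z f \<Longrightarrow> lin_on Z g \<Longrightarrow> lin_on Z (\<lambda>v. f v + g v)"
  unfolding lin_on_def by (auto simp: algebra_simps) metis

lemma lin_on_times: "lin_on Z f \<Longrightarrow> lin_on Z (\<lambda>v. c * f v)"
  unfolding lin_on_def by (auto simp: algebra_simps) metis

lemma lin_on_setsum: "finite Z \<Longrightarrow> (\<And>i. i \<in> K \<Longrightarrow> lin_on Z (f i)) \<Longrightarrow> lin_on Z (\<lambda>v. \<Sum>i\<in>K. f i v)"
  by (induction K rule: infinite_finite_induct) (auto simp: lin_on_zero_fun lin_on_plus)

lemma lin_on_reindex: "lin_on Z f \<Longrightarrow> g ` Z \<subseteq> Z' \<Longrightarrow> finite Z' \<Longrightarrow> lin_on Z' (\<lambda>v. f (\<lambda>i. v (g i)))"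
  by (rule lin_on_comp) (auto intro: lin_on_coord)

text \<open>A complex of free modules with basis \<open>basis\<close>, where \<open>hdeg\<close> is the homological and \<open>ideg\<close> the internal
  degree of a basis element. The value \<open>dif C v k\<close> at \<open>k\<close> of degree \<open>n\<close> is the \<open>k\<close>-th coordinate of the differential
  of the degree \<open>n + 1\<close> part of \<open>v\<close>.\<close>

record ('i, 's) based =
  basis :: "'i set"
  hdeg :: "'i \<Rightarrow> nat"
  ideg :: "'i \<Rightarrow> nat"
  dif :: "('i \<Rightarrow> 's) \<Rightarrow> 'i \<Rightarrow> 's"

definition lvl :: "('i, 's) based \<Rightarrow> nat \<Rightarrow> 'i set" where
  "lvl C n = {k \<in> basis C. hdeg C k = n}"

definition ent :: "('i, 's::comm_ring_1) based \<Rightarrow> 'i \<Rightarrow> 'i \<Rightarrow> 's" where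
  "ent C k l = dif C (unitv l) k"

text \<open>All statements are modulo an ideal \<open>N\<close>: the complex lives over the quotient by \<open>N\<close>, but its entries are
  elements of the ambient ring.\<close>

definition is_complex :: "'s::comm_ring_1 set \<Rightarrow> ('i, 's) based \<Rightarrow> bool" where
  "is_complex N C \<longleftrightarrow> (\<forall>n. finite (lvl C n)) \<and>
     (\<forall>k\<in>basis C. lin_on (lvl C (Suc (hdeg C k))) (\<lambda>v. dif C v k)) \<and>
     (\<forall>v. \<forall>k\<in>basis C. dif C (dif C v) k \<in> N)"

text \<open>Exactness in the degrees \<open>\<ge> 1\<close>. For a free resolution, the same condition modulo a larger
  ideal says that the Tor modules with the corresponding quotient ring vanish in positive degrees.\<close>

definition exact :: "'s::comm_ring_1 set \<Rightarrow> ('i, 's) based \<Rightarrow> bool" where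
  "exact N C \<longleftrightarrow> (\<forall>n v. (\<forall>k\<in>lvl C n. dif C v k \<in> N) \<longrightarrow>
     (\<exists>w. \<forall>k\<in>lvl C (Suc n). v k - dif C w k \<in> N))"

lemma exactD: "exact N C \<Longrightarrow> (\<And>k. k \<in> lvl C n \<Longrightarrow> dif C v k \<in> N) \<Longrightarrow>
     \<exists>w. \<forall>k\<in>lvl C (Suc n). v k - dif C w k \<in> N"
  by (auto simp: exact_def)

lemma is_complex_finite: "is_complex N C \<Longrightarrow> finite (lvl C n)"
  and is_complex_lin: "is_complex N C \<Longrightarrow> k \<in> basis C \<Longrightarrow> lin_on (lvl C (Suc (hdeg C k))) (\<lambda>v. dif C v k)"
  and is_complex_sq: "is_complex N C \<Longrightarrow> k \<in> basis C \<Longrightarrow> dif C (dif C v) k \<in> N"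
  by (auto simp: is_complex_def)

lemma lvl_basis: "k \<in> lvl C n \<Longrightarrow> k \<in> basis C" and lvl_hdeg: "k \<in> lvl C n \<Longrightarrow> hdeg C k = n"
  and in_lvl: "k \<in> basis C \<Longrightarrow> k \<in> lvl C (hdeg C k)"
  by (auto simp: lvl_def)

lemma is_complex_lin_lvl: "is_complex N C \<Longrightarrow> k \<in> lvl C n \<Longrightarrow> lin_on (lvl C (Suc n)) (\<lambda>v. dif C v k)"
  using is_complex_lin[of N C k] by (auto simp: lvl_def)

lemma dif_expand: "is_complex N C \<Longrightarrow> k \<in> lvl C n \<Longrightarrow> dif C v k = (\<Sum>l\<in>lvl C (Suc n). v l * ent C k l)"
  unfolding ent_def by (rule lin_on_expand[OF is_complex_lin_lvl])

lemma ent_sq: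
  assumes "is_complex N C" "k \<in> basis C"
  shows "(\<Sum>j\<in>lvl C (Suc (hdeg C k)). ent C j l * ent C k j) \<in> N"
  using is_complex_sq[OF assms, of "unitv l"]
  by (subst (asm) dif_expand[OF assms(1) in_lvl[OF assms(2)]]) (simp add: ent_def)

text \<open>\<open>Gs b a\<close> is the set of matrix entries allowed from a generator of internal degree \<open>b\<close> to one of
  degree \<open>a\<close>. The axioms say that these are the morphism groups of a preadditive category with the degrees as objects.
  For a graded ring they are the homogeneous elements of degree \<open>b - a\<close>; with \<open>UNIV\<close> throughout the
  graded statements specialise to ungraded ones.\<close>

definition gcat :: "'s::comm_ring_1 set \<Rightarrow> (nat \<Rightarrow> nat \<Rightarrow> 's set) \<Rightarrow> bool" where
  "gcat N Gs \<longleftrightarrow> (\<forall>b a. N \<subseteq> Gs b a \<and> (\<forall>x\<in>Gs b a. \<forall>y\<in>Gs b a. x + y \<in> Gs b a) \<and>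
     (\<forall>x\<in>Gs b a. - x \<in> Gs b a)) \<and> (\<forall>a. 1 \<in> Gs a a) \<and>
     (\<forall>a b c. \<forall>r\<in>Gs b a. \<forall>x\<in>Gs c b. x * r \<in> Gs c a)"

lemma gcat_UNIV: "gcat N (\<lambda>_ _. UNIV)" by (auto simp: gcat_def)

lemma gcat_N: "gcat N Gs \<Longrightarrow> x \<in> N \<Longrightarrow> x \<in> Gs b a"
  and gcat_add: "gcat N Gs \<Longrightarrow> x \<in> Gs b a \<Longrightarrow> y \<in> Gs b a \<Longrightarrow> x + y \<in> Gs b a"
  and gcat_minus: "gcat N Gs \<Longrightarrow> x \<in> Gs b a \<Longrightarrow> - x \<in> Gs b a"
  and gcat_one: "gcat N Gs \<Longrightarrow> 1 \<in> Gs a a"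
  and gcat_mult: "gcat N Gs \<Longrightarrow> x \<in> Gs c b \<Longrightarrow> r \<in> Gs b a \<Longrightarrow> x * r \<in> Gs c a"
  unfolding gcat_def by blast+

lemma gcat_diff: "gcat N Gs \<Longrightarrow> x \<in> Gs b a \<Longrightarrow> y \<in> Gs b a \<Longrightarrow> x - y \<in> Gs b a"
  using gcat_add[of N Gs x b a "- y"] gcat_minus[of N Gs y] by simp

lemma gcat_sum: "gcat N Gs \<Longrightarrow> is_ideal N \<Longrightarrow> (\<And>i. i \<in> K \<Longrightarrow> f i \<in> Gs b a) \<Longrightarrow> sum f K \<in> Gs b a"
  by (induction K rule: infinite_finite_induct) (auto intro: gcat_add gcat_N is_ideal_zero)

lemma gcat_sign: "gcat N Gs \<Longrightarrow> x \<in> Gs b a \<Longrightarrow> (-1)^n * x \<in> Gs b a"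
  by (cases "even n") (auto intro: gcat_minus)

definition graded_cpx :: "(nat \<Rightarrow> nat \<Rightarrow> 's::comm_ring_1 set) \<Rightarrow> ('i, 's) based \<Rightarrow> bool" where
  "graded_cpx Gs C \<longleftrightarrow> (\<forall>k\<in>basis C. \<forall>l\<in>lvl C (Suc (hdeg C k)). ent C k l \<in> Gs (ideg C l) (ideg C k))"

lemma graded_cpxD: "graded_cpx Gs C \<Longrightarrow> k \<in> lvl C n \<Longrightarrow> l \<in> lvl C (Suc n) \<Longrightarrow> ent C k l \<in> Gs (ideg C l) (ideg C k)"
  by (auto simp: graded_cpx_def lvl_def)

text \<open>Exactness in positive degrees with homogeneous preimages of homogeneous cycles.\<close>

definition gexact :: "'s::comm_ring_1 set \<Rightarrow> (nat \<Rightarrow> nat \<Rightarrow> 's set) \<Rightarrow> ('i, 's) based \<Rightarrow> bool" where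
  "gexact N Gs C \<longleftrightarrow> (\<forall>n b v. (\<forall>k\<in>lvl C (Suc n). v k \<in> Gs b (ideg C k)) \<longrightarrow>
      (\<forall>k\<in>lvl C n. dif C v k \<in> N) \<longrightarrow>
      (\<exists>w. (\<forall>k\<in>lvl C (Suc (Suc n)). w k \<in> Gs b (ideg C k)) \<and>
           (\<forall>k\<in>lvl C (Suc n). v k - dif C w k \<in> N)))"

lemma gexact_UNIV: "gexact N (\<lambda>_ _. UNIV) C \<longleftrightarrow> exact N C"
  by (simp add: gexact_def exact_def)

text \<open>The recursion behind comparison maps, homotopies and the vanishing of contractions. Given a map
  \<open>e\<close> from the part of \<open>F\<close> in degrees \<open>\<ge> n0\<close> to \<open>E\<close>, lowering degrees by \<open>n0\<close> and commuting with the differentials up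
  to the sign \<open>s\<close>, that is a boundary in the lowest degree, there is \<open>H\<close> with \<open>e = s H d + d H\<close>. On a basis element
  \<open>l\<close> the element \<open>e l - s H (d l)\<close> is a cycle, because \<open>H\<close> is already correct in lower degrees, and exactness of \<open>E\<close> provides
  \<open>H l\<close>. Comparison maps are the case where \<open>e\<close> is concentrated in the lowest degree.\<close>

lemma lift_along_exact:
  fixes F :: "('i, 's::comm_ring_1) based" and E :: "('j, 's) based"
  assumes N: "is_ideal N" and g: "gcat N Gs"
    and F: "is_complex N F" "graded_cpx Gs F" and E: "is_complex N E" and ex: "gexact N Gs E"
    and s: "s = 1 \<or> s = - 1"
    and ehom: "\<And>l k. l \<in> basis F \<Longrightarrow> n0 \<le> hdeg F l \<Longrightarrow> k \<in> lvl E (hdeg F l - n0) \<Longrightarrow> e l k \<in> Gs (ideg F l) (ideg E k)"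
    and bot: "\<And>l. l \<in> lvl F n0 \<Longrightarrow> \<exists>c. (\<forall>k\<in>lvl E 1. c k \<in> Gs (ideg F l) (ideg E k)) \<and> (\<forall>k\<in>lvl E 0. e l k - dif E c k \<in> N)"
    and ch: "\<And>l k. l \<in> basis F \<Longrightarrow> k \<in> basis E \<Longrightarrow> hdeg F l = Suc (n0 + hdeg E k) \<Longrightarrow>
       dif E (e l) k - s * (\<Sum>j\<in>lvl F (n0 + hdeg E k). ent F j l * e j k) \<in> N"
  shows "\<exists>H. \<forall>l\<in>basis F. n0 \<le> hdeg F l \<longrightarrow>
     (\<forall>k\<in>lvl E (Suc (hdeg F l - n0)). H l k \<in> Gs (ideg F l) (ideg E k)) \<and>
     (\<forall>k\<in>lvl E (hdeg F l - n0).
        e l k - s * (\<Sum>j\<in>{j\<in>basis F. n0 \<le> hdeg F j \<and> Suc (hdeg F j) = hdeg F l}. ent F j l * H j k) - dif E (H l) k \<in> N)"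
proof -
  \<comment> \<open>\<open>Lo l\<close> indexes the differential of \<open>l\<close> in the truncation of \<open>F\<close>; it is empty in degree \<open>n0\<close>.\<close>
  define Lo where "Lo l = {j\<in>basis F. n0 \<le> hdeg F j \<and> Suc (hdeg F j) = hdeg F l}" for l
  define P where "P H l c \<longleftrightarrow> (l \<in> basis F \<longrightarrow> n0 \<le> hdeg F l \<longrightarrow>
     (\<forall>k\<in>lvl E (Suc (hdeg F l - n0)). c k \<in> Gs (ideg F l) (ideg E k)) \<and>
     (\<forall>k\<in>lvl E (hdeg F l - n0). e l k - s * (\<Sum>j\<in>Lo l. ent F j l * H j k) - dif E c k \<in> N))" for H l c
  have ss: "s * s = 1" using s by auto
  have "\<exists>H. \<forall>l. P H l (H l)"
  proof (rule dependent_wf_choice[of "measure (hdeg F)"])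
    show "wf (measure (hdeg F))" by simp
  next
    fix H H' :: "'i \<Rightarrow> 'j \<Rightarrow> 's" and l c
    assume a: "\<And>z. (z, l) \<in> measure (hdeg F) \<Longrightarrow> H z = H' z"
    have "(\<Sum>j\<in>Lo l. ent F j l * H j k) = (\<Sum>j\<in>Lo l. ent F j l * H' j k)" for k
      by (rule sum.cong) (use a in \<open>auto simp: Lo_def\<close>)
    thus "P H l c = P H' l c" by (simp add: P_def)
  next
    fix l and H :: "'i \<Rightarrow> 'j \<Rightarrow> 's"
    assume IH: "\<And>j. (j, l) \<in> measure (hdeg F) \<Longrightarrow> P H j (H j)"
    show "\<exists>c. P H l c"
    proof (cases "l \<in> basis F \<and> n0 \<le> hdeg F l")
      case False thus ?thesis by (auto simp: P_def)
    next
      case True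
      hence lF: "l \<in> basis F" by simp
      \<comment> \<open>The cycle that \<open>H l\<close> has to bound.\<close>
      define c where "c k = e l k - s * (\<Sum>j\<in>Lo l. ent F j l * H j k)" for k
      have chom: "c k \<in> Gs (ideg F l) (ideg E k)" if k: "k \<in> lvl E (hdeg F l - n0)" for k
      proof -
        have "ent F j l * H j k \<in> Gs (ideg F l) (ideg E k)" if "j \<in> Lo l" for j
        proof (rule gcat_mult[OF g])
          show "ent F j l \<in> Gs (ideg F l) (ideg F j)"
            using that lF F(2) by (auto simp: Lo_def graded_cpx_def lvl_def)
          have "Suc (hdeg F j - n0) = hdeg F l - n0" using that by (auto simp: Lo_def)
          thus "H j k \<in> Gs (ideg F j) (ideg E k)"
            using IH[of j] that k unfolding P_def Lo_def by fastforce
        qed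
        hence "(\<Sum>j\<in>Lo l. ent F j l * H j k) \<in> Gs (ideg F l) (ideg E k)"
          by (rule gcat_sum[OF g N])
        hence "s * (\<Sum>j\<in>Lo l. ent F j l * H j k) \<in> Gs (ideg F l) (ideg E k)"
          using s gcat_minus[OF g] by auto
        thus ?thesis unfolding c_def using ehom[of l k] k True by (intro gcat_diff[OF g]) auto
      qed
      show ?thesis
      proof (cases "hdeg F l = n0")
        case eq: True
        hence "Lo l = {}" by (auto simp: Lo_def)
        thus ?thesis using bot[of l] lF eq unfolding P_def by (auto simp: lvl_def)
      next
        case False
        then obtain p where p: "hdeg F l = Suc (n0 + p)" using True
          by (metis le_antisym not_less_eq_eq Suc_leD le_Suc_ex add_Suc_right Suc_le_D)
        have Lo: "Lo l = lvl F (n0 + p)" using p by (auto simp: Lo_def lvl_def)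
        \<comment> \<open>The second differential of \<open>l\<close> lands on \<open>M\<close>; it is empty when that degree is truncated away.\<close>
        define M where "M = {i\<in>basis F. n0 \<le> hdeg F i \<and> Suc (hdeg F i) = n0 + p}"
        have LoM: "Lo j = M" if "j \<in> Lo l" for j using that by (auto simp: Lo_def lvl_def M_def p)
        have cyc: "dif E c k \<in> N" if k: "k \<in> lvl E p" for k
        proof -
          have lin: "lin_on (lvl E (Suc p)) (\<lambda>v. dif E v k)" using is_complex_lin_lvl[OF E k] .
          define r where "r j = e j k - s * (\<Sum>i\<in>M. ent F i j * H i k) - dif E (H j) k" for j
          have r: "r j \<in> N" if "j \<in> Lo l" for j
            using IH[of j] that k p unfolding P_def r_def
            by (auto simp: LoM[OF that]) (auto simp: Lo lvl_def)
          have kE: "k \<in> basis E" "hdeg E k = p" using k by (auto simp: lvl_def)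
          have S1: "dif E (e l) k - s * (\<Sum>j\<in>Lo l. ent F j l * e j k) \<in> N"
            using ch[OF lF kE(1)] p kE(2) Lo by simp
          have "(\<Sum>j\<in>Lo l. ent F j l * (\<Sum>i\<in>M. ent F i j * H i k)) = (\<Sum>i\<in>M. H i k * (\<Sum>j\<in>Lo l. ent F j l * ent F i j))"
            by (simp add: sum_distrib_left) (subst sum.swap, simp add: mult_ac)
          also have "\<dots> \<in> N"
          proof (rule is_ideal_sum[OF N], rule is_ideal_mult[OF N])
            fix i assume "i \<in> M"
            hence "i \<in> basis F" "Lo l = lvl F (Suc (hdeg F i))" by (auto simp: M_def Lo)
            thus "(\<Sum>j\<in>Lo l. ent F j l * ent F i j) \<in> N" using ent_sq[OF F(1)] by simp
          qed
          finally have S2: "(\<Sum>j\<in>Lo l. ent F j l * (\<Sum>i\<in>M. ent F i j * H i k)) \<in> N" .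
          have S3: "s * (\<Sum>j\<in>Lo l. ent F j l * r j) \<in> N" using r by (intro is_ideal_mult[OF N] is_ideal_sum[OF N]) auto
          have "dif E c k = dif E (e l) k - s * (\<Sum>j\<in>Lo l. ent F j l * dif E (H j) k)"
            unfolding c_def by (simp add: lin_on_diff[OF lin] lin_on_scale[OF lin] lin_on_sum[OF lin])
          also have "(\<Sum>j\<in>Lo l. ent F j l * dif E (H j) k) = (\<Sum>j\<in>Lo l. ent F j l * e j k - s * (ent F j l * (\<Sum>i\<in>M. ent F i j * H i k)) - ent F j l * r j)"
            by (rule sum.cong) (auto simp: r_def algebra_simps)
          also have "\<dots> = (\<Sum>j\<in>Lo l. ent F j l * e j k) - s * (\<Sum>j\<in>Lo l. (ent F j l * (\<Sum>i\<in>M. ent F i j * H i k))) - (\<Sum>j\<in>Lo l. ent F j l * r j)"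
            by (simp add: sum_subtractf sum_distrib_left)
          also have "dif E (e l) k - s * ((\<Sum>j\<in>Lo l. ent F j l * e j k) - s * (\<Sum>j\<in>Lo l. (ent F j l * (\<Sum>i\<in>M. ent F i j * H i k))) - (\<Sum>j\<in>Lo l. ent F j l * r j)) =
             (dif E (e l) k - s * (\<Sum>j\<in>Lo l. ent F j l * e j k)) + (s * s) * (\<Sum>j\<in>Lo l. (ent F j l * (\<Sum>i\<in>M. ent F i j * H i k))) + s * (\<Sum>j\<in>Lo l. ent F j l * r j)"
            by (simp only: algebra_simps)
          finally show ?thesis using is_ideal_add[OF N is_ideal_add[OF N S1 S2] S3] by (simp only: ss mult_1_left)
        qed
        have "\<exists>w. (\<forall>k\<in>lvl E (Suc (Suc p)). w k \<in> Gs (ideg F l) (ideg E k)) \<and> (\<forall>k\<in>lvl E (Suc p). c k - dif E w k \<in> N)"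
          using ex cyc chom p unfolding gexact_def by auto
        then obtain w where w: "\<forall>k\<in>lvl E (Suc (Suc p)). w k \<in> Gs (ideg F l) (ideg E k)"
          "\<forall>k\<in>lvl E (Suc p). c k - dif E w k \<in> N" by blast
        have "P H l w" unfolding P_def using p w by (simp add: c_def Suc_diff_le)
        show ?thesis by (rule exI[of _ w]) fact
      qed
    qed
  qed
  then obtain H where H: "\<forall>l. P H l (H l)" by (rule exE)
  show ?thesis by (rule exI[of _ H]) (use H in \<open>simp add: P_def Lo_def\<close>)
qed

section \<open>Comparison of resolutions and uniqueness of ranks\<close>

text \<open>A graded resolution of the cyclic module \<open>S/A\<close>, not necessarily with a single generator in degree zero:
  \<open>a k\<close> represents the image of the \<open>k\<close>-th generator. The clauses after those on \<open>C\<close> say that the augmentation is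
  homogeneous, is surjective, vanishes on boundaries, and is exact at degree zero with homogeneous preimages.\<close>

definition gres :: "'s::comm_ring_1 set \<Rightarrow> (nat \<Rightarrow> nat \<Rightarrow> 's set) \<Rightarrow> 's set \<Rightarrow> ('i, 's) based \<Rightarrow> ('i \<Rightarrow> 's) \<Rightarrow> bool" where
  "gres N Gs A C a \<longleftrightarrow> is_complex N C \<and> graded_cpx Gs C \<and> gexact N Gs C \<and>
     (\<forall>k\<in>lvl C 0. a k \<in> Gs (ideg C k) 0) \<and>
     (\<exists>u. (\<forall>k\<in>lvl C 0. u k \<in> Gs 0 (ideg C k)) \<and> (\<Sum>k\<in>lvl C 0. u k * a k) - 1 \<in> A) \<and>
     (\<forall>w. (\<Sum>k\<in>lvl C 0. dif C w k * a k) \<in> A) \<and>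
     (\<forall>b v. (\<forall>k\<in>lvl C 0. v k \<in> Gs b (ideg C k)) \<longrightarrow> (\<Sum>k\<in>lvl C 0. v k * a k) \<in> A \<longrightarrow>
        (\<exists>w. (\<forall>k\<in>lvl C 1. w k \<in> Gs b (ideg C k)) \<and> (\<forall>k\<in>lvl C 0. v k - dif C w k \<in> N)))"

text \<open>A chain map is stored by its values \<open>f l\<close> on the basis; they are only constrained at pairs of basis
  elements of equal homological degree.\<close>

definition chain_map :: "'s::comm_ring_1 set \<Rightarrow> ('i, 's) based \<Rightarrow> ('j, 's) based \<Rightarrow> ('i \<Rightarrow> 'j \<Rightarrow> 's) \<Rightarrow> bool" where
  "chain_map N C C' f \<longleftrightarrow> (\<forall>l\<in>basis C. \<forall>k\<in>basis C'. hdeg C l = Suc (hdeg C' k) \<longrightarrow>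
      dif C' (f l) k - (\<Sum>j\<in>lvl C (hdeg C' k). ent C j l * f j k) \<in> N)"

lemma chain_mapD:
  "chain_map N C C' f \<Longrightarrow> l \<in> lvl C (Suc n) \<Longrightarrow> k \<in> lvl C' n \<Longrightarrow>
     dif C' (f l) k - (\<Sum>j\<in>lvl C n. ent C j l * f j k) \<in> N"
  unfolding chain_map_def lvl_def by auto

definition hom_map :: "(nat \<Rightarrow> nat \<Rightarrow> 's::comm_ring_1 set) \<Rightarrow> ('i, 's) based \<Rightarrow> ('j, 's) based \<Rightarrow> ('i \<Rightarrow> 'j \<Rightarrow> 's) \<Rightarrow> bool" where
  "hom_map Gs C C' f \<longleftrightarrow> (\<forall>l\<in>basis C. \<forall>k\<in>lvl C' (hdeg C l). f l k \<in> Gs (ideg C l) (ideg C' k))"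

definition aug_map_comp :: "'s::comm_ring_1 set \<Rightarrow> ('i, 's) based \<Rightarrow> ('i \<Rightarrow> 's) \<Rightarrow> ('j, 's) based \<Rightarrow> ('j \<Rightarrow> 's) \<Rightarrow> ('i \<Rightarrow> 'j \<Rightarrow> 's) \<Rightarrow> bool" where
  "aug_map_comp A C a C' a' f \<longleftrightarrow> (\<forall>l\<in>lvl C 0. (\<Sum>k\<in>lvl C' 0. f l k * a' k) - a l \<in> A)"

text \<open>A map that is given in degree zero and sends first boundaries to boundaries extends to a chain map. This
  is \<open>lift_along_exact\<close> from degree one on, with the sign \<open>-1\<close>, applied to the composite of the differential with the
  given map.\<close>

lemma comparison_extend:
  fixes C :: "('i, 's::comm_ring_1) based" and C' :: "('j, 's) based"
  assumes N: "is_ideal N" and g: "gcat N Gs"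
    and CC: "is_complex N C" "graded_cpx Gs C" and CC': "is_complex N C'" "gexact N Gs C'"
    and f0: "\<And>j k. j \<in> lvl C 0 \<Longrightarrow> k \<in> lvl C' 0 \<Longrightarrow> f0 j k \<in> Gs (ideg C j) (ideg C' k)"
    and start: "\<And>l. l \<in> lvl C 1 \<Longrightarrow> \<exists>c. (\<forall>k\<in>lvl C' 1. c k \<in> Gs (ideg C l) (ideg C' k)) \<and>
       (\<forall>k\<in>lvl C' 0. (\<Sum>j\<in>lvl C 0. ent C j l * f0 j k) - dif C' c k \<in> N)"
  shows "\<exists>f. chain_map N C C' f \<and> hom_map Gs C C' f \<and> (\<forall>j\<in>lvl C 0. f j = f0 j)"
proof -
  define e where "e l k = (if hdeg C l = 1 then \<Sum>j\<in>lvl C 0. ent C j l * f0 j k else 0)" for l k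
  have "\<exists>H. \<forall>l\<in>basis C. 1 \<le> hdeg C l \<longrightarrow>
     (\<forall>k\<in>lvl C' (Suc (hdeg C l - 1)). H l k \<in> Gs (ideg C l) (ideg C' k)) \<and>
     (\<forall>k\<in>lvl C' (hdeg C l - 1).
        e l k - (-1) * (\<Sum>j\<in>{j\<in>basis C. 1 \<le> hdeg C j \<and> Suc (hdeg C j) = hdeg C l}. ent C j l * H j k) - dif C' (H l) k \<in> N)"
  proof (rule lift_along_exact[OF N g CC CC'])
    show "- 1 = 1 \<or> - 1 = (-1 :: 's)" by simp
  next
    fix l k assume l: "l \<in> basis C" "1 \<le> hdeg C l" and k: "k \<in> lvl C' (hdeg C l - 1)"
    show "e l k \<in> Gs (ideg C l) (ideg C' k)"
    proof (cases "hdeg C l = 1")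
      case True
      have "(\<Sum>j\<in>lvl C 0. ent C j l * f0 j k) \<in> Gs (ideg C l) (ideg C' k)"
        by (rule gcat_sum[OF g N], rule gcat_mult[OF g, of _ _ "ideg C _"])
           (use True l k f0 in \<open>auto intro!: graded_cpxD[OF CC(2), of _ 0] simp: lvl_def\<close>)
      thus ?thesis by (simp add: e_def True)
    qed (auto simp: e_def gcat_N[OF g] is_ideal_zero[OF N])
  next
    fix l assume l: "l \<in> lvl C 1"
    have el: "e l k = (\<Sum>j\<in>lvl C 0. ent C j l * f0 j k)" for k using l by (simp add: e_def lvl_def)
    show "\<exists>c. (\<forall>k\<in>lvl C' 1. c k \<in> Gs (ideg C l) (ideg C' k)) \<and> (\<forall>k\<in>lvl C' 0. e l k - dif C' c k \<in> N)"
      unfolding el by (rule start[OF l])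
  next
    fix l k assume l: "l \<in> basis C" and k: "k \<in> basis C'" and h: "hdeg C l = Suc (1 + hdeg C' k)"
    have [simp]: "e l = (\<lambda>k. 0)" using h by (auto simp: e_def)
    have z: "dif C' (\<lambda>k. 0) k = 0" by (rule lin_on_zero[OF is_complex_lin[OF CC'(1) k]])
    have "(\<Sum>j\<in>lvl C (1 + hdeg C' k). ent C j l * e j k) \<in> N"
    proof (cases "hdeg C' k = 0")
      case True
      have "(\<Sum>j\<in>lvl C (1 + hdeg C' k). ent C j l * e j k) =
          (\<Sum>j\<in>lvl C 1. \<Sum>i\<in>lvl C 0. ent C j l * (ent C i j * f0 i k))"
        using True by (intro sum.cong) (auto simp: e_def lvl_def sum_distrib_left)
      also have "\<dots> = (\<Sum>i\<in>lvl C 0. f0 i k * (\<Sum>j\<in>lvl C 1. ent C j l * ent C i j))"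
        by (subst sum.swap) (simp add: sum_distrib_left mult_ac)
      also have "\<dots> \<in> N"
      proof (rule is_ideal_sum[OF N], rule is_ideal_mult[OF N])
        fix i assume "i \<in> lvl C 0"
        thus "(\<Sum>j\<in>lvl C 1. ent C j l * ent C i j) \<in> N"
          using ent_sq[OF CC(1), of i l] by (auto simp: lvl_def)
      qed
      finally show ?thesis .
    next
      case False
      thus ?thesis by (intro is_ideal_sum[OF N]) (auto simp: e_def lvl_def is_ideal_zero[OF N])
    qed
    thus "dif C' (e l) k - - 1 * (\<Sum>j\<in>lvl C (1 + hdeg C' k). ent C j l * e j k) \<in> N"
      by (simp add: z)
  qed
  then obtain H where H: "\<forall>l\<in>basis C. 1 \<le> hdeg C l \<longrightarrow>
     (\<forall>k\<in>lvl C' (Suc (hdeg C l - 1)). H l k \<in> Gs (ideg C l) (ideg C' k)) \<and>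
     (\<forall>k\<in>lvl C' (hdeg C l - 1).
        e l k - (-1) * (\<Sum>j\<in>{j\<in>basis C. 1 \<le> hdeg C j \<and> Suc (hdeg C j) = hdeg C l}. ent C j l * H j k) - dif C' (H l) k \<in> N)"
    by (rule exE)
  define f where "f l = (if hdeg C l = 0 then f0 l else H l)" for l
  have "chain_map N C C' f"
    unfolding chain_map_def
  proof (intro ballI impI)
    fix l k assume l: "l \<in> basis C" and k: "k \<in> basis C'" and h: "hdeg C l = Suc (hdeg C' k)"
    have Hl: "e l k + (\<Sum>j\<in>{j\<in>basis C. 1 \<le> hdeg C j \<and> Suc (hdeg C j) = hdeg C l}. ent C j l * H j k) - dif C' (H l) k \<in> N" (is "?x \<in> N")
      using H[rule_format, OF l] h k by (auto simp: lvl_def)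
    have "e l k + (\<Sum>j\<in>{j\<in>basis C. 1 \<le> hdeg C j \<and> Suc (hdeg C j) = hdeg C l}. ent C j l * H j k) = (\<Sum>j\<in>lvl C (hdeg C' k). ent C j l * f j k)"
    proof (cases "hdeg C' k = 0")
      case True
      hence "{j\<in>basis C. 1 \<le> hdeg C j \<and> Suc (hdeg C j) = hdeg C l} = {}" using h by auto
      hence "(\<Sum>j\<in>{j\<in>basis C. 1 \<le> hdeg C j \<and> Suc (hdeg C j) = hdeg C l}. ent C j l * H j k) = 0"
        by (simp only: sum.empty)
      thus ?thesis using True h by (simp only: add_0_right) (simp add: e_def f_def lvl_def)
    next
      case False
      hence *: "{j\<in>basis C. 1 \<le> hdeg C j \<and> Suc (hdeg C j) = hdeg C l} = lvl C (hdeg C' k)"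
        using h by (auto simp: lvl_def)
      have "e l k = 0" using False h by (simp add: e_def)
      thus ?thesis unfolding * using False by (auto simp: f_def lvl_def intro!: sum.cong)
    qed
    thus "dif C' (f l) k - (\<Sum>j\<in>lvl C (hdeg C' k). ent C j l * f j k) \<in> N"
      using is_ideal_minus[OF N Hl] h by (simp add: f_def)
  qed
  moreover have "hom_map Gs C C' f"
    unfolding hom_map_def
  proof (intro ballI)
    fix l k assume l: "l \<in> basis C" and k: "k \<in> lvl C' (hdeg C l)"
    show "f l k \<in> Gs (ideg C l) (ideg C' k)"
    proof (cases "hdeg C l = 0")
      case True thus ?thesis using f0 l k by (auto simp: f_def lvl_def)
    next
      case False
      hence "Suc (hdeg C l - 1) = hdeg C l" "1 \<le> hdeg C l" by auto
      thus ?thesis using H[rule_format, OF l] k False by (auto simp: f_def)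
    qed
  qed
  moreover have "f j = f0 j" if "j \<in> lvl C 0" for j using that by (simp add: f_def lvl_def)
  ultimately show ?thesis by blast
qed

text \<open>The augmentation of \<open>C'\<close> is surjective, so some combination \<open>u\<close> of its generators maps to \<open>1\<close>, and
  \<open>j \<mapsto> a j \<cdot> u\<close> lifts the identity in degree zero.\<close>

lemma comparison:
  fixes C :: "('i, 's::comm_ring_1) based" and C' :: "('j, 's) based"
  assumes N: "is_ideal N" and A: "is_ideal A" "N \<subseteq> A" and g: "gcat N Gs"
    and C: "gres N Gs A C a" and C': "gres N Gs A C' a'"
  shows "\<exists>f. chain_map N C C' f \<and> hom_map Gs C C' f \<and> aug_map_comp A C a C' a' f"
proof -
  have CC: "is_complex N C" "graded_cpx Gs C" and CC': "is_complex N C'" "gexact N Gs C'"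
    using C C' by (auto simp: gres_def)
  obtain u where u: "\<forall>k\<in>lvl C' 0. u k \<in> Gs 0 (ideg C' k)" "(\<Sum>k\<in>lvl C' 0. u k * a' k) - 1 \<in> A"
    using C' by (auto simp: gres_def)
  have a: "a k \<in> Gs (ideg C k) 0" if "k \<in> lvl C 0" for k using C that by (auto simp: gres_def)
  have f0: "a j * u k \<in> Gs (ideg C j) (ideg C' k)" if "j \<in> lvl C 0" "k \<in> lvl C' 0" for j k
    using a u that by (blast intro: gcat_mult[OF g])
  have "\<exists>f. chain_map N C C' f \<and> hom_map Gs C C' f \<and> (\<forall>j\<in>lvl C 0. f j = (\<lambda>j k. a j * u k) j)"
  proof (rule comparison_extend[OF N g CC CC' f0])
    fix l assume l: "l \<in> lvl C 1"
    define e where "e k = (\<Sum>j\<in>lvl C 0. ent C j l * (a j * u k))" for k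
    have hom: "e k \<in> Gs (ideg C l) (ideg C' k)" if "k \<in> lvl C' 0" for k
      unfolding e_def by (rule gcat_sum[OF g N], rule gcat_mult[OF g, of _ _ "ideg C _"])
         (use l that f0 in \<open>auto intro!: graded_cpxD[OF CC(2), of _ 0] simp: lvl_def\<close>)
    have "(\<Sum>k\<in>lvl C' 0. e k * a' k) = (\<Sum>j\<in>lvl C 0. ent C j l * a j * (\<Sum>k\<in>lvl C' 0. u k * a' k))"
      unfolding e_def by (simp add: sum_distrib_left sum_distrib_right) (subst sum.swap, simp add: mult_ac)
    also have "\<dots> = (\<Sum>j\<in>lvl C 0. dif C (unitv l) j * a j) * (\<Sum>k\<in>lvl C' 0. u k * a' k)"
      by (simp add: sum_distrib_right ent_def)
    also have "\<dots> \<in> A" using C by (intro is_ideal_mult_right A) (auto simp: gres_def)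
    finally have "\<exists>c. (\<forall>k\<in>lvl C' 1. c k \<in> Gs (ideg C l) (ideg C' k)) \<and> (\<forall>k\<in>lvl C' 0. e k - dif C' c k \<in> N)"
      using C' hom unfolding gres_def by blast
    thus "\<exists>c. (\<forall>k\<in>lvl C' 1. c k \<in> Gs (ideg C l) (ideg C' k)) \<and>
        (\<forall>k\<in>lvl C' 0. (\<Sum>j\<in>lvl C 0. ent C j l * (a j * u k)) - dif C' c k \<in> N)"
      by (simp only: e_def)
  qed
  then obtain f where f: "chain_map N C C' f" "hom_map Gs C C' f" "\<And>j. j \<in> lvl C 0 \<Longrightarrow> f j = (\<lambda>k. a j * u k)" by auto
  have "aug_map_comp A C a C' a' f"
    unfolding aug_map_comp_def
  proof
    fix l assume l: "l \<in> lvl C 0"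
    have "(\<Sum>k\<in>lvl C' 0. f l k * a' k) - a l = a l * ((\<Sum>k\<in>lvl C' 0. u k * a' k) - 1)"
      by (simp add: f(3)[OF l] sum_distrib_left algebra_simps)
    thus "(\<Sum>k\<in>lvl C' 0. f l k * a' k) - a l \<in> A" using is_ideal_mult[OF A(1) u(2)] by simp
  qed
  thus ?thesis using f by blast
qed

text \<open>The difference between the round trip and the identity induces zero on the resolved module, so it starts
  as a boundary, and \<open>lift_along_exact\<close> with sign \<open>1\<close> makes it null homotopic.\<close>

lemma homotopy:
  fixes C :: "('i, 's::comm_ring_1) based" and C' :: "('j, 's) based"
  assumes N: "is_ideal N" and A: "is_ideal A" "N \<subseteq> A" and g: "gcat N Gs"
    and C: "gres N Gs A C a" and C': "gres N Gs A C' a'"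
    and f: "chain_map N C C' f" "hom_map Gs C C' f" "aug_map_comp A C a C' a' f"
    and f': "chain_map N C' C f'" "hom_map Gs C' C f'" "aug_map_comp A C' a' C a f'"
  shows "\<exists>H. \<forall>l\<in>basis C. \<forall>k\<in>lvl C (hdeg C l).
      (\<Sum>j\<in>lvl C' (hdeg C l). f l j * f' j k) - unitv l k
        - (\<Sum>j\<in>{j\<in>basis C. Suc (hdeg C j) = hdeg C l}. ent C j l * H j k) - dif C (H l) k \<in> N"
proof -
  have CC: "is_complex N C" "graded_cpx Gs C" "gexact N Gs C" and CC': "is_complex N C'"
    using C C' by (auto simp: gres_def)
  define e where "e l k = (\<Sum>j\<in>lvl C' (hdeg C l). f l j * f' j k) - unitv l k" for l k
  have ehom: "e l k \<in> Gs (ideg C l) (ideg C k)" if l: "l \<in> basis C" and k: "k \<in> lvl C (hdeg C l)" for l k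
    unfolding e_def
  proof (rule gcat_diff[OF g])
    show "(\<Sum>j\<in>lvl C' (hdeg C l). f l j * f' j k) \<in> Gs (ideg C l) (ideg C k)"
    proof (rule gcat_sum[OF g N])
      fix j assume j: "j \<in> lvl C' (hdeg C l)"
      show "f l j * f' j k \<in> Gs (ideg C l) (ideg C k)"
        by (rule gcat_mult[OF g, of _ _ "ideg C' j"])
           (use f(2) f'(2) l k j in \<open>auto simp: hom_map_def lvl_def\<close>)
    qed
    show "unitv l k \<in> Gs (ideg C l) (ideg C k)"
      by (auto simp: unitv_def intro: gcat_one[OF g] gcat_N[OF g] is_ideal_zero[OF N])
  qed
  have "\<exists>H. \<forall>l\<in>basis C. 0 \<le> hdeg C l \<longrightarrow>
     (\<forall>k\<in>lvl C (Suc (hdeg C l - 0)). H l k \<in> Gs (ideg C l) (ideg C k)) \<and>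
     (\<forall>k\<in>lvl C (hdeg C l - 0).
        e l k - 1 * (\<Sum>j\<in>{j\<in>basis C. 0 \<le> hdeg C j \<and> Suc (hdeg C j) = hdeg C l}. ent C j l * H j k) - dif C (H l) k \<in> N)"
  proof (rule lift_along_exact[OF N g CC(1,2) CC(1,3)])
    show "1 = 1 \<or> 1 = (- 1 :: 's)" by simp
  next
    fix l k assume l: "l \<in> basis C" and k: "k \<in> lvl C (hdeg C l - 0)"
    thus "e l k \<in> Gs (ideg C l) (ideg C k)" using ehom by simp
  next
    fix l assume l: "l \<in> lvl C 0"
    have fin: "finite (lvl C 0)" using is_complex_finite[OF CC(1)] .
    have "(\<Sum>k\<in>lvl C 0. e l k * a k) = (\<Sum>j\<in>lvl C' 0. f l j * (\<Sum>k\<in>lvl C 0. f' j k * a k)) - (\<Sum>k\<in>lvl C 0. unitv l k * a k)"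
      using l unfolding e_def
      by (simp add: sum_distrib_left sum_distrib_right left_diff_distrib sum_subtractf lvl_hdeg)
         (subst sum.swap, simp add: mult_ac)
    also have "(\<Sum>k\<in>lvl C 0. unitv l k * a k) = a l"
      using l fin by (simp add: unitv_def if_distrib[of "\<lambda>x. x * _"] sum.delta' cong: if_cong)
    also have "(\<Sum>j\<in>lvl C' 0. f l j * (\<Sum>k\<in>lvl C 0. f' j k * a k)) - a l =
       (\<Sum>j\<in>lvl C' 0. f l j * ((\<Sum>k\<in>lvl C 0. f' j k * a k) - a' j)) + ((\<Sum>j\<in>lvl C' 0. f l j * a' j) - a l)"
      by (simp add: right_diff_distrib sum_subtractf)
    also have "\<dots> \<in> A"
      using f(3) f'(3) l by (auto simp: aug_map_comp_def intro!: is_ideal_add A is_ideal_sum is_ideal_mult)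
    finally have "(\<Sum>k\<in>lvl C 0. e l k * a k) \<in> A" .
    moreover have "\<forall>k\<in>lvl C 0. e l k \<in> Gs (ideg C l) (ideg C k)" using ehom[of l] l by (auto simp: lvl_def)
    ultimately show "\<exists>c. (\<forall>k\<in>lvl C 1. c k \<in> Gs (ideg C l) (ideg C k)) \<and> (\<forall>k\<in>lvl C 0. e l k - dif C c k \<in> N)"
      using C unfolding gres_def by blast
  next
    fix l k assume l: "l \<in> basis C" and k: "k \<in> basis C" and h: "hdeg C l = Suc (0 + hdeg C k)"
    have lin: "lin_on (lvl C (Suc (hdeg C k))) (\<lambda>v. dif C v k)" by (rule is_complex_lin[OF CC(1) k])
    let ?n = "hdeg C k"
    \<comment> \<open>\<open>r\<close> and \<open>q\<close> are the defects of \<open>f'\<close> and \<open>f\<close> from being chain maps; both vanish modulo \<open>N\<close>.\<close>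
    define r where "r j = dif C (f' j) k - (\<Sum>i\<in>lvl C' ?n. ent C' i j * f' i k)" for j
    define q where "q i = dif C' (f l) i - (\<Sum>j\<in>lvl C ?n. ent C j l * f j i)" for i
    have r: "r j \<in> N" if "j \<in> lvl C' (Suc ?n)" for j
      unfolding r_def by (rule chain_mapD[OF f'(1) that in_lvl[OF k]])
    have q: "q i \<in> N" if "i \<in> lvl C' ?n" for i
      unfolding q_def by (rule chain_mapD[OF f(1) _ that]) (use l h in \<open>simp add: lvl_def\<close>)
    have "dif C (e l) k = (\<Sum>j\<in>lvl C' (Suc ?n). f l j * dif C (f' j) k) - ent C k l"
      unfolding e_def by (simp add: lin_on_diff[OF lin] lin_on_scale[OF lin] lin_on_sum[OF lin] h ent_def)
    also have "(\<Sum>j\<in>lvl C' (Suc ?n). f l j * dif C (f' j) k) = (\<Sum>j\<in>lvl C' (Suc ?n). f l j * (\<Sum>i\<in>lvl C' ?n. ent C' i j * f' i k)) + (\<Sum>j\<in>lvl C' (Suc ?n). f l j * r j)"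
      unfolding r_def by (simp add: right_diff_distrib sum_subtractf)
    also have "(\<Sum>j\<in>lvl C' (Suc ?n). f l j * (\<Sum>i\<in>lvl C' ?n. ent C' i j * f' i k)) = (\<Sum>i\<in>lvl C' ?n. f' i k * dif C' (f l) i)"
    proof -
      have "(\<Sum>i\<in>lvl C' ?n. f' i k * dif C' (f l) i) = (\<Sum>i\<in>lvl C' ?n. f' i k * (\<Sum>j\<in>lvl C' (Suc ?n). f l j * ent C' i j))"
        by (intro sum.cong refl) (simp add: dif_expand[OF CC'])
      thus ?thesis by (simp add: sum_distrib_left) (subst sum.swap, simp add: mult_ac)
    qed
    also have "\<dots> = (\<Sum>i\<in>lvl C' ?n. f' i k * (\<Sum>j\<in>lvl C ?n. ent C j l * f j i)) + (\<Sum>i\<in>lvl C' ?n. f' i k * q i)"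
      unfolding q_def by (simp add: right_diff_distrib sum_subtractf)
    also have "(\<Sum>i\<in>lvl C' ?n. f' i k * (\<Sum>j\<in>lvl C ?n. ent C j l * f j i)) = (\<Sum>j\<in>lvl C ?n. ent C j l * e j k) + ent C k l"
    proof -
      have "(\<Sum>j\<in>lvl C ?n. ent C j l * e j k) = (\<Sum>j\<in>lvl C ?n. ent C j l * (\<Sum>i\<in>lvl C' ?n. f j i * f' i k)) - (\<Sum>j\<in>lvl C ?n. ent C j l * unitv j k)"
        unfolding e_def sum_subtractf[symmetric] by (intro sum.cong refl) (simp add: lvl_hdeg right_diff_distrib)
      also have "(\<Sum>j\<in>lvl C ?n. ent C j l * unitv j k) = ent C k l"
        using in_lvl[OF k] is_complex_finite[OF CC(1)]
        by (simp add: unitv_def if_distrib[of "\<lambda>x. _ * x"] sum.delta cong: if_cong)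
      finally show ?thesis by (simp add: sum_distrib_left) (subst sum.swap, simp add: mult_ac)
    qed
    finally have "dif C (e l) k - (\<Sum>j\<in>lvl C ?n. ent C j l * e j k) = (\<Sum>i\<in>lvl C' ?n. f' i k * q i) + (\<Sum>j\<in>lvl C' (Suc ?n). f l j * r j)"
      by simp
    also have "\<dots> \<in> N" using r q by (auto intro!: is_ideal_add N is_ideal_sum is_ideal_mult)
    finally show "dif C (e l) k - 1 * (\<Sum>j\<in>lvl C (0 + hdeg C k). ent C j l * e j k) \<in> N" by simp
  qed
  then obtain H where "\<forall>l\<in>basis C. 0 \<le> hdeg C l \<longrightarrow>
     (\<forall>k\<in>lvl C (Suc (hdeg C l - 0)). H l k \<in> Gs (ideg C l) (ideg C k)) \<and>
     (\<forall>k\<in>lvl C (hdeg C l - 0).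
        e l k - 1 * (\<Sum>j\<in>{j\<in>basis C. 0 \<le> hdeg C j \<and> Suc (hdeg C j) = hdeg C l}. ent C j l * H j k) - dif C (H l) k \<in> N)"
    by (rule exE)
  thus ?thesis unfolding e_def by (intro exI[of _ H]) simp
qed

text \<open>Linear algebra over the residue field, with congruences modulo \<open>\<mm>\<close> instead of a quotient ring: a system with
  more unknowns than equations has a solution that is not zero. The proof eliminates one equation at a time with a
  pivot that is a unit modulo \<open>\<mm>\<close>.\<close>

lemma dependent_columns:
  fixes M :: "'j \<Rightarrow> 'i \<Rightarrow> 's::comm_ring_1"
  assumes m: "is_ideal \<mm>" and one: "1 \<notin> \<mm>" and inv: "\<And>x. x \<notin> \<mm> \<Longrightarrow> \<exists>y. x * y - 1 \<in> \<mm>"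
    and K: "finite K" and L: "finite L" "card K < card L"
  shows "\<exists>v. (\<exists>l\<in>L. v l \<notin> \<mm>) \<and> (\<forall>k\<in>K. (\<Sum>l\<in>L. M k l * v l) \<in> \<mm>)"
  using K L
proof (induction K arbitrary: L M rule: finite_induct)
  case empty
  hence "L \<noteq> {}" by auto
  thus ?case using one by (intro exI[of _ "\<lambda>_. 1"]) auto
next
  case (insert k0 K)
  show ?case
  proof (cases "\<forall>l\<in>L. M k0 l \<in> \<mm>")
    case True
    have "card K < card L" using insert by simp
    then obtain v where v: "\<exists>l\<in>L. v l \<notin> \<mm>" "\<forall>k\<in>K. (\<Sum>l\<in>L. M k l * v l) \<in> \<mm>"
      using insert.IH[of L M] insert.prems by blast
    have "(\<Sum>l\<in>L. M k0 l * v l) \<in> \<mm>" using True by (intro is_ideal_sum m is_ideal_mult_right) auto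
    thus ?thesis using v by auto
  next
    case False
    then obtain l0 where l0: "l0 \<in> L" "M k0 l0 \<notin> \<mm>" by blast
    then obtain c where c: "M k0 l0 * c - 1 \<in> \<mm>" using inv by blast
    define L' where "L' = L - {l0}"
    have L': "finite L'" "card K < card L'" using insert l0 by (auto simp: L'_def)
    define M' where "M' k l = M k l - M k l0 * c * M k0 l" for k l
    obtain v where v: "\<exists>l\<in>L'. v l \<notin> \<mm>" "\<forall>k\<in>K. (\<Sum>l\<in>L'. M' k l * v l) \<in> \<mm>"
      using insert.IH[of L' M'] L' by blast
    define t where "t = (\<Sum>l\<in>L'. M k0 l * v l)"
    \<comment> \<open>The value at the pivot column makes the eliminated equation hold.\<close>
    define w where "w l = (if l = l0 then - c * t else v l)" for l
    have s: "(\<Sum>l\<in>L. M k l * w l) = - M k l0 * c * t + (\<Sum>l\<in>L'. M k l * v l)" for k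
    proof -
      have "(\<Sum>l\<in>L. M k l * w l) = M k l0 * w l0 + (\<Sum>l\<in>L'. M k l * w l)"
        unfolding L'_def using insert.prems l0 by (simp add: sum.remove)
      also have "(\<Sum>l\<in>L'. M k l * w l) = (\<Sum>l\<in>L'. M k l * v l)"
        by (intro sum.cong) (auto simp: w_def L'_def)
      finally show ?thesis by (simp add: w_def)
    qed
    have "(\<Sum>l\<in>L. M k0 l * w l) = - t * (M k0 l0 * c - 1)"
      unfolding s t_def[symmetric] by (simp add: algebra_simps)
    hence "(\<Sum>l\<in>L. M k0 l * w l) \<in> \<mm>" using is_ideal_mult[OF m c, of "- t"] by (simp only:)
    moreover have "(\<Sum>l\<in>L. M k l * w l) \<in> \<mm>" if "k \<in> K" for k
    proof -
      have "(\<Sum>l\<in>L. M k l * w l) = (\<Sum>l\<in>L'. M' k l * v l)"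
      proof -
        have "(\<Sum>l\<in>L'. M' k l * v l) = (\<Sum>l\<in>L'. M k l * v l - M k l0 * c * (M k0 l * v l))"
          by (simp add: M'_def algebra_simps)
        thus ?thesis unfolding s t_def by (simp add: sum_subtractf sum_distrib_left[symmetric])
      qed
      thus ?thesis using v that by simp
    qed
    moreover have "\<exists>l\<in>L. w l \<notin> \<mm>" using v(1) by (auto simp: w_def L'_def)
    ultimately show ?thesis by blast
  qed
qed

definition minimal_cpx :: "'s::comm_ring_1 set \<Rightarrow> ('i, 's) based \<Rightarrow> bool" where
  "minimal_cpx \<mm> C \<longleftrightarrow> (\<forall>v. \<forall>k\<in>basis C. dif C v k \<in> \<mm>)"

text \<open>Modulo \<open>\<mm>\<close> the homotopy drops out of \<open>homotopy\<close>, so \<open>f\<close> is injective modulo \<open>\<mm>\<close> and cannot map to fewer generators.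
  Entries between generators of different class \<open>c\<close> lie in \<open>\<mm>\<close>, so this holds in each class separately; \<open>c\<close> is the
  internal degree for graded ranks, and constant for the total ranks.\<close>

lemma minimal_rank_le:
  fixes C :: "('i, 's::comm_ring_1) based" and C' :: "('j, 's) based"
  assumes N: "is_ideal N" and A: "is_ideal A" "N \<subseteq> A" and g: "gcat N Gs"
    and m: "is_ideal \<mm>" "N \<subseteq> \<mm>" "1 \<notin> \<mm>" "\<And>x. x \<notin> \<mm> \<Longrightarrow> \<exists>y. x * y - 1 \<in> \<mm>"
    and c: "\<And>a b. c a \<noteq> c b \<Longrightarrow> Gs b a \<subseteq> \<mm>"
    and C: "gres N Gs A C a" "minimal_cpx \<mm> C" and C': "gres N Gs A C' a'" "minimal_cpx \<mm> C'"
  shows "card {k \<in> lvl C n. c (ideg C k) = d} \<le> card {k \<in> lvl C' n. c (ideg C' k) = (d::nat)}"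
proof (rule ccontr)
  let ?L = "{k \<in> lvl C n. c (ideg C k) = d}" and ?K = "{k \<in> lvl C' n. c (ideg C' k) = d}"
  assume "\<not> card ?L \<le> card ?K"
  hence less: "card ?K < card ?L" by simp
  have fin: "finite ?L" "finite ?K" "finite (lvl C' n)"
    using is_complex_finite[of N C n] is_complex_finite[of N C' n] C(1) C'(1) unfolding gres_def by auto
  obtain f where f: "chain_map N C C' f" "hom_map Gs C C' f" "aug_map_comp A C a C' a' f"
    using comparison[OF N A g C(1) C'(1)] by blast
  obtain f' where f': "chain_map N C' C f'" "hom_map Gs C' C f'" "aug_map_comp A C' a' C a f'"
    using comparison[OF N A g C'(1) C(1)] by blast
  obtain H where H: "\<forall>l\<in>basis C. \<forall>k\<in>lvl C (hdeg C l).
      (\<Sum>j\<in>lvl C' (hdeg C l). f l j * f' j k) - unitv l k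
        - (\<Sum>j\<in>{j\<in>basis C. Suc (hdeg C j) = hdeg C l}. ent C j l * H j k) - dif C (H l) k \<in> N"
    using homotopy[OF N A g C(1) C'(1) f f'] by (rule exE)
  have key: "(\<Sum>j\<in>?K. f l j * f' j k) - unitv l k \<in> \<mm>" if l: "l \<in> ?L" and k: "k \<in> ?L" for l k
  proof -
    have lb: "l \<in> basis C" "hdeg C l = n" and kb: "k \<in> lvl C (hdeg C l)" using l k by (auto simp: lvl_def)
    let ?s = "\<Sum>j\<in>{j\<in>basis C. Suc (hdeg C j) = hdeg C l}. ent C j l * H j k"
    let ?F = "\<Sum>j\<in>lvl C' n. f l j * f' j k"
    have 1: "?F - unitv l k - ?s - dif C (H l) k \<in> \<mm>" using H lb kb m(2) by fastforce
    have 2: "?s \<in> \<mm>"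
      by (intro is_ideal_sum m is_ideal_mult_right) (use C(2) in \<open>auto simp: ent_def minimal_cpx_def\<close>)
    have 3: "dif C (H l) k \<in> \<mm>" using C(2) k by (auto simp: minimal_cpx_def lvl_def)
    have 4: "?F = (\<Sum>j\<in>?K. f l j * f' j k) + (\<Sum>j\<in>lvl C' n - ?K. f l j * f' j k)"
      using sum.subset_diff[of ?K "lvl C' n" "\<lambda>j. f l j * f' j k"] fin by (simp add: add.commute)
    have 5: "(\<Sum>j\<in>lvl C' n - ?K. f l j * f' j k) \<in> \<mm>"
    proof (intro is_ideal_sum m is_ideal_mult_right)
      fix j assume j: "j \<in> lvl C' n - ?K"
      hence "f l j \<in> Gs (ideg C l) (ideg C' j)" using f(2) lb by (auto simp: hom_map_def)
      moreover have "c (ideg C' j) \<noteq> c (ideg C l)" using j l by auto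
      ultimately show "f l j \<in> \<mm>" using c by blast
    qed
    have "(\<Sum>j\<in>?K. f l j * f' j k) - unitv l k =
        (?F - unitv l k - ?s - dif C (H l) k) + ?s + dif C (H l) k - (\<Sum>j\<in>lvl C' n - ?K. f l j * f' j k)"
      using 4 by simp
    thus ?thesis using is_ideal_diff[OF m(1) is_ideal_add[OF m(1) is_ideal_add[OF m(1) 1 2] 3] 5] by (simp only:)
  qed
  \<comment> \<open>A vector in the kernel of \<open>f\<close> modulo \<open>\<mm>\<close>; the round trip, which is the identity modulo \<open>\<mm>\<close>, kills it.\<close>
  obtain v where v: "\<exists>l\<in>?L. v l \<notin> \<mm>" "\<forall>j\<in>?K. (\<Sum>l\<in>?L. f l j * v l) \<in> \<mm>"
    using dependent_columns[OF m(1) m(3) m(4) fin(2) fin(1) less, of "\<lambda>j l. f l j"] by blast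
  have "v k \<in> \<mm>" if k: "k \<in> ?L" for k
  proof -
    have "(\<Sum>l\<in>?L. v l * ((\<Sum>j\<in>?K. f l j * f' j k) - unitv l k)) \<in> \<mm>"
      using key k by (intro is_ideal_sum m is_ideal_mult) auto
    also have "(\<Sum>l\<in>?L. v l * ((\<Sum>j\<in>?K. f l j * f' j k) - unitv l k)) =
       (\<Sum>l\<in>?L. v l * (\<Sum>j\<in>?K. f l j * f' j k)) - (\<Sum>l\<in>?L. v l * unitv l k)"
      by (simp add: right_diff_distrib sum_subtractf)
    also have "(\<Sum>l\<in>?L. v l * unitv l k) = v k"
      using k fin by (simp add: unitv_def if_distrib[of "\<lambda>x. _ * x"] sum.delta cong: if_cong)
    also have "(\<Sum>l\<in>?L. v l * (\<Sum>j\<in>?K. f l j * f' j k)) = (\<Sum>j\<in>?K. f' j k * (\<Sum>l\<in>?L. f l j * v l))"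
      by (simp add: sum_distrib_left) (subst sum.swap, simp add: mult_ac)
    finally have 1: "(\<Sum>j\<in>?K. f' j k * (\<Sum>l\<in>?L. f l j * v l)) - v k \<in> \<mm>" .
    have "(\<Sum>j\<in>?K. f' j k * (\<Sum>l\<in>?L. f l j * v l)) \<in> \<mm>"
      by (rule is_ideal_sum[OF m(1)], rule is_ideal_mult[OF m(1)], rule v(2)[rule_format])
    from is_ideal_diff[OF m(1) this 1] show ?thesis by simp
  qed
  thus False using v(1) by blast
qed

text \<open>The Tor modules of \<open>S/A\<close> and \<open>S/J\<close> do not depend on the resolution: transport a cycle modulo \<open>J\<close> from
  \<open>C'\<close> to \<open>C\<close>, bound it there, transport the bounding chain back and correct it by the homotopy.\<close>

lemma exact_modulo_transfer:
  fixes C :: "('i, 's::comm_ring_1) based" and C' :: "('j, 's) based"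
  assumes N: "is_ideal N" and A: "is_ideal A" "N \<subseteq> A" and J: "is_ideal J" "N \<subseteq> J"
    and C: "gres N (\<lambda>_ _. UNIV) A C a" and C': "gres N (\<lambda>_ _. UNIV) A C' a'"
    and ex: "\<And>n v. (\<And>k. k \<in> lvl C n \<Longrightarrow> dif C v k \<in> J) \<Longrightarrow> \<exists>w. \<forall>k\<in>lvl C (Suc n). v k - dif C w k \<in> J"
  shows "exact J C'"
  unfolding exact_def
proof (intro allI impI)
  fix n v assume v: "\<forall>k\<in>lvl C' n. dif C' v k \<in> J"
  note g = gcat_UNIV
  have CC: "is_complex N C" and CC': "is_complex N C'" using C C' by (auto simp: gres_def)
  obtain f where f: "chain_map N C' C f" "hom_map (\<lambda>_ _. UNIV) C' C f" "aug_map_comp A C' a' C a f"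
    using comparison[OF N A g C' C] by blast
  obtain f' where f': "chain_map N C C' f'" "hom_map (\<lambda>_ _. UNIV) C C' f'" "aug_map_comp A C a C' a' f'"
    using comparison[OF N A g C C'] by blast
  obtain H where H: "\<forall>l\<in>basis C'. \<forall>k\<in>lvl C' (hdeg C' l).
      (\<Sum>j\<in>lvl C (hdeg C' l). f l j * f' j k) - unitv l k
        - (\<Sum>j\<in>{j\<in>basis C'. Suc (hdeg C' j) = hdeg C' l}. ent C' j l * H j k) - dif C' (H l) k \<in> N"
    using homotopy[OF N A g C' C f f'] by (rule exE)
  let ?L = "lvl C' (Suc n)"
  \<comment> \<open>The image of \<open>v\<close> under the chain map \<open>f\<close>.\<close>
  define fv where "fv k = (\<Sum>l\<in>?L. v l * f l k)" for k
  have swap: "(\<Sum>l\<in>?L. v l * (\<Sum>j\<in>lvl C' n. ent C' j l * x j)) = (\<Sum>j\<in>lvl C' n. x j * dif C' v j)" for x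
  proof -
    have "(\<Sum>j\<in>lvl C' n. x j * dif C' v j) = (\<Sum>j\<in>lvl C' n. x j * (\<Sum>l\<in>?L. v l * ent C' j l))"
      by (intro sum.cong refl) (simp add: dif_expand[OF CC'])
    thus ?thesis by (simp add: sum_distrib_left) (subst sum.swap, simp add: mult_ac)
  qed
  have swapJ: "(\<Sum>l\<in>?L. v l * (\<Sum>j\<in>lvl C' n. ent C' j l * x j)) \<in> J" for x
    unfolding swap using v by (intro is_ideal_sum J is_ideal_mult) auto
  have "dif C fv k \<in> J" if k: "k \<in> lvl C n" for k
  proof -
    have lin: "lin_on (lvl C (Suc n)) (\<lambda>v. dif C v k)" by (rule is_complex_lin_lvl[OF CC k])
    have "dif C fv k = (\<Sum>l\<in>?L. v l * dif C (f l) k)"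
      unfolding fv_def by (simp add: lin_on_sum[OF lin] lin_on_scale[OF lin])
    also have "\<dots> = (\<Sum>l\<in>?L. v l * (dif C (f l) k - (\<Sum>j\<in>lvl C' n. ent C' j l * f j k))) + (\<Sum>l\<in>?L. v l * (\<Sum>j\<in>lvl C' n. ent C' j l * f j k))"
      by (simp add: right_diff_distrib sum_subtractf)
    also have "\<dots> \<in> J"
    proof (rule is_ideal_add[OF J(1) _ swapJ], rule is_ideal_sum[OF J(1)], rule is_ideal_mult[OF J(1)])
      fix l assume "l \<in> ?L"
      thus "dif C (f l) k - (\<Sum>j\<in>lvl C' n. ent C' j l * f j k) \<in> J"
        using chain_mapD[OF f(1) _ k] J(2) by blast
    qed
    finally show ?thesis .
  qed
  then obtain u where u: "\<forall>k\<in>lvl C (Suc n). fv k - dif C u k \<in> J" using ex by blast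
  \<comment> \<open>The bounding chain transported back, corrected by the homotopy \<open>H\<close>.\<close>
  define w where "w k = (\<Sum>i\<in>lvl C (Suc (Suc n)). u i * f' i k) - (\<Sum>l\<in>?L. v l * H l k)" for k
  have "v k - dif C' w k \<in> J" if k: "k \<in> ?L" for k
  proof -
    have lin: "lin_on (lvl C' (Suc (Suc n))) (\<lambda>v. dif C' v k)" by (rule is_complex_lin_lvl[OF CC' k])
    define q where "q l = (\<Sum>j\<in>lvl C (Suc n). f l j * f' j k) - unitv l k
        - (\<Sum>j\<in>lvl C' n. ent C' j l * H j k) - dif C' (H l) k" for l
    have q: "q l \<in> N" if l: "l \<in> ?L" for l
    proof -
      have "{j\<in>basis C'. Suc (hdeg C' j) = hdeg C' l} = lvl C' n" using l by (auto simp: lvl_def)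
      thus ?thesis using H l k unfolding q_def by (auto simp: lvl_def)
    qed
    define p where "p i = dif C' (f' i) k - (\<Sum>j\<in>lvl C (Suc n). ent C j i * f' j k)" for i
    have p: "p i \<in> N" if "i \<in> lvl C (Suc (Suc n))" for i
      unfolding p_def by (rule chain_mapD[OF f'(1) that k])
    define T where "T = (\<Sum>j\<in>lvl C (Suc n). (fv j - dif C u j) * f' j k)"
    have T: "T \<in> J" unfolding T_def using u by (intro is_ideal_sum J is_ideal_mult_right) auto
    have e1: "(\<Sum>l\<in>?L. v l * q l) = (\<Sum>j\<in>lvl C (Suc n). fv j * f' j k) - v k
        - (\<Sum>l\<in>?L. v l * (\<Sum>j\<in>lvl C' n. ent C' j l * H j k)) - (\<Sum>l\<in>?L. v l * dif C' (H l) k)"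
    proof -
      have "(\<Sum>l\<in>?L. v l * unitv l k) = v k"
        using k is_complex_finite[OF CC'] by (simp add: unitv_def if_distrib[of "\<lambda>x. _ * x"] sum.delta cong: if_cong)
      moreover have "(\<Sum>l\<in>?L. v l * (\<Sum>j\<in>lvl C (Suc n). f l j * f' j k)) = (\<Sum>j\<in>lvl C (Suc n). fv j * f' j k)"
        unfolding fv_def by (simp add: sum_distrib_left sum_distrib_right) (subst sum.swap, simp add: mult_ac)
      ultimately show ?thesis unfolding q_def by (simp add: right_diff_distrib sum_subtractf)
    qed
    have e2: "(\<Sum>j\<in>lvl C (Suc n). fv j * f' j k) = T + (\<Sum>j\<in>lvl C (Suc n). dif C u j * f' j k)"
      unfolding T_def by (simp add: left_diff_distrib sum_subtractf)
    have e3: "(\<Sum>j\<in>lvl C (Suc n). dif C u j * f' j k) = (\<Sum>i\<in>lvl C (Suc (Suc n)). u i * dif C' (f' i) k) - (\<Sum>i\<in>lvl C (Suc (Suc n)). u i * p i)"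
    proof -
      have "(\<Sum>j\<in>lvl C (Suc n). dif C u j * f' j k) = (\<Sum>j\<in>lvl C (Suc n). (\<Sum>i\<in>lvl C (Suc (Suc n)). u i * ent C j i) * f' j k)"
        by (intro sum.cong refl) (simp add: dif_expand[OF CC])
      also have "\<dots> = (\<Sum>i\<in>lvl C (Suc (Suc n)). u i * (\<Sum>j\<in>lvl C (Suc n). ent C j i * f' j k))"
        by (simp add: sum_distrib_left sum_distrib_right) (subst sum.swap, simp add: mult_ac)
      finally show ?thesis unfolding p_def by (simp add: right_diff_distrib sum_subtractf)
    qed
    have e4: "dif C' w k = (\<Sum>i\<in>lvl C (Suc (Suc n)). u i * dif C' (f' i) k) - (\<Sum>l\<in>?L. v l * dif C' (H l) k)"
      unfolding w_def by (simp add: lin_on_diff[OF lin] lin_on_sum[OF lin] lin_on_scale[OF lin])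
    have "v k - dif C' w k = T - (\<Sum>i\<in>lvl C (Suc (Suc n)). u i * p i)
        - (\<Sum>l\<in>?L. v l * (\<Sum>j\<in>lvl C' n. ent C' j l * H j k)) - (\<Sum>l\<in>?L. v l * q l)"
    proof -
      have "v k = (\<Sum>j\<in>lvl C (Suc n). fv j * f' j k) - (\<Sum>l\<in>?L. v l * (\<Sum>j\<in>lvl C' n. ent C' j l * H j k))
          - (\<Sum>l\<in>?L. v l * dif C' (H l) k) - (\<Sum>l\<in>?L. v l * q l)"
        unfolding e1 by simp
      hence "v k - dif C' w k = ((\<Sum>j\<in>lvl C (Suc n). fv j * f' j k) - (\<Sum>l\<in>?L. v l * (\<Sum>j\<in>lvl C' n. ent C' j l * H j k))
          - (\<Sum>l\<in>?L. v l * dif C' (H l) k) - (\<Sum>l\<in>?L. v l * q l)) - dif C' w k" by (rule arg_cong)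
      also have "\<dots> = T - (\<Sum>i\<in>lvl C (Suc (Suc n)). u i * p i)
        - (\<Sum>l\<in>?L. v l * (\<Sum>j\<in>lvl C' n. ent C' j l * H j k)) - (\<Sum>l\<in>?L. v l * q l)"
        unfolding e2 e3 e4 by (simp only: algebra_simps) (simp add: algebra_simps)?
      finally show ?thesis .
    qed
    also have "\<dots> \<in> J"
    proof (intro is_ideal_diff J(1) T swapJ)
      show "(\<Sum>i\<in>lvl C (Suc (Suc n)). u i * p i) \<in> J" using p J by (intro is_ideal_sum is_ideal_mult) auto
      show "(\<Sum>l\<in>?L. v l * q l) \<in> J" using q J by (intro is_ideal_sum is_ideal_mult) auto
    qed
    finally show ?thesis .
  qed
  thus "\<exists>w. \<forall>k\<in>?L. v k - dif C' w k \<in> J" by blast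
qed

section \<open>Cones and tensor products\<close>

text \<open>A resolution of \<open>S/A\<close> whose only generator in degree zero is \<open>e\<close>, in internal degree zero, with
  the augmentation that sends \<open>e\<close> to \<open>1\<close>. The last clause determines \<open>A\<close> from the complex.\<close>

definition cyc_res :: "'s::comm_ring_1 set \<Rightarrow> 's set \<Rightarrow> ('i, 's) based \<Rightarrow> 'i \<Rightarrow> bool" where
  "cyc_res N A C e \<longleftrightarrow> is_complex N C \<and> exact N C \<and> lvl C 0 = {e} \<and> ideg C e = 0 \<and>
     (\<forall>x. x \<in> A \<longleftrightarrow> (\<exists>w. x - dif C w e \<in> N))"

lemma cyc_resD:
  assumes "cyc_res N A C e"
  shows "is_complex N C" "exact N C" "lvl C 0 = {e}" "ideg C e = 0" "e \<in> basis C" "hdeg C e = 0"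
    "x \<in> A \<longleftrightarrow> (\<exists>w. x - dif C w e \<in> N)"
  using assms by (auto simp: cyc_res_def lvl_def)

lemma cyc_res_lin: "cyc_res N A C e \<Longrightarrow> lin_on (lvl C 1) (\<lambda>v. dif C v e)"
  using is_complex_lin_lvl[of N C e 0] by (auto simp: cyc_res_def)

lemma cyc_res_dif: "is_ideal N \<Longrightarrow> cyc_res N A C e \<Longrightarrow> dif C w e \<in> A"
  by (auto simp: cyc_resD(7) intro!: exI[of _ w] is_ideal_zero)

lemma cyc_res_ideal:
  assumes N: "is_ideal N" and C: "cyc_res N A C e"
  shows "is_ideal A" "N \<subseteq> A"
proof -
  note lin = cyc_res_lin[OF C]
  show "N \<subseteq> A" by (auto simp: cyc_resD(7)[OF C] lin_on_zero[OF lin] intro!: exI[of _ "\<lambda>_. 0"])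
  show "is_ideal A" unfolding is_ideal_def
  proof (intro conjI ballI allI)
    show "0 \<in> A" using \<open>N \<subseteq> A\<close> is_ideal_zero[OF N] by blast
  next
    fix x y assume "x \<in> A" "y \<in> A"
    then obtain v w where vw: "x - dif C v e \<in> N" "y - dif C w e \<in> N" by (auto simp: cyc_resD(7)[OF C])
    have "x + y - dif C (\<lambda>l. v l + w l) e = (x - dif C v e) + (y - dif C w e)"
      by (simp add: lin_on_add[OF lin])
    thus "x + y \<in> A" unfolding cyc_resD(7)[OF C] using is_ideal_add[OF N vw] by (metis (no_types))
  next
    fix r x assume "x \<in> A"
    then obtain v where v: "x - dif C v e \<in> N" by (auto simp: cyc_resD(7)[OF C])
    have "r * x - dif C (\<lambda>l. r * v l) e = r * (x - dif C v e)"
      by (simp add: lin_on_scale[OF lin] right_diff_distrib)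
    thus "r * x \<in> A" unfolding cyc_resD(7)[OF C] using is_ideal_mult[OF N v] by (metis (no_types))
  qed
qed

text \<open>The sign in the last clause makes the differential of the cone square to zero. No degree is shifted:
  \<open>\<theta>\<close> lowers the homological degree by one, like a component of the differential.\<close>

definition attach :: "'s::comm_ring_1 set \<Rightarrow> ('i, 's) based \<Rightarrow> ('j, 's) based \<Rightarrow> (('j \<Rightarrow> 's) \<Rightarrow> 'i \<Rightarrow> 's) \<Rightarrow> bool" where
  "attach N C Q \<theta> \<longleftrightarrow> (\<forall>k\<in>basis C. lin_on (lvl Q (Suc (hdeg C k))) (\<lambda>v. \<theta> v k)) \<and>
     (\<forall>v. \<forall>k\<in>basis C. dif C (\<theta> v) k + \<theta> (dif Q v) k \<in> N)"

text \<open>Cones are described by a property, with arbitrary injections of the two bases, because the Koszul complex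
  is a cone on lists, whereas the other cones are formed on sum types.\<close>

definition is_cone :: "('i \<Rightarrow> 'k) \<Rightarrow> ('j \<Rightarrow> 'k) \<Rightarrow> (('j \<Rightarrow> 's::comm_ring_1) \<Rightarrow> 'i \<Rightarrow> 's) \<Rightarrow>
    ('i, 's) based \<Rightarrow> ('j, 's) based \<Rightarrow> ('k, 's) based \<Rightarrow> bool" where
  "is_cone inl inr \<theta> C Q K \<longleftrightarrow> inj inl \<and> inj inr \<and> (\<forall>x y. inl x \<noteq> inr y) \<and>
     basis K = inl ` basis C \<union> inr ` basis Q \<and>
     (\<forall>k\<in>basis C. hdeg K (inl k) = hdeg C k \<and> ideg K (inl k) = ideg C k \<and>
        (\<forall>v. dif K v (inl k) = dif C (\<lambda>l. v (inl l)) k + \<theta> (\<lambda>q. v (inr q)) k)) \<and>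
     (\<forall>q\<in>basis Q. hdeg K (inr q) = hdeg Q q \<and> ideg K (inr q) = ideg Q q \<and>
        (\<forall>v. dif K v (inr q) = dif Q (\<lambda>q. v (inr q)) q))"

lemma is_coneD:
  assumes "is_cone inl inr \<theta> C Q K"
  shows "inj inl" "inj inr" "inl x \<noteq> inr y" "inr y \<noteq> inl x" "basis K = inl ` basis C \<union> inr ` basis Q"
    "k \<in> basis C \<Longrightarrow> hdeg K (inl k) = hdeg C k" "k \<in> basis C \<Longrightarrow> ideg K (inl k) = ideg C k"
    "k \<in> basis C \<Longrightarrow> dif K v (inl k) = dif C (\<lambda>l. v (inl l)) k + \<theta> (\<lambda>q. v (inr q)) k"
    "q \<in> basis Q \<Longrightarrow> hdeg K (inr q) = hdeg Q q" "q \<in> basis Q \<Longrightarrow> ideg K (inr q) = ideg Q q"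
    "q \<in> basis Q \<Longrightarrow> dif K v (inr q) = dif Q (\<lambda>q. v (inr q)) q"
  using assms by (auto simp: is_cone_def) metis

lemma cone_lvl:
  assumes "is_cone inl inr \<theta> C Q K"
  shows "lvl K n = inl ` lvl C n \<union> inr ` lvl Q n"
  unfolding lvl_def is_coneD(5)[OF assms] by (auto simp: is_coneD[OF assms])

lemma cone_glue:
  assumes "is_cone inl inr \<theta> C Q K"
  shows "\<exists>v. (\<forall>k. v (inl k) = z k) \<and> (\<forall>q. v (inr q) = w q)"
proof (intro exI conjI allI)
  show "(if inl k \<in> range inl then z (the_inv inl (inl k)) else w (the_inv inr (inl k))) = z k" for k
    using the_inv_f_f[OF is_coneD(1)[OF assms]] by simp
  show "(if inr q \<in> range inl then z (the_inv inl (inr q)) else w (the_inv inr (inr q))) = w q" for q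
    using the_inv_f_f[OF is_coneD(2)[OF assms]] is_coneD(4)[OF assms] by auto
qed

lemma cone_complex:
  assumes N: "is_ideal N" and K: "is_cone inl inr \<theta> C Q K" and C: "is_complex N C" and Q: "is_complex N Q"
    and th: "attach N C Q \<theta>"
  shows "is_complex N K"
  unfolding is_complex_def
proof (intro conjI allI ballI)
  have fin: "finite (lvl K n)" for n
    unfolding cone_lvl[OF K] using is_complex_finite[OF C] is_complex_finite[OF Q] by auto
  thus "finite (lvl K n)" for n .
  fix k assume k: "k \<in> basis K"
  show "lin_on (lvl K (Suc (hdeg K k))) (\<lambda>v. dif K v k)"
  proof (cases "\<exists>c\<in>basis C. k = inl c")
    case True
    then obtain c where c: "c \<in> basis C" "k = inl c" by blast
    have "lin_on (lvl K (Suc (hdeg K k))) (\<lambda>v. dif C (\<lambda>l. v (inl l)) c + \<theta> (\<lambda>q. v (inr q)) c)"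
    proof (rule lin_on_plus)
      show "lin_on (lvl K (Suc (hdeg K k))) (\<lambda>v. dif C (\<lambda>l. v (inl l)) c)"
        by (rule lin_on_reindex[OF is_complex_lin[OF C c(1)] _ fin])
           (auto simp: cone_lvl[OF K] c is_coneD[OF K])
      show "lin_on (lvl K (Suc (hdeg K k))) (\<lambda>v. \<theta> (\<lambda>q. v (inr q)) c)"
        by (rule lin_on_reindex[of "lvl Q (Suc (hdeg C c))" "\<lambda>v. \<theta> v c", OF _ _ fin])
           (use th c in \<open>auto simp: attach_def cone_lvl[OF K] is_coneD[OF K]\<close>)
    qed
    thus ?thesis using c by (simp add: is_coneD[OF K])
  next
    case False
    then obtain q where q: "q \<in> basis Q" "k = inr q" using k is_coneD(5)[OF K] by blast
    have "lin_on (lvl K (Suc (hdeg K k))) (\<lambda>v. dif Q (\<lambda>l. v (inr l)) q)"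
        by (rule lin_on_reindex[OF is_complex_lin[OF Q q(1)] _ fin])
           (auto simp: cone_lvl[OF K] q is_coneD[OF K])
    thus ?thesis using q by (simp add: is_coneD[OF K])
  qed
next
  fix v k assume k: "k \<in> basis K"
  show "dif K (dif K v) k \<in> N"
  proof (cases "\<exists>c\<in>basis C. k = inl c")
    case True
    then obtain c where c: "c \<in> basis C" "k = inl c" by blast
    note lin = is_complex_lin[OF C c(1)]
    have lin2: "lin_on (lvl Q (Suc (hdeg C c))) (\<lambda>v. \<theta> v c)" using th c by (auto simp: attach_def)
    let ?l = "\<lambda>l. v (inl l)" and ?r = "\<lambda>q. v (inr q)"
    have 1: "dif C (\<lambda>l. dif K v (inl l)) c = dif C (\<lambda>l. dif C ?l l + \<theta> ?r l) c"
      by (rule lin_on_local[OF lin]) (simp add: is_coneD[OF K] lvl_basis)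
    have 2: "\<theta> (\<lambda>q. dif K v (inr q)) c = \<theta> (dif Q ?r) c"
      by (rule lin_on_local[OF lin2]) (simp add: is_coneD[OF K] lvl_basis)
    have "dif K (dif K v) k = dif C (dif C ?l) c + (dif C (\<theta> ?r) c + \<theta> (dif Q ?r) c)"
      unfolding c(2) is_coneD(8)[OF K c(1)] 1 2 by (simp add: lin_on_add[OF lin] add.assoc)
    also have "\<dots> \<in> N" using is_complex_sq[OF C c(1)] th c(1) by (auto simp: attach_def intro: is_ideal_add[OF N])
    finally show ?thesis .
  next
    case False
    then obtain q where q: "q \<in> basis Q" "k = inr q" using k is_coneD(5)[OF K] by blast
    have "dif Q (\<lambda>l. dif K v (inr l)) q = dif Q (dif Q (\<lambda>q. v (inr q))) q"
      by (rule lin_on_local[OF is_complex_lin[OF Q q(1)]]) (simp add: is_coneD[OF K] lvl_basis)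
    thus ?thesis using is_complex_sq[OF Q q(1)] q by (simp add: is_coneD(11)[OF K])
  qed
qed

text \<open>Attaching \<open>Q\<close> to a resolution of \<open>S/A\<close> gives a resolution of the quotient by a larger ideal if \<open>Q\<close> has homology only
  in its lowest degree \<open>1\<close> and \<open>\<theta>\<close> embeds that homology into \<open>S/A\<close>. Both conditions are contained in the
  assumption \<open>ex\<close>: in the lowest degree a vector has to be a boundary only if \<open>\<theta>\<close> sends it into \<open>A\<close>.\<close>

lemma cone_cyc_res:
  assumes N: "is_ideal N" and K: "is_cone inl inr \<theta> C Q K" and C: "cyc_res N A C e" and Q: "is_complex N Q"
    and th: "attach N C Q \<theta>" and Q0: "lvl Q 0 = {}"
    and ex: "\<And>n v. (\<And>q. q \<in> lvl Q n \<Longrightarrow> dif Q v q \<in> N) \<Longrightarrow> (n = 0 \<Longrightarrow> \<theta> v e \<in> A) \<Longrightarrow>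
       \<exists>w. \<forall>q\<in>lvl Q (Suc n). v q - dif Q w q \<in> N"
  shows "cyc_res N {x. \<exists>v. x - \<theta> v e \<in> A} K (inl e)"
  unfolding cyc_res_def
proof (intro conjI allI)
  note Cc = cyc_resD(1)[OF C]
  note A = cyc_res_ideal[OF N C]
  have e: "e \<in> basis C" "hdeg C e = 0" using cyc_resD[OF C] by auto
  have linth: "k \<in> lvl C n \<Longrightarrow> lin_on (lvl Q (Suc n)) (\<lambda>v. \<theta> v k)" for k n
    using th by (auto simp: attach_def lvl_def)
  show "is_complex N K" by (rule cone_complex[OF N K Cc Q th])
  show "lvl K 0 = {inl e}" by (simp add: cone_lvl[OF K] Q0 cyc_resD[OF C])
  show "ideg K (inl e) = 0" using cyc_resD[OF C] by (simp add: is_coneD[OF K])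
  show "exact N K" unfolding exact_def
  proof (intro allI impI)
    fix n v assume v: "\<forall>k\<in>lvl K n. dif K v k \<in> N"
    let ?l = "\<lambda>l. v (inl l)" and ?r = "\<lambda>q. v (inr q)"
    have vl: "dif C ?l k + \<theta> ?r k \<in> N" if "k \<in> lvl C n" for k
      using bspec[OF v, of "inl k"] that lvl_basis[OF that] by (simp add: cone_lvl[OF K] is_coneD[OF K])
    have vr: "dif Q ?r q \<in> N" if "q \<in> lvl Q n" for q
      using bspec[OF v, of "inr q"] that lvl_basis[OF that] by (simp add: cone_lvl[OF K] is_coneD[OF K])
    have "\<theta> ?r e \<in> A" if "n = 0"
    proof -
      have "dif C ?l e + \<theta> ?r e \<in> A" using vl[of e] that A(2) by (auto simp: cyc_resD[OF C])
      from is_ideal_diff[OF A(1) this cyc_res_dif[OF N C, of ?l]] show ?thesis by simp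
    qed
    then obtain w where w: "\<forall>q\<in>lvl Q (Suc n). v (inr q) - dif Q w q \<in> N" using ex[of n ?r] vr by blast
    \<comment> \<open>Once the component in \<open>Q\<close> is bounded by \<open>w\<close>, subtracting the differential of \<open>w\<close> leaves a cycle in \<open>C\<close>.\<close>
    have "dif C (\<lambda>l. v (inl l) - \<theta> w l) k \<in> N" if k: "k \<in> lvl C n" for k
    proof -
      note lin = is_complex_lin_lvl[OF Cc k]
      have a: "dif C (\<theta> w) k + \<theta> (dif Q w) k \<in> N" using th k by (auto simp: attach_def lvl_def)
      have b: "\<theta> ?r k - \<theta> (dif Q w) k \<in> N"
        by (rule lin_on_cong_ideal[OF linth[OF k] N]) (use w in auto)
      have "dif C (\<lambda>l. v (inl l) - \<theta> w l) k = (dif C ?l k + \<theta> ?r k) - (\<theta> ?r k - \<theta> (dif Q w) k) - (dif C (\<theta> w) k + \<theta> (dif Q w) k)"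
        by (simp add: lin_on_diff[OF lin])
      thus ?thesis using is_ideal_diff[OF N is_ideal_diff[OF N vl[OF k] b] a] by simp
    qed
    then obtain z where z: "\<forall>k\<in>lvl C (Suc n). v (inl k) - \<theta> w k - dif C z k \<in> N"
      using exactD[OF cyc_resD(2)[OF C], of n "\<lambda>l. v (inl l) - \<theta> w l"] by blast
    obtain y where y: "\<forall>k. y (inl k) = z k" "\<forall>q. y (inr q) = w q" using cone_glue[OF K] by blast
    have "v k - dif K y k \<in> N" if "k \<in> lvl K (Suc n)" for k
      using that z w y by (auto simp: cone_lvl[OF K] is_coneD[OF K] lvl_basis algebra_simps)
    thus "\<exists>w. \<forall>k\<in>lvl K (Suc n). v k - dif K w k \<in> N" by blast
  qed
  fix x
  show "x \<in> {x. \<exists>v. x - \<theta> v e \<in> A} \<longleftrightarrow> (\<exists>w. x - dif K w (inl e) \<in> N)"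
  proof
    assume "x \<in> {x. \<exists>v. x - \<theta> v e \<in> A}"
    then obtain w z where wz: "x - \<theta> w e - dif C z e \<in> N" by (auto simp: cyc_resD(7)[OF C])
    obtain y where y: "\<forall>k. y (inl k) = z k" "\<forall>q. y (inr q) = w q" using cone_glue[OF K] by blast
    show "\<exists>w. x - dif K w (inl e) \<in> N"
      using wz y by (intro exI[of _ y]) (simp add: is_coneD[OF K] e algebra_simps)
  next
    assume "\<exists>w. x - dif K w (inl e) \<in> N"
    then obtain y where "x - dif K y (inl e) \<in> N" by blast
    hence "x - \<theta> (\<lambda>q. y (inr q)) e - dif C (\<lambda>q. y (inl q)) e \<in> N" by (simp add: is_coneD[OF K] e algebra_simps)
    thus "x \<in> {x. \<exists>v. x - \<theta> v e \<in> A}" using cyc_resD(7)[OF C] by blast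
  qed
qed

lemma cone_minimal:
  assumes m: "is_ideal \<mm>" and K: "is_cone inl inr \<theta> C Q K" and "minimal_cpx \<mm> C" "minimal_cpx \<mm> Q"
    "\<And>v k. k \<in> basis C \<Longrightarrow> \<theta> v k \<in> \<mm>"
  shows "minimal_cpx \<mm> K"
  using assms(3,4) by (auto simp: minimal_cpx_def is_coneD(5)[OF K] is_coneD[OF K] intro!: is_ideal_add[OF m] assms(5))

lemma unitv_compose: "inj f \<Longrightarrow> (\<lambda>l. unitv (f k) (f l)) = unitv k"
  by (auto simp: unitv_def inj_eq)

lemma cone_graded:
  assumes N: "is_ideal N" and g: "gcat N Gs" and K: "is_cone inl inr \<theta> C Q K" and C: "is_complex N C" and Q: "is_complex N Q"
    and th: "attach N C Q \<theta>" and gr: "graded_cpx Gs C" "graded_cpx Gs Q"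
    and gth: "\<And>k q. k \<in> basis C \<Longrightarrow> q \<in> lvl Q (Suc (hdeg C k)) \<Longrightarrow> \<theta> (unitv q) k \<in> Gs (ideg Q q) (ideg C k)"
  shows "graded_cpx Gs K"
  unfolding graded_cpx_def
proof (intro ballI)
  fix k l assume k: "k \<in> basis K" and l: "l \<in> lvl K (Suc (hdeg K k))"
  have u0: "(\<lambda>q. unitv (inl x) (inr q)) = (\<lambda>q. 0)" "(\<lambda>q. unitv (inr y) (inl q)) = (\<lambda>q. 0)" for x y
    by (auto simp: unitv_def is_coneD[OF K])
  note u = unitv_compose[OF is_coneD(1)[OF K]] unitv_compose[OF is_coneD(2)[OF K]]
  note z = lin_on_zero[OF is_complex_lin[OF C]] lin_on_zero[OF is_complex_lin[OF Q]]
  have zt: "c \<in> basis C \<Longrightarrow> \<theta> (\<lambda>q. 0) c = 0" for c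
    using th by (auto simp: attach_def intro: lin_on_zero)
  have zero: "0 \<in> Gs b a" for b a by (rule gcat_N[OF g is_ideal_zero[OF N]])
  show "ent K k l \<in> Gs (ideg K l) (ideg K k)"
  proof (cases "\<exists>c\<in>basis C. k = inl c")
    case True
    then obtain c where c: "c \<in> basis C" "k = inl c" by blast
    show ?thesis using l c unfolding cone_lvl[OF K] ent_def
      using gr(1) gth by (auto simp: is_coneD[OF K] u u0 z zt lvl_basis graded_cpx_def ent_def)
  next
    case False
    then obtain q where q: "q \<in> basis Q" "k = inr q" using k is_coneD(5)[OF K] by blast
    show ?thesis using l q unfolding cone_lvl[OF K] ent_def
      using gr(2) by (auto simp: is_coneD[OF K] u u0 z zero lvl_basis graded_cpx_def ent_def)
  qed
qed

definition sum_cone :: "(('j \<Rightarrow> 's) \<Rightarrow> 'i \<Rightarrow> 's) \<Rightarrow> ('i, 's::comm_ring_1) based \<Rightarrow> ('j, 's) based \<Rightarrow> ('i + 'j, 's) based" where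
  "sum_cone \<theta> C Q = \<lparr>basis = Inl ` basis C \<union> Inr ` basis Q, hdeg = case_sum (hdeg C) (hdeg Q),
     ideg = case_sum (ideg C) (ideg Q),
     dif = (\<lambda>v. case_sum (\<lambda>k. dif C (\<lambda>l. v (Inl l)) k + \<theta> (\<lambda>q. v (Inr q)) k) (dif Q (\<lambda>q. v (Inr q))))\<rparr>"

lemma is_cone_sum_cone: "is_cone Inl Inr \<theta> C Q (sum_cone \<theta> C Q)"
  by (auto simp: is_cone_def sum_cone_def)

definition tdif :: "('i, 's::comm_ring_1) based \<Rightarrow> ('j, 's) based \<Rightarrow> ('i \<times> 'j \<Rightarrow> 's) \<Rightarrow> 'i \<times> 'j \<Rightarrow> 's" where
  "tdif F Y v = (\<lambda>(i, j). dif F (\<lambda>i'. v (i', j)) i + (-1) ^ hdeg F i * dif Y (\<lambda>j'. v (i, j')) j)"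

text \<open>The part of \<open>F \<otimes> Y\<close> in degrees \<open>\<ge> a\<close> in \<open>F\<close> and \<open>\<ge> b\<close> in \<open>Y\<close>, with total degrees lowered by \<open>c\<close>. It is the
  quotient of \<open>F \<otimes> Y\<close> by a subcomplex, so the differential is the same formula; when \<open>c \<le> a + b\<close>, the truncated
  subtraction of degrees is harmless.\<close>

definition ttens :: "nat \<Rightarrow> nat \<Rightarrow> nat \<Rightarrow> ('i, 's::comm_ring_1) based \<Rightarrow> ('j, 's) based \<Rightarrow> ('i \<times> 'j, 's) based" where
  "ttens a b c F Y = \<lparr>basis = {(i, j). i \<in> basis F \<and> j \<in> basis Y \<and> a \<le> hdeg F i \<and> b \<le> hdeg Y j},
     hdeg = (\<lambda>(i, j). hdeg F i + hdeg Y j - c), ideg = (\<lambda>(i, j). ideg F i + ideg Y j), dif = tdif F Y\<rparr>"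

lemma ttens_simps [simp]:
  "basis (ttens a b c F Y) = {(i, j). i \<in> basis F \<and> j \<in> basis Y \<and> a \<le> hdeg F i \<and> b \<le> hdeg Y j}"
  "hdeg (ttens a b c F Y) (i, j) = hdeg F i + hdeg Y j - c"
  "ideg (ttens a b c F Y) (i, j) = ideg F i + ideg Y j"
  "dif (ttens a b c F Y) = tdif F Y"
  by (auto simp: ttens_def)

lemma tdif_apply: "tdif F Y v (i, j) = dif F (\<lambda>i'. v (i', j)) i + (-1) ^ hdeg F i * dif Y (\<lambda>j'. v (i, j')) j"
  by (simp add: tdif_def)

lemma sign_sq [simp]: "(-1) ^ n * ((-1) ^ n * x) = (x::'s::comm_ring_1)"
  by (simp add: mult.assoc[symmetric] power_add[symmetric])

lemma tdif_sq:
  fixes F :: "('i, 's::comm_ring_1) based" and Y :: "('j, 's) based"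
  assumes N: "is_ideal N" and F: "is_complex N F" and Y: "is_complex N Y" and i: "i \<in> basis F" and j: "j \<in> basis Y"
  shows "tdif F Y (tdif F Y v) (i, j) \<in> N"
proof -
  note lF = is_complex_lin[OF F i] and lY = is_complex_lin[OF Y j]
  let ?s = "(-1::'s) ^ hdeg F i"
  have 1: "dif F (\<lambda>i'. tdif F Y v (i', j)) i = dif F (dif F (\<lambda>i'. v (i', j))) i - ?s * dif F (\<lambda>i'. dif Y (\<lambda>j'. v (i', j')) j) i"
  proof -
    have "dif F (\<lambda>i'. tdif F Y v (i', j)) i = dif F (\<lambda>i'. dif F (\<lambda>i'. v (i', j)) i' - ?s * dif Y (\<lambda>j'. v (i', j')) j) i"
      by (rule lin_on_local[OF lF]) (simp add: tdif_apply lvl_hdeg)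
    thus ?thesis by (simp add: lin_on_diff[OF lF] lin_on_scale[OF lF])
  qed
  have 2: "dif Y (\<lambda>j'. tdif F Y v (i, j')) j = dif Y (\<lambda>j'. dif F (\<lambda>i'. v (i', j')) i) j + ?s * dif Y (dif Y (\<lambda>j'. v (i, j'))) j"
    by (simp add: tdif_apply lin_on_add[OF lY] lin_on_scale[OF lY])
  have 3: "dif F (\<lambda>i'. dif Y (\<lambda>j'. v (i', j')) j) i = dif Y (\<lambda>j'. dif F (\<lambda>i'. v (i', j')) i) j"
    by (rule lin_on_swap[OF lF lY])
  have "tdif F Y (tdif F Y v) (i, j) = dif F (dif F (\<lambda>i'. v (i', j))) i + (?s * ?s) * dif Y (dif Y (\<lambda>j'. v (i, j'))) j"
    unfolding tdif_apply[of F Y "tdif F Y v"] 1 2 3 by (simp add: algebra_simps)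
  thus ?thesis using is_complex_sq[OF F i] is_complex_sq[OF Y j]
    by (auto intro!: is_ideal_add[OF N] is_ideal_mult[OF N])
qed

lemma ttens_finite:
  assumes F: "is_complex N F" and Y: "is_complex N Y"
  shows "finite (lvl (ttens a b c F Y) n)"
proof (rule finite_subset)
  show "lvl (ttens a b c F Y) n \<subseteq> (\<Union>p\<le>n + c. \<Union>q\<le>n + c. lvl F p \<times> lvl Y q)" by (auto simp: lvl_def)
  show "finite (\<Union>p\<le>n + c. \<Union>q\<le>n + c. lvl F p \<times> lvl Y q)"
    using is_complex_finite[OF F] is_complex_finite[OF Y] by auto
qed

lemma ttens_complex:
  assumes N: "is_ideal N" and F: "is_complex N F" and Y: "is_complex N Y" and c: "c \<le> a + b"
  shows "is_complex N (ttens a b c F Y)"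
  unfolding is_complex_def
proof (intro conjI allI ballI)
  note fin = ttens_finite[OF F Y, of a b c]
  show "finite (lvl (ttens a b c F Y) n)" for n by (rule fin)
  fix k assume k: "k \<in> basis (ttens a b c F Y)"
  obtain i j where [simp]: "k = (i, j)" by (cases k)
  have ij: "i \<in> basis F" "j \<in> basis Y" "a \<le> hdeg F i" "b \<le> hdeg Y j" using k by auto
  show "lin_on (lvl (ttens a b c F Y) (Suc (hdeg (ttens a b c F Y) k))) (\<lambda>v. dif (ttens a b c F Y) v k)"
    unfolding ttens_simps \<open>k = (i, j)\<close> tdif_apply
  proof (intro lin_on_plus lin_on_times)
    show "lin_on (lvl (ttens a b c F Y) (Suc (hdeg F i + hdeg Y j - c))) (\<lambda>v. dif F (\<lambda>i'. v (i', j)) i)"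
      by (rule lin_on_reindex[OF is_complex_lin[OF F ij(1)] _ fin]) (use ij c in \<open>auto simp: lvl_def\<close>)
    show "lin_on (lvl (ttens a b c F Y) (Suc (hdeg F i + hdeg Y j - c))) (\<lambda>v. dif Y (\<lambda>j'. v (i, j')) j)"
      by (rule lin_on_reindex[OF is_complex_lin[OF Y ij(2)] _ fin]) (use ij c in \<open>auto simp: lvl_def\<close>)
  qed
  show "dif (ttens a b c F Y) (dif (ttens a b c F Y) v) k \<in> N" for v
    using tdif_sq[OF N F Y ij(1,2)] by simp
qed

lemma ttens_minimal:
  "is_ideal \<mm> \<Longrightarrow> minimal_cpx \<mm> F \<Longrightarrow> minimal_cpx \<mm> Y \<Longrightarrow> minimal_cpx \<mm> (ttens a b c F Y)"
  by (auto simp: minimal_cpx_def tdif_apply intro!: is_ideal_add is_ideal_mult)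

text \<open>Compatibility of the entry sets with tensor products, where internal degrees add up.\<close>

definition gmon :: "(nat \<Rightarrow> nat \<Rightarrow> 's::comm_ring_1 set) \<Rightarrow> bool" where
  "gmon Gs \<longleftrightarrow> (\<forall>a b c d. \<forall>x\<in>Gs b a. \<forall>y\<in>Gs d c. x * y \<in> Gs (b + d) (a + c))"

lemma gmon_mult: "gmon Gs \<Longrightarrow> x \<in> Gs b a \<Longrightarrow> y \<in> Gs d c \<Longrightarrow> x * y \<in> Gs (b + d) (a + c)"
  by (auto simp: gmon_def)

lemma gmon_shift:
  assumes "gcat N Gs" "gmon Gs" "x \<in> Gs b a" shows "x \<in> Gs (b + c) (a + c)" "x \<in> Gs (c + b) (c + a)"
  using gmon_mult[OF assms(2,3) gcat_one[OF assms(1)], of c] by (simp_all add: add.commute)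

lemma unitv_pair:
  "(\<lambda>i'. unitv (i0, j0) (i', j)) = (\<lambda>i'. if j = j0 then unitv i0 i' else 0)"
  "(\<lambda>j'. unitv (i0, j0) (i, j')) = (\<lambda>j'. if i = i0 then unitv j0 j' else 0)"
  by (auto simp: unitv_def)

lemma ttens_graded:
  assumes N: "is_ideal N" and g: "gcat N Gs" "gmon Gs" and F: "is_complex N F" "graded_cpx Gs F"
    and Y: "is_complex N Y" "graded_cpx Gs Y" and c: "c \<le> a + b"
  shows "graded_cpx Gs (ttens a b c F Y)"
  unfolding graded_cpx_def
proof (intro ballI)
  fix k l assume k: "k \<in> basis (ttens a b c F Y)" and l: "l \<in> lvl (ttens a b c F Y) (Suc (hdeg (ttens a b c F Y) k))"
  obtain i j i0 j0 where [simp]: "k = (i, j)" "l = (i0, j0)" by (cases k, cases l)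
  have ij: "i \<in> basis F" "j \<in> basis Y" "a \<le> hdeg F i" "b \<le> hdeg Y j" using k by auto
  have ij0: "i0 \<in> basis F" "j0 \<in> basis Y" "hdeg F i0 + hdeg Y j0 - c = Suc (hdeg F i + hdeg Y j - c)"
    using l by (auto simp: lvl_def)
  have zero: "0 \<in> Gs b a" for b a by (rule gcat_N[OF g(1) is_ideal_zero[OF N]])
  have 1: "dif F (\<lambda>i'. unitv (i0, j0) (i', j)) i \<in> Gs (ideg F i0 + ideg Y j0) (ideg F i + ideg Y j)"
  proof (cases "j = j0")
    case True
    hence "i0 \<in> lvl F (Suc (hdeg F i))" using ij ij0 c by (auto simp: lvl_def)
    thus ?thesis using F(2) ij True by (auto simp: unitv_pair graded_cpx_def ent_def intro: gmon_shift[OF g])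
  qed (simp add: unitv_pair lin_on_zero[OF is_complex_lin[OF F(1) ij(1)]] zero)
  have 2: "dif Y (\<lambda>j'. unitv (i0, j0) (i, j')) j \<in> Gs (ideg F i0 + ideg Y j0) (ideg F i + ideg Y j)"
  proof (cases "i = i0")
    case True
    hence "j0 \<in> lvl Y (Suc (hdeg Y j))" using ij ij0 c by (auto simp: lvl_def)
    thus ?thesis using Y(2) ij True by (auto simp: unitv_pair graded_cpx_def ent_def intro: gmon_shift[OF g])
  qed (simp add: unitv_pair lin_on_zero[OF is_complex_lin[OF Y(1) ij(2)]] zero)
  show "ent (ttens a b c F Y) k l \<in> Gs (ideg (ttens a b c F Y) l) (ideg (ttens a b c F Y) k)"
    using gcat_add[OF g(1) 1 gcat_sign[OF g(1) 2]] by (simp add: ent_def tdif_apply)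
qed

lemma tens_exactD:
  assumes "exact N (ttens 0 0 0 F Y)"
    "\<And>i j. i \<in> basis F \<Longrightarrow> j \<in> basis Y \<Longrightarrow> hdeg F i + hdeg Y j = n \<Longrightarrow> tdif F Y v (i, j) \<in> N"
  obtains w where "\<And>i j. i \<in> basis F \<Longrightarrow> j \<in> basis Y \<Longrightarrow> hdeg F i + hdeg Y j = Suc n \<Longrightarrow> v (i, j) - tdif F Y w (i, j) \<in> N"
proof -
  have "\<exists>w. \<forall>k\<in>lvl (ttens 0 0 0 F Y) (Suc n). v k - dif (ttens 0 0 0 F Y) w k \<in> N"
    using assms(2) by (intro exactD[OF assms(1)]) (auto simp: lvl_def)
  thus thesis using that by (auto simp: lvl_def)
qed

text \<open>If \<open>F\<close> stays exact modulo \<open>J\<close> and \<open>Y\<close> resolves \<open>S/J\<close>, then \<open>F \<otimes> Y\<close> is exact in positive degrees, because it has the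
  homology of \<open>F \<otimes> S/J\<close>. The bounding chain is built column by column: the hypothesis on \<open>F\<close> serves the column of
  \<open>Y\<close>-degree zero, and exactness of \<open>Y\<close> extends a chain that is correct in the columns before \<open>q\<close> to column \<open>q\<close>.\<close>

lemma tensor_exact:
  fixes F :: "('i, 's::comm_ring_1) based" and Y :: "('j, 's) based"
  assumes N: "is_ideal N" and F: "is_complex N F" and ex: "exact J F" and Y: "cyc_res N J Y e"
  shows "exact N (ttens 0 0 0 F Y)"
  unfolding exact_def
proof (intro allI impI)
  fix n v assume v0: "\<forall>k\<in>lvl (ttens 0 0 0 F Y) n. dif (ttens 0 0 0 F Y) v k \<in> N"
  note Yc = cyc_resD(1)[OF Y] and eY = cyc_resD(5,6)[OF Y]
  note J = cyc_res_ideal[OF N Y]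
  have v: "tdif F Y v (i, j) \<in> N" if "i \<in> basis F" "j \<in> basis Y" "hdeg F i + hdeg Y j = n" for i j
    using v0 that by (auto simp: lvl_def)
  have lY0: "j = e" if "j \<in> basis Y" "hdeg Y j = 0" for j using that cyc_resD(3)[OF Y] by (auto simp: lvl_def)
  have "\<exists>w. \<forall>i\<in>basis F. \<forall>j\<in>basis Y. hdeg F i + hdeg Y j = Suc n \<longrightarrow> hdeg Y j < q \<longrightarrow> v (i, j) - tdif F Y w (i, j) \<in> N" for q
  proof (induction q)
    case 0 show ?case by simp
  next
    case (Suc q)
    show ?case
    proof (cases "q = 0")
      case True
      have "dif F (\<lambda>i. v (i, e)) i \<in> J" if i: "i \<in> lvl F n" for i
      proof -
        have "dif F (\<lambda>i. v (i, e)) i + (-1) ^ hdeg F i * dif Y (\<lambda>j'. v (i, j')) e \<in> J"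
          using v[of i e] i eY J(2) by (auto simp: lvl_def tdif_apply)
        from is_ideal_diff[OF J(1) this is_ideal_mult[OF J(1) cyc_res_dif[OF N Y, of "\<lambda>j'. v (i, j')"], of "(-1) ^ hdeg F i"]]
        show ?thesis by simp
      qed
      then obtain z where z: "\<forall>i\<in>lvl F (Suc n). v (i, e) - dif F z i \<in> J" using exactD[OF ex] by blast
      have "\<exists>y. v (i, e) - dif F z i - dif Y y e \<in> N" if "i \<in> lvl F (Suc n)" for i
        using z that cyc_resD(7)[OF Y] by blast
      then obtain y where y: "\<And>i. i \<in> lvl F (Suc n) \<Longrightarrow> v (i, e) - dif F z i - dif Y (y i) e \<in> N" by metis
      \<comment> \<open>\<open>z\<close> bounds \<open>v\<close> in column zero only modulo \<open>J\<close>; the chains \<open>y i\<close> in \<open>Y\<close> absorb the error.\<close>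
      define w where "w = (\<lambda>(i, j). if j = e then z i else (-1) ^ hdeg F i * y i j)"
      have "v (i, j) - tdif F Y w (i, j) \<in> N" if i: "i \<in> basis F" and j: "j \<in> basis Y" and h: "hdeg F i + hdeg Y j = Suc n" "hdeg Y j < Suc q" for i j
      proof -
        have [simp]: "j = e" using lY0 j h True by simp
        have il: "i \<in> lvl F (Suc n)" using i h eY by (simp add: lvl_def)
        have "dif Y (\<lambda>j'. w (i, j')) e = dif Y (\<lambda>j'. (-1) ^ hdeg F i * y i j') e"
          by (rule lin_on_local[OF is_complex_lin[OF Yc eY(1)]]) (auto simp: w_def lvl_def eY)
        also have "\<dots> = (-1) ^ hdeg F i * dif Y (y i) e" by (rule lin_on_scale[OF is_complex_lin[OF Yc eY(1)]])
        finally have "tdif F Y w (i, e) = dif F z i + dif Y (y i) e" by (simp add: tdif_apply) (simp add: w_def)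
        thus ?thesis using y[OF il] by (simp add: algebra_simps)
      qed
      thus ?thesis by blast
    next
      case False
      then obtain p where p: "q = Suc p" by (cases q) auto
      obtain w where w: "\<And>i j. i \<in> basis F \<Longrightarrow> j \<in> basis Y \<Longrightarrow> hdeg F i + hdeg Y j = Suc n \<Longrightarrow> hdeg Y j < q \<Longrightarrow> v (i, j) - tdif F Y w (i, j) \<in> N"
        using Suc.IH by blast
      \<comment> \<open>The error vanishes in the columns before \<open>q\<close>, so its rows are cycles of \<open>Y\<close> there.\<close>
      define v' where "v' k = v k - tdif F Y w k" for k
      have "\<exists>y. \<forall>j\<in>lvl Y q. v' (i, j) - dif Y y j \<in> N" if i: "i \<in> basis F" "hdeg F i + q = Suc n" for i
      proof -
        have "dif Y (\<lambda>j. v' (i, j)) j \<in> N" if j: "j \<in> lvl Y p" for j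
        proof -
          have jb: "j \<in> basis Y" "hdeg Y j = p" using j by (auto simp: lvl_def)
          have t1: "tdif F Y v (i, j) \<in> N" using v[of i j] i jb p by simp
          have t2: "tdif F Y (tdif F Y w) (i, j) \<in> N" by (rule tdif_sq[OF N F Yc i(1) jb(1)])
          have "tdif F Y v' (i, j) = tdif F Y v (i, j) - tdif F Y (tdif F Y w) (i, j)"
            unfolding v'_def tdif_apply[of F Y "\<lambda>k. v k - tdif F Y w k"] tdif_apply[of F Y v] tdif_apply[of F Y "tdif F Y w"]
            by (simp add: lin_on_diff[OF is_complex_lin[OF F i(1)]] lin_on_diff[OF is_complex_lin[OF Yc jb(1)]] algebra_simps)
          hence t3: "dif F (\<lambda>i'. v' (i', j)) i + (-1) ^ hdeg F i * dif Y (\<lambda>j. v' (i, j)) j \<in> N"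
            using is_ideal_diff[OF N t1 t2] by (simp add: tdif_apply)
          have t4: "dif F (\<lambda>i'. v' (i', j)) i \<in> N"
            by (rule lin_on_ideal[OF is_complex_lin[OF F i(1)] N])
               (use w jb p i in \<open>auto simp: v'_def lvl_def\<close>)
          have "(-1) ^ hdeg F i * ((-1) ^ hdeg F i * dif Y (\<lambda>j. v' (i, j)) j) \<in> N"
            using is_ideal_mult[OF N is_ideal_diff[OF N t3 t4], of "(-1) ^ hdeg F i"] by simp
          thus ?thesis by simp
        qed
        thus ?thesis using exactD[OF cyc_resD(2)[OF Y], of p "\<lambda>j. v' (i, j)"] p by blast
      qed
      then obtain y where y: "\<And>i j. i \<in> basis F \<Longrightarrow> hdeg F i + q = Suc n \<Longrightarrow> j \<in> lvl Y q \<Longrightarrow> v' (i, j) - dif Y (y i) j \<in> N" by metis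
      define w' where "w' = (\<lambda>(i, j). w (i, j) + (if hdeg Y j = Suc q then (-1) ^ hdeg F i * y i j else 0))"
      have "v (i, j) - tdif F Y w' (i, j) \<in> N" if i: "i \<in> basis F" and j: "j \<in> basis Y" and h: "hdeg F i + hdeg Y j = Suc n" "hdeg Y j < Suc q" for i j
      proof -
        note lY = is_complex_lin[OF Yc j]
        have 1: "dif F (\<lambda>i'. w' (i', j)) i = dif F (\<lambda>i'. w (i', j)) i" using h by (simp add: w'_def)
        show ?thesis
        proof (cases "hdeg Y j = q")
          case True
          have "dif Y (\<lambda>j'. w' (i, j')) j = dif Y (\<lambda>j'. w (i, j') + (-1) ^ hdeg F i * y i j') j"
            by (rule lin_on_local[OF lY]) (auto simp: w'_def lvl_def True)
          also have "\<dots> = dif Y (\<lambda>j'. w (i, j')) j + (-1) ^ hdeg F i * dif Y (y i) j"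
            by (simp add: lin_on_add[OF lY] lin_on_scale[OF lY])
          finally have "tdif F Y w' (i, j) = tdif F Y w (i, j) + (-1) ^ hdeg F i * ((-1) ^ hdeg F i * dif Y (y i) j)"
            by (simp add: tdif_apply 1 algebra_simps)
          hence "v (i, j) - tdif F Y w' (i, j) = v' (i, j) - dif Y (y i) j"
            by (simp add: v'_def)
          thus ?thesis using y[of i j] i j h True by (simp add: lvl_def)
        next
          case False
          have "dif Y (\<lambda>j'. w' (i, j')) j = dif Y (\<lambda>j'. w (i, j')) j"
            by (rule lin_on_local[OF lY]) (use False in \<open>auto simp: w'_def lvl_def\<close>)
          hence "tdif F Y w' (i, j) = tdif F Y w (i, j)" by (simp add: tdif_apply 1)
          thus ?thesis using w[of i j] i j h False by simp
        qed
      qed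
      thus ?thesis by blast
    qed
  qed
  from this[of "Suc (Suc n)"] show "\<exists>w. \<forall>k\<in>lvl (ttens 0 0 0 F Y) (Suc n). v k - dif (ttens 0 0 0 F Y) w k \<in> N"
    by (auto simp: lvl_def)
qed

text \<open>The symmetry \<open>i \<otimes> j \<mapsto> (-1)\<^bsup>|i||j|\<^esup> j \<otimes> i\<close> is an isomorphism of complexes. It is needed because only the first
  factor is tensored with a quotient ring in \<open>tensor_exact\<close>, and \<open>T \<otimes> Z\<close> is accessible through \<open>Z\<close>.\<close>

lemma tens_flip:
  fixes F :: "('i, 's::comm_ring_1) based" and Y :: "('j, 's) based"
  assumes N: "is_ideal N" and F: "is_complex N F" and Y: "is_complex N Y" and ex: "exact N (ttens 0 0 0 F Y)"
  shows "exact N (ttens 0 0 0 Y F)"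
  unfolding exact_def
proof (intro allI impI)
  fix n v assume v: "\<forall>k\<in>lvl (ttens 0 0 0 Y F) n. dif (ttens 0 0 0 Y F) v k \<in> N"
  let ?s = "\<lambda>i j. (-1::'s) ^ (hdeg F i * hdeg Y j)"
  have key: "tdif Y F (\<lambda>(j, i). ?s i j * u (i, j)) (j, i) = ?s i j * tdif F Y u (i, j)"
    if i: "i \<in> basis F" and j: "j \<in> basis Y" for u i j
  proof -
    note lF = is_complex_lin[OF F i] and lY = is_complex_lin[OF Y j]
    have 1: "dif Y (\<lambda>j'. ?s i j' * u (i, j')) j = dif Y (\<lambda>j'. (?s i j * (-1) ^ hdeg F i) * u (i, j')) j"
      by (rule lin_on_local[OF lY]) (simp add: lvl_hdeg power_add)
    have 2: "dif F (\<lambda>i'. ?s i' j * u (i', j)) i = dif F (\<lambda>i'. (?s i j * (-1) ^ hdeg Y j) * u (i', j)) i"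
      by (rule lin_on_local[OF lF]) (simp add: lvl_hdeg power_add)
    have "tdif Y F (\<lambda>(j, i). ?s i j * u (i, j)) (j, i) =
       ?s i j * (-1) ^ hdeg F i * dif Y (\<lambda>j'. u (i, j')) j + (-1) ^ hdeg Y j * (?s i j * (-1) ^ hdeg Y j * dif F (\<lambda>i'. u (i', j)) i)"
      by (simp add: tdif_apply 1 2 lin_on_scale[OF lF] lin_on_scale[OF lY])
    also have "(-1) ^ hdeg Y j * (?s i j * (-1) ^ hdeg Y j * dif F (\<lambda>i'. u (i', j)) i) = (-1) ^ hdeg Y j * ((-1) ^ hdeg Y j * (?s i j * dif F (\<lambda>i'. u (i', j)) i))"
      by (simp only: mult_ac)
    finally show ?thesis by (simp only: sign_sq) (simp add: tdif_apply algebra_simps)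
  qed
  define u where "u = (\<lambda>(i, j). ?s i j * v (j, i))"
  have vu: "(\<lambda>(j, i). ?s i j * u (i, j)) = v" by (auto simp: u_def)
  obtain w where w: "\<And>i j. i \<in> basis F \<Longrightarrow> j \<in> basis Y \<Longrightarrow> hdeg F i + hdeg Y j = Suc n \<Longrightarrow> u (i, j) - tdif F Y w (i, j) \<in> N"
  proof (rule tens_exactD[OF ex, of n u])
    fix i j assume ij: "i \<in> basis F" "j \<in> basis Y" "hdeg F i + hdeg Y j = n"
    have "tdif Y F v (j, i) \<in> N" using v ij by (auto simp: lvl_def)
    hence "?s i j * (?s i j * tdif F Y u (i, j)) \<in> N" using key[OF ij(1,2), of u] is_ideal_mult[OF N] by (simp only: vu)
    thus "tdif F Y u (i, j) \<in> N" by simp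
  qed blast
  have "v (j, i) - tdif Y F (\<lambda>(j, i). ?s i j * w (i, j)) (j, i) \<in> N"
    if ij: "i \<in> basis F" "j \<in> basis Y" "hdeg F i + hdeg Y j = Suc n" for i j
  proof -
    have "v (j, i) - tdif Y F (\<lambda>(j, i). ?s i j * w (i, j)) (j, i) = ?s i j * (u (i, j) - tdif F Y w (i, j))"
      unfolding key[OF ij(1,2)] by (simp add: u_def right_diff_distrib)
    thus ?thesis using is_ideal_mult[OF N w[OF ij]] by simp
  qed
  thus "\<exists>w. \<forall>k\<in>lvl (ttens 0 0 0 Y F) (Suc n). v k - dif (ttens 0 0 0 Y F) w k \<in> N"
    by (intro exI[of _ "\<lambda>(j, i). ?s i j * w (i, j)"]) (auto simp: lvl_def add.commute)
qed

section \<open>The resolution of \<open>R/(I' + IJ + J')\<close>\<close>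

text \<open>A cycle \<open>v\<close> of the truncated complex \<open>F\<^sub>\<ge>\<^sub>1 \<otimes> Y\<close> extends to a cycle of \<open>F \<otimes> Y\<close>: its image \<open>a\<close> in the
  row of \<open>F\<close>-degree zero is a cycle of \<open>Y\<close>, hence a boundary. In the lowest degree \<open>n = 0\<close> this needs that \<open>a\<close> lies in \<open>J\<close>,
  which is the hypothesis \<open>v0\<close>. So \<open>F\<^sub>\<ge>\<^sub>1 \<otimes> Y\<close> resolves \<open>B/BJ\<close> if \<open>F\<close> resolves \<open>S/B\<close>, and \<open>B \<inter> J = BJ\<close>.\<close>

lemma tens_trunc_exact:
  fixes F :: "('i, 's::comm_ring_1) based" and Y :: "('j, 's) based"
  assumes N: "is_ideal N" and F: "is_complex N F" "lvl F 0 = {f}" and Y: "cyc_res N J Y e"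
    and ex: "exact N (ttens 0 0 0 F Y)"
    and v: "\<And>i j. i \<in> basis F \<Longrightarrow> j \<in> basis Y \<Longrightarrow> 1 \<le> hdeg F i \<Longrightarrow> hdeg F i + hdeg Y j = n \<Longrightarrow> tdif F Y v (i, j) \<in> N"
    and v0: "n = 0 \<Longrightarrow> dif F (\<lambda>i. v (i, e)) f \<in> J"
  shows "\<exists>w. \<forall>i\<in>basis F. \<forall>j\<in>basis Y. 1 \<le> hdeg F i \<longrightarrow> hdeg F i + hdeg Y j = Suc n \<longrightarrow> v (i, j) - tdif F Y w (i, j) \<in> N"
proof -
  note Yc = cyc_resD(1)[OF Y]
  have f: "f \<in> basis F" "hdeg F f = 0" using F(2) by (auto simp: lvl_def)
  note lf = is_complex_lin[OF F(1) f(1)]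
  define a where "a j = dif F (\<lambda>i. v (i, j)) f" for j
  have "\<exists>y. \<forall>j\<in>lvl Y n. a j - dif Y y j \<in> N"
  proof (cases n)
    case 0
    thus ?thesis using v0 by (simp add: a_def cyc_resD(3)[OF Y] cyc_resD(7)[OF Y])
  next
    case (Suc m)
    have "dif Y a j \<in> N" if j: "j \<in> lvl Y m" for j
    proof -
      note lj = is_complex_lin_lvl[OF Yc j]
      have 1: "dif Y a j = dif F (\<lambda>i. dif Y (\<lambda>j. v (i, j)) j) f"
        unfolding a_def by (rule lin_on_swap[OF lj lf])
      have 2: "dif F (dif F (\<lambda>i'. v (i', j))) f - dif F (\<lambda>i. dif Y (\<lambda>j. v (i, j)) j) f \<in> N"
      proof (rule lin_on_cong_ideal[OF lf N])
        fix i assume "i \<in> lvl F (Suc (hdeg F f))"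
        thus "dif F (\<lambda>i'. v (i', j)) i - dif Y (\<lambda>j. v (i, j)) j \<in> N"
          using v[of i j] j Suc by (auto simp: lvl_def f tdif_apply)
      qed
      show ?thesis unfolding 1 using is_ideal_diff[OF N is_complex_sq[OF F(1) f(1), of "\<lambda>i'. v (i', j)"] 2] by simp
    qed
    thus ?thesis using exactD[OF cyc_resD(2)[OF Y], of m a] Suc by blast
  qed
  then obtain y where y: "\<And>j. j \<in> lvl Y n \<Longrightarrow> a j - dif Y y j \<in> N" by blast
  define v' where "v' = (\<lambda>(i, j). if hdeg F i = 0 then - y j else v (i, j))"
  have "tdif F Y v' (i, j) \<in> N" if i: "i \<in> basis F" and j: "j \<in> basis Y" and h: "hdeg F i + hdeg Y j = n" for i j
  proof -
    have 1: "dif F (\<lambda>i'. v' (i', j)) i = dif F (\<lambda>i'. v (i', j)) i"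
      by (rule lin_on_local[OF is_complex_lin[OF F(1) i]]) (simp add: v'_def lvl_hdeg)
    show ?thesis
    proof (cases "hdeg F i = 0")
      case True
      hence [simp]: "i = f" using F(2) i by (auto simp: lvl_def)
      have "dif Y (\<lambda>j'. v' (f, j')) j = - dif Y y j"
        using f by (simp add: v'_def lin_on_minus[OF is_complex_lin[OF Yc j]])
      thus ?thesis using y[of j] 1 j h f by (simp add: tdif_apply a_def lvl_def)
    next
      case False
      hence "(\<lambda>j'. v' (i, j')) = (\<lambda>j'. v (i, j'))" by (simp add: v'_def)
      thus ?thesis using v[OF i j _ h] 1 False by (simp add: tdif_apply)
    qed
  qed
  from tens_exactD[OF ex this] obtain w where
    w: "\<And>i j. i \<in> basis F \<Longrightarrow> j \<in> basis Y \<Longrightarrow> hdeg F i + hdeg Y j = Suc n \<Longrightarrow> v' (i, j) - tdif F Y w (i, j) \<in> N"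
    by blast
  show ?thesis
  proof (intro exI[of _ w] ballI impI)
    fix i j assume ij: "i \<in> basis F" "j \<in> basis Y" and h: "1 \<le> hdeg F i" "hdeg F i + hdeg Y j = Suc n"
    show "v (i, j) - tdif F Y w (i, j) \<in> N" using w[OF ij h(2)] h(1) by (simp add: v'_def)
  qed
qed

text \<open>The same extension in both factors: the images of a cycle \<open>v\<close> in the row and in the column of degree zero are
  cycles of \<open>Y\<close> and of \<open>Z\<close>, and bounding them by \<open>p\<close> and \<open>q\<close> extends \<open>v\<close> to a cycle of \<open>Z \<otimes> Y\<close>. So \<open>Z\<^sub>\<ge>\<^sub>1 \<otimes> Y\<^sub>\<ge>\<^sub>1\<close> resolves
  \<open>I \<otimes> J\<close>, and multiplication embeds this into the ring.\<close>

lemma tens_trunc2_exact: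
  fixes Z :: "('i, 's::comm_ring_1) based" and Y :: "('j, 's) based"
  assumes N: "is_ideal N" and Z: "cyc_res N I Z eZ" and Y: "cyc_res N J Y eY"
    and ex: "exact N (ttens 0 0 0 Z Y)"
    and v: "\<And>i j. i \<in> basis Z \<Longrightarrow> j \<in> basis Y \<Longrightarrow> 1 \<le> hdeg Z i \<Longrightarrow> 1 \<le> hdeg Y j \<Longrightarrow> hdeg Z i + hdeg Y j = Suc n \<Longrightarrow> tdif Z Y v (i, j) \<in> N"
    and v0: "n = 0 \<Longrightarrow> dif Z (\<lambda>x. dif Y (\<lambda>y. v (x, y)) eY) eZ \<in> N"
  shows "\<exists>w. \<forall>i\<in>basis Z. \<forall>j\<in>basis Y. 1 \<le> hdeg Z i \<longrightarrow> 1 \<le> hdeg Y j \<longrightarrow> hdeg Z i + hdeg Y j = Suc (Suc n) \<longrightarrow>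
     v (i, j) - tdif Z Y w (i, j) \<in> N"
proof -
  note Zc = cyc_resD(1)[OF Z] and Yc = cyc_resD(1)[OF Y] and eZ = cyc_resD(5,6)[OF Z] and eY = cyc_resD(5,6)[OF Y]
  note lZ = is_complex_lin[OF Zc eZ(1)] and lY = is_complex_lin[OF Yc eY(1)]
  define a where "a j = dif Z (\<lambda>i. v (i, j)) eZ" for j
  define b where "b i = dif Y (\<lambda>j. v (i, j)) eY" for i
  have "dif Y a j \<in> N" if j: "j \<in> lvl Y n" for j
  proof -
    have 1: "dif Y a j = dif Z (\<lambda>i. dif Y (\<lambda>j. v (i, j)) j) eZ"
      unfolding a_def by (rule lin_on_swap[OF is_complex_lin_lvl[OF Yc j] lZ])
    show ?thesis
    proof (cases "n = 0")
      case True thus ?thesis using v0 j 1 cyc_resD(3)[OF Y] by simp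
    next
      case False
      have 2: "dif Z (dif Z (\<lambda>i'. v (i', j))) eZ - dif Z (\<lambda>i. dif Y (\<lambda>j. v (i, j)) j) eZ \<in> N"
      proof (rule lin_on_cong_ideal[OF lZ N])
        fix i assume "i \<in> lvl Z (Suc (hdeg Z eZ))"
        thus "dif Z (\<lambda>i'. v (i', j)) i - dif Y (\<lambda>j. v (i, j)) j \<in> N"
          using v[of i j] j False by (auto simp: lvl_def eZ tdif_apply)
      qed
      show ?thesis unfolding 1 using is_ideal_diff[OF N is_complex_sq[OF Zc eZ(1), of "\<lambda>i'. v (i', j)"] 2] by simp
    qed
  qed
  then obtain p where p: "\<And>j. j \<in> lvl Y (Suc n) \<Longrightarrow> a j - dif Y p j \<in> N"
    using exactD[OF cyc_resD(2)[OF Y], of n a] by blast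
  have "dif Z b i \<in> N" if i: "i \<in> lvl Z n" for i
  proof -
    have 1: "dif Z b i = dif Y (\<lambda>j. dif Z (\<lambda>i. v (i, j)) i) eY"
      unfolding b_def by (rule lin_on_swap[OF is_complex_lin_lvl[OF Zc i] lY])
    show ?thesis
    proof (cases "n = 0")
      case True
      hence [simp]: "i = eZ" using i cyc_resD(3)[OF Z] by simp
      show ?thesis using v0[OF True] by (simp add: b_def[abs_def])
    next
      case False
      have 2: "dif Y (\<lambda>j. dif Z (\<lambda>i'. v (i', j)) i) eY - dif Y (\<lambda>j. (- ((-1) ^ n)) * dif Y (\<lambda>j. v (i, j)) j) eY \<in> N"
      proof (rule lin_on_cong_ideal[OF lY N])
        fix j assume "j \<in> lvl Y (Suc (hdeg Y eY))"
        thus "dif Z (\<lambda>i'. v (i', j)) i - (- ((-1) ^ n)) * dif Y (\<lambda>j. v (i, j)) j \<in> N"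
          using v[of i j] i False by (auto simp: lvl_def eY tdif_apply)
      qed
      have 3: "dif Y (\<lambda>j. (- ((-1) ^ n)) * dif Y (\<lambda>j. v (i, j)) j) eY \<in> N"
        unfolding lin_on_scale[OF lY] by (rule is_ideal_mult[OF N is_complex_sq[OF Yc eY(1)]])
      show ?thesis unfolding 1 by (rule ideal_cong_mem[OF N 2 3])
    qed
  qed
  then obtain q where q: "\<And>i. i \<in> lvl Z (Suc n) \<Longrightarrow> b i - dif Z q i \<in> N"
    using exactD[OF cyc_resD(2)[OF Z], of n b] by blast
  define v' where "v' = (\<lambda>(i, j). if hdeg Z i = 0 then - p j else if hdeg Y j = 0 then (- ((-1) ^ Suc n)) * q i else v (i, j))"
  have "tdif Z Y v' (i, j) \<in> N" if i: "i \<in> basis Z" and j: "j \<in> basis Y" and h: "hdeg Z i + hdeg Y j = Suc n" for i j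
  proof -
    note li = is_complex_lin[OF Zc i] and lj = is_complex_lin[OF Yc j]
    have 1: "dif Z (\<lambda>i'. v' (i', j)) i = dif Z (\<lambda>i'. v (i', j)) i" if "hdeg Y j \<noteq> 0"
      by (rule lin_on_local[OF li]) (use that in \<open>simp add: v'_def lvl_hdeg\<close>)
    have 2: "dif Y (\<lambda>j'. v' (i, j')) j = dif Y (\<lambda>j'. v (i, j')) j" if "hdeg Z i \<noteq> 0"
      by (rule lin_on_local[OF lj]) (use that in \<open>simp add: v'_def lvl_hdeg\<close>)
    consider "hdeg Z i = 0" | "hdeg Y j = 0" | "hdeg Z i \<noteq> 0" "hdeg Y j \<noteq> 0" by blast
    thus ?thesis
    proof cases
      case 1
      hence [simp]: "i = eZ" using cyc_resD(3)[OF Z] i by (auto simp: lvl_def)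
      have "dif Y (\<lambda>j'. v' (eZ, j')) j = - dif Y p j"
        by (simp add: v'_def eZ lin_on_minus[OF lj])
      moreover have "dif Z (\<lambda>i'. v' (i', j)) eZ = a j" using \<open>hdeg Y j \<noteq> 0 \<Longrightarrow> _\<close> 1 h by (simp add: a_def)
      ultimately show ?thesis using p[of j] j h 1 by (simp add: tdif_apply lvl_def)
    next
      case 2
      hence [simp]: "j = eY" using cyc_resD(3)[OF Y] j by (auto simp: lvl_def)
      have hi: "hdeg Z i = Suc n" using h 2 by simp
      have 3: "dif Z (\<lambda>i'. v' (i', eY)) i = dif Z (\<lambda>i'. (- ((-1) ^ Suc n)) * q i') i"
        by (rule lin_on_local[OF li]) (simp add: v'_def lvl_hdeg eY)
      have 4: "dif Y (\<lambda>j'. v' (i, j')) eY = b i" using \<open>hdeg Z i \<noteq> 0 \<Longrightarrow> _\<close> hi by (simp add: b_def)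
      have "tdif Z Y v' (i, j) = (-1) ^ Suc n * (b i - dif Z q i)"
        unfolding tdif_apply \<open>j = eY\<close> 3 4 lin_on_scale[OF li] hi by (simp add: algebra_simps)
      thus ?thesis using is_ideal_mult[OF N q[of i], of "(-1) ^ Suc n"] i hi by (simp add: lvl_def)
    next
      case 3
      thus ?thesis using v[OF i j _ _ h] 1 2 by (simp add: tdif_apply)
    qed
  qed
  from tens_exactD[OF ex this] obtain w where
    w: "\<And>i j. i \<in> basis Z \<Longrightarrow> j \<in> basis Y \<Longrightarrow> hdeg Z i + hdeg Y j = Suc (Suc n) \<Longrightarrow> v' (i, j) - tdif Z Y w (i, j) \<in> N"
    by blast
  show ?thesis
  proof (intro exI[of _ w] ballI impI)
    fix i j assume ij: "i \<in> basis Z" "j \<in> basis Y" and h: "1 \<le> hdeg Z i" "1 \<le> hdeg Y j" "hdeg Z i + hdeg Y j = Suc (Suc n)"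
    show "v (i, j) - tdif Z Y w (i, j) \<in> N" using w[OF ij h(3)] h(1,2) by (simp add: v'_def)
  qed
qed

text \<open>The defining congruences of a chain map, extended from basis elements to arbitrary vectors.\<close>

lemma chain_map_vec:
  assumes N: "is_ideal N" and S: "is_complex N S" and Z: "is_complex N Z" and f: "chain_map N S Z f"
    and x: "x \<in> lvl Z n"
  shows "dif Z (\<lambda>x'. \<Sum>s\<in>lvl S (Suc n). c s * f s x') x - (\<Sum>s\<in>lvl S n. dif S c s * f s x) \<in> N"
proof -
  note lin = is_complex_lin_lvl[OF Z x]
  have "(\<Sum>s\<in>lvl S n. dif S c s * f s x) = (\<Sum>j\<in>lvl S n. (\<Sum>s\<in>lvl S (Suc n). c s * ent S j s) * f j x)"
    by (intro sum.cong refl) (simp add: dif_expand[OF S])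
  also have "\<dots> = (\<Sum>s\<in>lvl S (Suc n). c s * (\<Sum>j\<in>lvl S n. ent S j s * f j x))"
    by (simp add: sum_distrib_left sum_distrib_right) (subst sum.swap, simp add: mult_ac)
  finally have "dif Z (\<lambda>x'. \<Sum>s\<in>lvl S (Suc n). c s * f s x') x - (\<Sum>s\<in>lvl S n. dif S c s * f s x) =
      (\<Sum>s\<in>lvl S (Suc n). c s * (dif Z (f s) x - (\<Sum>j\<in>lvl S n. ent S j s * f j x)))"
    by (simp add: lin_on_sum[OF lin] lin_on_scale[OF lin] right_diff_distrib sum_subtractf)
  also have "\<dots> \<in> N"
    by (rule is_ideal_sum[OF N], rule is_ideal_mult[OF N], rule chain_mapD[OF f _ x])
  finally show ?thesis .
qed

definition unit_cpx :: "(unit, 's::comm_ring_1) based" where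
  "unit_cpx = \<lparr>basis = {()}, hdeg = (\<lambda>_. 0), ideg = (\<lambda>_. 0), dif = (\<lambda>_ _. 0)\<rparr>"

lemma unit_cpx_simps [simp]: "basis unit_cpx = {()}" "hdeg unit_cpx k = 0" "ideg unit_cpx k = 0" "dif unit_cpx v k = 0"
  "lvl unit_cpx n = (if n = 0 then {()} else {})"
  by (auto simp: unit_cpx_def lvl_def)

lemma unit_cpx_res: "is_ideal N \<Longrightarrow> cyc_res N N unit_cpx ()"
  by (auto simp: cyc_res_def is_complex_def lin_on_zero_fun exact_def is_ideal_zero)

text \<open>\<open>PW\<close> attaches \<open>W = Z\<^sub>\<ge>\<^sub>1 \<otimes> Y\<^sub>\<ge>\<^sub>1\<close> to the ring by the product of the augmentations \<open>Z\<^sub>1 \<rightarrow> I\<close> and \<open>Y\<^sub>1 \<rightarrow> J\<close>. It resolves the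
  quotient by \<open>IJ\<close>.\<close>

locale product_data =
  fixes N :: "'s::comm_ring_1 set" and Z :: "('x, 's) based" and Y :: "('y, 's) based"
    and I J :: "'s set" and eZ :: 'x and eY :: 'y
  assumes N: "is_ideal N" and Z: "cyc_res N I Z eZ" and Y: "cyc_res N J Y eY"
    and exZY: "exact N (ttens 0 0 0 Z Y)"
begin

lemmas Zc = cyc_resD(1)[OF Z] and Yc = cyc_resD(1)[OF Y]
lemmas eZ = cyc_resD(5,6)[OF Z] and eY = cyc_resD(5,6)[OF Y]
lemmas lZ = is_complex_lin[OF Zc eZ(1)] and lY = is_complex_lin[OF Yc eY(1)]
lemmas I = cyc_res_ideal[OF N Z] and J = cyc_res_ideal[OF N Y]

definition W :: "('x \<times> 'y, 's) based" where "W = ttens 1 1 1 Z Y"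

definition attW :: "('x \<times> 'y \<Rightarrow> 's) \<Rightarrow> unit \<Rightarrow> 's" where
  "attW v = (\<lambda>_. dif Z (\<lambda>x. dif Y (\<lambda>y. v (x, y)) eY) eZ)"

definition PW :: "(unit + 'x \<times> 'y, 's) based" where "PW = sum_cone attW unit_cpx W"

text \<open>The ideal that the cone construction produces; \<open>IJ_products\<close> and \<open>IJ_least\<close> identify it as the product of
  \<open>I\<close> and \<open>J\<close>.\<close>

definition IJ :: "'s set" where "IJ = {x. \<exists>v. x - attW v () \<in> N}"

lemma W_complex: "is_complex N W"
  unfolding W_def by (rule ttens_complex[OF N Zc Yc]) simp

lemma lvl_W: "lvl W n = {(x, y). x \<in> basis Z \<and> y \<in> basis Y \<and> 1 \<le> hdeg Z x \<and> 1 \<le> hdeg Y y \<and> hdeg Z x + hdeg Y y = Suc n}"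
  unfolding W_def lvl_def by auto

lemma lin_attW: "lin_on (lvl W 1) (\<lambda>v. attW v ())"
  unfolding attW_def
proof (rule lin_on_comp[OF lZ])
  fix x assume x: "x \<in> lvl Z (Suc (hdeg Z eZ))"
  show "lin_on (lvl W 1) (\<lambda>v. dif Y (\<lambda>y. v (x, y)) eY)"
    by (rule lin_on_reindex[OF lY]) (use x is_complex_finite[OF W_complex] in \<open>auto simp: lvl_W eZ eY lvl_def[of Z] lvl_def[of Y]\<close>)
qed (rule is_complex_finite[OF W_complex])

lemma attach_W: "attach N unit_cpx W attW"
  unfolding attach_def
proof (intro conjI ballI allI)
  fix k assume "k \<in> basis (unit_cpx :: (unit, 's) based)"
  thus "lin_on (lvl W (Suc (hdeg (unit_cpx :: (unit, 's) based) k))) (\<lambda>v. attW v k)" using lin_attW by simp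
next
  fix v and k :: unit
  have "attW (dif W v) k = dif Z (\<lambda>x. dif Y (\<lambda>y. dif Z (\<lambda>x'. v (x', y)) x - dif Y (\<lambda>y'. v (x, y')) y) eY) eZ"
    unfolding attW_def W_def
    by (intro lin_on_local[OF lZ] lin_on_local[OF lY]) (simp add: tdif_apply lvl_hdeg eZ)
  also have "\<dots> = dif Y (\<lambda>y. dif Z (dif Z (\<lambda>x'. v (x', y))) eZ) eY - dif Z (\<lambda>x. dif Y (dif Y (\<lambda>y'. v (x, y'))) eY) eZ"
    by (simp add: lin_on_diff[OF lZ] lin_on_diff[OF lY]) (rule lin_on_swap[OF lZ lY])
  also have "\<dots> \<in> N"
    by (intro is_ideal_diff[OF N] lin_on_ideal[OF lZ N] lin_on_ideal[OF lY N] is_complex_sq[OF Zc eZ(1)] is_complex_sq[OF Yc eY(1)])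
  finally show "dif unit_cpx (attW v) k + attW (dif W v) k \<in> N" by simp
qed

lemma is_cone_PW: "is_cone Inl Inr attW unit_cpx W PW"
  unfolding PW_def by (rule is_cone_sum_cone)

lemma PW_res: "cyc_res N IJ PW (Inl ())"
proof -
  have "cyc_res N {x. \<exists>v. x - attW v () \<in> N} PW (Inl ())"
  proof (rule cone_cyc_res[OF N is_cone_PW unit_cpx_res[OF N] W_complex attach_W])
    show "lvl W 0 = {}" by (auto simp: lvl_W)
    fix n v assume v: "\<And>q. q \<in> lvl W n \<Longrightarrow> dif W v q \<in> N" and v0: "n = 0 \<Longrightarrow> attW v () \<in> N"
    have "\<exists>w. \<forall>i\<in>basis Z. \<forall>j\<in>basis Y. 1 \<le> hdeg Z i \<longrightarrow> 1 \<le> hdeg Y j \<longrightarrow> hdeg Z i + hdeg Y j = Suc (Suc n) \<longrightarrow>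
       v (i, j) - tdif Z Y w (i, j) \<in> N"
    proof (rule tens_trunc2_exact[OF N Z Y exZY])
      fix i j assume "i \<in> basis Z" "j \<in> basis Y" "1 \<le> hdeg Z i" "1 \<le> hdeg Y j" "hdeg Z i + hdeg Y j = Suc n"
      hence "(i, j) \<in> lvl W n" by (simp add: lvl_W)
      from v[OF this] show "tdif Z Y v (i, j) \<in> N" by (simp add: W_def)
    next
      assume "n = 0" from v0[OF this] show "dif Z (\<lambda>x. dif Y (\<lambda>y. v (x, y)) eY) eZ \<in> N" by (simp add: attW_def)
    qed
    thus "\<exists>w. \<forall>q\<in>lvl W (Suc n). v q - dif W w q \<in> N" unfolding lvl_W by (auto simp: W_def)
  qed
  thus ?thesis by (simp add: IJ_def)
qed

lemma attW_mem: "attW v () \<in> I" "attW v () \<in> J"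
proof -
  show "attW v () \<in> I" unfolding attW_def by (rule cyc_res_dif[OF N Z])
  show "attW v () \<in> J" unfolding attW_def by (rule lin_on_ideal[OF lZ J(1)]) (rule cyc_res_dif[OF N Y])
qed

lemma IJ_subset: "IJ \<subseteq> I" "IJ \<subseteq> J"
proof -
  show "IJ \<subseteq> I" unfolding IJ_def using attW_mem(1) I by (auto intro: ideal_cong_mem[OF I(1)])
  show "IJ \<subseteq> J" unfolding IJ_def using attW_mem(2) J by (auto intro: ideal_cong_mem[OF J(1)])
qed

lemma IJ_products:
  assumes "a \<in> I" "b \<in> J" shows "a * b \<in> IJ"
proof -
  obtain p where p: "a - dif Z p eZ \<in> N" using assms(1) cyc_resD(7)[OF Z] by blast
  obtain q where q: "b - dif Y q eY \<in> N" using assms(2) cyc_resD(7)[OF Y] by blast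
  \<comment> \<open>The product of two first boundaries is the image of the tensor of the two chains.\<close>
  have "attW (\<lambda>(x, y). p x * q y) () = dif Z (\<lambda>x. dif Y q eY * p x) eZ"
    unfolding attW_def by (simp add: lin_on_scale[OF lY] mult.commute)
  also have "\<dots> = dif Y q eY * dif Z p eZ" by (rule lin_on_scale[OF lZ])
  finally have "a * b - attW (\<lambda>(x, y). p x * q y) () = b * (a - dif Z p eZ) + dif Z p eZ * (b - dif Y q eY)"
    by (simp add: algebra_simps)
  moreover have "\<dots> \<in> N" using p q by (intro is_ideal_add[OF N] is_ideal_mult[OF N])
  ultimately show ?thesis unfolding IJ_def by (metis (mono_tags, lifting) mem_Collect_eq)
qed

lemma IJ_least:
  assumes A: "is_ideal A" "N \<subseteq> A" and prods: "\<And>a b. a \<in> I \<Longrightarrow> b \<in> J \<Longrightarrow> a * b \<in> A"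
  shows "IJ \<subseteq> A"
proof
  fix x assume "x \<in> IJ"
  then obtain v where v: "x - attW v () \<in> N" by (auto simp: IJ_def)
  have "attW v () = (\<Sum>i\<in>lvl Z 1. \<Sum>j\<in>lvl Y 1. v (i, j) * (ent Z eZ i * ent Y eY j))"
    unfolding attW_def dif_expand[OF Zc in_lvl[OF eZ(1)]] dif_expand[OF Yc in_lvl[OF eY(1)]]
    by (simp add: eZ eY sum_distrib_left sum_distrib_right mult_ac)
  also have "\<dots> \<in> A"
    by (intro is_ideal_sum[OF A(1)] is_ideal_mult[OF A(1) prods]) (auto simp: ent_def intro: cyc_res_dif[OF N Z] cyc_res_dif[OF N Y])
  finally show "x \<in> A" using v A by (meson ideal_cong_mem subsetD)
qed

lemma PW_minimal: "is_ideal \<mm> \<Longrightarrow> minimal_cpx \<mm> Z \<Longrightarrow> minimal_cpx \<mm> Y \<Longrightarrow> minimal_cpx \<mm> PW"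
  by (rule cone_minimal[OF _ is_cone_PW])
     (auto simp: W_def attW_def minimal_cpx_def eZ is_ideal_zero tdif_apply intro!: is_ideal_add is_ideal_mult)

lemma PW_complex: "is_complex N PW"
  using cyc_resD(1)[OF PW_res] .

lemma PW_graded:
  assumes g: "gcat N Gs" "gmon Gs" and gZ: "graded_cpx Gs Z" and gY: "graded_cpx Gs Y"
  shows "graded_cpx Gs PW"
proof (rule cone_graded[OF N g(1) is_cone_PW cyc_resD(1)[OF unit_cpx_res[OF N]] W_complex attach_W])
  show "graded_cpx Gs unit_cpx" by (simp add: graded_cpx_def)
  show "graded_cpx Gs W" unfolding W_def by (rule ttens_graded[OF N g Zc gZ Yc gY]) simp
  fix k :: unit and q assume "q \<in> lvl W (Suc (hdeg (unit_cpx :: (unit, 's) based) k))"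
  then obtain x y where xy: "q = (x, y)" "x \<in> lvl Z 1" "y \<in> lvl Y 1"
    by (cases q) (auto simp: lvl_W lvl_def[of Z] lvl_def[of Y])
  have "attW (unitv q) k = dif Z (\<lambda>x'. ent Y eY y * unitv x x') eZ"
    unfolding attW_def xy(1)
    by (intro lin_on_local[OF lZ]) (auto simp: unitv_pair ent_def lin_on_zero[OF lY] unitv_def[of x])
  also have "\<dots> = ent Z eZ x * ent Y eY y"
    unfolding lin_on_scale[OF lZ] by (simp add: ent_def mult.commute)
  also have "\<dots> \<in> Gs (ideg Z x + ideg Y y) (ideg Z eZ + ideg Y eY)"
    by (rule gmon_mult[OF g(2)]) (use xy cyc_resD(3)[OF Z] cyc_resD(3)[OF Y] in \<open>auto intro!: graded_cpxD[OF gZ, of _ 0] graded_cpxD[OF gY, of _ 0]\<close>)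
  finally show "attW (unitv q) k \<in> Gs (ideg W q) (ideg (unit_cpx :: (unit, 's) based) k)"
    by (simp add: xy W_def cyc_resD[OF Z] cyc_resD[OF Y])
qed

end

lemma lin_on_scale_right: "lin_on Z f \<Longrightarrow> f (\<lambda>l. v l * c) = f v * c"
  using lin_on_scale[of Z f c v] by (simp add: mult.commute)

lemma lin_on_times_right: "lin_on Z f \<Longrightarrow> lin_on Z (\<lambda>v. f v * c)"
  using lin_on_times[of Z f c] by (simp add: mult.commute)

text \<open>The full resolution \<open>P\<close>. The comparison maps \<open>\<phi>\<close> and \<open>\<psi>\<close> lift the projections from the quotient
  by \<open>I'\<close> to the one by \<open>I\<close> and from the quotient by \<open>J'\<close> to the one by \<open>J\<close>.\<close>

locale resolution_data = product_data N Z Y I J eZ eY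
  for N :: "'s::comm_ring_1 set" and Z :: "('x, 's) based" and Y :: "('y, 's) based"
    and I J :: "'s set" and eZ :: 'x and eY :: 'y +
  fixes S :: "('a, 's) based" and T :: "('b, 's) based" and I' J' :: "'s set" and eS :: 'a and eT :: 'b
    and \<phi> :: "'a \<Rightarrow> 'x \<Rightarrow> 's" and \<psi> :: "'b \<Rightarrow> 'y \<Rightarrow> 's"
  assumes S: "cyc_res N I' S eS" and T: "cyc_res N J' T eT"
    and exSY: "exact N (ttens 0 0 0 S Y)" and exTZ: "exact N (ttens 0 0 0 T Z)"
    and phi: "chain_map N S Z \<phi>" "\<phi> eS eZ = 1" and psi: "chain_map N T Y \<psi>" "\<psi> eT eY = 1"
    and sub: "I' \<subseteq> I"
begin

lemmas Sc = cyc_resD(1)[OF S] and Tc = cyc_resD(1)[OF T]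
lemmas eS = cyc_resD(5,6)[OF S] and eT = cyc_resD(5,6)[OF T]
lemmas lS = is_complex_lin[OF Sc eS(1)] and lT = is_complex_lin[OF Tc eT(1)]

definition U :: "('a \<times> 'y, 's) based" where "U = ttens 1 0 0 S Y"
definition V :: "('b \<times> 'x, 's) based" where "V = ttens 1 0 0 T Z"

text \<open>The attaching map of \<open>U = S\<^sub>\<ge>\<^sub>1 \<otimes> Y\<close>. On \<open>S\<^sub>1 \<otimes> Y\<^sub>0\<close> it is the augmentation \<open>S\<^sub>1 \<rightarrow> I'\<close>; elsewhere it is \<open>\<phi> \<otimes> 1\<close> into \<open>W\<close>,
  and the sign accounts for the degree shift of \<open>W\<close>.\<close>

definition attU :: "('a \<times> 'y \<Rightarrow> 's) \<Rightarrow> unit + 'x \<times> 'y \<Rightarrow> 's" where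
  "attU v = case_sum (\<lambda>_. dif S (\<lambda>s. v (s, eY)) eS)
     (\<lambda>(x, y). (-1) ^ (hdeg Z x + hdeg Y y) * (\<Sum>s\<in>lvl S (hdeg Z x). v (s, y) * \<phi> s x))"

text \<open>The attaching map of \<open>V = T\<^sub>\<ge>\<^sub>1 \<otimes> Z\<close>, with \<open>\<psi>\<close> followed by the exchange of the two tensor factors; this and the
  degree shift of \<open>W\<close> produce the sign. It does not meet \<open>U\<close>, so in \<open>P\<close> its component there is zero.\<close>

definition attV :: "('b \<times> 'x \<Rightarrow> 's) \<Rightarrow> unit + 'x \<times> 'y \<Rightarrow> 's" where
  "attV v = case_sum (\<lambda>_. dif T (\<lambda>t. v (t, eZ)) eT)
     (\<lambda>(x, y). (-1) ^ (Suc (hdeg Z x) * Suc (hdeg Y y)) * (\<Sum>t\<in>lvl T (hdeg Y y). v (t, x) * \<psi> t y))"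

definition PU :: "((unit + 'x \<times> 'y) + 'a \<times> 'y, 's) based" where "PU = sum_cone attU PW U"

definition P :: "(((unit + 'x \<times> 'y) + 'a \<times> 'y) + 'b \<times> 'x, 's) based" where
  "P = sum_cone (\<lambda>v. case_sum (attV v) (\<lambda>_. 0)) PU V"

lemma U_complex: "is_complex N U" unfolding U_def by (rule ttens_complex[OF N Sc Yc]) simp
lemma V_complex: "is_complex N V" unfolding V_def by (rule ttens_complex[OF N Tc Zc]) simp

lemma lvl_U: "lvl U n = {(s, y). s \<in> basis S \<and> y \<in> basis Y \<and> 1 \<le> hdeg S s \<and> hdeg S s + hdeg Y y = n}"
  unfolding U_def lvl_def by auto
lemma lvl_V: "lvl V n = {(t, x). t \<in> basis T \<and> x \<in> basis Z \<and> 1 \<le> hdeg T t \<and> hdeg T t + hdeg Z x = n}"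
  unfolding V_def lvl_def by auto

lemma basis_PW: "k \<in> basis PW \<longleftrightarrow> k = Inl () \<or> (\<exists>x y. k = Inr (x, y) \<and> x \<in> basis Z \<and> y \<in> basis Y \<and> 1 \<le> hdeg Z x \<and> 1 \<le> hdeg Y y)"
  by (auto simp: PW_def sum_cone_def W_def)

lemma hdeg_PW: "hdeg PW (Inl ()) = 0" "1 \<le> hdeg Z x \<Longrightarrow> 1 \<le> hdeg Y y \<Longrightarrow> Suc (hdeg PW (Inr (x, y))) = hdeg Z x + hdeg Y y"
  by (auto simp: PW_def sum_cone_def W_def)

lemma dif_PW: "dif PW w (Inl ()) = attW (\<lambda>q. w (Inr q)) ()" "dif PW w (Inr q) = tdif Z Y (\<lambda>q. w (Inr q)) q"
  by (auto simp: PW_def sum_cone_def W_def)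

text \<open>At the generator of degree zero, both terms reduce to \<open>\<phi>\<close> commuting with the differentials in degree
  one and lifting the identity. At a generator of \<open>W\<close> the \<open>Y\<close>-differentials cancel because of the sign, and what
  remains is the defect of \<open>\<phi>\<close> from being a chain map.\<close>

lemma attach_U: "attach N PW U attU"
  unfolding attach_def
proof (intro conjI ballI allI)
  fix k assume k: "k \<in> basis PW"
  note fin = is_complex_finite[OF U_complex]
  show "lin_on (lvl U (Suc (hdeg PW k))) (\<lambda>v. attU v k)"
  proof (cases k)
    case (Inl u)
    hence [simp]: "k = Inl ()" by simp
    have "lin_on (lvl U 1) (\<lambda>v. dif S (\<lambda>s. v (s, eY)) eS)"
      by (rule lin_on_reindex[OF lS _ fin]) (auto simp: lvl_U eS eY lvl_def[of S])
    thus ?thesis by (simp add: attU_def hdeg_PW)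
  next
    case (Inr q)
    then obtain x y where [simp]: "k = Inr (x, y)" and xy: "x \<in> basis Z" "y \<in> basis Y" "1 \<le> hdeg Z x" "1 \<le> hdeg Y y"
      using k by (auto simp: basis_PW)
    have "lin_on (lvl U (hdeg Z x + hdeg Y y)) (\<lambda>v. (-1) ^ (hdeg Z x + hdeg Y y) * (\<Sum>s\<in>lvl S (hdeg Z x). v (s, y) * \<phi> s x))"
      by (intro lin_on_times lin_on_setsum lin_on_times_right lin_on_coord fin) (use xy in \<open>auto simp: lvl_U lvl_def[of S]\<close>)
    thus ?thesis using xy by (simp add: attU_def hdeg_PW)
  qed
next
  fix v k assume k: "k \<in> basis PW"
  show "dif PW (attU v) k + attU (dif U v) k \<in> N"
  proof (cases k)
    case (Inl u)
    hence [simp]: "k = Inl ()" by simp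
    define c where "c s = dif Y (\<lambda>y. v (s, y)) eY" for s
    have "dif PW (attU v) k = dif Z (\<lambda>x. \<Sum>s\<in>lvl S (Suc 0). c s * \<phi> s x) eZ"
      unfolding \<open>k = Inl ()\<close> dif_PW attW_def
    proof (rule lin_on_local[OF lZ])
      fix x assume x: "x \<in> lvl Z (Suc (hdeg Z eZ))"
      have "dif Y (\<lambda>y. attU v (Inr (x, y))) eY = dif Y (\<lambda>y. \<Sum>s\<in>lvl S (Suc 0). v (s, y) * \<phi> s x) eY"
        by (rule lin_on_local[OF lY]) (use x in \<open>simp add: attU_def lvl_hdeg eZ eY\<close>)
      also have "\<dots> = (\<Sum>s\<in>lvl S (Suc 0). c s * \<phi> s x)"
        by (simp add: lin_on_sum[OF lY] lin_on_scale_right[OF lY] c_def)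
      finally show "dif Y (\<lambda>y. attU v (Inr (x, y))) eY = (\<Sum>s\<in>lvl S (Suc 0). c s * \<phi> s x)" .
    qed
    moreover have "dif Z (\<lambda>x. \<Sum>s\<in>lvl S (Suc 0). c s * \<phi> s x) eZ - dif S c eS \<in> N"
      using chain_map_vec[OF N Sc Zc phi(1), of eZ 0 c] by (simp add: cyc_resD(3)[OF S] cyc_resD(3)[OF Z] phi(2))
    moreover have "attU (dif U v) k = dif S (dif S (\<lambda>s. v (s, eY))) eS - dif S c eS"
    proof -
      have "attU (dif U v) k = dif S (\<lambda>s. dif S (\<lambda>s. v (s, eY)) s - c s) eS"
        by (simp add: attU_def U_def) (rule lin_on_local[OF lS], simp add: tdif_apply lvl_hdeg eS c_def)
      thus ?thesis by (simp add: lin_on_diff[OF lS])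
    qed
    ultimately have "dif PW (attU v) k + attU (dif U v) k = (dif Z (\<lambda>x. \<Sum>s\<in>lvl S (Suc 0). c s * \<phi> s x) eZ - dif S c eS) + dif S (dif S (\<lambda>s. v (s, eY))) eS"
      by simp
    also have "\<dots> \<in> N" by (rule is_ideal_add[OF N _ is_complex_sq[OF Sc eS(1)]]) fact
    finally show ?thesis .
  next
    case (Inr q)
    then obtain x y where [simp]: "k = Inr (x, y)" and xy: "x \<in> basis Z" "y \<in> basis Y" "1 \<le> hdeg Z x" "1 \<le> hdeg Y y"
      using k by (auto simp: basis_PW)
    note lx = is_complex_lin[OF Zc xy(1)] and ly = is_complex_lin[OF Yc xy(2)]
    let ?e = "(-1::'s) ^ (hdeg Z x + hdeg Y y)" and ?n = "hdeg Z x"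
    define D where "D = dif Z (\<lambda>x'. \<Sum>s\<in>lvl S (Suc ?n). v (s, y) * \<phi> s x') x"
    define E where "E = (\<Sum>s\<in>lvl S ?n. dif Y (\<lambda>y'. v (s, y')) y * \<phi> s x)"
    define G where "G = (\<Sum>s\<in>lvl S ?n. dif S (\<lambda>s. v (s, y)) s * \<phi> s x)"
    have a: "dif Z (\<lambda>x'. attU v (Inr (x', y))) x = - ?e * D"
    proof -
      have "dif Z (\<lambda>x'. attU v (Inr (x', y))) x = dif Z (\<lambda>x'. - ?e * (\<Sum>s\<in>lvl S (Suc ?n). v (s, y) * \<phi> s x')) x"
        by (rule lin_on_local[OF lx]) (simp add: attU_def lvl_hdeg)
      thus ?thesis unfolding D_def by (simp only: lin_on_scale[OF lx])
    qed
    have b: "dif Y (\<lambda>y'. attU v (Inr (x, y'))) y = - ?e * E"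
    proof -
      have "dif Y (\<lambda>y'. attU v (Inr (x, y'))) y = dif Y (\<lambda>y'. - ?e * (\<Sum>s\<in>lvl S ?n. v (s, y') * \<phi> s x)) y"
        by (rule lin_on_local[OF ly]) (simp add: attU_def lvl_hdeg)
      also have "\<dots> = - ?e * E" unfolding E_def
        by (simp only: lin_on_scale[OF ly] lin_on_sum[OF ly] lin_on_scale_right[OF ly])
      finally show ?thesis .
    qed
    have c: "attU (dif U v) k = ?e * (G + (-1) ^ ?n * E)"
    proof -
      have "(\<Sum>s\<in>lvl S ?n. tdif S Y v (s, y) * \<phi> s x) = (\<Sum>s\<in>lvl S ?n. dif S (\<lambda>s. v (s, y)) s * \<phi> s x + (-1) ^ ?n * (dif Y (\<lambda>y'. v (s, y')) y * \<phi> s x))"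
        by (intro sum.cong refl) (simp add: tdif_apply lvl_hdeg algebra_simps)
      also have "\<dots> = G + (-1) ^ ?n * E" by (simp add: G_def E_def sum.distrib sum_distrib_left)
      finally show ?thesis by (simp add: attU_def U_def)
    qed
    have d: "D - G \<in> N" unfolding D_def G_def
      by (rule chain_map_vec[OF N Sc Zc phi(1)]) (use xy in \<open>simp add: in_lvl\<close>)
    have "dif PW (attU v) k + attU (dif U v) k = - ?e * (D - G)"
      unfolding \<open>k = Inr (x, y)\<close> dif_PW tdif_apply a b c[unfolded \<open>k = Inr (x, y)\<close>] by (simp add: algebra_simps)
    thus ?thesis using is_ideal_mult[OF N d] by (simp only:)
  qed
qed

lemma attach_V0: "attach N PW V attV"
  unfolding attach_def
proof (intro conjI ballI allI)
  fix k assume k: "k \<in> basis PW"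
  note fin = is_complex_finite[OF V_complex]
  show "lin_on (lvl V (Suc (hdeg PW k))) (\<lambda>v. attV v k)"
  proof (cases k)
    case (Inl u)
    hence [simp]: "k = Inl ()" by simp
    have "lin_on (lvl V 1) (\<lambda>v. dif T (\<lambda>t. v (t, eZ)) eT)"
      by (rule lin_on_reindex[OF lT _ fin]) (auto simp: lvl_V eT eZ lvl_def[of T])
    thus ?thesis by (simp add: attV_def hdeg_PW)
  next
    case (Inr q)
    then obtain x y where [simp]: "k = Inr (x, y)" and xy: "x \<in> basis Z" "y \<in> basis Y" "1 \<le> hdeg Z x" "1 \<le> hdeg Y y"
      using k by (auto simp: basis_PW)
    have "lin_on (lvl V (hdeg Z x + hdeg Y y)) (\<lambda>v. (-1) ^ (Suc (hdeg Z x) * Suc (hdeg Y y)) * (\<Sum>t\<in>lvl T (hdeg Y y). v (t, x) * \<psi> t y))"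
      by (intro lin_on_times lin_on_setsum lin_on_times_right lin_on_coord fin) (use xy in \<open>auto simp: lvl_V lvl_def[of T]\<close>)
    thus ?thesis using xy by (simp add: attV_def hdeg_PW)
  qed
next
  fix v k assume k: "k \<in> basis PW"
  show "dif PW (attV v) k + attV (dif V v) k \<in> N"
  proof (cases k)
    case (Inl u)
    hence [simp]: "k = Inl ()" by simp
    define c where "c t = dif Z (\<lambda>x. v (t, x)) eZ" for t
    have 1: "dif PW (attV v) k - dif Z (\<lambda>x. dif T (\<lambda>t. v (t, x)) eT) eZ \<in> N"
      unfolding \<open>k = Inl ()\<close> dif_PW attW_def
    proof (rule lin_on_cong_ideal[OF lZ N])
      fix x assume x: "x \<in> lvl Z (Suc (hdeg Z eZ))"
      have "dif Y (\<lambda>y. attV v (Inr (x, y))) eY = dif Y (\<lambda>y. \<Sum>t\<in>lvl T (Suc 0). v (t, x) * \<psi> t y) eY"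
        by (rule lin_on_local[OF lY]) (use x in \<open>simp add: attV_def lvl_hdeg eZ eY\<close>)
      thus "dif Y (\<lambda>y. attV v (Inr (x, y))) eY - dif T (\<lambda>t. v (t, x)) eT \<in> N"
        using chain_map_vec[OF N Tc Yc psi(1), of eY 0 "\<lambda>t. v (t, x)"] by (simp add: cyc_resD(3)[OF T] cyc_resD(3)[OF Y] psi(2))
    qed
    have 2: "dif Z (\<lambda>x. dif T (\<lambda>t. v (t, x)) eT) eZ = dif T c eT"
      unfolding c_def by (rule lin_on_swap[OF lZ lT])
    have 3: "attV (dif V v) k = dif T (dif T (\<lambda>t. v (t, eZ))) eT - dif T c eT"
    proof -
      have "attV (dif V v) k = dif T (\<lambda>t. dif T (\<lambda>t. v (t, eZ)) t - c t) eT"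
        by (simp add: attV_def V_def) (rule lin_on_local[OF lT], simp add: tdif_apply lvl_hdeg eT c_def)
      thus ?thesis by (simp add: lin_on_diff[OF lT])
    qed
    have "dif PW (attV v) k + attV (dif V v) k = (dif PW (attV v) k - dif T c eT) + dif T (dif T (\<lambda>t. v (t, eZ))) eT"
      unfolding 3 by simp
    also have "\<dots> \<in> N" by (rule is_ideal_add[OF N _ is_complex_sq[OF Tc eT(1)]]) (use 1 2 in simp)
    finally show ?thesis .
  next
    case (Inr q)
    then obtain x y where [simp]: "k = Inr (x, y)" and xy: "x \<in> basis Z" "y \<in> basis Y" "1 \<le> hdeg Z x" "1 \<le> hdeg Y y"
      using k by (auto simp: basis_PW)
    note lx = is_complex_lin[OF Zc xy(1)] and ly = is_complex_lin[OF Yc xy(2)]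
    let ?e = "(-1::'s) ^ (Suc (hdeg Z x) * Suc (hdeg Y y))" and ?n = "hdeg Y y"
    define D where "D = dif Y (\<lambda>y'. \<Sum>t\<in>lvl T (Suc ?n). v (t, x) * \<psi> t y') y"
    define E where "E = (\<Sum>t\<in>lvl T ?n. dif Z (\<lambda>x'. v (t, x')) x * \<psi> t y)"
    define G where "G = (\<Sum>t\<in>lvl T ?n. dif T (\<lambda>t. v (t, x)) t * \<psi> t y)"
    have a: "dif Z (\<lambda>x'. attV v (Inr (x', y))) x = - ?e * ((-1) ^ ?n * E)"
    proof -
      have "dif Z (\<lambda>x'. attV v (Inr (x', y))) x = dif Z (\<lambda>x'. (- ?e * (-1) ^ ?n) * (\<Sum>t\<in>lvl T ?n. v (t, x') * \<psi> t y)) x"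
        by (rule lin_on_local[OF lx]) (simp add: attV_def lvl_hdeg power_add mult_ac)
      also have "\<dots> = (- ?e * (-1) ^ ?n) * E" unfolding E_def
        by (simp only: lin_on_scale[OF lx] lin_on_sum[OF lx] lin_on_scale_right[OF lx])
      finally show ?thesis by (simp add: mult_ac)
    qed
    have b: "(-1) ^ hdeg Z x * dif Y (\<lambda>y'. attV v (Inr (x, y'))) y = - ?e * D"
    proof -
      have "dif Y (\<lambda>y'. attV v (Inr (x, y'))) y = dif Y (\<lambda>y'. ((-1) ^ hdeg Z x * - ?e) * (\<Sum>t\<in>lvl T (Suc ?n). v (t, x) * \<psi> t y')) y"
        by (rule lin_on_local[OF ly]) (simp add: attV_def lvl_hdeg power_add mult_ac)
      also have "\<dots> = (-1) ^ hdeg Z x * (- ?e * D)" unfolding D_def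
        by (simp only: lin_on_scale[OF ly] mult.assoc)
      finally show ?thesis by (simp only: sign_sq)
    qed
    have c: "attV (dif V v) k = ?e * (G + (-1) ^ ?n * E)"
    proof -
      have "(\<Sum>t\<in>lvl T ?n. tdif T Z v (t, x) * \<psi> t y) = (\<Sum>t\<in>lvl T ?n. dif T (\<lambda>t. v (t, x)) t * \<psi> t y + (-1) ^ ?n * (dif Z (\<lambda>x'. v (t, x')) x * \<psi> t y))"
        by (intro sum.cong refl) (simp add: tdif_apply lvl_hdeg algebra_simps)
      also have "\<dots> = G + (-1) ^ ?n * E" by (simp add: G_def E_def sum.distrib sum_distrib_left)
      finally show ?thesis by (simp add: attV_def V_def)
    qed
    have d: "D - G \<in> N" unfolding D_def G_def
      by (rule chain_map_vec[OF N Tc Yc psi(1)]) (use xy in \<open>simp add: in_lvl\<close>)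
    have "dif PW (attV v) k + attV (dif V v) k = - ?e * (D - G)"
      unfolding \<open>k = Inr (x, y)\<close> dif_PW tdif_apply a b c[unfolded \<open>k = Inr (x, y)\<close>] by (simp add: algebra_simps)
    thus ?thesis using is_ideal_mult[OF N d] by (simp only:)
  qed
qed

lemma is_cone_PU: "is_cone Inl Inr attU PW U PU"
  unfolding PU_def by (rule is_cone_sum_cone)

lemma is_cone_P: "is_cone Inl Inr (\<lambda>v. case_sum (attV v) (\<lambda>_. 0)) PU V P"
  unfolding P_def by (rule is_cone_sum_cone)

lemma PU_complex: "is_complex N PU"
  by (rule cone_complex[OF N is_cone_PU PW_complex U_complex attach_U])

lemma attach_V: "attach N PU V (\<lambda>v. case_sum (attV v) (\<lambda>_. 0))"
  unfolding attach_def
proof (intro conjI ballI allI)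
  fix k assume k: "k \<in> basis PU"
  show "lin_on (lvl V (Suc (hdeg PU k))) (\<lambda>v. case_sum (attV v) (\<lambda>_. 0) k)"
    using k attach_V0 lin_on_zero_fun[OF is_complex_finite[OF V_complex]]
    by (auto simp: attach_def is_coneD[OF is_cone_PU])
  fix v
  have z: "attU (\<lambda>_. 0) k = 0" if "k \<in> basis PW" for k
    using attach_U that lin_on_zero[of "lvl U (Suc (hdeg PW k))" "\<lambda>v. attU v k"] unfolding attach_def by blast
  show "dif PU (case_sum (attV v) (\<lambda>_. 0)) k + case_sum (attV (dif V v)) (\<lambda>_. 0) k \<in> N"
    using k attach_V0
    by (auto simp: attach_def is_coneD[OF is_cone_PU] z lin_on_zero[OF is_complex_lin[OF U_complex]] is_ideal_zero[OF N])
qed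

definition IIJ :: "'s set" where "IIJ = {x. \<exists>v. x - attU v (Inl ()) \<in> IJ}"

definition K :: "'s set" where "K = {x. \<exists>v. x - attV v (Inl ()) \<in> IIJ}"

text \<open>Only the lowest degree is not formal: a vector of \<open>S\<^sub>1 \<otimes> Y\<^sub>0\<close> with image in \<open>IJ\<close> has image in \<open>J\<close>,
  which is the condition under which the truncated tensor product bounds it.\<close>

lemma PU_res: "cyc_res N IIJ PU (Inl (Inl ()))"
  unfolding IIJ_def
proof (rule cone_cyc_res[OF N is_cone_PU PW_res U_complex attach_U])
  show "lvl U 0 = {}" by (auto simp: lvl_U)
  fix n v assume v: "\<And>q. q \<in> lvl U n \<Longrightarrow> dif U v q \<in> N" and v0: "n = 0 \<Longrightarrow> attU v (Inl ()) \<in> IJ"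
  have "\<exists>w. \<forall>i\<in>basis S. \<forall>j\<in>basis Y. 1 \<le> hdeg S i \<longrightarrow> hdeg S i + hdeg Y j = Suc n \<longrightarrow> v (i, j) - tdif S Y w (i, j) \<in> N"
  proof (rule tens_trunc_exact[OF N Sc cyc_resD(3)[OF S] Y exSY])
    fix i j assume "i \<in> basis S" "j \<in> basis Y" "1 \<le> hdeg S i" "hdeg S i + hdeg Y j = n"
    hence "(i, j) \<in> lvl U n" by (simp add: lvl_U)
    from v[OF this] show "tdif S Y v (i, j) \<in> N" by (simp add: U_def)
  next
    assume "n = 0" from v0[OF this] show "dif S (\<lambda>i. v (i, eY)) eS \<in> J" using IJ_subset by (auto simp: attU_def)
  qed
  thus "\<exists>w. \<forall>q\<in>lvl U (Suc n). v q - dif U w q \<in> N" unfolding lvl_U by (auto simp: U_def)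
qed

lemma IIJ_sub: "IIJ \<subseteq> I"
proof
  fix x assume "x \<in> IIJ"
  then obtain v where v: "x - attU v (Inl ()) \<in> IJ" by (auto simp: IIJ_def)
  have "attU v (Inl ()) \<in> I" unfolding attU_def using sub cyc_res_dif[OF N S] by auto
  thus "x \<in> I" using v IJ_subset(1) by (meson ideal_cong_mem[OF I(1)] subsetD)
qed

text \<open>As for \<open>U\<close>, now with \<open>I\<close> in the place of \<open>J\<close>: the image lies in \<open>I' + IJ\<close>, which is contained
  in \<open>I\<close>. The inclusion \<open>I' \<subseteq> I\<close> is used here.\<close>

lemma P_res: "cyc_res N K P (Inl (Inl (Inl ())))"
proof -
  have "cyc_res N {x. \<exists>v. x - case_sum (attV v) (\<lambda>_::'a \<times> 'y. 0) (Inl (Inl ())) \<in> IIJ} P (Inl (Inl (Inl ())))"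
  proof (rule cone_cyc_res[OF N is_cone_P PU_res V_complex attach_V])
    show "lvl V 0 = {}" by (auto simp: lvl_V)
    fix n v assume v: "\<And>q. q \<in> lvl V n \<Longrightarrow> dif V v q \<in> N"
      and v0: "n = 0 \<Longrightarrow> case_sum (attV v) (\<lambda>_::'a \<times> 'y. 0) (Inl (Inl ())) \<in> IIJ"
    have "\<exists>w. \<forall>i\<in>basis T. \<forall>j\<in>basis Z. 1 \<le> hdeg T i \<longrightarrow> hdeg T i + hdeg Z j = Suc n \<longrightarrow> v (i, j) - tdif T Z w (i, j) \<in> N"
    proof (rule tens_trunc_exact[OF N Tc cyc_resD(3)[OF T] Z exTZ])
      fix i j assume "i \<in> basis T" "j \<in> basis Z" "1 \<le> hdeg T i" "hdeg T i + hdeg Z j = n"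
      hence "(i, j) \<in> lvl V n" by (simp add: lvl_V)
      from v[OF this] show "tdif T Z v (i, j) \<in> N" by (simp add: V_def)
    next
      assume "n = 0" from v0[OF this] show "dif T (\<lambda>i. v (i, eZ)) eT \<in> I" using IIJ_sub by (auto simp: attV_def)
    qed
    thus "\<exists>w. \<forall>q\<in>lvl V (Suc n). v q - dif V w q \<in> N" unfolding lvl_V by (auto simp: V_def)
  qed
  thus ?thesis by (simp add: K_def)
qed

lemma IJ_ideal: "is_ideal IJ" "N \<subseteq> IJ" using cyc_res_ideal[OF N PW_res] .
lemma IIJ_ideal: "is_ideal IIJ" "N \<subseteq> IIJ" using cyc_res_ideal[OF N PU_res] .
lemma K_ideal: "is_ideal K" "N \<subseteq> K" using cyc_res_ideal[OF N P_res] .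

lemma K_contains: "IJ \<subseteq> K" "I' \<subseteq> K" "J' \<subseteq> K"
proof -
  have zU: "attU (\<lambda>_. 0) (Inl ()) = 0" by (simp add: attU_def lin_on_zero[OF lS])
  have zV: "attV (\<lambda>_. 0) (Inl ()) = 0" by (simp add: attV_def lin_on_zero[OF lT])
  have 1: "IIJ \<subseteq> K" unfolding K_def using zV by (auto intro!: exI[of _ "\<lambda>_. 0"])
  have "IJ \<subseteq> IIJ" unfolding IIJ_def using zU by (auto intro!: exI[of _ "\<lambda>_. 0"])
  thus "IJ \<subseteq> K" using 1 by blast
  have "I' \<subseteq> IIJ"
  proof
    fix a assume "a \<in> I'"
    then obtain w where "a - dif S w eS \<in> N" using cyc_resD(7)[OF S] by blast
    thus "a \<in> IIJ" unfolding IIJ_def attU_def using IJ_ideal by (auto intro!: exI[of _ "\<lambda>(s, y). w s"])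
  qed
  thus "I' \<subseteq> K" using 1 by blast
  show "J' \<subseteq> K"
  proof
    fix a assume "a \<in> J'"
    then obtain w where "a - dif T w eT \<in> N" using cyc_resD(7)[OF T] by blast
    thus "a \<in> K" unfolding K_def attV_def using IIJ_ideal by (auto intro!: exI[of _ "\<lambda>(s, y). w s"])
  qed
qed

lemma K_least:
  assumes A: "is_ideal A" and "IJ \<subseteq> A" "I' \<subseteq> A" "J' \<subseteq> A"
  shows "K \<subseteq> A"
proof
  fix x assume "x \<in> K"
  then obtain u v where uv: "x - attV v (Inl ()) - attU u (Inl ()) \<in> IJ" by (auto simp: K_def IIJ_def)
  have "attU u (Inl ()) \<in> A" unfolding attU_def using assms(3) cyc_res_dif[OF N S] by auto
  moreover have "attV v (Inl ()) \<in> A" unfolding attV_def using assms(4) cyc_res_dif[OF N T] by auto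
  ultimately show "x \<in> A" using uv assms(2) by (meson ideal_cong_mem[OF A] subsetD)
qed

lemma P_minimal:
  assumes m: "is_ideal \<mm>" and min: "minimal_cpx \<mm> Z" "minimal_cpx \<mm> Y" "minimal_cpx \<mm> S" "minimal_cpx \<mm> T"
    and phi0: "\<And>s x. s \<in> basis S \<Longrightarrow> x \<in> lvl Z (hdeg S s) \<Longrightarrow> 1 \<le> hdeg S s \<Longrightarrow> \<phi> s x \<in> \<mm>"
    and psi0: "\<And>t y. t \<in> basis T \<Longrightarrow> y \<in> lvl Y (hdeg T t) \<Longrightarrow> 1 \<le> hdeg T t \<Longrightarrow> \<psi> t y \<in> \<mm>"
  shows "minimal_cpx \<mm> P"
proof (rule cone_minimal[OF m is_cone_P])
  show "minimal_cpx \<mm> V" unfolding V_def by (rule ttens_minimal[OF m min(4,1)])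
  show "minimal_cpx \<mm> PU"
  proof (rule cone_minimal[OF m is_cone_PU PW_minimal[OF m min(1,2)]])
    show "minimal_cpx \<mm> U" unfolding U_def by (rule ttens_minimal[OF m min(3,2)])
    fix v k assume "k \<in> basis PW"
    thus "attU v k \<in> \<mm>" unfolding basis_PW
      using min(3) eS phi0 by (auto simp: attU_def minimal_cpx_def lvl_def intro!: is_ideal_mult[OF m] is_ideal_sum[OF m])
  qed
  fix v k assume "k \<in> basis PU"
  thus "case_sum (attV v) (\<lambda>_. 0) k \<in> \<mm>" unfolding is_coneD(5)[OF is_cone_PU]
    using min(4) eT psi0
    by (auto simp: basis_PW attV_def minimal_cpx_def lvl_def is_ideal_zero[OF m] intro!: is_ideal_mult[OF m] is_ideal_sum[OF m] is_ideal_minus[OF m])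
qed

lemma P_graded:
  assumes g: "gcat N Gs" "gmon Gs" and gr: "graded_cpx Gs Z" "graded_cpx Gs Y" "graded_cpx Gs S" "graded_cpx Gs T"
    and h: "hom_map Gs S Z \<phi>" "hom_map Gs T Y \<psi>"
  shows "graded_cpx Gs P"
proof (rule cone_graded[OF N g(1) is_cone_P PU_complex V_complex attach_V])
  have zero: "0 \<in> Gs b a" for b a by (rule gcat_N[OF g(1) is_ideal_zero[OF N]])
  have ideg_PW: "ideg PW (Inl ()) = 0" "ideg PW (Inr (x, y)) = ideg Z x + ideg Y y" for x y
    by (auto simp: PW_def sum_cone_def W_def)
  have UU: "attU (unitv q) k \<in> Gs (ideg U q) (ideg PW k)" if k: "k \<in> basis PW" and q: "q \<in> lvl U (Suc (hdeg PW k))" for k q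
  proof -
    obtain s0 y0 where [simp]: "q = (s0, y0)" by (cases q)
    have sy: "s0 \<in> basis S" "y0 \<in> basis Y" "1 \<le> hdeg S s0" "hdeg S s0 + hdeg Y y0 = Suc (hdeg PW k)"
      using q by (auto simp: lvl_U)
    have iU: "ideg U q = ideg S s0 + ideg Y y0" by (simp add: U_def)
    show ?thesis
    proof (cases k)
      case (Inl u)
      hence [simp]: "k = Inl ()" by simp
      show ?thesis
      proof (cases "y0 = eY")
        case True
        hence "s0 \<in> lvl S 1" using sy eY by (simp add: hdeg_PW lvl_def)
        hence "ent S eS s0 \<in> Gs (ideg S s0) (ideg S eS)" using cyc_resD(3)[OF S] by (intro graded_cpxD[OF gr(3), of _ 0]) auto
        thus ?thesis using True unfolding iU by (auto simp: attU_def unitv_pair ideg_PW ent_def cyc_resD(4)[OF S] cyc_resD(4)[OF Y])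
      qed (simp add: attU_def unitv_pair lin_on_zero[OF lS] zero)
    next
      case (Inr p)
      then obtain x y where [simp]: "k = Inr (x, y)" and xy: "x \<in> basis Z" "y \<in> basis Y" "1 \<le> hdeg Z x" "1 \<le> hdeg Y y"
        using k by (auto simp: basis_PW)
      have "(\<Sum>s\<in>lvl S (hdeg Z x). unitv (s0, y0) (s, y) * \<phi> s x) \<in> Gs (ideg S s0 + ideg Y y0) (ideg Z x + ideg Y y)"
      proof (rule gcat_sum[OF g(1) N])
        fix s assume s: "s \<in> lvl S (hdeg Z x)"
        show "unitv (s0, y0) (s, y) * \<phi> s x \<in> Gs (ideg S s0 + ideg Y y0) (ideg Z x + ideg Y y)"
        proof (cases "s = s0 \<and> y = y0")
          case True
          have "\<phi> s x \<in> Gs (ideg S s) (ideg Z x)" using h(1) s xy by (auto simp: hom_map_def lvl_def)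
          thus ?thesis using True gmon_shift[OF g] by (auto simp: unitv_def)
        qed (auto simp: unitv_def zero)
      qed
      thus ?thesis unfolding iU by (simp add: attU_def ideg_PW gcat_sign[OF g(1)])
    qed
  qed
  have VV: "attV (unitv q) k \<in> Gs (ideg V q) (ideg PW k)" if k: "k \<in> basis PW" and q: "q \<in> lvl V (Suc (hdeg PW k))" for k q
  proof -
    obtain t0 x0 where [simp]: "q = (t0, x0)" by (cases q)
    have sy: "t0 \<in> basis T" "x0 \<in> basis Z" "1 \<le> hdeg T t0" "hdeg T t0 + hdeg Z x0 = Suc (hdeg PW k)"
      using q by (auto simp: lvl_V)
    have iV: "ideg V q = ideg T t0 + ideg Z x0" by (simp add: V_def)
    show ?thesis
    proof (cases k)
      case (Inl u)
      hence [simp]: "k = Inl ()" by simp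
      show ?thesis
      proof (cases "x0 = eZ")
        case True
        hence "t0 \<in> lvl T 1" using sy eZ by (simp add: hdeg_PW lvl_def)
        hence "ent T eT t0 \<in> Gs (ideg T t0) (ideg T eT)" using cyc_resD(3)[OF T] by (intro graded_cpxD[OF gr(4), of _ 0]) auto
        thus ?thesis using True unfolding iV by (auto simp: attV_def unitv_pair ideg_PW ent_def cyc_resD(4)[OF T] cyc_resD(4)[OF Z])
      qed (simp add: attV_def unitv_pair lin_on_zero[OF lT] zero)
    next
      case (Inr p)
      then obtain x y where [simp]: "k = Inr (x, y)" and xy: "x \<in> basis Z" "y \<in> basis Y" "1 \<le> hdeg Z x" "1 \<le> hdeg Y y"
        using k by (auto simp: basis_PW)
      have "(\<Sum>t\<in>lvl T (hdeg Y y). unitv (t0, x0) (t, x) * \<psi> t y) \<in> Gs (ideg T t0 + ideg Z x0) (ideg Z x + ideg Y y)"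
      proof (rule gcat_sum[OF g(1) N])
        fix t assume t: "t \<in> lvl T (hdeg Y y)"
        show "unitv (t0, x0) (t, x) * \<psi> t y \<in> Gs (ideg T t0 + ideg Z x0) (ideg Z x + ideg Y y)"
        proof (cases "t = t0 \<and> x = x0")
          case True
          have "\<psi> t y \<in> Gs (ideg T t) (ideg Y y)" using h(2) t xy by (auto simp: hom_map_def lvl_def)
          from gmon_shift(1)[OF g this, of "ideg Z x0"] show ?thesis using True by (auto simp: unitv_def add.commute)
        qed (auto simp: unitv_def zero)
      qed
      thus ?thesis unfolding iV by (simp add: attV_def ideg_PW gcat_sign[OF g(1)] del: mult_Suc mult_Suc_right)
    qed
  qed
  show "graded_cpx Gs V" unfolding V_def by (rule ttens_graded[OF N g Tc gr(4) Zc gr(1)]) simp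
  show "graded_cpx Gs PU"
  proof (rule cone_graded[OF N g(1) is_cone_PU PW_complex U_complex attach_U PW_graded[OF g gr(1,2)]])
    show "graded_cpx Gs U" unfolding U_def by (rule ttens_graded[OF N g Sc gr(3) Yc gr(2)]) simp
  qed (rule UU)
  fix k q assume k: "k \<in> basis PU" and q: "q \<in> lvl V (Suc (hdeg PU k))"
  thus "case_sum (attV (unitv q)) (\<lambda>_. 0) k \<in> Gs (ideg V q) (ideg PU k)"
    unfolding is_coneD(5)[OF is_cone_PU] using zero by (auto simp: is_coneD[OF is_cone_PU] intro!: VV)
qed

end

section \<open>Koszul complexes and contractions\<close>

text \<open>The ideal generated by \<open>N\<close> and a list, in a form that exhibits one generator at a time.\<close>

fun gid :: "'s::comm_ring_1 set \<Rightarrow> 's list \<Rightarrow> 's set" where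
  "gid N [] = N"
| "gid N (x # xs) = {y. \<exists>r. y - x * r \<in> gid N xs}"

text \<open>A regular sequence read from the end of the list, since lists grow at the front: every entry is
  a non-zero-divisor modulo \<open>N\<close> and the later entries.\<close>

fun nzd_seq :: "'s::comm_ring_1 set \<Rightarrow> 's list \<Rightarrow> bool" where
  "nzd_seq N [] = True"
| "nzd_seq N (x # xs) \<longleftrightarrow> nzd_seq N xs \<and> (\<forall>r. x * r \<in> gid N xs \<longrightarrow> r \<in> gid N xs)"

definition ntrue :: "bool list \<Rightarrow> nat" where "ntrue t = length (filter id t)"

lemma ntrue_simps [simp]: "ntrue [] = 0" "ntrue (True # t) = Suc (ntrue t)" "ntrue (False # t) = ntrue t"
  by (auto simp: ntrue_def)

text \<open>The Koszul complex of \<open>xs\<close>. A basis element \<open>e\<^sub>A\<close> of the exterior algebra is the list of truth values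
  of membership in \<open>A\<close>, so the degree is the number of entries \<open>True\<close>, and the complex for \<open>x # xs\<close> is the
  cone of multiplication by \<open>x\<close> on the complex for \<open>xs\<close>.\<close>

fun kdif :: "'s::comm_ring_1 list \<Rightarrow> (bool list \<Rightarrow> 's) \<Rightarrow> bool list \<Rightarrow> 's" where
  "kdif [] v t = 0"
| "kdif (x # xs) v [] = 0"
| "kdif (x # xs) v (False # t) = kdif xs (\<lambda>u. v (False # u)) t + (-1) ^ ntrue t * x * v (True # t)"
| "kdif (x # xs) v (True # t) = kdif xs (\<lambda>u. v (True # u)) t"

fun kideg :: "nat list \<Rightarrow> bool list \<Rightarrow> nat" where
  "kideg (d # ds) (b # t) = (if b then d else 0) + kideg ds t"
| "kideg _ _ = 0"

definition koszul :: "'s::comm_ring_1 list \<Rightarrow> nat list \<Rightarrow> (bool list, 's) based" where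
  "koszul xs ds = \<lparr>basis = {t. length t = length xs}, hdeg = ntrue, ideg = kideg ds, dif = kdif xs\<rparr>"

lemma koszul_simps [simp]: "basis (koszul xs ds) = {t. length t = length xs}" "hdeg (koszul xs ds) = ntrue"
  "ideg (koszul xs ds) = kideg ds" "dif (koszul xs ds) = kdif xs"
  by (auto simp: koszul_def)

lemma lvl_koszul_Nil [simp]: "lvl (koszul [] ds) n = (if n = 0 then {[]} else {})"
  by (auto simp: lvl_def)

definition shift_cpx :: "nat \<Rightarrow> ('i, 's::comm_ring_1) based \<Rightarrow> ('i, 's) based" where
  "shift_cpx d C = C\<lparr>hdeg := (\<lambda>k. Suc (hdeg C k)), ideg := (\<lambda>k. d + ideg C k)\<rparr>"

lemma shift_cpx_simps [simp]: "basis (shift_cpx d C) = basis C" "hdeg (shift_cpx d C) k = Suc (hdeg C k)"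
  "ideg (shift_cpx d C) k = d + ideg C k" "dif (shift_cpx d C) = dif C"
  "lvl (shift_cpx d C) 0 = {}" "lvl (shift_cpx d C) (Suc n) = lvl C n" "ent (shift_cpx d C) = ent C"
  by (auto simp: shift_cpx_def lvl_def ent_def fun_eq_iff)

lemma shift_cpx_complex: assumes "is_complex N C" shows "is_complex N (shift_cpx d C)"
  unfolding is_complex_def
proof (intro conjI allI)
  show "finite (lvl (shift_cpx d C) n)" for n using is_complex_finite[OF assms] by (cases n) auto
qed (use assms in \<open>auto simp: is_complex_def\<close>)

lemma koszul_cone:
  "is_cone (Cons False) (Cons True) (\<lambda>v t. (-1) ^ ntrue t * x * v t) (koszul xs ds)
     (shift_cpx d (koszul xs ds)) (koszul (x # xs) (d # ds))"
proof -
  have "{t. length t = Suc (length xs)} = Cons False ` {t. length t = length xs} \<union> Cons True ` {t. length t = length xs}"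
    by (auto simp: length_Suc_conv image_iff)
  thus ?thesis by (auto simp: is_cone_def)
qed

lemma nzd_attach:
  assumes N: "is_ideal N" and C: "is_complex N C"
  shows "attach N C (shift_cpx d C) (\<lambda>v k. (-1) ^ hdeg C k * x * v k)"
  unfolding attach_def
proof (intro conjI ballI allI)
  fix k assume k: "k \<in> basis C"
  show "lin_on (lvl (shift_cpx d C) (Suc (hdeg C k))) (\<lambda>v. (-1) ^ hdeg C k * x * v k)"
    using is_complex_finite[OF C] by (intro lin_on_times lin_on_coord) (auto simp: in_lvl[OF k])
  fix v
  have "dif C (\<lambda>k. (-1) ^ hdeg C k * x * v k) k = dif C (\<lambda>l. (- ((-1) ^ hdeg C k) * x) * v l) k"
    by (rule lin_on_local[OF is_complex_lin[OF C k]]) (simp add: lvl_hdeg)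
  also have "\<dots> = (- ((-1) ^ hdeg C k) * x) * dif C v k" by (rule lin_on_scale[OF is_complex_lin[OF C k]])
  finally show "dif C (\<lambda>k. (-1) ^ hdeg C k * x * v k) k + (-1) ^ hdeg C k * x * dif (shift_cpx d C) v k \<in> N"
    by (simp add: is_ideal_zero[OF N])
qed

text \<open>The cone of multiplication by a non-zero-divisor on \<open>S/A\<close> resolves \<open>S/(A + xS)\<close>.\<close>

lemma nzd_cone_res:
  assumes N: "is_ideal N" and C: "cyc_res N A C e" and x: "\<And>r. x * r \<in> A \<Longrightarrow> r \<in> A"
    and K: "is_cone inl inr (\<lambda>v k. (-1) ^ hdeg C k * x * v k) C (shift_cpx d C) K"
  shows "cyc_res N {y. \<exists>r. y - x * r \<in> A} K (inl e)"
proof -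
  have "cyc_res N {y. \<exists>v. y - (-1) ^ hdeg C e * x * v e \<in> A} K (inl e)"
  proof (rule cone_cyc_res[OF N K C shift_cpx_complex[OF cyc_resD(1)[OF C]] nzd_attach[OF N cyc_resD(1)[OF C]]])
    fix n v assume v: "\<And>q. q \<in> lvl (shift_cpx d C) n \<Longrightarrow> dif (shift_cpx d C) v q \<in> N"
      and v0: "n = 0 \<Longrightarrow> (-1) ^ hdeg C e * x * v e \<in> A"
    show "\<exists>w. \<forall>q\<in>lvl (shift_cpx d C) (Suc n). v q - dif (shift_cpx d C) w q \<in> N"
    proof (cases n)
      case 0
      hence "v e \<in> A" using v0 x by (simp add: cyc_resD(6)[OF C])
      thus ?thesis using 0 by (simp add: cyc_resD(3)[OF C] cyc_resD(7)[OF C])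
    next
      case (Suc m)
      thus ?thesis using v exactD[OF cyc_resD(2)[OF C], of m v] by simp
    qed
  qed simp
  moreover have "(\<exists>v. y - (-1) ^ hdeg C e * x * v e \<in> A) \<longleftrightarrow> (\<exists>r. y - x * r \<in> A)" for y
    by (auto simp: cyc_resD(6)[OF C] intro: exI[of _ "\<lambda>_. _"])
  ultimately show ?thesis by simp
qed

lemma koszul_res:
  assumes N: "is_ideal N"
  shows "nzd_seq N xs \<Longrightarrow> length ds = length xs \<Longrightarrow> cyc_res N (gid N xs) (koszul xs ds) (replicate (length xs) False)"
proof (induction xs arbitrary: ds)
  case Nil
  show ?case using Nil by (auto simp: cyc_res_def is_complex_def lin_on_zero_fun exact_def is_ideal_zero[OF N])
next
  case (Cons x xs)
  then obtain d ds' where [simp]: "ds = d # ds'" by (cases ds) auto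
  have IH: "cyc_res N (gid N xs) (koszul xs ds') (replicate (length xs) False)" using Cons by simp
  show ?case
    using nzd_cone_res[OF N IH, of x "Cons False" "Cons True" d "koszul (x # xs) (d # ds')"] Cons.prems koszul_cone[of x xs ds' d]
    by simp
qed

lemma koszul_complex:
  assumes N: "is_ideal N"
  shows "length ds = length xs \<Longrightarrow> is_complex N (koszul xs ds)"
proof (induction xs arbitrary: ds)
  case Nil
  show ?case by (auto simp: is_complex_def lin_on_zero_fun is_ideal_zero[OF N])
next
  case (Cons x xs)
  then obtain d ds' where [simp]: "ds = d # ds'" by (cases ds) auto
  have IH: "is_complex N (koszul xs ds')" using Cons by simp
  have "attach N (koszul xs ds') (shift_cpx d (koszul xs ds')) (\<lambda>v k. (-1) ^ ntrue k * x * v k)"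
    using nzd_attach[OF N IH, of d x] by simp
  thus ?case using cone_complex[OF N koszul_cone IH shift_cpx_complex[OF IH]] by simp
qed

lemma koszul_minimal:
  assumes A: "is_ideal A"
  shows "set xs \<subseteq> A \<Longrightarrow> kdif xs v t \<in> A"
proof (induction xs v t rule: kdif.induct)
  case (3 x xs v t)
  hence "v (True # t) * ((-1) ^ ntrue t * x) \<in> A" by (intro is_ideal_mult[OF A]) auto
  thus ?case using 3 by (auto intro!: is_ideal_add[OF A] simp: mult_ac)
qed (auto simp: is_ideal_zero[OF A])

lemma koszul_graded:
  assumes N: "is_ideal N" and g: "gcat N Gs" "gmon Gs"
  shows "list_all2 (\<lambda>x d. x \<in> Gs d 0) xs ds \<Longrightarrow> graded_cpx Gs (koszul xs ds)"
proof (induction xs arbitrary: ds)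
  case Nil
  thus ?case by (auto simp: graded_cpx_def lvl_def)
next
  case (Cons x xs)
  then obtain d ds' where [simp]: "ds = d # ds'" and x: "x \<in> Gs d 0" and l: "list_all2 (\<lambda>x d. x \<in> Gs d 0) xs ds'"
    by (auto simp: list_all2_Cons1)
  note IH = Cons.IH[OF l]
  have len: "length ds' = length xs" using l by (simp add: list_all2_lengthD)
  note C = koszul_complex[OF N len]
  have "graded_cpx Gs (koszul (x # xs) (d # ds'))"
  proof (rule cone_graded[OF N g(1) koszul_cone C shift_cpx_complex[OF C] _ IH])
    show "attach N (koszul xs ds') (shift_cpx d (koszul xs ds')) (\<lambda>v t. (-1) ^ ntrue t * x * v t)"
      using nzd_attach[OF N C, of d x] by simp
    show "graded_cpx Gs (shift_cpx d (koszul xs ds'))"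
      using IH gmon_shift[OF g] by (auto simp: graded_cpx_def)
    fix k q assume k: "k \<in> basis (koszul xs ds')" and q: "q \<in> lvl (shift_cpx d (koszul xs ds')) (Suc (hdeg (koszul xs ds') k))"
    have "x * unitv q k \<in> Gs (d + kideg ds' q) (kideg ds' k)"
      using gmon_shift(1)[OF g x, of "kideg ds' k"] by (auto simp: unitv_def gcat_N[OF g(1) is_ideal_zero[OF N]])
    thus "(-1) ^ ntrue k * x * unitv q k \<in> Gs (ideg (shift_cpx d (koszul xs ds')) q) (ideg (koszul xs ds') k)"
      using gcat_sign[OF g(1)] by (simp add: mult.assoc)
  qed
  thus ?case by simp
qed

lemma koszul_rank: "length ds = length xs \<Longrightarrow> card (lvl (koszul xs ds) n) = length xs choose n"
proof (induction xs arbitrary: ds n)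
  case Nil
  show ?case by (cases n) auto
next
  case (Cons x xs)
  then obtain d ds' where [simp]: "ds = d # ds'" by (cases ds) auto
  have len: "length ds' = length xs" using Cons by simp
  have fin: "finite (lvl (koszul xs ds') n)" for n
    using is_complex_finite[OF koszul_complex[of UNIV ds' xs]] len by (simp add: is_ideal_def)
  have "lvl (koszul (x # xs) (d # ds')) n = Cons False ` lvl (koszul xs ds') n \<union> Cons True ` lvl (shift_cpx d (koszul xs ds')) n"
    by (rule cone_lvl[OF koszul_cone])
  moreover have "card \<dots> = card (lvl (koszul xs ds') n) + card (lvl (shift_cpx d (koszul xs ds')) n)"
    using fin by (subst card_Un_disjoint) (cases n; auto simp: card_image)+
  ultimately show ?case using Cons.IH[OF len] by (cases n) auto
qed

text \<open>The contraction with the \<open>s\<close>-th vector of the dual basis, in the coordinates of \<open>kdif\<close>. It lowers the degree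
  by one.\<close>

fun iota :: "nat \<Rightarrow> (bool list \<Rightarrow> 's::comm_ring_1) \<Rightarrow> bool list \<Rightarrow> 's" where
  "iota s v [] = 0"
| "iota 0 v (b # t) = (if b then 0 else (-1) ^ ntrue t * v (True # t))"
| "iota (Suc s) v (b # t) = iota s (\<lambda>u. v (b # u)) t"

lemma iota_lin: "iota s (\<lambda>u. c * v u + w u) t = c * iota s v t + iota s w t"
  by (induction s v t arbitrary: w rule: iota.induct) (auto simp: algebra_simps)

text \<open>Multiplication by \<open>(-1)\<^bsup>deg\<^esup>\<close> anticommutes with every operator of degree \<open>-1\<close>.\<close>

lemma iota_sign: "iota s (\<lambda>u. (-1) ^ ntrue u * c * v u) t = - ((-1) ^ ntrue t * c * iota s v t)"
proof (induction s v t arbitrary: c rule: iota.induct)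
  case (3 s v b t)
  show ?case
  proof (cases b)
    case True
    thus ?thesis using 3[of "- c"] by simp
  next
    case False
    thus ?thesis using 3[of c] by simp
  qed
qed (auto simp: mult_ac)

lemma kdif_zero: "kdif xs (\<lambda>u. 0) t = 0"
  by (induction xs "\<lambda>u::bool list. 0::'a" t rule: kdif.induct) auto

lemma kdif_sign: "kdif xs (\<lambda>u. (-1) ^ ntrue u * c * v u) t = - ((-1) ^ ntrue t * c * kdif xs v t)"
proof (induction xs v t arbitrary: c rule: kdif.induct)
  case (3 x xs v t)
  thus ?case using 3[of c] by (simp add: algebra_simps)
next
  case (4 x xs v t)
  show ?case using 4[of "- c"] by simp
qed auto

text \<open>Contractions with linear forms on a free module anticommute, and the Koszul differential is itself such a
  contraction, with the linear form given by \<open>xs\<close>.\<close>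

lemma iota_anticommute: "length t = length xs \<Longrightarrow> kdif xs (iota s v) t = - iota s (kdif xs v) t"
proof (induction xs arbitrary: s v t)
  case Nil thus ?case by simp
next
  case (Cons x xs)
  then obtain b t' where [simp]: "t = b # t'" and len: "length t' = length xs" by (cases t) auto
  show ?case
  proof (cases s)
    case 0
    show ?thesis
    proof (cases b)
      case True thus ?thesis by (simp add: 0 kdif_zero)
    next
      case False
      thus ?thesis using kdif_sign[of xs 1 "\<lambda>u. v (True # u)" t'] by (simp add: 0)
    qed
  next
    case (Suc s')
    show ?thesis
    proof (cases b)
      case True thus ?thesis using Cons.IH[OF len, of s' "\<lambda>u. v (True # u)"] by (simp add: Suc)
    next
      case False
      have "iota s' (\<lambda>u. kdif xs (\<lambda>u. v (False # u)) u + (-1) ^ ntrue u * x * v (True # u)) t' =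
         iota s' (kdif xs (\<lambda>u. v (False # u))) t' - (-1) ^ ntrue t' * x * iota s' (\<lambda>u. v (True # u)) t'"
        using iota_lin[of s' 1 "kdif xs (\<lambda>u. v (False # u))" "\<lambda>u. (-1) ^ ntrue u * x * v (True # u)" t']
          iota_sign[of s' x "\<lambda>u. v (True # u)" t'] by simp
      thus ?thesis using Cons.IH[OF len, of s' "\<lambda>u. v (False # u)"] False by (simp add: Suc)
    qed
  qed
qed

text \<open>In coordinates a contraction is zero or picks one entry up to a sign, so it commutes with all operations that act
  on each coordinate separately.\<close>

lemma iota_coord:
  "(\<forall>v::bool list \<Rightarrow> 's::comm_ring_1. iota s v t = 0) \<or>
   (\<exists>c u. length u = length t \<and> ntrue u = Suc (ntrue t) \<and> (\<forall>v::bool list \<Rightarrow> 's. iota s v t = c * v u))"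
proof (induction t arbitrary: s)
  case Nil thus ?case by simp
next
  case (Cons b t)
  show ?case
  proof (cases s)
    case 0
    thus ?thesis by (cases b) (auto intro!: exI[of _ "True # t"])
  next
    case (Suc s')
    from Cons[of s'] show ?thesis
    proof
      assume "\<exists>c u. length u = length t \<and> ntrue u = Suc (ntrue t) \<and> (\<forall>v::bool list \<Rightarrow> 's. iota s' v t = c * v u)"
      then obtain c u where "length u = length t" "ntrue u = Suc (ntrue t)" "\<And>v::bool list \<Rightarrow> 's. iota s' v t = c * v u" by blast
      thus ?thesis by (intro disjI2 exI[of _ c] exI[of _ "b # u"]) (cases b; simp add: Suc)
    qed (simp add: Suc)
  qed
qed

text \<open>A basis element of positive degree involves some generator, and the contraction with the dual of that generator
  recovers its coordinate.\<close>

lemma iota_detect: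
  "1 \<le> ntrue u \<Longrightarrow> \<exists>s t. length t = length u \<and> Suc (ntrue t) = ntrue u \<and>
     (\<forall>v::bool list \<Rightarrow> 's::comm_ring_1. \<exists>c. v u = c * iota s v t)"
proof (induction u)
  case Nil thus ?case by simp
next
  case (Cons b u)
  show ?case
  proof (cases b)
    case True
    have "v (True # u) = (-1) ^ ntrue u * iota 0 v (False # u)" for v :: "bool list \<Rightarrow> 's" by simp
    thus ?thesis using True by (intro exI[of _ 0] exI[of _ "False # u"]) (auto simp del: iota.simps)
  next
    case False
    then obtain s t where "length t = length u" "Suc (ntrue t) = ntrue u" "\<And>v::bool list \<Rightarrow> 's. \<exists>c. v u = c * iota s v t"
      using Cons by auto
    thus ?thesis using False by (intro exI[of _ "Suc s"] exI[of _ "False # t"]) auto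
  qed
qed

text \<open>The elements of \<open>I\<close> that are first boundaries of chains with coefficients in \<open>I\<close>: an explicit form of \<open>I\<^sup>2\<close>.\<close>

definition sq_ideal :: "'s::comm_ring_1 set \<Rightarrow> 's list \<Rightarrow> 's set" where
  "sq_ideal N xs = {z. \<exists>c. (\<forall>u. c u \<in> gid N xs) \<and> z - kdif xs c (replicate (length xs) False) \<in> N}"

lemma sq_ideal_products:
  assumes N: "is_ideal N" and xs: "nzd_seq N xs"
  shows "is_ideal (sq_ideal N xs)" "N \<subseteq> sq_ideal N xs"
    "\<And>a b. a \<in> gid N xs \<Longrightarrow> b \<in> gid N xs \<Longrightarrow> a * b \<in> sq_ideal N xs"
proof -
  let ?e = "replicate (length xs) False" and ?I = "gid N xs"
  define ds where "ds = replicate (length xs) (0::nat)"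
  have res: "cyc_res N ?I (koszul xs ds) ?e" by (rule koszul_res[OF N xs]) (simp add: ds_def)
  have lin: "lin_on (lvl (koszul xs ds) 1) (\<lambda>v. kdif xs v ?e)" using cyc_res_lin[OF res] by simp
  note I = cyc_res_ideal[OF N res]
  show NN: "N \<subseteq> sq_ideal N xs" unfolding sq_ideal_def
    by (auto intro!: exI[of _ "\<lambda>_. 0"] simp: kdif_zero is_ideal_zero[OF I(1)])
  show "is_ideal (sq_ideal N xs)" unfolding is_ideal_def
  proof (intro conjI ballI allI)
    show "0 \<in> sq_ideal N xs" using NN is_ideal_zero[OF N] by blast
  next
    fix x y assume "x \<in> sq_ideal N xs" "y \<in> sq_ideal N xs"
    then obtain c d where cd: "\<forall>u. c u \<in> ?I" "x - kdif xs c ?e \<in> N" "\<forall>u. d u \<in> ?I" "y - kdif xs d ?e \<in> N"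
      by (auto simp: sq_ideal_def)
    have "x + y - kdif xs (\<lambda>u. c u + d u) ?e \<in> N"
      using is_ideal_add[OF N cd(2,4)] by (simp add: lin_on_add[OF lin] algebra_simps)
    thus "x + y \<in> sq_ideal N xs" unfolding sq_ideal_def using cd
      by (auto intro!: exI[of _ "\<lambda>u. c u + d u"] is_ideal_add[OF I(1)])
  next
    fix r x assume "x \<in> sq_ideal N xs"
    then obtain c where c: "\<forall>u. c u \<in> ?I" "x - kdif xs c ?e \<in> N" by (auto simp: sq_ideal_def)
    have "r * x - kdif xs (\<lambda>u. r * c u) ?e = r * (x - kdif xs c ?e)"
      by (simp add: lin_on_scale[OF lin] right_diff_distrib)
    thus "r * x \<in> sq_ideal N xs" unfolding sq_ideal_def using c is_ideal_mult[OF N c(2)]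
      by (auto intro!: exI[of _ "\<lambda>u. r * c u"] is_ideal_mult[OF I(1)])
  qed
  fix a b assume a: "a \<in> ?I" and b: "b \<in> ?I"
  obtain w where w: "b - kdif xs w ?e \<in> N" using b cyc_resD(7)[OF res] by auto
  have "a * b - kdif xs (\<lambda>u. a * w u) ?e = a * (b - kdif xs w ?e)"
    by (simp add: lin_on_scale[OF lin] right_diff_distrib)
  thus "a * b \<in> sq_ideal N xs" unfolding sq_ideal_def using is_ideal_mult[OF N w] a
    by (auto intro!: exI[of _ "\<lambda>u. a * w u"] is_ideal_mult_right[OF I(1)])
qed

lemma gid_ideal:
  assumes N: "is_ideal N" shows "is_ideal (gid N xs) \<and> N \<subseteq> gid N xs \<and> set xs \<subseteq> gid N xs"
proof (induction xs)
  case Nil show ?case using N by simp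
next
  case (Cons x xs)
  hence A: "is_ideal (gid N xs)" by simp
  have sub: "gid N xs \<subseteq> gid N (x # xs)" by (auto intro: exI[of _ 0])
  have "x \<in> gid N (x # xs)" using is_ideal_zero[OF A] by (auto intro: exI[of _ 1])
  moreover have "is_ideal (gid N (x # xs))" unfolding is_ideal_def
  proof (intro conjI ballI allI)
    show "0 \<in> gid N (x # xs)" using sub is_ideal_zero[OF A] by blast
  next
    fix y z assume "y \<in> gid N (x # xs)" "z \<in> gid N (x # xs)"
    then obtain r s where "y - x * r \<in> gid N xs" "z - x * s \<in> gid N xs" by auto
    from is_ideal_add[OF A this] show "y + z \<in> gid N (x # xs)"
      by (auto intro!: exI[of _ "r + s"] simp: algebra_simps)
  next
    fix c y assume "y \<in> gid N (x # xs)"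
    then obtain r where "y - x * r \<in> gid N xs" by auto
    from is_ideal_mult[OF A this, of c] show "c * y \<in> gid N (x # xs)"
      by (auto intro!: exI[of _ "c * r"] simp: algebra_simps)
  qed
  ultimately show ?case using Cons sub by auto
qed

lemma gid_least: "is_ideal A \<Longrightarrow> N \<subseteq> A \<Longrightarrow> set xs \<subseteq> A \<Longrightarrow> gid N xs \<subseteq> A"
proof (induction xs)
  case (Cons x xs)
  have "y \<in> A" if "y - x * r \<in> gid N xs" for y r
  proof (rule ideal_cong_mem[OF Cons.prems(1)])
    show "y - x * r \<in> A" using Cons that by auto
    show "x * r \<in> A" using Cons.prems by (intro is_ideal_mult_right) auto
  qed
  thus ?case by auto
qed simp

text \<open>First, \<open>\<phi>\<close> maps \<open>S\<^sub>1\<close> into \<open>I C\<^sub>1\<close>: its value on a generator and the chain with coefficients in \<open>I\<close>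
  supplied by \<open>I' \<subseteq> I\<^sup>2\<close> have the same boundary, so they differ by a boundary, and boundaries have
  coefficients in \<open>I\<close>. So each contraction of \<open>\<phi>\<close> is a map on \<open>S\<^sub>\<ge>\<^sub>1\<close> which takes \<open>S\<^sub>1\<close> to
  \<open>I\<close>, that is, to first boundaries, and commutes with the differentials up to sign. By
  \<open>lift_along_exact\<close> it has the form \<open>d H - H d\<close>, with coefficients in \<open>\<mm>\<close>. Finally
  some contraction detects any given coordinate of positive degree.\<close>

lemma koszul_comparison_minimal:
  fixes S :: "('i, 's::comm_ring_1) based"
  assumes N: "is_ideal N" and xs: "nzd_seq N xs" "length ds = length xs"
    and m: "is_ideal \<mm>" "gid N xs \<subseteq> \<mm>"
    and S: "cyc_res N I' S eS" "minimal_cpx \<mm> S" and sub: "I' \<subseteq> sq_ideal N xs"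
    and f: "chain_map N S (koszul xs ds) \<phi>" "\<phi> eS (replicate (length xs) False) = 1"
    and s: "s \<in> basis S" "1 \<le> hdeg S s" and x: "x \<in> lvl (koszul xs ds) (hdeg S s)"
  shows "\<phi> s x \<in> \<mm>"
proof -
  let ?C = "koszul xs ds" and ?e = "replicate (length xs) False" and ?I = "gid N xs"
  have res: "cyc_res N ?I ?C ?e" by (rule koszul_res[OF N xs])
  note I = cyc_res_ideal[OF N res] and Cc = cyc_resD(1)[OF res] and Sc = cyc_resD(1)[OF S(1)]
  have dI: "kdif xs v t \<in> ?I" for v t
    using gid_ideal[OF N, of xs] by (intro koszul_minimal) auto
  have lin: "lin_on (lvl ?C 1) (\<lambda>v. kdif xs v ?e)" using cyc_res_lin[OF res] by simp
  \<comment> \<open>\<open>\<phi>\<close> maps the first syzygies into \<open>I\<close> times the complex.\<close>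
  have first: "\<phi> l k \<in> ?I" if l: "l \<in> lvl S 1" and k: "k \<in> lvl ?C 1" for l k
  proof -
    have "ent S eS l \<in> I'" using cyc_res_dif[OF N S(1)] by (simp add: ent_def)
    then obtain c where c: "\<forall>u. c u \<in> ?I" "ent S eS l - kdif xs c ?e \<in> N" using sub by (auto simp: sq_ideal_def)
    have "kdif xs (\<phi> l) ?e - ent S eS l \<in> N"
      using chain_mapD[OF f(1), of l 0 ?e] l by (simp add: cyc_resD(3)[OF S(1)] cyc_resD(3)[OF res] f(2))
    from is_ideal_add[OF N this c(2)] have "dif ?C (\<lambda>u. \<phi> l u - c u) ?e \<in> N" by (simp add: lin_on_diff[OF lin])
    then obtain w where w: "\<forall>k\<in>lvl ?C (Suc 0). \<phi> l k - c k - dif ?C w k \<in> N"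
      using exactD[OF cyc_resD(2)[OF res], of 0 "\<lambda>u. \<phi> l u - c u"] by (auto simp: cyc_resD(3)[OF res])
    have "\<phi> l k - c k - kdif xs w k \<in> ?I" using w k I(2) by auto
    from is_ideal_add[OF I(1) is_ideal_add[OF I(1) this dI[of w k]] c(1)[rule_format, of k]]
    show ?thesis by simp
  qed
  \<comment> \<open>Contractions of \<open>\<phi>\<close> are null homotopic, hence zero modulo \<open>\<mm>\<close>.\<close>
  have iotam: "iota i (\<phi> l) k \<in> \<mm>" if l: "l \<in> basis S" "1 \<le> hdeg S l" and k: "k \<in> lvl ?C (hdeg S l - 1)" for i l k
  proof -
    define e where "e l k = iota i (\<phi> l) k" for l k
    have "\<exists>H. \<forall>l\<in>basis S. 1 \<le> hdeg S l \<longrightarrow>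
      (\<forall>k\<in>lvl ?C (Suc (hdeg S l - 1)). H l k \<in> UNIV) \<and>
      (\<forall>k\<in>lvl ?C (hdeg S l - 1).
        e l k - (-1) * (\<Sum>j\<in>{j\<in>basis S. 1 \<le> hdeg S j \<and> Suc (hdeg S j) = hdeg S l}. ent S j l * H j k) - dif ?C (H l) k \<in> N)"
    proof (rule lift_along_exact[OF N gcat_UNIV Sc _ Cc])
      show "graded_cpx (\<lambda>_ _. UNIV) S" by (simp add: graded_cpx_def)
      show "gexact N (\<lambda>_ _. UNIV) ?C" using cyc_resD(2)[OF res] by (simp add: gexact_UNIV)
      show "- 1 = 1 \<or> - 1 = (-1 :: 's)" by simp
    next
      fix l assume l: "l \<in> lvl S 1"
      have "e l ?e \<in> ?I"
        using iota_coord[of i ?e, where ?'s = 's]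
      proof
        assume "\<exists>c u. length u = length ?e \<and> ntrue u = Suc (ntrue ?e) \<and> (\<forall>v::bool list \<Rightarrow> 's. iota i v ?e = c * v u)"
        then obtain c u where u: "length u = length xs" "ntrue u = Suc (ntrue ?e)" "iota i (\<phi> l) ?e = c * \<phi> l u" by auto
        have "u \<in> lvl ?C 1" using u cyc_resD(6)[OF res] by (simp add: lvl_def)
        thus ?thesis using u(3) first[OF l] is_ideal_mult[OF I(1)] by (simp add: e_def)
      qed (simp add: e_def is_ideal_zero[OF I(1)])
      thus "\<exists>c. (\<forall>k\<in>lvl ?C 1. c k \<in> UNIV) \<and> (\<forall>k\<in>lvl ?C 0. e l k - dif ?C c k \<in> N)"
        using cyc_resD(7)[OF res] by (simp add: cyc_resD(3)[OF res])
    next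
      fix l k assume l: "l \<in> basis S" and k: "k \<in> basis ?C" and h: "hdeg S l = Suc (1 + hdeg ?C k)"
      have a: "dif ?C (e l) k = - iota i (kdif xs (\<phi> l)) k"
        using iota_anticommute[of k xs i "\<phi> l"] k by (simp add: e_def[abs_def])
      have "iota i (kdif xs (\<phi> l)) k - (\<Sum>j\<in>lvl S (1 + hdeg ?C k). ent S j l * e j k) \<in> N"
        using iota_coord[of i k, where ?'s = 's]
      proof
        assume "\<exists>c u. length u = length k \<and> ntrue u = Suc (ntrue k) \<and> (\<forall>v::bool list \<Rightarrow> 's. iota i v k = c * v u)"
        then obtain c u where u': "length u = length k" "ntrue u = Suc (ntrue k)" "\<forall>v::bool list \<Rightarrow> 's. iota i v k = c * v u"
          by (elim exE conjE)
        hence u: "length u = length xs" "ntrue u = Suc (ntrue k)" "\<And>v::bool list \<Rightarrow> 's. iota i v k = c * v u"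
          using k by auto
        have ul: "u \<in> lvl ?C (Suc (ntrue k))" using u by (simp add: lvl_def)
        have ll: "l \<in> lvl S (Suc (Suc (ntrue k)))" using l h by (simp add: lvl_def)
        have "kdif xs (\<phi> l) u - (\<Sum>j\<in>lvl S (Suc (ntrue k)). ent S j l * \<phi> j u) \<in> N"
          using chain_mapD[OF f(1) ll ul] by simp
        from is_ideal_mult[OF N this, of c] show ?thesis
          by (simp add: e_def u(3) right_diff_distrib sum_distrib_left mult_ac)
      qed (simp add: e_def is_ideal_zero[OF N])
      from is_ideal_minus[OF N this]
      show "dif ?C (e l) k - - 1 * (\<Sum>j\<in>lvl S (1 + hdeg ?C k). ent S j l * e j k) \<in> N" unfolding a by simp
    qed simp
    then obtain H where H: "\<forall>l\<in>basis S. 1 \<le> hdeg S l \<longrightarrow>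
      (\<forall>k\<in>lvl ?C (Suc (hdeg S l - 1)). H l k \<in> UNIV) \<and>
      (\<forall>k\<in>lvl ?C (hdeg S l - 1).
        e l k - (-1) * (\<Sum>j\<in>{j\<in>basis S. 1 \<le> hdeg S j \<and> Suc (hdeg S j) = hdeg S l}. ent S j l * H j k) - dif ?C (H l) k \<in> N)"
      by (rule exE)
    let ?s = "\<Sum>j\<in>{j\<in>basis S. 1 \<le> hdeg S j \<and> Suc (hdeg S j) = hdeg S l}. ent S j l * H j k"
    have 1: "e l k + ?s - dif ?C (H l) k \<in> \<mm>" using H[rule_format, OF l] k I(2) m(2) by auto
    have 2: "?s \<in> \<mm>"
      by (rule is_ideal_sum[OF m(1)], rule is_ideal_mult_right[OF m(1)]) (use S(2) in \<open>auto simp: ent_def minimal_cpx_def\<close>)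
    have 3: "dif ?C (H l) k \<in> \<mm>" using dI m(2) by auto
    from is_ideal_diff[OF m(1) is_ideal_add[OF m(1) 1 3] 2] show ?thesis by (simp add: e_def)
  qed
  have xx: "length x = length xs" "ntrue x = hdeg S s" using x by (auto simp: lvl_def)
  obtain i t where t: "length t = length x" "Suc (ntrue t) = ntrue x" "\<And>v::bool list \<Rightarrow> 's. \<exists>c. v x = c * iota i v t"
    using iota_detect[of x, where ?'s = 's] xx s by auto
  obtain c where c: "\<phi> s x = c * iota i (\<phi> s) t" using t(3) by blast
  have "t \<in> lvl ?C (hdeg S s - 1)" using t xx by (auto simp: lvl_def)
  from iotam[OF s this] show ?thesis unfolding c by (rule is_ideal_mult[OF m(1)])
qed

section \<open>Existence of minimal graded resolutions\<close>

text \<open>The ungraded version of \<open>gres\<close>.\<close>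

definition res_with :: "'s::comm_ring_1 set \<Rightarrow> 's set \<Rightarrow> ('i, 's) based \<Rightarrow> ('i \<Rightarrow> 's) \<Rightarrow> bool" where
  "res_with N A C a \<longleftrightarrow> is_complex N C \<and> exact N C \<and>
     (\<exists>u. (\<Sum>k\<in>lvl C 0. u k * a k) - 1 \<in> A) \<and>
     (\<forall>w. (\<Sum>k\<in>lvl C 0. dif C w k * a k) \<in> A) \<and>
     (\<forall>v. (\<Sum>k\<in>lvl C 0. v k * a k) \<in> A \<longrightarrow> (\<exists>w. \<forall>k\<in>lvl C 0. v k - dif C w k \<in> N))"

lemma res_with_UNIV: "res_with N A C a \<Longrightarrow> gres N (\<lambda>_ _. UNIV) A C a"
  by (simp add: res_with_def gres_def graded_cpx_def gexact_UNIV)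

lemma cyc_res_with:
  assumes N: "is_ideal N" and C: "cyc_res N A C e" shows "res_with N A C (\<lambda>_. 1)"
  unfolding res_with_def
proof (intro conjI allI impI)
  note A = cyc_res_ideal[OF N C]
  show "\<exists>u. (\<Sum>k\<in>lvl C 0. u k * 1) - 1 \<in> A"
    by (rule exI[of _ "\<lambda>_. 1"]) (simp add: cyc_resD(3)[OF C] is_ideal_zero[OF A(1)])
  show "(\<Sum>k\<in>lvl C 0. dif C w k * 1) \<in> A" for w by (simp add: cyc_resD(3)[OF C] cyc_res_dif[OF N C])
  fix v assume "(\<Sum>k\<in>lvl C 0. v k * 1) \<in> A"
  thus "\<exists>w. \<forall>k\<in>lvl C 0. v k - dif C w k \<in> N" by (simp add: cyc_resD(3)[OF C] cyc_resD(7)[OF C])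
qed (use cyc_resD[OF C] in auto)

text \<open>Submodules of the free module on \<open>K\<close> over the quotient by \<open>N\<close>, as sets of functions that are saturated
  with respect to congruence modulo \<open>N\<close> on \<open>K\<close>.\<close>

definition submod :: "'s::comm_ring_1 set \<Rightarrow> 'i set \<Rightarrow> ('i \<Rightarrow> 's) set \<Rightarrow> bool" where
  "submod N K M \<longleftrightarrow> (\<forall>v. (\<forall>k\<in>K. v k \<in> N) \<longrightarrow> v \<in> M) \<and>
     (\<forall>v\<in>M. \<forall>w\<in>M. (\<lambda>k. v k + w k) \<in> M) \<and> (\<forall>r. \<forall>v\<in>M. (\<lambda>k. r * v k) \<in> M)"

lemma submodD:
  assumes "submod N K M"
  shows "(\<And>k. k \<in> K \<Longrightarrow> v k \<in> N) \<Longrightarrow> v \<in> M" "v \<in> M \<Longrightarrow> w \<in> M \<Longrightarrow> (\<lambda>k. v k + w k) \<in> M"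
    "v \<in> M \<Longrightarrow> (\<lambda>k. r * v k) \<in> M"
  using assms by (auto simp: submod_def)

lemma submod_diff: assumes "submod N K M" "v \<in> M" "w \<in> M" shows "(\<lambda>k. v k - w k) \<in> M"
  using submodD(2)[OF assms(1,2) submodD(3)[OF assms(1,3), of "-1"]] by simp

lemma submod_cong:
  assumes "submod N K M" "w \<in> M" "\<And>k. k \<in> K \<Longrightarrow> v k - w k \<in> N" shows "v \<in> M"
  using submodD(2)[OF assms(1,2) submodD(1)[OF assms(1), of "\<lambda>k. v k - w k"]] assms(3) by simp

lemma submod_sum:
  assumes "is_ideal N" "submod N K M" "\<And>i. i \<in> I \<Longrightarrow> f i \<in> M" shows "(\<lambda>k. \<Sum>i\<in>I. f i k) \<in> M"
  using assms(3)
proof (induction I rule: infinite_finite_induct)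
  case (insert x F)
  thus ?case using submodD(2)[OF assms(2), of "f x" "\<lambda>k. \<Sum>i\<in>F. f i k"] by simp
qed (auto intro!: submodD(1)[OF assms(2)] is_ideal_zero[OF assms(1)])

text \<open>The quotient by \<open>N\<close> is noetherian. Being generated by \<open>F\<close> is expressed by the ideals that contain \<open>F\<close>, which
  avoids linear combinations; \<open>submod_fg\<close> does the same for submodules.\<close>

definition noeth :: "'s::comm_ring_1 set \<Rightarrow> bool" where
  "noeth N \<longleftrightarrow> (\<forall>A. is_ideal A \<longrightarrow> N \<subseteq> A \<longrightarrow>
     (\<exists>F. finite F \<and> F \<subseteq> A \<and> (\<forall>B. is_ideal B \<longrightarrow> N \<subseteq> B \<longrightarrow> F \<subseteq> B \<longrightarrow> A \<subseteq> B)))"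

lemma submod_coordinate_ideal:
  assumes N: "is_ideal N" and M: "submod N K M"
  shows "is_ideal {x. \<exists>v\<in>M. x - v k \<in> N}" "N \<subseteq> {x. \<exists>v\<in>M. x - v k \<in> N}"
proof -
  have z: "(\<lambda>_. 0) \<in> M" by (rule submodD(1)[OF M]) (rule is_ideal_zero[OF N])
  thus *: "N \<subseteq> {x. \<exists>v\<in>M. x - v k \<in> N}" by (auto intro!: bexI[of _ "\<lambda>_. 0"])
  show "is_ideal {x. \<exists>v\<in>M. x - v k \<in> N}" unfolding is_ideal_def
  proof (intro conjI ballI allI)
    show "0 \<in> {x. \<exists>v\<in>M. x - v k \<in> N}" using * is_ideal_zero[OF N] by blast
  next
    fix x y assume "x \<in> {x. \<exists>v\<in>M. x - v k \<in> N}" "y \<in> {x. \<exists>v\<in>M. x - v k \<in> N}"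
    then obtain v w where vw: "v \<in> M" "x - v k \<in> N" "w \<in> M" "y - w k \<in> N" by blast
    have "x + y - (v k + w k) \<in> N" using is_ideal_add[OF N vw(2,4)] by (simp add: algebra_simps)
    thus "x + y \<in> {x. \<exists>v\<in>M. x - v k \<in> N}" using submodD(2)[OF M vw(1,3)] by (intro CollectI bexI[of _ "\<lambda>k. v k + w k"])
  next
    fix r x assume "x \<in> {x. \<exists>v\<in>M. x - v k \<in> N}"
    then obtain v where v: "v \<in> M" "x - v k \<in> N" by blast
    have "r * x - r * v k \<in> N" using is_ideal_mult[OF N v(2), of r] by (simp add: algebra_simps)
    thus "r * x \<in> {x. \<exists>v\<in>M. x - v k \<in> N}" using submodD(3)[OF M v(1)] by (intro CollectI bexI[of _ "\<lambda>k. r * v k"])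
  qed
qed

lemma submod_restrict:
  assumes N: "is_ideal N" and M: "submod N (insert k0 K) M"
  shows "submod N K {v. \<exists>u\<in>M. u k0 \<in> N \<and> (\<forall>k\<in>K. v k - u k \<in> N)}"
  unfolding submod_def
proof (intro conjI ballI allI impI)
  fix v assume "\<forall>k\<in>K. v k \<in> N"
  thus "v \<in> {v. \<exists>u\<in>M. u k0 \<in> N \<and> (\<forall>k\<in>K. v k - u k \<in> N)}"
    using is_ideal_zero[OF N] by (auto intro!: bexI[of _ "\<lambda>_. 0"] submodD(1)[OF M])
next
  fix v w assume "v \<in> {v. \<exists>u\<in>M. u k0 \<in> N \<and> (\<forall>k\<in>K. v k - u k \<in> N)}" "w \<in> {v. \<exists>u\<in>M. u k0 \<in> N \<and> (\<forall>k\<in>K. v k - u k \<in> N)}"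
  then obtain a b where ab: "a \<in> M" "a k0 \<in> N" "\<forall>k\<in>K. v k - a k \<in> N" "b \<in> M" "b k0 \<in> N" "\<forall>k\<in>K. w k - b k \<in> N" by blast
  have "v k + w k - (a k + b k) \<in> N" if "k \<in> K" for k
    using is_ideal_add[OF N ab(3)[rule_format, OF that] ab(6)[rule_format, OF that]] by (simp add: algebra_simps)
  thus "(\<lambda>k. v k + w k) \<in> {v. \<exists>u\<in>M. u k0 \<in> N \<and> (\<forall>k\<in>K. v k - u k \<in> N)}"
    using submodD(2)[OF M ab(1,4)] is_ideal_add[OF N ab(2,5)] by (intro CollectI bexI[of _ "\<lambda>k. a k + b k"]) auto
next
  fix r v assume "v \<in> {v. \<exists>u\<in>M. u k0 \<in> N \<and> (\<forall>k\<in>K. v k - u k \<in> N)}"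
  then obtain a where a: "a \<in> M" "a k0 \<in> N" "\<forall>k\<in>K. v k - a k \<in> N" by blast
  have "r * v k - r * a k \<in> N" if "k \<in> K" for k
    using is_ideal_mult[OF N a(3)[rule_format, OF that], of r] by (simp add: algebra_simps)
  thus "(\<lambda>k. r * v k) \<in> {v. \<exists>u\<in>M. u k0 \<in> N \<and> (\<forall>k\<in>K. v k - u k \<in> N)}"
    using submodD(3)[OF M a(1)] is_ideal_mult[OF N a(2)] by (intro CollectI bexI[of _ "\<lambda>k. r * a k"]) auto
qed

text \<open>Submodules of finite free modules over a noetherian ring are finitely generated, by induction on the rank:
  generators of the ideal of \<open>k0\<close>-th coordinates, together with generators of the submodule where that coordinate vanishes.\<close>

lemma submod_fg:
  fixes M :: "('i \<Rightarrow> 's::comm_ring_1) set"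
  assumes N: "is_ideal N" and no: "noeth N" and K: "finite K" and M: "submod N K M"
  shows "\<exists>G. finite G \<and> G \<subseteq> M \<and> (\<forall>M'. submod N K M' \<longrightarrow> G \<subseteq> M' \<longrightarrow> M \<subseteq> M')"
  using K M
proof (induction K arbitrary: M rule: finite_induct)
  case empty
  thus ?case by (intro exI[of _ "{}"]) (auto simp: submod_def)
next
  case (insert k0 K)
  note M = insert.prems
  define A where "A = {x. \<exists>v\<in>M. x - v k0 \<in> N}"
  have "is_ideal A" "N \<subseteq> A" unfolding A_def by (rule submod_coordinate_ideal[OF N M])+
  then obtain F where F: "finite F" "F \<subseteq> A" "\<And>B. is_ideal B \<Longrightarrow> N \<subseteq> B \<Longrightarrow> F \<subseteq> B \<Longrightarrow> A \<subseteq> B"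
    using no unfolding noeth_def by metis
  have "\<forall>y\<in>F. \<exists>g. g \<in> M \<and> y - g k0 \<in> N" using F(2) by (auto simp: A_def)
  then obtain g where g: "\<And>y. y \<in> F \<Longrightarrow> g y \<in> M" "\<And>y. y \<in> F \<Longrightarrow> y - g y k0 \<in> N" by metis
  define M1 where "M1 = {v. \<exists>u\<in>M. u k0 \<in> N \<and> (\<forall>k\<in>K. v k - u k \<in> N)}"
  have "submod N K M1" unfolding M1_def by (rule submod_restrict[OF N M])
  from insert.IH[OF this] obtain H where H: "finite H" "H \<subseteq> M1" "\<And>M'. submod N K M' \<Longrightarrow> H \<subseteq> M' \<Longrightarrow> M1 \<subseteq> M'" by blast
  have "\<forall>x\<in>H. \<exists>u. u \<in> M \<and> u k0 \<in> N \<and> (\<forall>k\<in>K. x k - u k \<in> N)" using H(2) by (auto simp: M1_def)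
  then obtain u where u: "\<And>x. x \<in> H \<Longrightarrow> u x \<in> M" "\<And>x. x \<in> H \<Longrightarrow> u x k0 \<in> N" "\<And>x k. x \<in> H \<Longrightarrow> k \<in> K \<Longrightarrow> x k - u x k \<in> N" by metis
  show ?case
  proof (intro exI[of _ "g ` F \<union> u ` H"] conjI allI impI subsetI)
    show "finite (g ` F \<union> u ` H)" using F H by simp
    show "x \<in> M" if "x \<in> g ` F \<union> u ` H" for x using that g u by auto
    fix M' v assume M': "submod N (insert k0 K) M'" "g ` F \<union> u ` H \<subseteq> M'" and v: "v \<in> M"
    have MM': "submod N (insert k0 K) (M \<inter> M')" using M M'(1) unfolding submod_def by blast
    have "A \<subseteq> {x. \<exists>v\<in>M \<inter> M'. x - v k0 \<in> N}"
      using g M'(2) by (intro F(3) submod_coordinate_ideal[OF N MM']) blast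
    moreover have "v k0 \<in> A" using v is_ideal_zero[OF N] by (auto simp: A_def intro!: bexI[of _ v])
    ultimately obtain w where w: "w \<in> M" "w \<in> M'" "v k0 - w k0 \<in> N" by blast
    have vw: "(\<lambda>k. v k - w k) \<in> M1" unfolding M1_def
      using submod_diff[OF M v w(1)] w(3) is_ideal_zero[OF N] by (auto intro!: bexI[of _ "\<lambda>k. v k - w k"])
    have "M1 \<subseteq> {v. \<exists>u\<in>M'. u k0 \<in> N \<and> (\<forall>k\<in>K. v k - u k \<in> N)}"
      using u M'(2) by (intro H(3) submod_restrict[OF N M'(1)]) blast
    then obtain z where z: "z \<in> M'" "z k0 \<in> N" "\<forall>k\<in>K. v k - w k - z k \<in> N" using vw by blast
    have "v k - (w k + z k) \<in> N" if "k \<in> insert k0 K" for k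
      using that z w(3) is_ideal_diff[OF N w(3) z(2)] by (auto simp: algebra_simps)
    thus "v \<in> M'" by (rule submod_cong[OF M'(1) submodD(2)[OF M'(1) w(2) z(1)]])
  qed
qed

text \<open>A grading of the quotient by \<open>N\<close>, pulled back to the ambient ring: \<open>Gr d\<close> is the preimage of the
  \<open>d\<close>-th component, so it contains \<open>N\<close>, and homogeneous components are unique only modulo \<open>N\<close>.\<close>

locale graded_mod =
  fixes N :: "'s::comm_ring_1 set" and Gr :: "nat \<Rightarrow> 's set"
  assumes N: "is_ideal N"
    and Gr_add: "\<And>d x y. x \<in> Gr d \<Longrightarrow> y \<in> Gr d \<Longrightarrow> x + y \<in> Gr d"
    and Gr_minus: "\<And>d x. x \<in> Gr d \<Longrightarrow> - x \<in> Gr d"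
    and Gr_N: "\<And>d. N \<subseteq> Gr d"
    and Gr_one: "1 \<in> Gr 0"
    and Gr_mult: "\<And>d e x y. x \<in> Gr d \<Longrightarrow> y \<in> Gr e \<Longrightarrow> x * y \<in> Gr (d + e)"
    and Gr_decomp: "\<And>x. \<exists>c n. (\<forall>d. c d \<in> Gr d) \<and> x - (\<Sum>d\<le>n. c d) \<in> N"
    and Gr_indep: "\<And>c n d. (\<And>d. c d \<in> Gr d) \<Longrightarrow> (\<Sum>d\<le>n. c d) \<in> N \<Longrightarrow> d \<le> n \<Longrightarrow> c d \<in> N"
begin

definition Gs :: "nat \<Rightarrow> nat \<Rightarrow> 's set" where "Gs b a = (if a \<le> b then Gr (b - a) else N)"

lemma Gr_zero: "0 \<in> Gr d" using Gr_N is_ideal_zero[OF N] by blast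

lemma Gr_diff: "x \<in> Gr d \<Longrightarrow> y \<in> Gr d \<Longrightarrow> x - y \<in> Gr d" using Gr_add[of x d "- y"] Gr_minus by simp

lemma N_mult: "x \<in> N \<or> y \<in> N \<Longrightarrow> x * y \<in> N"
  using is_ideal_mult[OF N] is_ideal_mult_right[OF N] by blast

lemma gcat_Gs: "gcat N Gs"
proof -
  have "x * r \<in> Gs c a" if "r \<in> Gs b a" "x \<in> Gs c b" for a b c r x
  proof (cases "a \<le> b \<and> b \<le> c")
    case True
    thus ?thesis using that Gr_mult[of x "c - b" r "b - a"] by (simp add: Gs_def)
  next
    case False
    hence "x * r \<in> N" using that by (intro N_mult) (auto simp: Gs_def split: if_splits)
    thus ?thesis using Gr_N by (auto simp: Gs_def)
  qed
  thus ?thesis unfolding gcat_def using Gr_N Gr_one Gr_add Gr_minus is_ideal_add[OF N] is_ideal_minus[OF N]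
    by (auto simp: Gs_def)
qed

lemma gmon_Gs: "gmon Gs"
  unfolding gmon_def
proof (intro allI ballI)
  fix a b c d x y assume xy: "x \<in> Gs b a" "y \<in> Gs d c"
  show "x * y \<in> Gs (b + d) (a + c)"
  proof (cases "a \<le> b \<and> c \<le> d")
    case True
    hence "b + d - (a + c) = (b - a) + (d - c)" by simp
    thus ?thesis using xy True Gr_mult[of x "b - a" y "d - c"] by (simp add: Gs_def)
  next
    case False
    hence "x * y \<in> N" using xy by (intro N_mult) (auto simp: Gs_def split: if_splits)
    thus ?thesis using Gr_N by (auto simp: Gs_def)
  qed
qed

text \<open>\<open>c\<close> is the family of homogeneous components of \<open>x\<close>. Asking for all large bounds \<open>k\<close> makes almost all
  components vanish modulo \<open>N\<close> and lets two decompositions be added.\<close>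

definition dec :: "'s \<Rightarrow> (nat \<Rightarrow> 's) \<Rightarrow> bool" where
  "dec x c \<longleftrightarrow> (\<forall>d. c d \<in> Gr d) \<and> (\<exists>n. \<forall>k\<ge>n. x - (\<Sum>d\<le>k. c d) \<in> N)"

lemma dec_ex: "\<exists>c. dec x c"
proof -
  obtain c n where c: "\<And>d. c d \<in> Gr d" "x - (\<Sum>d\<le>n. c d) \<in> N" using Gr_decomp by blast
  define c' where "c' d = (if d \<le> n then c d else 0)" for d
  have "(\<Sum>d\<le>k. c' d) = (\<Sum>d\<le>n. c d)" if "k \<ge> n" for k
  proof -
    have "(\<Sum>d\<le>k. c' d) = (\<Sum>d\<in>{..k} \<inter> {..n}. c d)" unfolding c'_def by (subst sum.inter_restrict) auto
    also have "{..k} \<inter> {..n} = {..n}" using that by auto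
    finally show ?thesis .
  qed
  hence "\<forall>k\<ge>n. x - (\<Sum>d\<le>k. c' d) \<in> N" using c(2) by simp
  moreover have "c' d \<in> Gr d" for d using c(1) by (simp add: c'_def Gr_zero)
  ultimately have "dec x c'" unfolding dec_def by blast
  thus ?thesis by blast
qed

lemma dec_unique: assumes "dec x c" "dec x c'" shows "c d - c' d \<in> N"
proof -
  obtain n n' where n: "\<And>k. k \<ge> n \<Longrightarrow> x - (\<Sum>d\<le>k. c d) \<in> N" "\<And>k. k \<ge> n' \<Longrightarrow> x - (\<Sum>d\<le>k. c' d) \<in> N"
    using assms by (auto simp: dec_def)
  let ?k = "n + n' + d"
  have "(x - (\<Sum>d\<le>?k. c' d)) - (x - (\<Sum>d\<le>?k. c d)) \<in> N" by (intro is_ideal_diff[OF N] n) auto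
  hence "(\<Sum>d\<le>?k. c d - c' d) \<in> N" by (simp add: sum_subtractf)
  thus ?thesis using assms by (intro Gr_indep[of "\<lambda>d. c d - c' d" ?k d]) (auto simp: dec_def intro: Gr_diff)
qed

definition cmp :: "'s \<Rightarrow> nat \<Rightarrow> 's" where "cmp x = (SOME c. dec x c)"

lemma dec_cmp: "dec x (cmp x)" unfolding cmp_def by (rule someI_ex[OF dec_ex])

lemma cmp_in: "cmp x d \<in> Gr d" using dec_cmp by (auto simp: dec_def)

lemma cmp_eq: "dec x c \<Longrightarrow> cmp x d - c d \<in> N" by (rule dec_unique[OF dec_cmp])

lemma dec_add: assumes "dec x c" "dec y c'" shows "dec (x + y) (\<lambda>d. c d + c' d)"
proof -
  obtain n n' where n: "\<And>k. k \<ge> n \<Longrightarrow> x - (\<Sum>d\<le>k. c d) \<in> N" "\<And>k. k \<ge> n' \<Longrightarrow> y - (\<Sum>d\<le>k. c' d) \<in> N"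
    using assms by (auto simp: dec_def)
  have "x + y - (\<Sum>d\<le>k. c d + c' d) \<in> N" if "k \<ge> n + n'" for k
    using is_ideal_add[OF N n(1)[of k] n(2)[of k]] that by (simp add: sum.distrib algebra_simps)
  thus ?thesis using assms by (auto simp: dec_def Gr_add)
qed

lemma dec_N: "x \<in> N \<Longrightarrow> dec x (\<lambda>_. 0)" by (auto simp: dec_def Gr_zero)

lemma dec_Gr: assumes "x \<in> Gr e" shows "dec x (\<lambda>d. if d = e then x else 0)"
proof -
  have "x - (\<Sum>d\<le>k. if d = e then x else 0) \<in> N" if "k \<ge> e" for k
    using that is_ideal_zero[OF N] by (simp add: sum.delta)
  thus ?thesis using assms by (auto simp: dec_def Gr_zero)
qed

lemma dec_mult: assumes "r \<in> Gr a" "dec x c" shows "dec (r * x) (\<lambda>d. if a \<le> d then r * c (d - a) else 0)"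
proof -
  obtain n where n: "\<And>k. k \<ge> n \<Longrightarrow> x - (\<Sum>d\<le>k. c d) \<in> N" using assms by (auto simp: dec_def)
  have "r * x - (\<Sum>d\<le>k. if a \<le> d then r * c (d - a) else 0) \<in> N" if "k \<ge> n + a" for k
  proof -
    have "(\<Sum>d\<le>k. if a \<le> d then r * c (d - a) else 0) = (\<Sum>d\<in>{a..k}. r * c (d - a))"
      by (rule sum.mono_neutral_cong_right) auto
    also have "\<dots> = (\<Sum>d\<le>k - a. r * c d)"
      by (rule sum.reindex_bij_witness[of _ "\<lambda>d. d + a" "\<lambda>d. d - a"]) (use that in auto)
    finally have "r * x - (\<Sum>d\<le>k. if a \<le> d then r * c (d - a) else 0) = r * (x - (\<Sum>d\<le>k - a. c d))"
      by (simp add: sum_distrib_left right_diff_distrib)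
    thus ?thesis using is_ideal_mult[OF N n[of "k - a"]] that by simp
  qed
  moreover have "(if a \<le> d then r * c (d - a) else 0) \<in> Gr d" for d
    using assms Gr_mult[of r a "c (d - a)" "d - a"] by (auto simp: dec_def Gr_zero)
  ultimately show ?thesis unfolding dec_def by blast
qed

text \<open>The component of \<open>x\<close> that is allowed as an entry from a generator of degree \<open>b\<close> to one of degree \<open>a\<close>.\<close>

definition hc :: "nat \<Rightarrow> nat \<Rightarrow> 's \<Rightarrow> 's" where "hc b a x = (if a \<le> b then cmp x (b - a) else 0)"

lemma hc_in: "hc b a x \<in> Gs b a" by (auto simp: hc_def Gs_def cmp_in is_ideal_zero[OF N])

lemma hc_add: "hc b a (x + y) - (hc b a x + hc b a y) \<in> N"
  using cmp_eq[OF dec_add[OF dec_cmp dec_cmp]] by (auto simp: hc_def is_ideal_zero[OF N])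

lemma hc_N: "x \<in> N \<Longrightarrow> hc b a x \<in> N"
  using cmp_eq[OF dec_N] by (auto simp: hc_def is_ideal_zero[OF N])

lemma hc_cong: assumes "x - y \<in> N" shows "hc b a x - hc b a y \<in> N"
proof -
  have "hc b a x - (hc b a (x - y) + hc b a y) \<in> N" using hc_add[of b a "x - y" y] by simp
  from is_ideal_add[OF N this hc_N[OF assms, of b a]] show ?thesis by simp
qed

lemma hc_self: assumes "x \<in> Gs b a" shows "hc b a x - x \<in> N"
proof (cases "a \<le> b")
  case True
  thus ?thesis using cmp_eq[OF dec_Gr[of x "b - a"], of "b - a"] assms by (simp add: Gs_def hc_def)
next
  case False
  thus ?thesis using assms is_ideal_minus[OF N] by (simp add: Gs_def hc_def)
qed

lemma hc_mult: assumes "r \<in> Gs c a" shows "hc b a (r * x) - r * hc b c x \<in> N"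
proof (cases "a \<le> c")
  case False
  hence "r \<in> N" using assms by (simp add: Gs_def)
  thus ?thesis by (intro is_ideal_diff[OF N hc_N] N_mult) (auto intro: N_mult)
next
  case True
  hence r: "r \<in> Gr (c - a)" using assms by (simp add: Gs_def)
  note e = cmp_eq[OF dec_mult[OF r dec_cmp[of x]], of "b - a"]
  show ?thesis
  proof (cases "a \<le> b")
    case ab: True
    show ?thesis
    proof (cases "c \<le> b")
      case True
      hence "c - a \<le> b - a" "b - a - (c - a) = b - c" using \<open>a \<le> c\<close> by auto
      thus ?thesis using e ab True by (simp add: hc_def)
    next
      case False
      hence "\<not> c - a \<le> b - a" using \<open>a \<le> c\<close> ab by auto
      thus ?thesis using e ab False by (simp add: hc_def)
    qed
  next
    case False
    thus ?thesis using True by (simp add: hc_def is_ideal_zero[OF N])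
  qed
qed

lemma hc_sum: "hc b a (\<Sum>i\<in>K. f i) - (\<Sum>i\<in>K. hc b a (f i)) \<in> N"
proof (induction K rule: infinite_finite_induct)
  case (insert i F)
  have "hc b a (f i + sum f F) - (hc b a (f i) + (\<Sum>i\<in>F. hc b a (f i))) \<in> N"
    using is_ideal_add[OF N hc_add[of b a "f i" "sum f F"] insert.IH] by (simp add: algebra_simps)
  thus ?case using insert by simp
qed (auto intro: hc_N is_ideal_zero[OF N])

text \<open>Taking components commutes with a homogeneous matrix. Hence a linear system with homogeneous coefficients and a
  homogeneous right-hand side has a homogeneous solution as soon as it has any.\<close>

lemma hc_lincomb:
  assumes "\<And>i. i \<in> K \<Longrightarrow> r i \<in> Gs (d i) a"
  shows "hc b a (\<Sum>i\<in>K. x i * r i) - (\<Sum>i\<in>K. hc b (d i) (x i) * r i) \<in> N"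
proof -
  have "(\<Sum>i\<in>K. hc b a (x i * r i)) - (\<Sum>i\<in>K. hc b (d i) (x i) * r i) = (\<Sum>i\<in>K. hc b a (r i * x i) - r i * hc b (d i) (x i))"
    by (simp add: sum_subtractf mult.commute)
  moreover have "\<dots> \<in> N" by (intro is_ideal_sum[OF N] hc_mult assms)
  ultimately show ?thesis using ideal_cong_trans[OF N hc_sum[of b a "\<lambda>i. x i * r i" K]] by simp
qed

lemma hc_decomp: "\<exists>n. \<forall>k\<ge>n. x - (\<Sum>b\<le>k. hc b a x) \<in> N"
proof -
  obtain n where n: "\<And>k. k \<ge> n \<Longrightarrow> x - (\<Sum>d\<le>k. cmp x d) \<in> N" using dec_cmp[of x] by (auto simp: dec_def)
  have "x - (\<Sum>b\<le>k. hc b a x) \<in> N" if "k \<ge> n + a" for k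
  proof -
    have "(\<Sum>b\<le>k. hc b a x) = (\<Sum>b\<in>{a..k}. cmp x (b - a))"
      unfolding hc_def by (rule sum.mono_neutral_cong_right) auto
    also have "\<dots> = (\<Sum>d\<le>k - a. cmp x d)"
      by (rule sum.reindex_bij_witness[of _ "\<lambda>d. d + a" "\<lambda>d. d - a"]) (use that in auto)
    finally show ?thesis using n[of "k - a"] that by simp
  qed
  thus ?thesis by blast
qed

definition hideal :: "'s set \<Rightarrow> bool" where
  "hideal A \<longleftrightarrow> is_ideal A \<and> N \<subseteq> A \<and> (\<forall>x\<in>A. \<forall>d. cmp x d \<in> A)"

lemma hideal_hc: "hideal A \<Longrightarrow> x \<in> A \<Longrightarrow> hc b a x \<in> A"
  by (auto simp: hideal_def hc_def is_ideal_zero)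

lemma homogeneous_preimage:
  assumes C: "is_complex N C" "graded_cpx Gs C"
    and v: "\<And>k. k \<in> lvl C n \<Longrightarrow> v k \<in> Gs b (ideg C k)" and w: "\<And>k. k \<in> lvl C n \<Longrightarrow> v k - dif C w k \<in> N"
  shows "\<exists>w. (\<forall>k\<in>lvl C (Suc n). w k \<in> Gs b (ideg C k)) \<and> (\<forall>k\<in>lvl C n. v k - dif C w k \<in> N)"
proof (intro exI[of _ "\<lambda>l. hc b (ideg C l) (w l)"] conjI ballI)
  fix k assume k: "k \<in> lvl C n"
  have 1: "hc b (ideg C k) (v k) - hc b (ideg C k) (dif C w k) \<in> N" by (rule hc_cong[OF w[OF k]])
  have 2: "hc b (ideg C k) (dif C w k) - dif C (\<lambda>l. hc b (ideg C l) (w l)) k \<in> N"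
    unfolding dif_expand[OF C(1) k] by (rule hc_lincomb) (rule graded_cpxD[OF C(2) k])
  have 3: "v k - hc b (ideg C k) (v k) \<in> N" by (rule ideal_cong_sym[OF N hc_self[OF v[OF k]]])
  show "v k - dif C (\<lambda>l. hc b (ideg C l) (w l)) k \<in> N"
    by (rule ideal_cong_trans[OF N 3 ideal_cong_trans[OF N 1 2]])
qed (rule hc_in)

text \<open>Exactness gives homogeneous exactness for free: replace a preimage by its component in the right degree.\<close>

lemma gres_graded:
  assumes C: "res_with N A C a" "graded_cpx Gs C" and A: "hideal A"
    and a: "\<And>k. k \<in> lvl C 0 \<Longrightarrow> a k \<in> Gs (ideg C k) 0"
  shows "gres N Gs A C a"
proof -
  have Cc: "is_complex N C" and ex: "exact N C" using C(1) by (auto simp: res_with_def)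
  have Ai: "is_ideal A" "N \<subseteq> A" using A by (auto simp: hideal_def)
  have "gexact N Gs C" unfolding gexact_def
  proof (intro allI impI)
    fix n b v assume v: "\<forall>k\<in>lvl C (Suc n). v k \<in> Gs b (ideg C k)" "\<forall>k\<in>lvl C n. dif C v k \<in> N"
    then obtain w where "\<forall>k\<in>lvl C (Suc n). v k - dif C w k \<in> N" using exactD[OF ex, of n v] by blast
    thus "\<exists>w. (\<forall>k\<in>lvl C (Suc (Suc n)). w k \<in> Gs b (ideg C k)) \<and> (\<forall>k\<in>lvl C (Suc n). v k - dif C w k \<in> N)"
      using v by (intro homogeneous_preimage[OF Cc C(2)]) auto
  qed
  moreover have "\<exists>u. (\<forall>k\<in>lvl C 0. u k \<in> Gs 0 (ideg C k)) \<and> (\<Sum>k\<in>lvl C 0. u k * a k) - 1 \<in> A"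
  proof -
    obtain u where u: "(\<Sum>k\<in>lvl C 0. u k * a k) - 1 \<in> A" using C(1) by (auto simp: res_with_def)
    have 1: "hc 0 0 (\<Sum>k\<in>lvl C 0. u k * a k) - (\<Sum>k\<in>lvl C 0. hc 0 (ideg C k) (u k) * a k) \<in> N"
      by (rule hc_lincomb) (rule a)
    have 2: "hc 0 0 ((\<Sum>k\<in>lvl C 0. u k * a k) - 1 + 1) - (hc 0 0 ((\<Sum>k\<in>lvl C 0. u k * a k) - 1) + hc 0 0 1) \<in> N"
      by (rule hc_add)
    have 3: "hc 0 0 1 - 1 \<in> N" by (rule hc_self) (simp add: Gs_def Gr_one)
    have 4: "hc 0 0 ((\<Sum>k\<in>lvl C 0. u k * a k) - 1) \<in> A" by (rule hideal_hc[OF A u])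
    have "(\<Sum>k\<in>lvl C 0. hc 0 (ideg C k) (u k) * a k) - 1 =
       (hc 0 0 ((\<Sum>k\<in>lvl C 0. u k * a k) - 1 + 1) - (hc 0 0 ((\<Sum>k\<in>lvl C 0. u k * a k) - 1) + hc 0 0 1))
       + (hc 0 0 1 - 1) + hc 0 0 ((\<Sum>k\<in>lvl C 0. u k * a k) - 1)
       - (hc 0 0 (\<Sum>k\<in>lvl C 0. u k * a k) - (\<Sum>k\<in>lvl C 0. hc 0 (ideg C k) (u k) * a k))" by simp
    also have "\<dots> \<in> A" by (rule is_ideal_diff[OF Ai(1)], rule is_ideal_add[OF Ai(1)], rule is_ideal_add[OF Ai(1)]) (use 1 2 3 4 Ai(2) in blast)+
    finally show ?thesis using hc_in by (intro exI[of _ "\<lambda>k. hc 0 (ideg C k) (u k)"]) auto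
  qed
  moreover have "\<exists>w. (\<forall>k\<in>lvl C 1. w k \<in> Gs b (ideg C k)) \<and> (\<forall>k\<in>lvl C 0. v k - dif C w k \<in> N)"
    if v: "\<forall>k\<in>lvl C 0. v k \<in> Gs b (ideg C k)" and s: "(\<Sum>k\<in>lvl C 0. v k * a k) \<in> A" for b v
  proof -
    obtain w where "\<forall>k\<in>lvl C 0. v k - dif C w k \<in> N" using C(1) s by (auto simp: res_with_def)
    thus ?thesis using v homogeneous_preimage[OF Cc C(2), of 0 v b w] by simp
  qed
  ultimately show ?thesis using C a by (auto simp: gres_def res_with_def)
qed

end

text \<open>The conditions on \<open>\<mm>\<close> that make graded Nakayama arguments work, for local rings as well as for graded rings: homogeneous elements
  of positive degree lie in \<open>\<mm>\<close>, and those of degree zero outside \<open>\<mm>\<close> are units modulo \<open>N\<close>.\<close>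

locale graded_quot = graded_mod N Gr for N :: "'s::comm_ring_1 set" and Gr :: "nat \<Rightarrow> 's set" +
  fixes \<mm> :: "'s set"
  assumes m: "is_ideal \<mm>" "N \<subseteq> \<mm>" "1 \<notin> \<mm>"
    and Gr_pos: "\<And>d. 0 < d \<Longrightarrow> Gr d \<subseteq> \<mm>"
    and Gr_unit: "\<And>x. x \<in> Gr 0 \<Longrightarrow> x \<notin> \<mm> \<Longrightarrow> \<exists>y. x * y - 1 \<in> N"
    and no: "noeth N"
begin

lemma Gs_ne: "a \<noteq> b \<Longrightarrow> Gs b a \<subseteq> \<mm>"
  using Gr_pos[of "b - a"] m(2) by (auto simp: Gs_def)

lemma cong_degree_zero: "x - hc b b x \<in> \<mm>"
proof -
  obtain n where n: "\<And>k. k \<ge> n \<Longrightarrow> x - (\<Sum>d\<le>k. cmp x d) \<in> N" using dec_cmp[of x] by (auto simp: dec_def)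
  have "(\<Sum>d\<le>n. cmp x d) = cmp x 0 + (\<Sum>d\<in>{1..n}. cmp x d)"
    by (simp add: atMost_atLeast0 sum.atLeast_Suc_atMost)
  hence e: "x - hc b b x = (x - (\<Sum>d\<le>n. cmp x d)) + (\<Sum>d\<in>{1..n}. cmp x d)" by (simp add: hc_def)
  have "(\<Sum>d\<in>{1..n}. cmp x d) \<in> \<mm>"
  proof (rule is_ideal_sum[OF m(1)])
    fix d assume "d \<in> {1..n}"
    thus "cmp x d \<in> \<mm>" using Gr_pos[of d] cmp_in[of x d] by auto
  qed
  moreover have "x - (\<Sum>d\<le>n. cmp x d) \<in> \<mm>" using n[of n] m(2) by auto
  ultimately show ?thesis unfolding e by (intro is_ideal_add[OF m(1)])
qed

text \<open>Modulo \<open>\<mm>\<close> every element equals its component of degree zero, which is a unit unless it lies in \<open>\<mm>\<close>.\<close>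

lemma residue_field: assumes "x \<notin> \<mm>" shows "\<exists>y. x * y - 1 \<in> \<mm>"
proof -
  have "hc 0 0 x \<notin> \<mm>" using assms ideal_cong_mem[OF m(1) cong_degree_zero[of x 0]] by blast
  then obtain y where y: "hc 0 0 x * y - 1 \<in> N" using Gr_unit[of "hc 0 0 x"] cmp_in by (auto simp: hc_def)
  have "x * y - 1 = (x - hc 0 0 x) * y + (hc 0 0 x * y - 1)" by (simp add: algebra_simps)
  also have "\<dots> \<in> \<mm>" using y m(2) by (intro is_ideal_add[OF m(1)] is_ideal_mult_right[OF m(1)] cong_degree_zero) auto
  finally show ?thesis by blast
qed

lemma generates_submod:
  "submod N K {v. \<exists>c. \<forall>k\<in>K. v k - (\<Sum>i\<in>I. c i * g i k) \<in> N}"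
  unfolding submod_def
proof (intro conjI ballI allI impI)
  fix v assume "\<forall>k\<in>K. v k \<in> N"
  thus "v \<in> {v. \<exists>c. \<forall>k\<in>K. v k - (\<Sum>i\<in>I. c i * g i k) \<in> N}" by (auto intro!: exI[of _ "\<lambda>_. 0"])
next
  fix v w assume "v \<in> {v. \<exists>c. \<forall>k\<in>K. v k - (\<Sum>i\<in>I. c i * g i k) \<in> N}" "w \<in> {v. \<exists>c. \<forall>k\<in>K. v k - (\<Sum>i\<in>I. c i * g i k) \<in> N}"
  then obtain c d where cd: "\<forall>k\<in>K. v k - (\<Sum>i\<in>I. c i * g i k) \<in> N" "\<forall>k\<in>K. w k - (\<Sum>i\<in>I. d i * g i k) \<in> N" by blast
  have "v k + w k - (\<Sum>i\<in>I. (c i + d i) * g i k) \<in> N" if "k \<in> K" for k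
    using is_ideal_add[OF N cd(1)[rule_format, OF that] cd(2)[rule_format, OF that]]
    by (simp add: distrib_right sum.distrib algebra_simps)
  thus "(\<lambda>k. v k + w k) \<in> {v. \<exists>c. \<forall>k\<in>K. v k - (\<Sum>i\<in>I. c i * g i k) \<in> N}" by (intro CollectI exI[of _ "\<lambda>i. c i + d i"]) auto
next
  fix r v assume "v \<in> {v. \<exists>c. \<forall>k\<in>K. v k - (\<Sum>i\<in>I. c i * g i k) \<in> N}"
  then obtain c where c: "\<forall>k\<in>K. v k - (\<Sum>i\<in>I. c i * g i k) \<in> N" by blast
  have "r * v k - (\<Sum>i\<in>I. (r * c i) * g i k) \<in> N" if "k \<in> K" for k
    using is_ideal_mult[OF N c[rule_format, OF that], of r] by (simp add: right_diff_distrib sum_distrib_left mult.assoc)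
  thus "(\<lambda>k. r * v k) \<in> {v. \<exists>c. \<forall>k\<in>K. v k - (\<Sum>i\<in>I. c i * g i k) \<in> N}" by (intro CollectI exI[of _ "\<lambda>i. r * c i"]) auto
qed

text \<open>A finite homogeneous generating system of \<open>M\<close>, indexed by natural numbers so that all stages of a resolution have bases of
  the same type; \<open>s\<close> gives the degrees of the coordinates and \<open>d\<close> those of the generators.\<close>

definition hom_gens :: "'i set \<Rightarrow> ('i \<Rightarrow> nat) \<Rightarrow> ('i \<Rightarrow> 's) set \<Rightarrow> nat set \<Rightarrow> (nat \<Rightarrow> 'i \<Rightarrow> 's) \<Rightarrow> (nat \<Rightarrow> nat) \<Rightarrow> bool" where
  "hom_gens K s M I g d \<longleftrightarrow> finite I \<and> (\<forall>i\<in>I. g i \<in> M \<and> (\<forall>k\<in>K. g i k \<in> Gs (d i) (s k))) \<and>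
     (\<forall>v\<in>M. \<exists>c. \<forall>k\<in>K. v k - (\<Sum>i\<in>I. c i * g i k) \<in> N)"

text \<open>The components of finitely many generators are finitely many homogeneous generators.\<close>

lemma hom_gens_ex:
  fixes M :: "('i \<Rightarrow> 's) set"
  assumes K: "finite K" and M: "submod N K M" and h: "\<And>v b. v \<in> M \<Longrightarrow> (\<lambda>k. hc b (s k) (v k)) \<in> M"
  shows "\<exists>I g d. hom_gens K s M I g d"
proof -
  obtain G where G: "finite G" "G \<subseteq> M" "\<And>M'. submod N K M' \<Longrightarrow> G \<subseteq> M' \<Longrightarrow> M \<subseteq> M'"
    using submod_fg[OF N no K M] by blast
  have "\<exists>n. \<forall>k\<in>K. v k - (\<Sum>b\<le>n. hc b (s k) (v k)) \<in> N" for v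
  proof -
    have "\<exists>n. \<forall>k\<in>K. \<forall>j\<ge>n. v k - (\<Sum>b\<le>j. hc b (s k) (v k)) \<in> N"
      using K
    proof (induction K rule: finite_induct)
      case (insert k K)
      obtain n where "\<forall>j\<ge>n. v k - (\<Sum>b\<le>j. hc b (s k) (v k)) \<in> N" using hc_decomp by blast
      moreover obtain n' where "\<forall>k\<in>K. \<forall>j\<ge>n'. v k - (\<Sum>b\<le>j. hc b (s k) (v k)) \<in> N" using insert.IH by blast
      ultimately show ?case by (intro exI[of _ "max n n'"]) auto
    qed auto
    thus ?thesis by blast
  qed
  then obtain n where n: "\<And>v k. k \<in> K \<Longrightarrow> v k - (\<Sum>b\<le>n v. hc b (s k) (v k)) \<in> N" by metis
  \<comment> \<open>The degree is kept with each component, since a vector that vanishes has no degree of its own.\<close>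
  define H where "H = (\<Union>v\<in>G. (\<lambda>b. (b, \<lambda>k. hc b (s k) (v k))) ` {..n v})"
  have "finite H" unfolding H_def using G(1) by auto
  then obtain e where e: "bij_betw e {0..<card H} H" using ex_bij_betw_nat_finite by blast
  define I where "I = {0..<card H}"
  define g where "g i = snd (e i)" for i
  define d where "d i = fst (e i)" for i
  have eH: "e i \<in> H" if "i \<in> I" for i using e that by (auto simp: bij_betw_def I_def)
  have "g i \<in> M \<and> (\<forall>k\<in>K. g i k \<in> Gs (d i) (s k))" if iI: "i \<in> I" for i
  proof -
    obtain v b where "v \<in> G" "e i = (b, \<lambda>k. hc b (s k) (v k))" using eH[OF iI] by (auto simp: H_def)
    thus ?thesis using h G(2) hc_in by (auto simp: g_def d_def)
  qed
  moreover have "M \<subseteq> {v. \<exists>c. \<forall>k\<in>K. v k - (\<Sum>i\<in>I. c i * g i k) \<in> N}"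
  proof (rule G(3)[OF generates_submod], rule subsetI)
    fix v assume v: "v \<in> G"
    have "(\<lambda>k. hc b (s k) (v k)) \<in> {v. \<exists>c. \<forall>k\<in>K. v k - (\<Sum>i\<in>I. c i * g i k) \<in> N}" if b: "b \<le> n v" for b
    proof -
      have "(b, \<lambda>k. hc b (s k) (v k)) \<in> e ` I" using e v b unfolding bij_betw_def I_def H_def by auto
      then obtain i where i: "i \<in> I" "e i = (b, \<lambda>k. hc b (s k) (v k))" by auto
      have "(\<Sum>j\<in>I. (if j = i then 1 else 0) * g j k) = hc b (s k) (v k)" for k
      proof -
        have "(\<Sum>j\<in>I. (if j = i then 1 else 0) * g j k) = (\<Sum>j\<in>I. if j = i then g j k else 0)"
          by (rule sum.cong) auto
        also have "\<dots> = g i k" using i(1) by (simp add: I_def)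
        finally show ?thesis using i(2) by (simp add: g_def)
      qed
      thus ?thesis using is_ideal_zero[OF N] by (intro CollectI exI[of _ "\<lambda>j. if j = i then 1 else 0"]) simp
    qed
    hence "(\<lambda>k. \<Sum>b\<le>n v. hc b (s k) (v k)) \<in> {v. \<exists>c. \<forall>k\<in>K. v k - (\<Sum>i\<in>I. c i * g i k) \<in> N}"
      by (intro submod_sum[OF N generates_submod]) auto
    thus "v \<in> {v. \<exists>c. \<forall>k\<in>K. v k - (\<Sum>i\<in>I. c i * g i k) \<in> N}"
      by (rule submod_cong[OF generates_submod]) (rule n)
  qed
  ultimately have "hom_gens K s M I g d" unfolding hom_gens_def by (auto simp: I_def)
  thus ?thesis by blast
qed

text \<open>A system with the least number of generators has all its relations in \<open>\<mm>\<close>. Otherwise the degree zero part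
  of a coefficient outside \<open>\<mm>\<close> would be a unit, and the homogeneous component of the relation in the degree of
  that generator would express the generator by the others.\<close>

lemma minimal_hom_gens:
  fixes M :: "('i \<Rightarrow> 's) set"
  assumes K: "finite K" and M: "submod N K M" and h: "\<And>v b. v \<in> M \<Longrightarrow> (\<lambda>k. hc b (s k) (v k)) \<in> M"
  shows "\<exists>I g d. hom_gens K s M I g d \<and> (\<forall>c. (\<forall>k\<in>K. (\<Sum>i\<in>I. c i * g i k) \<in> N) \<longrightarrow> (\<forall>i\<in>I. c i \<in> \<mm>))"
proof -
  define Q where "Q r \<longleftrightarrow> (\<exists>I g d. hom_gens K s M I g d \<and> card I = r)" for r
  define r where "r = (LEAST r. Q r)"
  have "\<exists>r. Q r" unfolding Q_def using hom_gens_ex[OF K M h] by blast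
  hence "Q r" unfolding r_def by (rule LeastI_ex)
  then obtain I g d where G: "hom_gens K s M I g d" "card I = r" unfolding Q_def by blast
  have fin: "finite I" and hom: "\<And>i k. i \<in> I \<Longrightarrow> k \<in> K \<Longrightarrow> g i k \<in> Gs (d i) (s k)"
    and gen: "\<And>v. v \<in> M \<Longrightarrow> \<exists>c. \<forall>k\<in>K. v k - (\<Sum>i\<in>I. c i * g i k) \<in> N" and gM: "\<And>i. i \<in> I \<Longrightarrow> g i \<in> M"
    using G(1) by (auto simp: hom_gens_def)
  have "c i0 \<in> \<mm>" if c: "\<forall>k\<in>K. (\<Sum>i\<in>I. c i * g i k) \<in> N" and i0: "i0 \<in> I" for c i0
  proof (rule ccontr)
    assume ni: "c i0 \<notin> \<mm>"
    \<comment> \<open>The component of the relation in which the coefficient of \<open>g i0\<close> has degree zero.\<close>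
    define c' where "c' i = hc (d i0) (d i) (c i)" for i
    have rel: "(\<Sum>i\<in>I. c' i * g i k) \<in> N" if k: "k \<in> K" for k
    proof -
      have "hc (d i0) (s k) (\<Sum>i\<in>I. c i * g i k) - (\<Sum>i\<in>I. c' i * g i k) \<in> N"
        unfolding c'_def by (rule hc_lincomb) (use hom k in blast)
      from is_ideal_diff[OF N hc_N[OF c[rule_format, OF k], of "d i0" "s k"] this] show ?thesis by simp
    qed
    have "c' i0 \<notin> \<mm>" using ni ideal_cong_mem[OF m(1) cong_degree_zero[of "c i0" "d i0"]] by (auto simp: c'_def)
    moreover have "c' i0 \<in> Gr 0" using cmp_in by (simp add: c'_def hc_def)
    ultimately obtain y where y: "c' i0 * y - 1 \<in> N" using Gr_unit by blast
    have "hom_gens K s M (I - {i0}) g d" unfolding hom_gens_def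
    proof (intro conjI ballI)
      show "finite (I - {i0})" using fin by simp
      show "g i \<in> M" if "i \<in> I - {i0}" for i using gM that by simp
      show "g i k \<in> Gs (d i) (s k)" if "i \<in> I - {i0}" "k \<in> K" for i k using hom that by simp
      fix v assume "v \<in> M"
      then obtain e where e: "\<And>k. k \<in> K \<Longrightarrow> v k - (\<Sum>i\<in>I. e i * g i k) \<in> N" using gen by blast
      show "\<exists>c. \<forall>k\<in>K. v k - (\<Sum>i\<in>I - {i0}. c i * g i k) \<in> N"
      proof (intro exI[of _ "\<lambda>i. e i - e i0 * y * c' i"] ballI)
        fix k assume k: "k \<in> K"
        have s1: "(\<Sum>i\<in>I. f i) = f i0 + (\<Sum>i\<in>I - {i0}. f i)" for f :: "nat \<Rightarrow> 's"
          using fin i0 by (rule sum.remove)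
        have "v k - (\<Sum>i\<in>I - {i0}. (e i - e i0 * y * c' i) * g i k) =
          (v k - (\<Sum>i\<in>I. e i * g i k)) + e i0 * y * (\<Sum>i\<in>I. c' i * g i k) - e i0 * g i0 k * (c' i0 * y - 1)"
          unfolding s1[of "\<lambda>i. e i * g i k"] s1[of "\<lambda>i. c' i * g i k"]
          by (simp add: left_diff_distrib sum_subtractf sum_distrib_left algebra_simps)
        also have "\<dots> \<in> N"
          by (intro is_ideal_diff[OF N] is_ideal_add[OF N] e[OF k] is_ideal_mult[OF N rel[OF k]] is_ideal_mult[OF N y])
        finally show "v k - (\<Sum>i\<in>I - {i0}. (e i - e i0 * y * c' i) * g i k) \<in> N" .
      qed
    qed
    hence "Q (card (I - {i0}))" unfolding Q_def by blast
    hence "r \<le> card (I - {i0})" unfolding r_def by (rule Least_le)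
    moreover have "card (I - {i0}) < card I" by (rule card_Diff1_less[OF fin i0])
    ultimately show False using G(2) by simp
  qed
  thus ?thesis using G(1) by blast
qed

text \<open>One homogeneous matrix of a minimal resolution, with entries and column relations in \<open>\<mm>\<close>. The columns of
  the next matrix are such relations.\<close>

definition stage :: "nat set \<Rightarrow> (nat \<Rightarrow> nat) \<Rightarrow> nat set \<Rightarrow> (nat \<Rightarrow> nat) \<Rightarrow> (nat \<Rightarrow> nat \<Rightarrow> 's) \<Rightarrow> bool" where
  "stage K s L t D \<longleftrightarrow> finite K \<and> finite L \<and> (\<forall>k\<in>K. \<forall>l\<in>L. D k l \<in> Gs (t l) (s k) \<and> D k l \<in> \<mm>) \<and>
     (\<forall>c. (\<forall>k\<in>K. (\<Sum>l\<in>L. c l * D k l) \<in> N) \<longrightarrow> (\<forall>l\<in>L. c l \<in> \<mm>))"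

lemma next_stage:
  assumes "stage K s L t D"
  shows "\<exists>P r E. stage L t P r E \<and>
     (\<forall>c. (\<forall>k\<in>K. (\<Sum>l\<in>L. c l * D k l) \<in> N) \<longleftrightarrow> (\<exists>e. \<forall>l\<in>L. c l - (\<Sum>p\<in>P. e p * E l p) \<in> N))"
proof -
  define M where "M = {c. \<forall>k\<in>K. (\<Sum>l\<in>L. c l * D k l) \<in> N}"
  have fin: "finite L" and D: "\<And>k l. k \<in> K \<Longrightarrow> l \<in> L \<Longrightarrow> D k l \<in> Gs (t l) (s k)"
    and min: "\<And>c l. c \<in> M \<Longrightarrow> l \<in> L \<Longrightarrow> c l \<in> \<mm>" using assms by (auto simp: stage_def M_def)
  have M: "submod N L M" unfolding submod_def
  proof (intro conjI ballI allI impI)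
    show "v \<in> M" if "\<forall>l\<in>L. v l \<in> N" for v unfolding M_def
      using that by (auto intro!: is_ideal_sum[OF N] is_ideal_mult_right[OF N])
    show "(\<lambda>k. v k + w k) \<in> M" if "v \<in> M" "w \<in> M" for v w
      using that is_ideal_add[OF N] by (simp add: M_def distrib_right sum.distrib)
    show "(\<lambda>k. r * v k) \<in> M" if "v \<in> M" for v r
      using that is_ideal_mult[OF N, where r = r] by (simp add: M_def sum_distrib_left[symmetric] mult.assoc)
  qed
  have h: "(\<lambda>k. hc b (t k) (v k)) \<in> M" if v: "v \<in> M" for v b
    unfolding M_def
  proof (intro CollectI ballI)
    fix k assume k: "k \<in> K"
    have "hc b (s k) (\<Sum>l\<in>L. v l * D k l) - (\<Sum>l\<in>L. hc b (t l) (v l) * D k l) \<in> N"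
      by (rule hc_lincomb) (rule D[OF k])
    moreover have "hc b (s k) (\<Sum>l\<in>L. v l * D k l) \<in> N" using v k by (intro hc_N) (auto simp: M_def)
    ultimately show "(\<Sum>l\<in>L. hc b (t l) (v l) * D k l) \<in> N" using is_ideal_diff[OF N] by fastforce
  qed
  obtain P g r where G: "hom_gens L t M P g r" and rel: "\<And>c i. (\<forall>k\<in>L. (\<Sum>i\<in>P. c i * g i k) \<in> N) \<Longrightarrow> i \<in> P \<Longrightarrow> c i \<in> \<mm>"
    using minimal_hom_gens[OF fin M h] by blast
  have "stage L t P r (\<lambda>l p. g p l)" unfolding stage_def
    using G fin min rel by (auto simp: hom_gens_def)
  moreover have "(\<forall>k\<in>K. (\<Sum>l\<in>L. c l * D k l) \<in> N) \<longleftrightarrow> (\<exists>e. \<forall>l\<in>L. c l - (\<Sum>p\<in>P. e p * g p l) \<in> N)" for c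
  proof
    assume "\<forall>k\<in>K. (\<Sum>l\<in>L. c l * D k l) \<in> N"
    hence "c \<in> M" by (simp add: M_def)
    thus "\<exists>e. \<forall>l\<in>L. c l - (\<Sum>p\<in>P. e p * g p l) \<in> N" using G by (auto simp: hom_gens_def)
  next
    assume "\<exists>e. \<forall>l\<in>L. c l - (\<Sum>p\<in>P. e p * g p l) \<in> N"
    then obtain e where e: "\<And>l. l \<in> L \<Longrightarrow> c l - (\<Sum>p\<in>P. e p * g p l) \<in> N" by blast
    have "(\<lambda>l. \<Sum>p\<in>P. e p * g p l) \<in> M"
      using G by (intro submod_sum[OF N M] submodD(3)[OF M]) (auto simp: hom_gens_def)
    from submod_cong[OF M this e] show "\<forall>k\<in>K. (\<Sum>l\<in>L. c l * D k l) \<in> N" by (simp add: M_def)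
  qed
  ultimately show ?thesis by blast
qed

text \<open>Starting with minimal homogeneous generators of \<open>A\<close>, the relations at each stage have minimal homogeneous
  generators again; dependent choice puts the matrices together.\<close>

theorem minimal_resolution_ex:
  assumes A: "hideal A" "A \<subseteq> \<mm>"
  shows "\<exists>C :: (nat \<times> nat, 's) based. cyc_res N A C (0, 0) \<and> graded_cpx Gs C \<and> minimal_cpx \<mm> C"
proof -
  have Ai: "is_ideal A" "N \<subseteq> A" using A by (auto simp: hideal_def)
  \<comment> \<open>A state consists of one matrix with the degrees of its rows and columns; \<open>step\<close> says that the next
  matrix generates the relations of the present one.\<close>
  define inv0 where "inv0 n st \<longleftrightarrow> (case st of (K, s, L, t, D) \<Rightarrow> stage K s L t D \<and>
     (n = (0::nat) \<longrightarrow> K = {0} \<and> s = (\<lambda>_. 0) \<and> (\<forall>x. x \<in> A \<longleftrightarrow> (\<exists>e. x - (\<Sum>l\<in>L. e l * D 0 l) \<in> N))))"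
    for n and st :: "nat set \<times> (nat \<Rightarrow> nat) \<times> nat set \<times> (nat \<Rightarrow> nat) \<times> (nat \<Rightarrow> nat \<Rightarrow> 's)"
  define step where "step n st st' \<longleftrightarrow> (case st of (K, s, L, t, D) \<Rightarrow> case st' of (K', s', L', t', D') \<Rightarrow>
     K' = L \<and> s' = t \<and>
     (\<forall>c. (\<forall>k\<in>K. (\<Sum>l\<in>L. c l * D k l) \<in> N) \<longleftrightarrow> (\<exists>e. \<forall>l\<in>L. c l - (\<Sum>p\<in>L'. e p * D' l p) \<in> N)))"
    for n :: nat and st st' :: "nat set \<times> (nat \<Rightarrow> nat) \<times> nat set \<times> (nat \<Rightarrow> nat) \<times> (nat \<Rightarrow> nat \<Rightarrow> 's)"
  have "\<exists>f. \<forall>n. inv0 n (f n) \<and> step n (f n) (f (Suc n))"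
  proof (rule dependent_nat_choice)
    define M where "M = {v :: nat \<Rightarrow> 's. v 0 \<in> A}"
    have M: "submod N {0} M" using Ai by (auto simp: submod_def M_def intro: is_ideal_add is_ideal_mult)
    have h: "(\<lambda>k. hc b ((\<lambda>_. 0) k) (v k)) \<in> M" if "v \<in> M" for v b using that hideal_hc[OF A(1)] by (simp add: M_def)
    obtain L g t where G: "hom_gens {0} (\<lambda>_. 0) M L g t"
      and rel: "\<And>c i. (\<forall>k\<in>{0}. (\<Sum>i\<in>L. c i * g i k) \<in> N) \<Longrightarrow> i \<in> L \<Longrightarrow> c i \<in> \<mm>"
      using minimal_hom_gens[of "{0}", OF _ M h] by blast
    have "stage {0} (\<lambda>_. 0) L t (\<lambda>k l. g l k)" unfolding stage_def
      using G rel A(2) by (auto simp: hom_gens_def M_def)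
    moreover have "x \<in> A \<longleftrightarrow> (\<exists>e. x - (\<Sum>l\<in>L. e l * g l 0) \<in> N)" for x
    proof
      assume "x \<in> A"
      hence "(\<lambda>_. x) \<in> M" by (simp add: M_def)
      then show "\<exists>e. x - (\<Sum>l\<in>L. e l * g l 0) \<in> N" using G by (auto simp: hom_gens_def)
    next
      assume "\<exists>e. x - (\<Sum>l\<in>L. e l * g l 0) \<in> N"
      then obtain e where e: "x - (\<Sum>l\<in>L. e l * g l 0) \<in> N" by blast
      have "(\<Sum>l\<in>L. e l * g l 0) \<in> A"
        using G by (intro is_ideal_sum[OF Ai(1)] is_ideal_mult[OF Ai(1)]) (auto simp: hom_gens_def M_def)
      thus "x \<in> A" using e Ai by (meson ideal_cong_mem subsetD)
    qed
    ultimately have "inv0 0 ({0}, (\<lambda>_. 0), L, t, (\<lambda>k l. g l k))" by (simp add: inv0_def)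
    thus "\<exists>x. inv0 0 x" by blast
  next
    fix st n assume "inv0 n st"
    then obtain K s L t D where st: "st = (K, s, L, t, D)" "stage K s L t D" by (cases st) (auto simp: inv0_def)
    obtain P r E where "stage L t P r E"
       "\<forall>c. (\<forall>k\<in>K. (\<Sum>l\<in>L. c l * D k l) \<in> N) \<longleftrightarrow> (\<exists>e. \<forall>l\<in>L. c l - (\<Sum>p\<in>P. e p * E l p) \<in> N)"
      using next_stage[OF st(2)] by blast
    hence "inv0 (Suc n) (L, t, P, r, E) \<and> step n st (L, t, P, r, E)" by (simp add: inv0_def step_def st(1))
    thus "\<exists>y. inv0 (Suc n) y \<and> step n st y" by blast
  qed
  then obtain f where f: "\<And>n. inv0 n (f n)" "\<And>n. step n (f n) (f (Suc n))" by blast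
  define I where "I n = fst (f n)" for n
  define s where "s n = fst (snd (f n))" for n
  define D where "D n = snd (snd (snd (snd (f n))))" for n
  have fn: "f n = (I n, s n, I (Suc n), s (Suc n), D n)" for n
    using f(2)[of n] by (cases "f n"; cases "f (Suc n)") (auto simp: step_def I_def s_def D_def)
  have st: "stage (I n) (s n) (I (Suc n)) (s (Suc n)) (D n)" for n
    using f(1)[of n] by (simp add: inv0_def fn)
  have zero: "I 0 = {0}" "s 0 = (\<lambda>_. 0)" "\<And>x. x \<in> A \<longleftrightarrow> (\<exists>e. x - (\<Sum>l\<in>I 1. e l * D 0 0 l) \<in> N)"
    using f(1)[of 0] by (auto simp: inv0_def fn)
  have ker: "(\<forall>k\<in>I n. (\<Sum>l\<in>I (Suc n). c l * D n k l) \<in> N) \<longleftrightarrow>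
      (\<exists>e. \<forall>l\<in>I (Suc n). c l - (\<Sum>p\<in>I (Suc (Suc n)). e p * D (Suc n) l p) \<in> N)" for n c
    using f(2)[of n] unfolding fn step_def by simp
  define C :: "(nat \<times> nat, 's) based" where
    "C = \<lparr>basis = {(n, i). i \<in> I n}, hdeg = fst, ideg = (\<lambda>(n, i). s n i),
       dif = (\<lambda>v (n, k). \<Sum>l\<in>I (Suc n). v (Suc n, l) * D n k l)\<rparr>"
  have C_simps: "basis C = {(n, i). i \<in> I n}" "hdeg C = fst" "ideg C (n, k) = s n k"
    "dif C v (n, k) = (\<Sum>l\<in>I (Suc n). v (Suc n, l) * D n k l)" for v n k by (auto simp: C_def)
  have lvlC: "lvl C n = Pair n ` I n" for n by (auto simp: lvl_def C_simps)
  have finI: "finite (I n)" for n using st[of n] by (simp add: stage_def)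
  have Cc: "is_complex N C" unfolding is_complex_def
  proof (intro conjI allI ballI)
    show fin: "finite (lvl C n)" for n using finI by (simp add: lvlC)
    fix k assume k: "k \<in> basis C"
    obtain n i where [simp]: "k = (n, i)" by (cases k)
    show "lin_on (lvl C (Suc (hdeg C k))) (\<lambda>v. dif C v k)" unfolding \<open>k = (n, i)\<close> C_simps
      by (intro lin_on_setsum lin_on_times_right lin_on_coord fin) (auto simp: lvlC)
    fix v
    have "\<forall>k\<in>I n. (\<Sum>l\<in>I (Suc n). (\<Sum>p\<in>I (Suc (Suc n)). v (Suc (Suc n), p) * D (Suc n) l p) * D n k l) \<in> N"
      by (rule iffD2[OF ker], rule exI[of _ "\<lambda>p. v (Suc (Suc n), p)"]) (simp add: is_ideal_zero[OF N])
    thus "dif C (dif C v) k \<in> N" using k by (simp add: C_simps)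
  qed
  have ex: "exact N C" unfolding exact_def
  proof (intro allI impI)
    fix n v assume v: "\<forall>k\<in>lvl C n. dif C v k \<in> N"
    hence "\<forall>k\<in>I n. (\<Sum>l\<in>I (Suc n). v (Suc n, l) * D n k l) \<in> N" by (simp add: lvlC C_simps)
    then obtain e where "\<forall>l\<in>I (Suc n). v (Suc n, l) - (\<Sum>p\<in>I (Suc (Suc n)). e p * D (Suc n) l p) \<in> N"
      using iffD1[OF ker[of n "\<lambda>l. v (Suc n, l)"]] by blast
    thus "\<exists>w. \<forall>k\<in>lvl C (Suc n). v k - dif C w k \<in> N"
      by (intro exI[of _ "\<lambda>(n, p). e p"]) (simp add: lvlC C_simps)
  qed
  have "x \<in> A \<longleftrightarrow> (\<exists>w. x - dif C w (0, 0) \<in> N)" for x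
  proof
    assume "x \<in> A"
    then obtain e where "x - (\<Sum>l\<in>I 1. e l * D 0 0 l) \<in> N" using zero(3) by blast
    thus "\<exists>w. x - dif C w (0, 0) \<in> N" by (intro exI[of _ "\<lambda>(n, p). e p"]) (simp add: C_simps)
  next
    assume "\<exists>w. x - dif C w (0, 0) \<in> N"
    then obtain w where "x - (\<Sum>l\<in>I (Suc 0). w (Suc 0, l) * D 0 0 l) \<in> N" by (auto simp: C_simps)
    thus "x \<in> A" unfolding zero(3) One_nat_def by (rule exI[of _ "\<lambda>l. w (Suc 0, l)"])
  qed
  hence "cyc_res N A C (0, 0)" unfolding cyc_res_def using Cc ex zero by (simp add: lvlC C_simps)
  moreover have ent: "ent C (n, k) (Suc n, l) = D n k l" if "l \<in> I (Suc n)" for n k l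
  proof -
    have "ent C (n, k) (Suc n, l) = (\<Sum>j\<in>I (Suc n). if j = l then D n k j else 0)"
      unfolding ent_def C_simps unitv_def by (rule sum.cong) auto
    thus ?thesis using that finI by simp
  qed
  hence "graded_cpx Gs C" unfolding graded_cpx_def using st by (auto simp: lvlC C_simps stage_def)
  moreover have "minimal_cpx \<mm> C" unfolding minimal_cpx_def
    using st by (auto simp: C_simps stage_def intro!: is_ideal_sum[OF m(1)] is_ideal_mult[OF m(1)])
  ultimately show ?thesis by blast
qed

end

section \<open>Record rings as quotients of a type class ring\<close>

text \<open>A type cannot depend on the ring \<open>R\<close>. So take the product of \<^emph>\<open>all\<close> commutative ring structures on \<open>'a\<close> at once, a
  single ring that maps onto each of them by a projection. The integers are a further factor only to ensure \<open>0 \<noteq> 1\<close>, which the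
  type class demands and which fails in a product of zero rings.\<close>

typedef ('a, 'r) sect = "{p :: int \<times> (('a, 'r) ring_scheme \<Rightarrow> 'a).
    \<forall>R. if cring R then snd p R \<in> carrier R else snd p R = undefined}"
proof
  show "(0, \<lambda>R. if cring R then \<zero>\<^bsub>R\<^esub> else undefined) \<in> {p :: int \<times> (('a, 'r) ring_scheme \<Rightarrow> 'a).
    \<forall>R. if cring R then snd p R \<in> carrier R else snd p R = undefined}"
    by (auto simp: cring.cring_simprules)
qed

setup_lifting type_definition_sect

instantiation sect :: (type, type) comm_ring_1
begin

lift_definition zero_sect :: "('a, 'b) sect" is "(0, \<lambda>R. if cring R then \<zero>\<^bsub>R\<^esub> else undefined)"
  by (auto simp: cring.cring_simprules)
lift_definition one_sect :: "('a, 'b) sect" is "(1, \<lambda>R. if cring R then \<one>\<^bsub>R\<^esub> else undefined)"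
  by (auto simp: cring.cring_simprules)
lift_definition plus_sect :: "('a, 'b) sect \<Rightarrow> ('a, 'b) sect \<Rightarrow> ('a, 'b) sect" is
  "\<lambda>p q. (fst p + fst q, \<lambda>R. if cring R then snd p R \<oplus>\<^bsub>R\<^esub> snd q R else undefined)"
  by (auto simp: cring.cring_simprules)
lift_definition times_sect :: "('a, 'b) sect \<Rightarrow> ('a, 'b) sect \<Rightarrow> ('a, 'b) sect" is
  "\<lambda>p q. (fst p * fst q, \<lambda>R. if cring R then snd p R \<otimes>\<^bsub>R\<^esub> snd q R else undefined)"
  by (auto simp: cring.cring_simprules)
lift_definition uminus_sect :: "('a, 'b) sect \<Rightarrow> ('a, 'b) sect" is
  "\<lambda>p. (- fst p, \<lambda>R. if cring R then \<ominus>\<^bsub>R\<^esub> snd p R else undefined)"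
  by (auto simp: cring.cring_simprules)
lift_definition minus_sect :: "('a, 'b) sect \<Rightarrow> ('a, 'b) sect \<Rightarrow> ('a, 'b) sect" is
  "\<lambda>p q. (fst p - fst q, \<lambda>R. if cring R then snd p R \<ominus>\<^bsub>R\<^esub> snd q R else undefined)"
  by (auto simp: cring.cring_simprules)

instance
proof
  fix a b c :: "('a, 'b) sect"
  show "a * b * c = a * (b * c)" by transfer (auto simp: fun_eq_iff cring.cring_simprules)
  show "a * b = b * a" by transfer (auto simp: fun_eq_iff cring.cring_simprules)
  show "1 * a = a" by transfer (auto simp: fun_eq_iff prod_eq_iff cring.cring_simprules)
  show "a + b + c = a + (b + c)" by transfer (auto simp: fun_eq_iff cring.cring_simprules)
  show "a + b = b + a" by transfer (auto simp: fun_eq_iff cring.cring_simprules)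
  show "0 + a = a" by transfer (auto simp: fun_eq_iff prod_eq_iff cring.cring_simprules)
  show "- a + a = 0" by transfer (auto simp: fun_eq_iff cring.cring_simprules)
  show "a - b = a + - b" by transfer (auto simp: fun_eq_iff cring.cring_simprules)
  show "(a + b) * c = a * c + b * c" by transfer (auto simp: fun_eq_iff cring.cring_simprules algebra_simps)
  show "(0 :: ('a, 'b) sect) \<noteq> 1" by transfer auto
qed

end

lift_definition sect_at :: "('a, 'r) ring_scheme \<Rightarrow> ('a, 'r) sect \<Rightarrow> 'a" is "\<lambda>R p. snd p R" .

lemma sect_at:
  assumes "cring R"
  shows "sect_at R x \<in> carrier R" "sect_at R (x + y) = sect_at R x \<oplus>\<^bsub>R\<^esub> sect_at R y"
    "sect_at R (x * y) = sect_at R x \<otimes>\<^bsub>R\<^esub> sect_at R y" "sect_at R 1 = \<one>\<^bsub>R\<^esub>"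
  using assms by (transfer, auto)+

lemma sect_at_surj:
  assumes "cring R" "r \<in> carrier R" shows "\<exists>x. sect_at R x = r"
  using assms
proof (transfer fixing: R r)
  assume a: "cring R" "r \<in> carrier R"
  show "\<exists>x\<in>{p :: int \<times> (('a, 'b) ring_scheme \<Rightarrow> 'a). \<forall>R. if cring R then snd p R \<in> carrier R else snd p R = undefined}. snd x R = r"
    by (rule bexI[of _ "(0, \<lambda>R'. if cring R' then (if R' = R then r else \<zero>\<^bsub>R'\<^esub>) else undefined)"])
       (use a in \<open>auto simp: cring.cring_simprules\<close>)
qed

text \<open>A surjective ring homomorphism from a type class ring onto \<open>R\<close>. By \<open>pre\<close> the ideals of \<open>R\<close> correspond
  to the ideals that contain the kernel \<open>NN\<close>.\<close>

locale ring_cover = cring R for R :: "('a, 'r) ring_scheme" (structure) +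
  fixes ev :: "'s::comm_ring_1 \<Rightarrow> 'a"
  assumes ev_closed [simp, intro]: "ev x \<in> carrier R"
    and ev_add: "ev (x + y) = ev x \<oplus> ev y"
    and ev_mult: "ev (x * y) = ev x \<otimes> ev y"
    and ev_one: "ev 1 = \<one>"
    and ev_surj: "r \<in> carrier R \<Longrightarrow> \<exists>x. ev x = r"
begin

definition pre :: "'a set \<Rightarrow> 's set" where "pre A = {x. ev x \<in> A}"

abbreviation NN :: "'s set" where "NN \<equiv> pre {\<zero>}"

lemma ev_zero: "ev 0 = \<zero>"
proof -
  have "ev 0 \<oplus> ev 0 = ev 0 \<oplus> \<zero>" using ev_add[of 0 0] by simp
  thus ?thesis by (simp only: add.l_cancel ev_closed zero_closed)
qed

lemma ev_minus: "ev (- x) = \<ominus> ev x"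
  using ev_add[of "- x" x] ev_zero by (simp add: minus_equality)

lemma ev_diff: "ev (x - y) = ev x \<ominus> ev y"
  using ev_add[of x "- y"] by (simp add: ev_minus minus_eq)

lemma ev_eq_iff: "ev x = ev y \<longleftrightarrow> x - y \<in> NN"
  by (simp add: pre_def ev_diff)

lemma pre_ideal: assumes "ideal A R" shows "is_ideal (pre A)" "NN \<subseteq> pre A"
proof -
  interpret A: ideal A R by fact
  show "is_ideal (pre A)" by (auto simp: is_ideal_def pre_def ev_zero ev_add ev_mult A.I_l_closed)
  show "NN \<subseteq> pre A" by (auto simp: pre_def)
qed

lemma NN_ideal: "is_ideal NN" using pre_ideal(1)[OF zeroideal] .

lemma pre_image: assumes "is_ideal B" "NN \<subseteq> B" shows "pre (ev ` B) = B"
proof -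
  have "x \<in> B" if "ev x = ev y" "y \<in> B" for x y
    using that ev_eq_iff assms by (meson ideal_cong_mem subsetD)
  thus ?thesis by (auto simp: pre_def)
qed

lemma image_pre: "A \<subseteq> carrier R \<Longrightarrow> ev ` pre A = A"
  using ev_surj by (force simp: pre_def)

lemma image_ideal: assumes "is_ideal B" shows "ideal (ev ` B) R"
proof (rule idealI)
  show "ring R" by (rule ring_axioms)
  show "subgroup (ev ` B) (add_monoid R)"
  proof (rule add.subgroupI)
    show "ev ` B \<subseteq> carrier R" by auto
    show "ev ` B \<noteq> {}" using is_ideal_zero[OF assms] by auto
    show "\<ominus> a \<in> ev ` B" if aB: "a \<in> ev ` B" for a
    proof -
      obtain x where x: "x \<in> B" "a = ev x" using aB by auto
      show ?thesis unfolding x(2) ev_minus[symmetric] by (rule imageI) (rule is_ideal_minus[OF assms x(1)])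
    qed
    show "a \<oplus> b \<in> ev ` B" if abB: "a \<in> ev ` B" "b \<in> ev ` B" for a b
    proof -
      obtain x y where x: "x \<in> B" "a = ev x" "y \<in> B" "b = ev y" using abB by auto
      show ?thesis unfolding x(2,4) ev_add[symmetric] by (rule imageI) (rule is_ideal_add[OF assms x(1,3)])
    qed
  qed
  fix a r assume a: "a \<in> ev ` B" and r: "r \<in> carrier R"
  obtain x y where xy: "a = ev x" "x \<in> B" "r = ev y" using a ev_surj[OF r] by blast
  show "r \<otimes> a \<in> ev ` B" unfolding xy(1,3) ev_mult[symmetric] by (rule imageI) (rule is_ideal_mult[OF assms xy(2)])
  show "a \<otimes> r \<in> ev ` B" unfolding xy(1,3) ev_mult[symmetric] by (rule imageI) (rule is_ideal_mult_right[OF assms xy(2)])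
qed

lemma pre_Idl_least:
  assumes S: "S \<subseteq> carrier R" and B: "is_ideal B" "NN \<subseteq> B" and sub: "pre S \<subseteq> B"
  shows "pre (Idl S) \<subseteq> B"
proof -
  have "S \<subseteq> ev ` B" using image_pre[OF S] sub by blast
  hence "Idl S \<subseteq> ev ` B" by (rule genideal_minimal[OF image_ideal[OF B(1)]])
  hence "pre (Idl S) \<subseteq> pre (ev ` B)" by (auto simp: pre_def)
  thus ?thesis by (simp add: pre_image[OF B])
qed

lemma noeth_NN: assumes "noetherian_ring R" shows "noeth NN"
  unfolding noeth_def
proof (intro allI impI)
  interpret noetherian_ring R by fact
  fix A assume A: "is_ideal A" "NN \<subseteq> A"
  obtain S where S: "S \<subseteq> carrier R" "finite S" "ev ` A = Idl S" using finetely_gen[OF image_ideal[OF A(1)]] by blast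
  have "S \<subseteq> ev ` A" using S genideal_self by auto
  then obtain F where F: "finite F" "F \<subseteq> A" "S = ev ` F" using finite_subset_image[OF S(2)] by metis
  show "\<exists>F. finite F \<and> F \<subseteq> A \<and> (\<forall>B. is_ideal B \<longrightarrow> NN \<subseteq> B \<longrightarrow> F \<subseteq> B \<longrightarrow> A \<subseteq> B)"
  proof (intro exI[of _ F] conjI allI impI F)
    fix B assume B: "is_ideal B" "NN \<subseteq> B" "F \<subseteq> B"
    have "pre S \<subseteq> pre (ev ` B)" using F(3) B(3) by (auto simp: pre_def)
    hence "pre (Idl S) \<subseteq> B" by (intro pre_Idl_least S B) (simp add: pre_image[OF B(1,2)])
    thus "A \<subseteq> B" using S(3) pre_image[OF A] by simp
  qed
qed

text \<open>Bridges the two descriptions of finitely generated ideals.\<close>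

lemma pre_Idl_list: "pre (Idl (ev ` set ys)) = gid NN ys"
proof
  note G = gid_ideal[OF NN_ideal, of ys]
  have "pre (ev ` set ys) \<subseteq> gid NN ys"
    using pre_image[of "gid NN ys"] G by (auto simp: pre_def)
  thus "pre (Idl (ev ` set ys)) \<subseteq> gid NN ys" using G by (intro pre_Idl_least) auto
  have I: "ideal (Idl (ev ` set ys)) R" by (rule genideal_ideal) auto
  show "gid NN ys \<subseteq> pre (Idl (ev ` set ys))"
    by (rule gid_least[OF pre_ideal[OF I]]) (use genideal_self[of "ev ` set ys"] in \<open>auto simp: pre_def\<close>)
qed

text \<open>\<open>\<pi>\<close> presents \<open>M\<close> as the quotient of the covering ring by \<open>B\<close>. The instances are \<open>R\<close> itself and its quotients by
  ideals.\<close>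

definition module_cover :: "('a, 'b, 'm) module_scheme \<Rightarrow> ('s \<Rightarrow> 'b) \<Rightarrow> 's set \<Rightarrow> bool" where
  "module_cover M \<pi> B \<longleftrightarrow> abelian_monoid M \<and> carrier M = range \<pi> \<and> \<pi> 0 = \<zero>\<^bsub>M\<^esub> \<and>
     (\<forall>x y. \<pi> (x + y) = \<pi> x \<oplus>\<^bsub>M\<^esub> \<pi> y) \<and> (\<forall>r x. ev r \<odot>\<^bsub>M\<^esub> \<pi> x = \<pi> (r * x)) \<and>
     (\<forall>x y. \<pi> x = \<pi> y \<longleftrightarrow> x - y \<in> B)"

lemma self_cover: "module_cover (self_module R) ev NN"
proof -
  have "abelian_monoid (self_module R)"
    by (rule abelian_monoidI) (auto simp: self_module_def a_ac)
  moreover have "carrier R = range ev" using ev_surj by auto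
  ultimately show ?thesis unfolding module_cover_def
    by (auto simp: self_module_def ev_zero ev_add ev_mult ev_eq_iff)
qed

definition qmap :: "'a set \<Rightarrow> 's \<Rightarrow> 'a set" where "qmap A x = A +>\<^bsub>R\<^esub> ev x"

lemma quot_module_simps:
  "carrier (quot_module R A) = carrier (R Quot A)" "\<zero>\<^bsub>quot_module R A\<^esub> = \<zero>\<^bsub>R Quot A\<^esub>"
  "x \<oplus>\<^bsub>quot_module R A\<^esub> y = x \<oplus>\<^bsub>R Quot A\<^esub> y"
  "r \<odot>\<^bsub>quot_module R A\<^esub> y = (A +> r) \<otimes>\<^bsub>R Quot A\<^esub> y"
  by (simp_all add: quot_module_def)

lemma abelian_monoid_quot_module: assumes "ideal A R" shows "abelian_monoid (quot_module R A)"
proof -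
  interpret Q: ring "R Quot A" by (rule ideal.quotient_is_ring[OF assms])
  show ?thesis
  proof (rule abelian_monoidI, unfold quot_module_simps)
    fix x y z assume xyz: "x \<in> carrier (R Quot A)" "y \<in> carrier (R Quot A)" "z \<in> carrier (R Quot A)"
    show "x \<oplus>\<^bsub>R Quot A\<^esub> y \<oplus>\<^bsub>R Quot A\<^esub> z = x \<oplus>\<^bsub>R Quot A\<^esub> (y \<oplus>\<^bsub>R Quot A\<^esub> z)" by (rule Q.a_assoc[OF xyz])
  next
    fix x y assume xy: "x \<in> carrier (R Quot A)" "y \<in> carrier (R Quot A)"
    show "x \<oplus>\<^bsub>R Quot A\<^esub> y \<in> carrier (R Quot A)" by (rule Q.a_closed[OF xy])
    show "x \<oplus>\<^bsub>R Quot A\<^esub> y = y \<oplus>\<^bsub>R Quot A\<^esub> x" by (rule Q.a_comm[OF xy])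
  next
    show "\<zero>\<^bsub>R Quot A\<^esub> \<in> carrier (R Quot A)" by (rule Q.zero_closed)
    fix x assume "x \<in> carrier (R Quot A)"
    thus "\<zero>\<^bsub>R Quot A\<^esub> \<oplus>\<^bsub>R Quot A\<^esub> x = x" by (rule Q.l_zero)
  qed
qed

lemma quot_cover: assumes "ideal A R" shows "module_cover (quot_module R A) (qmap A) (pre A)"
proof -
  interpret A: ideal A R by fact
  have h: "((+>) A) \<in> ring_hom R (R Quot A)" by (rule A.rcos_ring_hom)
  have 2: "carrier (R Quot A) = range (qmap A)"
  proof -
    have "carrier (R Quot A) = (+>) A ` carrier R" by (auto simp: FactRing_def A_RCOSETS_def')
    also have "carrier R = range ev" using ev_surj by auto
    finally show ?thesis by (simp add: qmap_def[abs_def] image_image)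
  qed
  have 3: "qmap A x = qmap A y \<longleftrightarrow> x - y \<in> pre A" for x y
    unfolding qmap_def pre_def mem_Collect_eq ev_diff
    by (rule quotient_eq_iff_same_a_r_cos[OF assms ev_closed ev_closed, symmetric])
  have 4: "qmap A 0 = \<zero>\<^bsub>R Quot A\<^esub>"
    using a_rcos_zero[OF assms additive_subgroup.zero_closed[OF A.is_additive_subgroup]]
    by (simp add: qmap_def ev_zero FactRing_def)
  have 5: "qmap A (x + y) = qmap A x \<oplus>\<^bsub>R Quot A\<^esub> qmap A y" for x y
    unfolding qmap_def ev_add by (rule ring_hom_add[OF h]) auto
  have 6: "(A +> ev r) \<otimes>\<^bsub>R Quot A\<^esub> qmap A x = qmap A (r * x)" for r x
    unfolding qmap_def ev_mult by (rule ring_hom_mult[OF h, symmetric]) auto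
  show ?thesis unfolding module_cover_def quot_module_simps
    using abelian_monoid_quot_module[OF assms] 2 3 4 5 6 by blast
qed

lemma cover_finsum:
  assumes "module_cover M \<pi> B"
  shows "(\<Oplus>\<^bsub>M\<^esub>l\<in>L. \<pi> (f l)) = \<pi> (\<Sum>l\<in>L. f l)"
proof -
  interpret M: abelian_monoid M using assms by (simp add: module_cover_def)
  have c: "\<pi> x \<in> carrier M" for x using assms by (auto simp: module_cover_def)
  have z: "\<pi> 0 = \<zero>\<^bsub>M\<^esub>" "\<pi> (x + y) = \<pi> x \<oplus>\<^bsub>M\<^esub> \<pi> y" for x y using assms by (auto simp: module_cover_def)
  show ?thesis
  proof (induction L rule: infinite_finite_induct)
    case (insert x F)
    thus ?case using c by (simp add: z)
  qed (simp_all add: z)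
qed

text \<open>The element of \<open>M\<^sup>n\<close> that is represented by \<open>w\<close>; the restriction matches the extensional functions of the power
  module.\<close>

definition vres :: "('s \<Rightarrow> 'b) \<Rightarrow> nat \<Rightarrow> (nat \<Rightarrow> 's) \<Rightarrow> nat \<Rightarrow> 'b" where
  "vres \<pi> n w = (\<lambda>k\<in>{..<n}. \<pi> (w k))"

lemma power_carrier:
  assumes "module_cover M \<pi> B" shows "carrier (power_module M n) = range (vres \<pi> n)"
proof
  have c: "carrier M = range \<pi>" using assms by (simp add: module_cover_def)
  show "range (vres \<pi> n) \<subseteq> carrier (power_module M n)" by (intro image_subsetI) (simp add: power_module_def vres_def c)
  show "carrier (power_module M n) \<subseteq> range (vres \<pi> n)"
  proof
    fix v assume v: "v \<in> carrier (power_module M n)"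
    hence "\<forall>k\<in>{..<n}. \<exists>x. v k = \<pi> x" using c by (auto simp: power_module_def)
    then obtain w where w: "\<And>k. k < n \<Longrightarrow> v k = \<pi> (w k)" by (metis lessThan_iff)
    have "v = vres \<pi> n w" using v w by (auto simp: power_module_def vres_def PiE_def extensional_def)
    thus "v \<in> range (vres \<pi> n)" by blast
  qed
qed

lemma vres_eq_iff:
  assumes "module_cover M \<pi> B" shows "vres \<pi> n w = vres \<pi> n w' \<longleftrightarrow> (\<forall>k<n. w k - w' k \<in> B)"
  using assms by (auto simp: module_cover_def vres_def fun_eq_iff restrict_def)

lemma power_zero:
  assumes "module_cover M \<pi> B" shows "\<zero>\<^bsub>power_module M n\<^esub> = vres \<pi> n (\<lambda>_. 0)"
  using assms by (auto simp: module_cover_def vres_def power_module_def)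

lemma vres_zero_iff:
  assumes "module_cover M \<pi> B" shows "vres \<pi> n w = \<zero>\<^bsub>power_module M n\<^esub> \<longleftrightarrow> (\<forall>k<n. w k \<in> B)"
  using vres_eq_iff[OF assms, of n w "\<lambda>_. 0"] power_zero[OF assms] by simp

lemma matrix_map_cover:
  assumes M: "module_cover M \<pi> B" and D: "\<And>k l. k < p \<Longrightarrow> l < q \<Longrightarrow> A k l = ev (D k l)"
  shows "matrix_map M p q A (vres \<pi> q w) = vres \<pi> p (\<lambda>k. \<Sum>l<q. w l * D k l)"
proof -
  interpret M: abelian_monoid M using M by (simp add: module_cover_def)
  have c: "\<pi> x \<in> carrier M" for x using M by (auto simp: module_cover_def)
  have s: "ev r \<odot>\<^bsub>M\<^esub> \<pi> x = \<pi> (r * x)" for r x using M by (auto simp: module_cover_def)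
  have "(\<Oplus>\<^bsub>M\<^esub>l\<in>{..<q}. A k l \<odot>\<^bsub>M\<^esub> vres \<pi> q w l) = \<pi> (\<Sum>l<q. w l * D k l)" if "k < p" for k
  proof -
    have "(\<Oplus>\<^bsub>M\<^esub>l\<in>{..<q}. A k l \<odot>\<^bsub>M\<^esub> vres \<pi> q w l) = (\<Oplus>\<^bsub>M\<^esub>l\<in>{..<q}. \<pi> (w l * D k l))"
      by (rule M.finsum_cong') (use that D s c in \<open>auto simp: vres_def mult.commute\<close>)
    thus ?thesis by (simp add: cover_finsum[OF M])
  qed
  thus ?thesis by (auto simp: matrix_map_def vres_def)
qed

text \<open>The common shape of all exactness conditions of a free resolution, moved to representatives.\<close>

lemma kernel_image_iff:
  assumes M: "module_cover M \<pi> B" and Q: "module_cover M' \<pi>' B'"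
    and f: "\<And>w. f (vres \<pi> p w) = z \<longleftrightarrow> P w" and g: "\<And>w. g (vres \<pi>' q w) = vres \<pi> p (h w)"
  shows "{v \<in> carrier (power_module M p). f v = z} = g ` carrier (power_module M' q) \<longleftrightarrow>
     (\<forall>w. P w \<longleftrightarrow> (\<exists>u. \<forall>k<p. w k - h u k \<in> B))"
proof -
  have "{v \<in> carrier (power_module M p). f v = z} = vres \<pi> p ` {w. P w}"
    using f by (auto simp: power_carrier[OF M])
  moreover have "g ` carrier (power_module M' q) = range (\<lambda>w. vres \<pi> p (h w))"
    by (auto simp: power_carrier[OF Q] g image_image)
  moreover have "vres \<pi> p ` {w. P w} = range (\<lambda>w. vres \<pi> p (h w)) \<longleftrightarrow> (\<forall>w. P w \<longleftrightarrow> (\<exists>u. vres \<pi> p w = vres \<pi> p (h u)))"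
  proof
    assume e: "vres \<pi> p ` {w. P w} = range (\<lambda>w. vres \<pi> p (h w))"
    show "\<forall>w. P w \<longleftrightarrow> (\<exists>u. vres \<pi> p w = vres \<pi> p (h u))"
    proof (intro allI iffI)
      fix w assume "P w"
      hence "vres \<pi> p w \<in> range (\<lambda>w. vres \<pi> p (h w))" using e by blast
      thus "\<exists>u. vres \<pi> p w = vres \<pi> p (h u)" by auto
    next
      fix w assume "\<exists>u. vres \<pi> p w = vres \<pi> p (h u)"
      hence "vres \<pi> p w \<in> vres \<pi> p ` {w. P w}" using e by auto
      then obtain w' where "P w'" "vres \<pi> p w = vres \<pi> p w'" by auto
      thus "P w" using f by metis
    qed
  qed (use f in \<open>auto; metis\<close>)
  ultimately show ?thesis by (simp only: vres_eq_iff[OF M])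
qed

text \<open>A free resolution in terms of representatives of its matrix entries and of its augmentation.\<close>

definition mat_res :: "'s set \<Rightarrow> (nat \<Rightarrow> nat) \<Rightarrow> (nat \<Rightarrow> nat \<Rightarrow> nat \<Rightarrow> 's) \<Rightarrow> (nat \<Rightarrow> 's) \<Rightarrow> bool" where
  "mat_res A r D a \<longleftrightarrow>
     (\<exists>u. (\<Sum>k<r 0. u k * a k) - 1 \<in> A) \<and>
     (\<forall>w. (\<Sum>k<r 0. w k * a k) \<in> A \<longleftrightarrow> (\<exists>u. \<forall>k<r 0. w k - (\<Sum>l<r 1. u l * D 0 k l) \<in> NN)) \<and>
     (\<forall>i w. (\<forall>k<r i. (\<Sum>l<r (Suc i). w l * D i k l) \<in> NN) \<longleftrightarrow>
        (\<exists>u. \<forall>k<r (Suc i). w k - (\<Sum>l<r (Suc (Suc i)). u l * D (Suc i) k l) \<in> NN))"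

lemma free_resolution_iff:
  assumes A: "ideal A R" and D: "\<And>i k l. k < rank F i \<Longrightarrow> l < rank F (Suc i) \<Longrightarrow> diff F i k l = ev (D i k l)"
    and a: "\<And>k. k < rank F 0 \<Longrightarrow> aug F k = qmap A (a k)"
  shows "free_resolution R (quot_module R A) F \<longleftrightarrow> mat_res (pre A) (rank F) D a"
proof -
  let ?M = "quot_module R A"
  note Q = quot_cover[OF A]
  interpret M: abelian_monoid ?M using Q by (simp add: module_cover_def)
  have Qc: "carrier ?M = range (qmap A)" and Qs: "\<And>r x. ev r \<odot>\<^bsub>?M\<^esub> qmap A x = qmap A (r * x)"
    and Qe: "\<And>x y. qmap A x = qmap A y \<longleftrightarrow> x - y \<in> pre A" and Q0: "qmap A 0 = \<zero>\<^bsub>?M\<^esub>"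
    using Q by (auto simp: module_cover_def)
  have aug: "aug_map ?M F (vres ev (rank F 0) w) = qmap A (\<Sum>k<rank F 0. w k * a k)" for w
  proof -
    have "aug_map ?M F (vres ev (rank F 0) w) = (\<Oplus>\<^bsub>?M\<^esub>k\<in>{..<rank F 0}. qmap A (w k * a k))"
      unfolding aug_map_def by (rule M.finsum_cong') (auto simp: a vres_def Qs Qc)
    thus ?thesis by (simp add: cover_finsum[OF Q])
  qed
  have dm: "diff_map (self_module R) F i (vres ev (rank F (Suc i)) w) = vres ev (rank F i) (\<lambda>k. \<Sum>l<rank F (Suc i). w l * D i k l)" for i w
    unfolding diff_map_def by (rule matrix_map_cover[OF self_cover D])
  have c1: "\<forall>i. \<forall>k<rank F i. \<forall>l<rank F (Suc i). diff F i k l \<in> carrier R" using D by auto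
  have c2: "\<forall>k<rank F 0. aug F k \<in> carrier ?M" using a Qc by auto
  have c3: "aug_map ?M F ` carrier (free_module R (rank F 0)) = carrier ?M \<longleftrightarrow> (\<exists>u. (\<Sum>k<rank F 0. u k * a k) - 1 \<in> pre A)"
  proof -
    have e: "aug_map ?M F ` carrier (free_module R (rank F 0)) = range (\<lambda>w. qmap A (\<Sum>k<rank F 0. w k * a k))"
      by (auto simp: power_carrier[OF self_cover] aug image_image)
    show ?thesis unfolding e Qc
    proof
      assume "range (\<lambda>w. qmap A (\<Sum>k<rank F 0. w k * a k)) = range (qmap A)"
      hence "qmap A 1 \<in> range (\<lambda>w. qmap A (\<Sum>k<rank F 0. w k * a k))" by auto
      then obtain u where "qmap A (\<Sum>k<rank F 0. u k * a k) = qmap A 1" by auto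
      thus "\<exists>u. (\<Sum>k<rank F 0. u k * a k) - 1 \<in> pre A" unfolding Qe by (rule exI[of _ u])
    next
      assume "\<exists>u. (\<Sum>k<rank F 0. u k * a k) - 1 \<in> pre A"
      then obtain u where u: "(\<Sum>k<rank F 0. u k * a k) - 1 \<in> pre A" by blast
      have "qmap A (\<Sum>k<rank F 0. (x * u k) * a k) = qmap A x" for x
      proof -
        have "(\<Sum>k<rank F 0. (x * u k) * a k) - x = x * ((\<Sum>k<rank F 0. u k * a k) - 1)"
          by (simp add: sum_distrib_left right_diff_distrib mult.assoc)
        thus ?thesis using is_ideal_mult[OF pre_ideal(1)[OF A] u] Qe by simp
      qed
      hence "qmap A x \<in> range (\<lambda>w. qmap A (\<Sum>k<rank F 0. w k * a k))" for x
        by (intro range_eqI[of _ _ "\<lambda>k. x * u k"]) simp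
      thus "range (\<lambda>w. qmap A (\<Sum>k<rank F 0. w k * a k)) = range (qmap A)" by auto
    qed
  qed
  have c4: "{v \<in> carrier (free_module R (rank F 0)). aug_map ?M F v = \<zero>\<^bsub>?M\<^esub>} =
       diff_map (self_module R) F 0 ` carrier (free_module R (rank F 1)) \<longleftrightarrow>
     (\<forall>w. (\<Sum>k<rank F 0. w k * a k) \<in> pre A \<longleftrightarrow> (\<exists>u. \<forall>k<rank F 0. w k - (\<Sum>l<rank F 1. u l * D 0 k l) \<in> NN))"
  proof (rule kernel_image_iff[OF self_cover self_cover])
    show "aug_map ?M F (vres ev (rank F 0) w) = \<zero>\<^bsub>?M\<^esub> \<longleftrightarrow> (\<Sum>k<rank F 0. w k * a k) \<in> pre A" for w
      unfolding aug Q0[symmetric] Qe by simp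
    show "diff_map (self_module R) F 0 (vres ev (rank F 1) w) = vres ev (rank F 0) (\<lambda>k. \<Sum>l<rank F 1. w l * D 0 k l)" for w
      using dm[of 0 w] by simp
  qed
  have c5: "{v \<in> carrier (free_module R (rank F (Suc i))). diff_map (self_module R) F i v = \<zero>\<^bsub>free_module R (rank F i)\<^esub>} =
          diff_map (self_module R) F (Suc i) ` carrier (free_module R (rank F (Suc (Suc i)))) \<longleftrightarrow>
     (\<forall>w. (\<forall>k<rank F i. (\<Sum>l<rank F (Suc i). w l * D i k l) \<in> NN) \<longleftrightarrow>
        (\<exists>u. \<forall>k<rank F (Suc i). w k - (\<Sum>l<rank F (Suc (Suc i)). u l * D (Suc i) k l) \<in> NN))" for i
    by (rule kernel_image_iff[OF self_cover self_cover]) (auto simp: dm vres_zero_iff[OF self_cover])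
  show ?thesis unfolding free_resolution_def mat_res_def using c1 c2 c3 c4 c5 by simp
qed

text \<open>The complex with numbered bases that is given by matrices, with internal degrees \<open>sh\<close>.\<close>

definition cplx :: "(nat \<Rightarrow> nat) \<Rightarrow> (nat \<Rightarrow> nat \<Rightarrow> nat) \<Rightarrow> (nat \<Rightarrow> nat \<Rightarrow> nat \<Rightarrow> 's) \<Rightarrow> (nat \<times> nat, 's) based" where
  "cplx r sh D = \<lparr>basis = {(i, k). k < r i}, hdeg = fst, ideg = (\<lambda>(i, k). sh i k),
     dif = (\<lambda>v (i, k). \<Sum>l<r (Suc i). v (Suc i, l) * D i k l)\<rparr>"

lemma cplx_simps: "basis (cplx r sh D) = {(i, k). k < r i}" "hdeg (cplx r sh D) = fst" "ideg (cplx r sh D) (i, k) = sh i k"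
  "dif (cplx r sh D) v (i, k) = (\<Sum>l<r (Suc i). v (Suc i, l) * D i k l)"
  by (auto simp: cplx_def)

lemma lvl_cplx: "lvl (cplx r sh D) n = Pair n ` {..<r n}"
  by (auto simp: lvl_def cplx_simps)

lemma ent_cplx: assumes "l < r (Suc i)" shows "ent (cplx r sh D) (i, k) (Suc i, l) = D i k l"
proof -
  have "ent (cplx r sh D) (i, k) (Suc i, l) = (\<Sum>j<r (Suc i). if j = l then D i k j else 0)"
    unfolding ent_def cplx_simps unitv_def by (rule sum.cong) auto
  thus ?thesis using assms by simp
qed

lemma mat_res_with:
  assumes "mat_res A r D a"
  shows "res_with NN A (cplx r sh D) (\<lambda>(i, k). a k)"
proof -
  have ker: "(\<forall>k<r i. (\<Sum>l<r (Suc i). w l * D i k l) \<in> NN) \<longleftrightarrow>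
        (\<exists>u. \<forall>k<r (Suc i). w k - (\<Sum>l<r (Suc (Suc i)). u l * D (Suc i) k l) \<in> NN)" for i w
    using assms by (auto simp: mat_res_def)
  have ker0: "(\<Sum>k<r 0. w k * a k) \<in> A \<longleftrightarrow> (\<exists>u. \<forall>k<r 0. w k - (\<Sum>l<r 1. u l * D 0 k l) \<in> NN)" for w
    using assms by (auto simp: mat_res_def)
  let ?C = "cplx r sh D"
  have fin: "finite (lvl ?C n)" for n by (simp add: lvl_cplx)
  have s0: "(\<Sum>k\<in>lvl ?C 0. f k) = (\<Sum>k<r 0. f (0, k))" for f :: "nat \<times> nat \<Rightarrow> 's"
    unfolding lvl_cplx by (simp add: sum.reindex inj_on_def)
  have "is_complex NN ?C" unfolding is_complex_def
  proof (intro conjI allI ballI fin)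
    fix k assume k: "k \<in> basis ?C"
    obtain n i where [simp]: "k = (n, i)" by (cases k)
    show "lin_on (lvl ?C (Suc (hdeg ?C k))) (\<lambda>v. dif ?C v k)" unfolding \<open>k = (n, i)\<close> cplx_simps
      by (intro lin_on_setsum lin_on_times_right lin_on_coord fin) (auto simp: lvl_cplx)
    fix v
    have "\<forall>k<r n. (\<Sum>l<r (Suc n). (\<Sum>p<r (Suc (Suc n)). v (Suc (Suc n), p) * D (Suc n) l p) * D n k l) \<in> NN"
      by (rule iffD2[OF ker], rule exI[of _ "\<lambda>p. v (Suc (Suc n), p)"]) (simp add: is_ideal_zero[OF NN_ideal])
    thus "dif ?C (dif ?C v) k \<in> NN" using k by (simp add: cplx_simps)
  qed
  moreover have "exact NN ?C" unfolding exact_def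
  proof (intro allI impI)
    fix n v assume v: "\<forall>k\<in>lvl ?C n. dif ?C v k \<in> NN"
    hence "\<forall>k<r n. (\<Sum>l<r (Suc n). v (Suc n, l) * D n k l) \<in> NN" by (simp add: lvl_cplx cplx_simps)
    then obtain e where "\<forall>l<r (Suc n). v (Suc n, l) - (\<Sum>p<r (Suc (Suc n)). e p * D (Suc n) l p) \<in> NN"
      using iffD1[OF ker[of n "\<lambda>l. v (Suc n, l)"]] by blast
    thus "\<exists>w. \<forall>k\<in>lvl ?C (Suc n). v k - dif ?C w k \<in> NN"
      by (intro exI[of _ "\<lambda>(n, p). e p"]) (simp add: lvl_cplx cplx_simps)
  qed
  moreover have "\<exists>u. (\<Sum>k\<in>lvl ?C 0. u k * (\<lambda>(i, k). a k) k) - 1 \<in> A"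
  proof -
    obtain u where "(\<Sum>k<r 0. u k * a k) - 1 \<in> A" using assms by (auto simp: mat_res_def)
    thus ?thesis unfolding s0 by (intro exI[of _ "\<lambda>(i, k). u k"]) simp
  qed
  moreover have "(\<Sum>k\<in>lvl ?C 0. dif ?C w k * (\<lambda>(i, k). a k) k) \<in> A" for w
  proof -
    have "(\<Sum>k<r 0. (\<Sum>l<r 1. w (1, l) * D 0 k l) * a k) \<in> A"
      by (rule iffD2[OF ker0], rule exI[of _ "\<lambda>l. w (1, l)"]) (simp add: is_ideal_zero[OF NN_ideal])
    thus ?thesis unfolding s0 by (simp add: cplx_simps)
  qed
  moreover have "\<exists>w. \<forall>k\<in>lvl ?C 0. v k - dif ?C w k \<in> NN" if "(\<Sum>k\<in>lvl ?C 0. v k * (\<lambda>(i, k). a k) k) \<in> A" for v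
  proof -
    have "(\<Sum>k<r 0. v (0, k) * a k) \<in> A" using that unfolding s0 by simp
    then obtain u where "\<forall>k<r 0. v (0, k) - (\<Sum>l<r 1. u l * D 0 k l) \<in> NN" using iffD1[OF ker0[of "\<lambda>k. v (0, k)"]] by blast
    thus ?thesis by (intro exI[of _ "\<lambda>(n, p). u p"]) (simp add: lvl_cplx cplx_simps)
  qed
  ultimately show ?thesis unfolding res_with_def by blast
qed

lemma cyc_res_matrix:
  fixes C :: "('i, 's) based"
  assumes C: "cyc_res NN A C e" and b: "\<And>n. bij_betw (\<beta> n) {..<r n} (lvl C n)"
  shows "mat_res A r (\<lambda>i k l. ent C (\<beta> i k) (\<beta> (Suc i) l)) (\<lambda>_. 1)"
proof -
  note Cc = cyc_resD(1)[OF C] and A = cyc_res_ideal[OF NN_ideal C]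
  have sr: "(\<Sum>k\<in>lvl C n. f k) = (\<Sum>k<r n. f (\<beta> n k))" for f :: "'i \<Rightarrow> 's" and n
    by (rule sum.reindex_bij_betw[OF b, symmetric])
  have bl: "\<beta> n k \<in> lvl C n" if "k < r n" for n k using b that by (auto simp: bij_betw_def)
  have "card (lvl C 0) = r 0" using bij_betw_same_card[OF b[of 0]] by simp
  hence r0: "r 0 = 1" by (simp add: cyc_resD(3)[OF C])
  hence b0: "\<beta> 0 0 = e" using bl[of 0 0] by (simp add: cyc_resD(3)[OF C])
  have dif: "dif C v (\<beta> n k) = (\<Sum>l<r (Suc n). v (\<beta> (Suc n) l) * ent C (\<beta> n k) (\<beta> (Suc n) l))" if "k < r n" for v n k
    unfolding dif_expand[OF Cc bl[OF that]] sr by simp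
  have lift: "\<exists>v. \<forall>l<r n. v (\<beta> n l) = w l" for n and w :: "nat \<Rightarrow> 's"
  proof (intro exI allI impI)
    fix l assume "l < r n"
    thus "w (the_inv_into {..<r n} (\<beta> n) (\<beta> n l)) = w l" using b[of n] by (simp add: bij_betw_def the_inv_into_f_f)
  qed
  show ?thesis unfolding mat_res_def
  proof (intro conjI allI)
    show "\<exists>u. (\<Sum>k<r 0. u k * 1) - 1 \<in> A" by (rule exI[of _ "\<lambda>_. 1"]) (simp add: r0 is_ideal_zero[OF A(1)])
  next
    fix w
    show "(\<Sum>k<r 0. w k * 1) \<in> A \<longleftrightarrow> (\<exists>u. \<forall>k<r 0. w k - (\<Sum>l<r 1. u l * ent C (\<beta> 0 k) (\<beta> (Suc 0) l)) \<in> NN)"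
    proof
      assume "(\<Sum>k<r 0. w k * 1) \<in> A"
      then obtain v where "w 0 - dif C v e \<in> NN" by (auto simp: r0 cyc_resD(7)[OF C])
      thus "\<exists>u. \<forall>k<r 0. w k - (\<Sum>l<r 1. u l * ent C (\<beta> 0 k) (\<beta> (Suc 0) l)) \<in> NN"
        using dif[of 0 0 v] by (intro exI[of _ "\<lambda>l. v (\<beta> (Suc 0) l)"]) (simp add: r0 b0)
    next
      assume "\<exists>u. \<forall>k<r 0. w k - (\<Sum>l<r 1. u l * ent C (\<beta> 0 k) (\<beta> (Suc 0) l)) \<in> NN"
      then obtain u where u: "w 0 - (\<Sum>l<r 1. u l * ent C e (\<beta> (Suc 0) l)) \<in> NN" by (auto simp: r0 b0)
      obtain v where v: "\<forall>l<r 1. v (\<beta> 1 l) = u l" using lift by blast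
      have "w 0 - dif C v e \<in> NN" using u v dif[of 0 0 v] by (simp add: r0 b0)
      thus "(\<Sum>k<r 0. w k * 1) \<in> A" by (auto simp: r0 cyc_resD(7)[OF C])
    qed
  next
    fix i and w :: "nat \<Rightarrow> 's"
    obtain v where v: "\<forall>l<r (Suc i). v (\<beta> (Suc i) l) = w l" using lift by blast
    have dv: "dif C v (\<beta> i k) = (\<Sum>l<r (Suc i). w l * ent C (\<beta> i k) (\<beta> (Suc i) l))" if "k < r i" for k
      using dif[OF that] v by simp
    show "(\<forall>k<r i. (\<Sum>l<r (Suc i). w l * ent C (\<beta> i k) (\<beta> (Suc i) l)) \<in> NN) \<longleftrightarrow>
        (\<exists>u. \<forall>k<r (Suc i). w k - (\<Sum>l<r (Suc (Suc i)). u l * ent C (\<beta> (Suc i) k) (\<beta> (Suc (Suc i)) l)) \<in> NN)"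
    proof
      assume a: "\<forall>k<r i. (\<Sum>l<r (Suc i). w l * ent C (\<beta> i k) (\<beta> (Suc i) l)) \<in> NN"
      have "dif C v x \<in> NN" if "x \<in> lvl C i" for x
      proof -
        obtain k where "k < r i" "x = \<beta> i k" using b[of i] \<open>x \<in> lvl C i\<close> by (auto simp: bij_betw_def)
        thus ?thesis using a dv by simp
      qed
      then obtain z where z: "\<forall>k\<in>lvl C (Suc i). v k - dif C z k \<in> NN" using exactD[OF cyc_resD(2)[OF C]] by blast
      show "\<exists>u. \<forall>k<r (Suc i). w k - (\<Sum>l<r (Suc (Suc i)). u l * ent C (\<beta> (Suc i) k) (\<beta> (Suc (Suc i)) l)) \<in> NN"
      proof (intro exI[of _ "\<lambda>l. z (\<beta> (Suc (Suc i)) l)"] allI impI)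
        fix k assume k: "k < r (Suc i)"
        show "w k - (\<Sum>l<r (Suc (Suc i)). z (\<beta> (Suc (Suc i)) l) * ent C (\<beta> (Suc i) k) (\<beta> (Suc (Suc i)) l)) \<in> NN"
          using z[rule_format, OF bl[OF k]] v[rule_format, OF k] dif[OF k, of z] by simp
      qed
    next
      assume "\<exists>u. \<forall>k<r (Suc i). w k - (\<Sum>l<r (Suc (Suc i)). u l * ent C (\<beta> (Suc i) k) (\<beta> (Suc (Suc i)) l)) \<in> NN"
      then obtain u where u: "\<forall>k<r (Suc i). w k - (\<Sum>l<r (Suc (Suc i)). u l * ent C (\<beta> (Suc i) k) (\<beta> (Suc (Suc i)) l)) \<in> NN" by blast
      obtain z where z: "\<forall>l<r (Suc (Suc i)). z (\<beta> (Suc (Suc i)) l) = u l" using lift by blast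
      have vz: "v x - dif C z x \<in> NN" if "x \<in> lvl C (Suc i)" for x
      proof -
        obtain k where "k < r (Suc i)" "x = \<beta> (Suc i) k" using b[of "Suc i"] \<open>x \<in> lvl C (Suc i)\<close> by (auto simp: bij_betw_def)
        thus ?thesis using u v z dif[of k "Suc i" z] by simp
      qed
      show "\<forall>k<r i. (\<Sum>l<r (Suc i). w l * ent C (\<beta> i k) (\<beta> (Suc i) l)) \<in> NN"
      proof (intro allI impI)
        fix k assume k: "k < r i"
        have "dif C v (\<beta> i k) - dif C (dif C z) (\<beta> i k) \<in> NN"
          by (rule lin_on_cong_ideal[OF is_complex_lin_lvl[OF Cc bl[OF k]] NN_ideal vz])
        hence "dif C v (\<beta> i k) \<in> NN"
          by (rule ideal_cong_mem[OF NN_ideal]) (rule is_complex_sq[OF Cc lvl_basis[OF bl[OF k]]])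
        thus "(\<Sum>l<r (Suc i). w l * ent C (\<beta> i k) (\<beta> (Suc i) l)) \<in> NN" using dv[OF k] by simp
      qed
    qed
  qed
qed

end

section \<open>Graded rings and their maximal ideals\<close>

lemma exists_maximal_ideal:
  assumes B: "is_ideal B" "1 \<notin> B"
  shows "\<exists>Q. is_ideal Q \<and> B \<subseteq> Q \<and> 1 \<notin> Q \<and> (\<forall>C. is_ideal C \<longrightarrow> Q \<subseteq> C \<longrightarrow> 1 \<notin> C \<longrightarrow> C = Q)"
proof -
  let ?A = "{Q. is_ideal Q \<and> B \<subseteq> Q \<and> 1 \<notin> Q}"
  have "\<exists>M\<in>?A. \<forall>C\<in>?A. M \<subseteq> C \<longrightarrow> C = M"
  proof (rule subset_Zorn_nonempty)
    show "?A \<noteq> {}" using B by blast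
    fix \<C> assume ne: "\<C> \<noteq> {}" and ch: "subset.chain ?A \<C>"
    have sub: "is_ideal C" "B \<subseteq> C" "1 \<notin> C" if "C \<in> \<C>" for C
      using ch that by (auto simp: subset.chain_def)
    obtain C0 where C0: "C0 \<in> \<C>" using ne by blast
    have "is_ideal (\<Union>\<C>)" unfolding is_ideal_def
    proof (intro conjI ballI allI)
      show "0 \<in> \<Union>\<C>" using C0 is_ideal_zero[OF sub(1)[OF C0]] by (rule UnionI)
    next
      fix r x assume "x \<in> \<Union>\<C>"
      then obtain C where C: "C \<in> \<C>" "x \<in> C" by (rule UnionE)
      show "r * x \<in> \<Union>\<C>" by (rule UnionI[OF C(1) is_ideal_mult[OF sub(1)[OF C(1)] C(2)]])
    next
      fix x y assume "x \<in> \<Union>\<C>" "y \<in> \<Union>\<C>"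
      then obtain C D where CD: "C \<in> \<C>" "x \<in> C" "D \<in> \<C>" "y \<in> D" by (elim UnionE)
      hence "C \<subseteq> D \<or> D \<subseteq> C" using ch by (auto simp: subset.chain_def)
      then obtain E where E: "E \<in> \<C>" "x \<in> E" "y \<in> E" using CD by auto
      show "x + y \<in> \<Union>\<C>" by (rule UnionI[OF E(1) is_ideal_add[OF sub(1)[OF E(1)] E(2,3)]])
    qed
    moreover have "B \<subseteq> \<Union>\<C>" using sub(2)[OF C0] C0 by auto
    moreover have "1 \<notin> \<Union>\<C>" using sub(3) by auto
    ultimately show "\<Union>\<C> \<in> ?A" by simp
  qed
  then obtain Q where "Q \<in> ?A" "\<forall>C\<in>?A. Q \<subseteq> C \<longrightarrow> C = Q" by (rule bexE)
  hence "is_ideal Q \<and> B \<subseteq> Q \<and> 1 \<notin> Q \<and> (\<forall>C. is_ideal C \<longrightarrow> Q \<subseteq> C \<longrightarrow> 1 \<notin> C \<longrightarrow> C = Q)" by auto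
  thus ?thesis by blast
qed

lemma ideal_sum:
  assumes A: "is_ideal A" and B: "is_ideal B"
  shows "is_ideal {x. \<exists>a\<in>A. x - a \<in> B}" "A \<subseteq> {x. \<exists>a\<in>A. x - a \<in> B}" "B \<subseteq> {x. \<exists>a\<in>A. x - a \<in> B}"
proof -
  show 1: "A \<subseteq> {x. \<exists>a\<in>A. x - a \<in> B}" using is_ideal_zero[OF B] by (auto intro!: bexI)
  show "B \<subseteq> {x. \<exists>a\<in>A. x - a \<in> B}" using is_ideal_zero[OF A] by (auto intro!: bexI[of _ 0])
  show "is_ideal {x. \<exists>a\<in>A. x - a \<in> B}" unfolding is_ideal_def
  proof (intro conjI ballI allI)
    show "0 \<in> {x. \<exists>a\<in>A. x - a \<in> B}" using 1 is_ideal_zero[OF A] by blast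
  next
    fix x y assume "x \<in> {x. \<exists>a\<in>A. x - a \<in> B}" "y \<in> {x. \<exists>a\<in>A. x - a \<in> B}"
    then obtain a b where ab: "a \<in> A" "x - a \<in> B" "b \<in> A" "y - b \<in> B" by blast
    have "x + y - (a + b) \<in> B" using is_ideal_add[OF B ab(2,4)] by (simp add: algebra_simps)
    thus "x + y \<in> {x. \<exists>a\<in>A. x - a \<in> B}" using is_ideal_add[OF A ab(1,3)] by (intro CollectI bexI)
  next
    fix r x assume "x \<in> {x. \<exists>a\<in>A. x - a \<in> B}"
    then obtain a where a: "a \<in> A" "x - a \<in> B" by blast
    have "r * x - r * a \<in> B" using is_ideal_mult[OF B a(2), of r] by (simp add: algebra_simps)
    thus "r * x \<in> {x. \<exists>a\<in>A. x - a \<in> B}" using is_ideal_mult[OF A a(1)] by (intro CollectI bexI)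
  qed
qed

context graded_mod begin

lemma cmp_N: "x \<in> N \<Longrightarrow> cmp x d \<in> N" using cmp_eq[OF dec_N, of x d] by simp
lemma cmp_add: "cmp (x + y) d - (cmp x d + cmp y d) \<in> N" by (rule cmp_eq[OF dec_add[OF dec_cmp dec_cmp]])
lemma cmp_Gr: "x \<in> Gr e \<Longrightarrow> cmp x d - (if d = e then x else 0) \<in> N" by (rule cmp_eq[OF dec_Gr])

text \<open>The component of a product is the sum over the products of components, stated so that the components of \<open>x\<close> appear as factors.\<close>

lemma cmp_mult: "\<exists>n. cmp (r * x) d - (\<Sum>e\<le>n. hc d e x * cmp r e) \<in> N"
proof -
  obtain n where n: "r - (\<Sum>e\<le>n. cmp r e) \<in> N" using dec_cmp[of r] by (auto simp: dec_def)
  have "r * x - (\<Sum>e\<le>n. x * cmp r e) \<in> N"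
    using is_ideal_mult[OF N n, of x] by (simp add: right_diff_distrib sum_distrib_left mult.commute)
  hence 1: "hc d 0 (r * x) - hc d 0 (\<Sum>e\<le>n. x * cmp r e) \<in> N" by (rule hc_cong)
  have 2: "hc d 0 (\<Sum>e\<le>n. x * cmp r e) - (\<Sum>e\<le>n. hc d e x * cmp r e) \<in> N"
    by (rule hc_lincomb) (simp add: Gs_def cmp_in)
  have "hc d 0 (r * x) = cmp (r * x) d" by (simp add: hc_def)
  thus ?thesis using ideal_cong_trans[OF N 1 2] by auto
qed

text \<open>The elements all of whose components lie in \<open>A\<close> form an ideal, so it is enough to look at generators.\<close>

lemma hideal_generated:
  assumes A: "is_ideal A" "N \<subseteq> A" and S: "S \<subseteq> A" "\<And>x. x \<in> S \<Longrightarrow> \<exists>d. x \<in> Gr d"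
    and least: "\<And>B. is_ideal B \<Longrightarrow> N \<subseteq> B \<Longrightarrow> S \<subseteq> B \<Longrightarrow> A \<subseteq> B"
  shows "hideal A"
proof -
  let ?B = "{x. \<forall>d. cmp x d \<in> A}"
  have "is_ideal ?B" unfolding is_ideal_def
  proof (intro conjI ballI allI CollectI)
    show "cmp 0 d \<in> A" for d using cmp_N[OF is_ideal_zero[OF N]] A by blast
    show "cmp (x + y) d \<in> A" if xy: "x \<in> ?B" "y \<in> ?B" for x y d
    proof (rule ideal_cong_mem[OF A(1)])
      show "cmp (x + y) d - (cmp x d + cmp y d) \<in> A" using cmp_add A(2) by blast
      show "cmp x d + cmp y d \<in> A" using xy by (intro is_ideal_add[OF A(1)]) auto
    qed
    fix r x d assume x: "x \<in> ?B"
    obtain n where n: "cmp (r * x) d - (\<Sum>e\<le>n. hc d e x * cmp r e) \<in> N" using cmp_mult by blast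
    have "hc d e x \<in> A" for e using x by (auto simp: hc_def is_ideal_zero[OF A(1)])
    hence "(\<Sum>e\<le>n. hc d e x * cmp r e) \<in> A" by (intro is_ideal_sum[OF A(1)] is_ideal_mult_right[OF A(1)])
    thus "cmp (r * x) d \<in> A" by (rule ideal_cong_mem[OF A(1) subsetD[OF A(2) n]])
  qed
  moreover have "N \<subseteq> ?B" using cmp_N A(2) by auto
  moreover have "S \<subseteq> ?B"
  proof (intro subsetI CollectI allI)
    fix x d assume x: "x \<in> S"
    obtain e where "x \<in> Gr e" using S(2)[OF x] by (rule exE)
    from subsetD[OF A(2) cmp_Gr[OF this, of d]] have "cmp x d - (if d = e then x else 0) \<in> A" .
    moreover have "(if d = e then x else 0) \<in> A" using subsetD[OF S(1) x] is_ideal_zero[OF A(1)] by simp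
    ultimately show "cmp x d \<in> A" by (rule ideal_cong_mem[OF A(1)])
  qed
  ultimately have "A \<subseteq> ?B" by (rule least)
  thus ?thesis using A by (auto simp: hideal_def)
qed

text \<open>The irrelevant ideal, generated by \<open>N\<close> and the elements of positive degree.\<close>

definition irr :: "'s set" where "irr = {x. cmp x 0 \<in> N}"

lemma irr_ideal: "is_ideal irr" "N \<subseteq> irr" "0 < d \<Longrightarrow> Gr d \<subseteq> irr" "x - cmp x 0 \<in> irr"
proof -
  show NI: "N \<subseteq> irr" using cmp_N by (auto simp: irr_def)
  show G: "Gr d \<subseteq> irr" if "0 < d" for d unfolding irr_def
  proof (intro subsetI CollectI)
    fix x assume "x \<in> Gr d"
    from cmp_Gr[OF this, of 0] show "cmp x 0 \<in> N" using that by simp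
  qed
  show I: "is_ideal irr" unfolding is_ideal_def
  proof (intro conjI ballI allI)
    show "0 \<in> irr" using NI is_ideal_zero[OF N] by blast
    show "x + y \<in> irr" if "x \<in> irr" "y \<in> irr" for x y
      using that ideal_cong_mem[OF N cmp_add[of x y 0] is_ideal_add[OF N]] by (simp add: irr_def)
    fix r x assume x: "x \<in> irr"
    obtain n where n: "cmp (r * x) 0 - (\<Sum>e\<le>n. hc 0 e x * cmp r e) \<in> N" using cmp_mult by blast
    have "hc 0 e x \<in> N" for e using x by (auto simp: hc_def irr_def is_ideal_zero[OF N])
    hence "(\<Sum>e\<le>n. hc 0 e x * cmp r e) \<in> N" by (intro is_ideal_sum[OF N] is_ideal_mult_right[OF N])
    from ideal_cong_mem[OF N n this] show "r * x \<in> irr" by (simp add: irr_def)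
  qed
  obtain n where n: "x - (\<Sum>d\<le>n. cmp x d) \<in> N" using dec_cmp[of x] by (auto simp: dec_def)
  have "(\<Sum>d\<le>n. cmp x d) = cmp x 0 + (\<Sum>d\<in>{1..n}. cmp x d)"
    by (simp add: atMost_atLeast0 sum.atLeast_Suc_atMost)
  hence e: "x - cmp x 0 = (x - (\<Sum>d\<le>n. cmp x d)) + (\<Sum>d\<in>{1..n}. cmp x d)" by simp
  have "(\<Sum>d\<in>{1..n}. cmp x d) \<in> irr"
  proof (rule is_ideal_sum[OF I])
    fix d assume "d \<in> {1..n}"
    thus "cmp x d \<in> irr" using G[of d] cmp_in[of x d] by auto
  qed
  thus "x - cmp x 0 \<in> irr" unfolding e using n NI by (intro is_ideal_add[OF I]) auto
qed

text \<open>Modulo the irrelevant ideal every element has degree zero.\<close>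

lemma hideal_of_irr: assumes "is_ideal A" "irr \<subseteq> A" shows "hideal A"
  unfolding hideal_def
proof (intro conjI ballI allI assms(1))
  show "N \<subseteq> A" using irr_ideal(2) assms by blast
  fix x d assume x: "x \<in> A"
  show "cmp x d \<in> A"
  proof (cases "d = 0")
    case True
    have "x - (x - cmp x 0) \<in> A" by (rule is_ideal_diff[OF assms(1) x subsetD[OF assms(2) irr_ideal(4)]])
    thus ?thesis using True by simp
  next
    case False
    thus ?thesis using irr_ideal(3)[of d] cmp_in[of x d] assms by auto
  qed
qed

lemma one_notin_sum_irr: assumes A: "hideal A" "1 \<notin> A" shows "1 \<notin> {x. \<exists>a\<in>A. x - a \<in> irr}"
proof
  assume "1 \<in> {x. \<exists>a\<in>A. x - a \<in> irr}"
  then obtain a where a: "a \<in> A" "cmp (1 - a) 0 \<in> N" by (auto simp: irr_def)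
  have Ai: "is_ideal A" "N \<subseteq> A" "cmp a 0 \<in> A" using A a by (auto simp: hideal_def)
  have 1: "cmp 1 0 - (cmp (1 - a) 0 + cmp a 0) \<in> A" using cmp_add[of "1 - a" a 0] Ai by auto
  have 2: "cmp 1 0 - 1 \<in> A" using cmp_Gr[OF Gr_one, of 0] Ai by auto
  have 3: "cmp (1 - a) 0 + cmp a 0 \<in> A" using a Ai by (intro is_ideal_add[OF Ai(1)]) auto
  have "cmp 1 0 \<in> A" by (rule ideal_cong_mem[OF Ai(1) 1 3])
  hence "cmp 1 0 - (cmp 1 0 - 1) \<in> A" using 2 by (rule is_ideal_diff[OF Ai(1)])
  thus False using A by simp
qed

context
  fixes M :: "'s set"
  assumes M: "hideal M" "1 \<notin> M"
    and uniq: "\<And>Q. hideal Q \<Longrightarrow> 1 \<notin> Q \<Longrightarrow> (\<And>C. is_ideal C \<Longrightarrow> Q \<subseteq> C \<Longrightarrow> 1 \<notin> C \<Longrightarrow> C = Q) \<Longrightarrow> Q = M"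
begin

text \<open>An ideal that contains the irrelevant ideal is homogeneous, and so is any maximal ideal above it. If there is
  only one homogeneous ideal that is maximal, then it contains all proper ideals above the irrelevant ideal.\<close>

lemma le_unique_maximal: assumes A: "is_ideal A" "irr \<subseteq> A" "1 \<notin> A" shows "A \<subseteq> M"
proof -
  obtain Q where Q: "is_ideal Q" "A \<subseteq> Q" "1 \<notin> Q" "\<And>C. is_ideal C \<Longrightarrow> Q \<subseteq> C \<Longrightarrow> 1 \<notin> C \<Longrightarrow> C = Q"
    using exists_maximal_ideal[OF A(1,3)] by blast
  have "hideal Q" using Q A(2) by (intro hideal_of_irr) auto
  hence "Q = M" using Q uniq by blast
  thus ?thesis using Q by blast
qed

text \<open>The sum of a proper homogeneous ideal and the irrelevant ideal is proper, since a component of degree zero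
  equal to \<open>1\<close> would already lie in the homogeneous ideal.\<close>

lemma hideal_le_maximal: assumes A: "hideal A" "1 \<notin> A" shows "A \<subseteq> M" "irr \<subseteq> M"
proof -
  have Ai: "is_ideal A" using A by (simp add: hideal_def)
  note S = ideal_sum[OF Ai irr_ideal(1)]
  have "{x. \<exists>a\<in>A. x - a \<in> irr} \<subseteq> M"
    by (rule le_unique_maximal[OF S(1,3) one_notin_sum_irr[OF A]])
  thus "A \<subseteq> M" "irr \<subseteq> M" using subset_trans[OF S(2)] subset_trans[OF S(3)] by auto
qed

text \<open>If \<open>x\<close> is not a unit, then \<open>x\<close> and the irrelevant ideal generate a proper ideal: comparing components of
  degree zero in \<open>1 = x r + p\<close> would give an inverse of \<open>x\<close>.\<close>

lemma degree_zero_unit: assumes x: "x \<in> Gr 0" "x \<notin> M" shows "\<exists>y. x * y - 1 \<in> N"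
proof (rule ccontr)
  assume n: "\<nexists>y. x * y - 1 \<in> N"
  have P: "is_ideal (range (\<lambda>r. x * r))"
    unfolding is_ideal_def
  proof (intro conjI ballI allI)
    show "0 \<in> range ((*) x)" by (auto intro: image_eqI[of _ _ 0])
    show "a + b \<in> range ((*) x)" if "a \<in> range ((*) x)" "b \<in> range ((*) x)" for a b
      using that by (auto simp: distrib_left[symmetric])
    show "r * a \<in> range ((*) x)" if "a \<in> range ((*) x)" for a r
    proof -
      have "\<exists>b. a = x * b" using that by auto
      then obtain b where b: "a = x * b" by (rule exE)
      show ?thesis unfolding b by (rule range_eqI[of _ _ "r * b"]) (simp add: mult_ac)
    qed
  qed
  note S = ideal_sum[OF P irr_ideal(1)]
  have "1 \<notin> {z. \<exists>a\<in>range (\<lambda>r. x * r). z - a \<in> irr}"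
  proof
    assume "1 \<in> {z. \<exists>a\<in>range (\<lambda>r. x * r). z - a \<in> irr}"
    then obtain r where r: "cmp (1 - x * r) 0 \<in> N" by (auto simp: irr_def)
    have 1: "cmp 1 0 - (cmp (1 - x * r) 0 + cmp (x * r) 0) \<in> N" using cmp_add[of "1 - x * r" "x * r" 0] by simp
    have 2: "cmp 1 0 - 1 \<in> N" using cmp_Gr[OF Gr_one, of 0] by simp
    have 3: "cmp (x * r) 0 - x * cmp r 0 \<in> N" using cmp_eq[OF dec_mult[OF x(1) dec_cmp], of r 0] by simp
    have "x * cmp r 0 - 1 = (cmp 1 0 - 1) - (cmp 1 0 - (cmp (1 - x * r) 0 + cmp (x * r) 0)) - cmp (1 - x * r) 0 - (cmp (x * r) 0 - x * cmp r 0)"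
      by simp
    also have "\<dots> \<in> N" by (intro is_ideal_diff[OF N] 1 2 3 r)
    finally show False using n by blast
  qed
  from le_unique_maximal[OF S(1,3) this] have "x * 1 \<in> M" using S(2) by blast
  thus False using x by simp
qed

end

end

lemma ex1_unique: "\<exists>!x. P x \<Longrightarrow> P a \<Longrightarrow> P b \<Longrightarrow> a = b" by blast

context ring_cover begin

lemma ev_sum: "ev (\<Sum>i\<in>K. f i) = (\<Oplus>i\<in>K. ev (f i))"
  by (induction K rule: infinite_finite_induct) (auto simp: ev_zero ev_add)

lemma graded_ringD:
  assumes "graded_ring R G"
  shows "additive_subgroup (G d) R" "\<one> \<in> G 0" "x \<in> G d \<Longrightarrow> y \<in> G e \<Longrightarrow> x \<otimes> y \<in> G (d + e)"
    "x \<in> carrier R \<Longrightarrow> \<exists>!c. (\<forall>d. c d \<in> G d) \<and> finite {d. c d \<noteq> \<zero>} \<and> x = finsum R c {d. c d \<noteq> \<zero>}"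
  using assms unfolding graded_ring_def by blast+

lemma graded_mod_pre:
  assumes G: "graded_ring R G" shows "graded_mod NN (\<lambda>d. pre (G d))"
proof
  note sub = graded_ringD(1)[OF G]
  have Gc: "G d \<subseteq> carrier R" for d using additive_subgroup.a_subset[OF sub] .
  have Gz: "\<zero> \<in> G d" for d using additive_subgroup.zero_closed[OF sub] .
  show "is_ideal NN" by (rule NN_ideal)
  show "x + y \<in> pre (G d)" if "x \<in> pre (G d)" "y \<in> pre (G d)" for d x y
    using that additive_subgroup.a_closed[OF sub] by (auto simp: pre_def ev_add)
  show "- x \<in> pre (G d)" if "x \<in> pre (G d)" for d x
    using that subgroup.m_inv_closed[OF additive_subgroup.a_subgroup[OF sub], of "ev x" d]
    by (simp add: pre_def ev_minus a_inv_def)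
  show "NN \<subseteq> pre (G d)" for d using Gz by (auto simp: pre_def)
  show "1 \<in> pre (G 0)" using graded_ringD(2)[OF G] by (simp add: pre_def ev_one)
  show "x * y \<in> pre (G (d + e))" if "x \<in> pre (G d)" "y \<in> pre (G e)" for d e x y
    using that graded_ringD(3)[OF G] by (auto simp: pre_def ev_mult)
  have fs: "finsum R c {d. c d \<noteq> \<zero>} = finsum R c {..n}"
    if "\<And>d. c d \<in> carrier R" "\<And>d. c d \<noteq> \<zero> \<Longrightarrow> d \<le> n" for c and n :: nat
    by (rule add.finprod_mono_neutral_cong_left) (use that in auto)
  show "\<exists>c n. (\<forall>d. c d \<in> pre (G d)) \<and> x - (\<Sum>d\<le>n. c d) \<in> NN" for x
  proof -
    obtain c where "(\<forall>d. c d \<in> G d) \<and> finite {d. c d \<noteq> \<zero>} \<and> ev x = finsum R c {d. c d \<noteq> \<zero>}"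
      using ex1_implies_ex[OF graded_ringD(4)[OF G ev_closed[of x]]] by (rule exE)
    hence c: "\<And>d. c d \<in> G d" "finite {d. c d \<noteq> \<zero>}" "ev x = finsum R c {d. c d \<noteq> \<zero>}" by simp_all
    have "\<forall>d. \<exists>y. ev y = c d" by (intro allI ev_surj subsetD[OF Gc c(1)])
    then obtain c' where c': "\<And>d. ev (c' d) = c d" by metis
    obtain n where n: "\<And>d. c d \<noteq> \<zero> \<Longrightarrow> d \<le> n" using c(2) by (auto simp: finite_nat_set_iff_bounded_le)
    have "ev (\<Sum>d\<le>n. c' d) = ev x" unfolding ev_sum c' c(3) using c(1) Gc n by (intro fs[symmetric]) auto
    hence "x - (\<Sum>d\<le>n. c' d) \<in> NN" using ev_eq_iff by metis
    thus ?thesis using c(1) c' by (intro exI[of _ c'] exI[of _ n]) (simp add: pre_def)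
  qed
  fix c n d assume c: "\<And>d. c d \<in> pre (G d)" and s: "(\<Sum>d\<le>n. c d) \<in> NN" and d: "d \<le> n"
  define b where "b e = (if e \<le> n then ev (c e) else \<zero>)" for e
  have bG: "b e \<in> G e" for e using c Gz by (auto simp: b_def pre_def)
  have "(\<Oplus>e\<in>{..n}. b e) = (\<Oplus>e\<in>{..n}. ev (c e))" by (rule finsum_cong') (auto simp: b_def)
  also have "\<dots> = \<zero>" using s by (simp add: ev_sum[symmetric] pre_def)
  finally have z: "(\<Oplus>e\<in>{..n}. b e) = \<zero>" .
  have bn: "e \<le> n" if "b e \<noteq> \<zero>" for e
  proof (rule ccontr)
    assume "\<not> e \<le> n"
    thus False using that by (simp add: b_def)
  qed
  have bc: "b e \<in> carrier R" for e using bG Gc by (rule subsetD[rotated])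
  have "finsum R b {d. b d \<noteq> \<zero>} = \<zero>" using fs[of b n, OF bc bn] z by simp
  moreover have "finite {d. b d \<noteq> \<zero>}" by (rule finite_subset[of _ "{..n}"]) (use bn in auto)
  ultimately have "(\<forall>d. b d \<in> G d) \<and> finite {d. b d \<noteq> \<zero>} \<and> \<zero> = finsum R b {d. b d \<noteq> \<zero>}" using bG by simp
  moreover have "(\<forall>d. (\<lambda>_. \<zero>) d \<in> G d) \<and> finite {d. (\<lambda>_::nat. \<zero>) d \<noteq> \<zero>} \<and> \<zero> = finsum R (\<lambda>_::nat. \<zero>) {d. (\<lambda>_::nat. \<zero>) d \<noteq> \<zero>}"
    using Gz by simp
  ultimately have "b = (\<lambda>_. \<zero>)" by (rule ex1_unique[OF graded_ringD(4)[OF G zero_closed]])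
  hence "b d = \<zero>" by simp
  thus "c d \<in> NN" using d by (simp add: b_def pre_def)
qed

lemma pre_carrier_mem: "1 \<in> pre A \<Longrightarrow> ideal A R \<Longrightarrow> A = carrier R"
  using ideal.one_imp_carrier by (auto simp: pre_def ev_one)

lemma homogeneous_ideal_pre:
  assumes G: "graded_ring R G" and A: "homogeneous_ideal R G A"
  shows "graded_mod.hideal NN (\<lambda>d. pre (G d)) (pre A)"
proof -
  interpret graded_mod NN "\<lambda>d. pre (G d)" by (rule graded_mod_pre[OF G])
  have Ai: "ideal A R" and Ag: "A = Idl (A \<inter> homogeneous_elements G)" using A by (auto simp: homogeneous_ideal_def)
  have AC: "A \<subseteq> carrier R" using ideal.Icarr[OF Ai] by blast
  show ?thesis
  proof (rule hideal_generated[OF pre_ideal[OF Ai], of "pre (A \<inter> homogeneous_elements G)"])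
    show "pre (A \<inter> homogeneous_elements G) \<subseteq> pre A" by (auto simp: pre_def)
    show "\<exists>d. x \<in> pre (G d)" if "x \<in> pre (A \<inter> homogeneous_elements G)" for x
      using that by (auto simp: pre_def homogeneous_elements_def)
    fix B assume "is_ideal B" "NN \<subseteq> B" "pre (A \<inter> homogeneous_elements G) \<subseteq> B"
    hence "pre (Idl (A \<inter> homogeneous_elements G)) \<subseteq> B" using AC by (intro pre_Idl_least) auto
    thus "pre A \<subseteq> B" using Ag by simp
  qed
qed

lemma homogeneous_ideal_image:
  assumes G: "graded_ring R G" and Q: "graded_mod.hideal NN (\<lambda>d. pre (G d)) Q"
  shows "homogeneous_ideal R G (ev ` Q)"
  unfolding homogeneous_ideal_def
proof
  interpret graded_mod NN "\<lambda>d. pre (G d)" by (rule graded_mod_pre[OF G])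
  have Qi: "is_ideal Q" "NN \<subseteq> Q" "\<And>x d. x \<in> Q \<Longrightarrow> cmp x d \<in> Q" using Q by (auto simp: hideal_def)
  show I: "ideal (ev ` Q) R" by (rule image_ideal[OF Qi(1)])
  let ?H = "ev ` Q \<inter> homogeneous_elements G"
  have HC: "?H \<subseteq> carrier R" by auto
  show "ev ` Q = Idl ?H"
  proof
    show "Idl ?H \<subseteq> ev ` Q" by (rule genideal_minimal[OF I]) auto
    have J: "ideal (Idl ?H) R" by (rule genideal_ideal[OF HC])
    note pJ = pre_ideal[OF J]
    show "ev ` Q \<subseteq> Idl ?H"
    proof
      fix y assume "y \<in> ev ` Q"
      then obtain q where q: "q \<in> Q" "y = ev q" by blast
      obtain n where n: "q - (\<Sum>d\<le>n. cmp q d) \<in> NN" using dec_cmp[of q] by (auto simp: dec_def)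
      have "cmp q d \<in> pre (Idl ?H)" for d
      proof -
        have "ev (cmp q d) \<in> ?H" using Qi(3)[OF q(1)] cmp_in[of q d] by (auto simp: homogeneous_elements_def pre_def)
        thus ?thesis using genideal_self[OF HC] by (auto simp: pre_def)
      qed
      hence "(\<Sum>d\<le>n. cmp q d) \<in> pre (Idl ?H)" by (intro is_ideal_sum[OF pJ(1)])
      hence "q \<in> pre (Idl ?H)" using n pJ(2) by (blast intro: ideal_cong_mem[OF pJ(1)])
      thus "y \<in> Idl ?H" using q by (simp add: pre_def)
    qed
  qed
qed

lemma maximalideal_image:
  assumes Q: "is_ideal Q" "NN \<subseteq> Q" "1 \<notin> Q" "\<And>C. is_ideal C \<Longrightarrow> Q \<subseteq> C \<Longrightarrow> 1 \<notin> C \<Longrightarrow> C = Q"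
  shows "maximalideal (ev ` Q) R"
proof (rule maximalidealI)
  show "ideal (ev ` Q) R" by (rule image_ideal[OF Q(1)])
  show "carrier R \<noteq> ev ` Q"
  proof
    assume e: "carrier R = ev ` Q"
    have "ev 1 \<in> ev ` Q" using ev_closed[of 1] unfolding e .
    hence "1 \<in> pre (ev ` Q)" by (simp add: pre_def)
    thus False using Q(3) pre_image[OF Q(1,2)] by simp
  qed
  fix J assume J: "ideal J R" "ev ` Q \<subseteq> J" "J \<subseteq> carrier R"
  have QJ: "Q \<subseteq> pre J" using J(2) by (auto simp: pre_def)
  show "J = ev ` Q \<or> J = carrier R"
  proof (cases "1 \<in> pre J")
    case True thus ?thesis using pre_carrier_mem J(1) by blast
  next
    case False
    hence "pre J = Q" using Q(4)[OF pre_ideal(1)[OF J(1)] QJ] by blast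
    thus ?thesis using image_pre[OF J(3)] by metis
  qed
qed

lemma maximalideal_one: assumes "maximalideal \<mm> R" shows "1 \<notin> pre \<mm>"
proof
  interpret maximalideal \<mm> R by fact
  assume "1 \<in> pre \<mm>"
  thus False using pre_carrier_mem[OF _ is_ideal] I_notcarr by blast
qed

lemma unique_maximal_pre:
  assumes G: "graded_ring R G" and m: "maximalideal \<mm> R" "homogeneous_ideal R G \<mm>"
    and u: "\<And>\<nn>. maximalideal \<nn> R \<Longrightarrow> homogeneous_ideal R G \<nn> \<Longrightarrow> \<nn> = \<mm>"
    and Q: "graded_mod.hideal NN (\<lambda>d. pre (G d)) Q" "1 \<notin> Q" "\<And>C. is_ideal C \<Longrightarrow> Q \<subseteq> C \<Longrightarrow> 1 \<notin> C \<Longrightarrow> C = Q"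
  shows "Q = pre \<mm>"
proof -
  interpret graded_mod NN "\<lambda>d. pre (G d)" by (rule graded_mod_pre[OF G])
  have Qi: "is_ideal Q" "NN \<subseteq> Q" using Q(1) by (auto simp: hideal_def)
  have "ev ` Q = \<mm>" by (intro u maximalideal_image[OF Qi Q(2,3)] homogeneous_ideal_image[OF G Q(1)])
  thus ?thesis using pre_image[OF Qi] by metis
qed

text \<open>That \<open>\<mm>\<close> is the only homogeneous maximal ideal suffices for all conditions of the locale, by the
  preceding lemmas on the irrelevant ideal.\<close>

lemma graded_quot_pre:
  assumes G: "graded_ring R G" and no: "noetherian_ring R" and m: "maximalideal \<mm> R" "homogeneous_ideal R G \<mm>"
    and u: "\<And>\<nn>. maximalideal \<nn> R \<Longrightarrow> homogeneous_ideal R G \<nn> \<Longrightarrow> \<nn> = \<mm>"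
  shows "graded_quot NN (\<lambda>d. pre (G d)) (pre \<mm>)"
proof -
  interpret gm: graded_mod NN "\<lambda>d. pre (G d)" by (rule graded_mod_pre[OF G])
  have mi: "ideal \<mm> R" using m(1) by (rule maximalideal.axioms(1))
  note M = homogeneous_ideal_pre[OF G m(2)] maximalideal_one[OF m(1)]
  note U = unique_maximal_pre[OF G m u]
  show ?thesis
  proof
    show "is_ideal (pre \<mm>)" "NN \<subseteq> pre \<mm>" by (rule pre_ideal[OF mi])+
    show "1 \<notin> pre \<mm>" by fact
    show "pre (G d) \<subseteq> pre \<mm>" if "0 < d" for d
      using gm.irr_ideal(3)[OF that] gm.hideal_le_maximal(2)[OF M U M] by blast
    show "\<exists>y. x * y - 1 \<in> NN" if "x \<in> pre (G 0)" "x \<notin> pre \<mm>" for x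
      by (rule gm.degree_zero_unit[OF M U that])
    show "noeth NN" by (rule noeth_NN[OF no])
  qed
qed

lemma proper_homogeneous_le:
  assumes G: "graded_ring R G" and m: "maximalideal \<mm> R" "homogeneous_ideal R G \<mm>"
    and u: "\<And>\<nn>. maximalideal \<nn> R \<Longrightarrow> homogeneous_ideal R G \<nn> \<Longrightarrow> \<nn> = \<mm>"
    and A: "homogeneous_ideal R G A" "A \<noteq> carrier R"
  shows "pre A \<subseteq> pre \<mm>"
proof -
  interpret gm: graded_mod NN "\<lambda>d. pre (G d)" by (rule graded_mod_pre[OF G])
  note M = homogeneous_ideal_pre[OF G m(2)] maximalideal_one[OF m(1)]
  have one: "1 \<notin> pre A" using pre_carrier_mem A by (auto simp: homogeneous_ideal_def)
  show ?thesis by (rule gm.hideal_le_maximal(1)[OF M unique_maximal_pre[OF G m u] homogeneous_ideal_pre[OF G A(1)] one])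
qed

text \<open>A local ring is a graded ring concentrated in degree zero, where every ideal is homogeneous. So the local case
  requires no proofs of its own.\<close>

lemma trivial_grading: "graded_ring R (\<lambda>d. if d = 0 then carrier R else {\<zero>})" (is "graded_ring R ?G")
  unfolding graded_ring_def
proof (intro conjI allI ballI)
  show "additive_subgroup (?G d) R" for d
    using ideal.axioms(1)[OF oneideal] ideal.axioms(1)[OF zeroideal] by simp
  show "\<one> \<in> ?G 0" by simp
  show "x \<otimes> y \<in> ?G (d + e)" if "x \<in> ?G d" "y \<in> ?G e" for d e x y
    using that by (auto split: if_splits)
  fix x assume x: "x \<in> carrier R"
  have fs: "finsum R c {d. c d \<noteq> \<zero>} = c 0" if "\<And>d. c d \<in> ?G d" for c
  proof -
    have c: "c d \<in> carrier R" "d \<noteq> 0 \<Longrightarrow> c d = \<zero>" for d using that[of d] by (auto split: if_splits)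
    have "finsum R c {d. c d \<noteq> \<zero>} = finsum R c {0}"
      by (rule add.finprod_mono_neutral_cong_left) (use c in auto)
    thus ?thesis using c by simp
  qed
  show "\<exists>!c. (\<forall>d. c d \<in> ?G d) \<and> finite {d. c d \<noteq> \<zero>} \<and> x = finsum R c {d. c d \<noteq> \<zero>}"
  proof (rule ex1I)
    let ?c = "\<lambda>d::nat. if d = 0 then x else \<zero>"
    have g: "\<forall>d. ?c d \<in> ?G d" using x by simp
    moreover have "finite {d. ?c d \<noteq> \<zero>}" by (rule finite_subset[of _ "{0}"]) auto
    moreover have "x = finsum R ?c {d. ?c d \<noteq> \<zero>}" using fs[of ?c] g by simp
    ultimately show "(\<forall>d. ?c d \<in> ?G d) \<and> finite {d. ?c d \<noteq> \<zero>} \<and> x = finsum R ?c {d. ?c d \<noteq> \<zero>}" by blast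
  next
    fix c assume c: "(\<forall>d. c d \<in> ?G d) \<and> finite {d. c d \<noteq> \<zero>} \<and> x = finsum R c {d. c d \<noteq> \<zero>}"
    hence "x = c 0" using fs[of c] by simp
    moreover have "c d = \<zero>" if "d \<noteq> 0" for d using conjunct1[OF c, rule_format, of d] that by simp
    ultimately show "c = (\<lambda>d. if d = 0 then x else \<zero>)" by auto
  qed
qed

lemma trivial_homogeneous: assumes "ideal A R" shows "homogeneous_ideal R (\<lambda>d. if d = 0 then carrier R else {\<zero>}) A"
proof -
  have AC: "A \<subseteq> carrier R" using ideal.Icarr[OF assms] by blast
  have "A \<inter> homogeneous_elements (\<lambda>d. if d = 0 then carrier R else {\<zero>}) = A"
    using AC by (auto simp: homogeneous_elements_def intro!: exI[of _ 0])
  moreover have "Idl A = A" using genideal_minimal[OF assms order_refl] genideal_self[OF AC] by blast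
  ultimately show ?thesis using assms by (simp add: homogeneous_ideal_def)
qed

text \<open>The list is reversed because \<open>nzd_seq\<close> reads regular sequences from the end.\<close>

lemma regular_sequence_pre:
  assumes "generated_by_regular_sequence R H A n" "H \<subseteq> carrier R"
  shows "\<exists>ys. length ys = n \<and> (\<forall>y\<in>set ys. ev y \<in> H) \<and> nzd_seq NN ys \<and> pre A = gid NN ys"
proof -
  obtain xs where xs: "length xs = n" "set xs \<subseteq> H" "regular_sequence R xs" "A = Idl (set xs)"
    using assms by (auto simp: generated_by_regular_sequence_def)
  have xc: "set xs \<subseteq> carrier R" using xs assms(2) by blast
  define li where "li r = (SOME x. ev x = r)" for r
  have li: "ev (li r) = r" if "r \<in> carrier R" for r unfolding li_def using ev_surj[OF that] by (rule someI_ex)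
  have evs: "ev ` set (map li (rev zs)) = set zs" if "set zs \<subseteq> carrier R" for zs
    using that li by (force simp: image_image)
  have g: "gid NN (map li (rev zs)) = pre (Idl (set zs))" if "set zs \<subseteq> carrier R" for zs
    using pre_Idl_list[of "map li (rev zs)"] evs[OF that] by simp
  have "nzd_seq NN (map li (rev (take i xs)))" if "i \<le> length xs" for i
    using that
  proof (induction i)
    case (Suc i)
    hence i: "i < length xs" by simp
    have tc: "set (take i xs) \<subseteq> carrier R" using xc set_take_subset[of i xs] by blast
    have xi: "xs ! i \<in> carrier R" using xc i nth_mem by blast
    have "\<forall>r. li (xs ! i) * r \<in> pre (Idl (set (take i xs))) \<longrightarrow> r \<in> pre (Idl (set (take i xs)))"
      using xs(3) i li[OF xi] unfolding regular_sequence_def by (auto simp: pre_def ev_mult)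
    thus ?case using Suc by (simp add: take_Suc_conv_app_nth[OF i] g[OF tc])
  qed simp
  from this[of "length xs"] have "nzd_seq NN (map li (rev xs))" by simp
  moreover have "\<forall>y\<in>set (map li (rev xs)). ev y \<in> H" using xs(2) xc li by (auto simp: subset_iff)
  ultimately show ?thesis using xs(1,4) g[OF xc] by (intro exI[of _ "map li (rev xs)"]) simp
qed

end

section \<open>Tor and Betti numbers from a single resolution\<close>

text \<open>Between resolutions with one generator in degree zero the comparison map can be chosen to be exactly \<open>1\<close> there,
  also when it covers a proper quotient map \<open>S/I' \<rightarrow> S/I\<close>.\<close>

lemma cyc_comparison:
  fixes S :: "('i, 's::comm_ring_1) based" and C :: "('j, 's) based"
  assumes N: "is_ideal N" and g: "gcat N Gs" and S: "cyc_res N I' S eS" "graded_cpx Gs S"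
    and C: "cyc_res N I C e" "gres N Gs I C (\<lambda>_. 1)" and sub: "I' \<subseteq> I"
  shows "\<exists>f. chain_map N S C f \<and> hom_map Gs S C f \<and> f eS e = 1"
proof -
  have ge: "gexact N Gs C" using C(2) by (simp add: gres_def)
  note S0 = cyc_resD(3)[OF S(1)] and C0 = cyc_resD(3)[OF C(1)]
  have aug0: "\<exists>w. (\<forall>k\<in>lvl C 1. w k \<in> Gs b (ideg C k)) \<and> (\<forall>k\<in>lvl C 0. v k - dif C w k \<in> N)"
    if "\<forall>k\<in>lvl C 0. v k \<in> Gs b (ideg C k)" "(\<Sum>k\<in>lvl C 0. v k * 1) \<in> I" for v b
    using C(2) that unfolding gres_def by blast
  have "\<exists>f. chain_map N S C f \<and> hom_map Gs S C f \<and> (\<forall>j\<in>lvl S 0. f j = (\<lambda>_ _. 1) j)"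
  proof (rule comparison_extend[OF N g cyc_resD(1)[OF S(1)] S(2) cyc_resD(1)[OF C(1)] ge])
    show "1 \<in> Gs (ideg S j) (ideg C k)" if "j \<in> lvl S 0" "k \<in> lvl C 0" for j k
      using that gcat_one[OF g, of 0] by (simp add: S0 C0 cyc_resD(4)[OF S(1)] cyc_resD(4)[OF C(1)])
    fix l assume l: "l \<in> lvl S 1"
    define x where "x = ent S eS l"
    have "x \<in> I" using cyc_res_dif[OF N S(1)] sub by (auto simp: x_def ent_def)
    moreover have "x \<in> Gs (ideg S l) (ideg C e)"
      using graded_cpxD[OF S(2), of eS 0 l] l by (simp add: S0 x_def cyc_resD(4)[OF S(1)] cyc_resD(4)[OF C(1)])
    ultimately have "\<exists>c. (\<forall>k\<in>lvl C 1. c k \<in> Gs (ideg S l) (ideg C k)) \<and> (\<forall>k\<in>lvl C 0. (\<lambda>_. x) k - dif C c k \<in> N)"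
      by (intro aug0[of "\<lambda>_. x"]) (simp_all add: C0)
    thus "\<exists>c. (\<forall>k\<in>lvl C 1. c k \<in> Gs (ideg S l) (ideg C k)) \<and>
       (\<forall>k\<in>lvl C 0. (\<Sum>j\<in>lvl S 0. ent S j l * 1) - dif C c k \<in> N)"
      by (simp add: S0 x_def)
  qed
  thus ?thesis by (auto simp: S0)
qed

text \<open>An ideal generated by homogeneous entries is homogeneous.\<close>

lemma (in graded_mod) cyc_res_hideal:
  assumes C: "cyc_res N A C e" "graded_cpx Gs C" shows "hideal A"
  unfolding hideal_def
proof (intro conjI ballI allI)
  show "is_ideal A" "N \<subseteq> A" using cyc_res_ideal[OF N C(1)] by auto
  fix x d assume "x \<in> A"
  then obtain w where w: "x - dif C w e \<in> N" using cyc_resD(7)[OF C(1)] by blast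
  note e = cyc_resD(3)[OF C(1)] and z = cyc_resD(4)[OF C(1)]
  have el: "e \<in> lvl C 0" using e by simp
  have 1: "hc d 0 x - hc d 0 (dif C w e) \<in> N" by (rule hc_cong[OF w])
  have 2: "hc d 0 (dif C w e) - dif C (\<lambda>l. hc d (ideg C l) (w l)) e \<in> N"
    unfolding dif_expand[OF cyc_resD(1)[OF C(1)] el]
    by (rule hc_lincomb) (use graded_cpxD[OF C(2) el] z in auto)
  have "hc d 0 x - dif C (\<lambda>l. hc d (ideg C l) (w l)) e \<in> N" by (rule ideal_cong_trans[OF N 1 2])
  hence "hc d 0 x \<in> A" using cyc_resD(7)[OF C(1)] by blast
  thus "cmp x d \<in> A" by (simp add: hc_def)
qed

context ring_cover begin

lemma matrix_of_resolution:
  assumes A: "ideal A R" and F: "free_resolution R (quot_module R A) F"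
    and a: "\<And>k. k < rank F 0 \<Longrightarrow> aug F k = qmap A (a k)"
  shows "\<exists>D. (\<forall>i k l. k < rank F i \<longrightarrow> l < rank F (Suc i) \<longrightarrow> diff F i k l = ev (D i k l)) \<and>
     res_with NN (pre A) (cplx (rank F) sh D) (\<lambda>(i, k). a k)"
proof -
  define D where "D i k l = (SOME x. ev x = diff F i k l)" for i k l
  have D: "diff F i k l = ev (D i k l)" if kl: "k < rank F i" "l < rank F (Suc i)" for i k l
  proof -
    have "diff F i k l \<in> carrier R" using F kl by (auto simp: free_resolution_def)
    from someI_ex[OF ev_surj[OF this]] show ?thesis by (simp add: D_def)
  qed
  have "mat_res (pre A) (rank F) D a" using F free_resolution_iff[OF A D a] by blast
  from mat_res_with[OF this] show ?thesis using D by blast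
qed

lemma augmentation_lift:
  assumes A: "ideal A R" and F: "free_resolution R (quot_module R A) F"
  shows "\<exists>a. \<forall>k<rank F 0. aug F k = qmap A (a k)"
proof -
  have "aug F k \<in> range (qmap A)" if "k < rank F 0" for k
    using F quot_cover[OF A] that by (simp add: free_resolution_def module_cover_def)
  hence "\<forall>k. \<exists>x. k < rank F 0 \<longrightarrow> aug F k = qmap A x" by auto
  thus ?thesis by metis
qed

lemma level_enumeration:
  assumes "is_complex N C" shows "\<exists>\<beta>. \<forall>n. bij_betw (\<beta> n) {..<card (lvl C n)} (lvl C n)"
proof -
  have "\<forall>n. \<exists>b. bij_betw b {..<card (lvl C n)} (lvl C n)"
    using ex_bij_betw_nat_finite[OF is_complex_finite[OF assms]] by (simp add: atLeast0LessThan)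
  thus ?thesis by metis
qed

lemma resolution_of_complex:
  assumes A: "ideal A R" and C: "cyc_res NN (pre A) C e"
    and b: "\<And>n. bij_betw (\<beta> n) {..<card (lvl C n)} (lvl C n)"
    and F: "rank F = (\<lambda>n. card (lvl C n))" "diff F = (\<lambda>i k l. ev (ent C (\<beta> i k) (\<beta> (Suc i) l)))" "aug F = (\<lambda>_. qmap A 1)"
  shows "free_resolution R (quot_module R A) F"
  using free_resolution_iff[OF A, of F "\<lambda>i k l. ent C (\<beta> i k) (\<beta> (Suc i) l)" "\<lambda>_. 1"] cyc_res_matrix[OF C b] F by simp

text \<open>Unfolds the vanishing of Tor, which is a quotient of groups of extensional functions, to a statement about
  representatives.\<close>

lemma tor_vanishing:
  assumes B: "ideal B R" and F: "F = (SOME F :: ('a, 'b) free_res. free_resolution R M F)"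
    and D: "\<And>i k l. k < rank F i \<Longrightarrow> l < rank F (Suc i) \<Longrightarrow> diff F i k l = ev (D i k l)"
    and T: "trivial_group (Tor R M (quot_module R B) (Suc n))"
    and w: "\<And>k. k < rank F n \<Longrightarrow> (\<Sum>l<rank F (Suc n). w l * D n k l) \<in> pre B"
  shows "\<exists>u. \<forall>k<rank F (Suc n). w k - (\<Sum>l<rank F (Suc (Suc n)). u l * D (Suc n) k l) \<in> pre B"
proof -
  let ?MB = "quot_module R B"
  note Q = quot_cover[OF B]
  define P where "P = power_module ?MB (rank F (Suc n))"
  define cy where "cy = tensor_cycles ?MB F (Suc n)"
  define bd where "bd = tensor_boundaries ?MB F (Suc n)"
  define H where "H = (add_monoid P)\<lparr>carrier := cy\<rparr>"
  have dm: "diff_map ?MB F i (vres (qmap B) (rank F (Suc i)) w) = vres (qmap B) (rank F i) (\<lambda>k. \<Sum>l<rank F (Suc i). w l * D i k l)" for i w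
    unfolding diff_map_def by (rule matrix_map_cover[OF Q D])
  let ?v = "vres (qmap B) (rank F (Suc n)) w"
  have v: "?v \<in> cy"
    unfolding cy_def tensor_cycles_def using w
    by (simp add: power_carrier[OF Q] dm vres_zero_iff[OF Q])
  have tor: "carrier (H Mod bd) = {\<one>\<^bsub>H Mod bd\<^esub>}"
    using T unfolding Tor_def F[symmetric] Let_def trivial_group_def H_def P_def cy_def bd_def by simp
  have "bd #>\<^bsub>H\<^esub> ?v \<in> carrier (H Mod bd)"
    using v by (auto simp: FactGroup_def RCOSETS_def H_def)
  hence e: "bd #>\<^bsub>H\<^esub> ?v = bd" using tor by (simp add: FactGroup_def)
  have bd: "bd = range (\<lambda>u. vres (qmap B) (rank F (Suc n)) (\<lambda>k. \<Sum>l<rank F (Suc (Suc n)). u l * D (Suc n) k l))"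
    unfolding bd_def tensor_boundaries_def by (simp add: power_carrier[OF Q] image_image dm)
  have z: "vres (qmap B) (rank F (Suc n)) (\<lambda>_. 0) \<in> bd"
    unfolding bd by (rule range_eqI[of _ _ "\<lambda>_. 0"]) simp
  have q: "qmap B 0 \<oplus>\<^bsub>?MB\<^esub> qmap B x = qmap B x" for x
    using Q unfolding module_cover_def by (metis add_0)
  have vv: "vres (qmap B) (rank F (Suc n)) (\<lambda>_. 0) \<oplus>\<^bsub>P\<^esub> ?v = ?v"
    by (auto simp: P_def power_module_def vres_def q intro!: restrict_ext)
  have "?v \<in> bd #>\<^bsub>H\<^esub> ?v" unfolding r_coset_def by (rule UN_I[OF z]) (simp add: H_def vv)
  hence "?v \<in> bd" using e by simp
  then obtain u where "?v = vres (qmap B) (rank F (Suc n)) (\<lambda>k. \<Sum>l<rank F (Suc (Suc n)). u l * D (Suc n) k l)"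
    unfolding bd by (rule rangeE)
  thus ?thesis unfolding vres_eq_iff[OF Q] by (rule exI[of _ u])
qed

text \<open>Vanishing of Tor is known for the resolution chosen in its definition, and \<open>exact_modulo_transfer\<close> carries it to
  the given resolution \<open>C\<close>.\<close>

lemma tor_independent_exact:
  fixes C :: "('i, 's) based"
  assumes A: "ideal A R" and B: "ideal B R" and T: "tor_independent R A B" and C: "cyc_res NN (pre A) C e"
  shows "exact (pre B) C"
proof -
  let ?M = "quot_module R A"
  obtain \<beta> where b: "\<And>n. bij_betw (\<beta> n) {..<card (lvl C n)} (lvl C n)" using level_enumeration[OF cyc_resD(1)[OF C]] by blast
  define F0 :: "('a, 'a set) free_res" where "F0 = \<lparr>rank = (\<lambda>n. card (lvl C n)),
     diff = (\<lambda>i k l. ev (ent C (\<beta> i k) (\<beta> (Suc i) l))), aug = (\<lambda>_. qmap A 1)\<rparr>"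
  have "free_resolution R ?M F0" by (rule resolution_of_complex[OF A C b]) (simp_all add: F0_def)
  define F where "F = (SOME F :: ('a, 'a set) free_res. free_resolution R ?M F)"
  have F: "free_resolution R ?M F" unfolding F_def by (rule someI) fact
  obtain a where a: "\<And>k. k < rank F 0 \<Longrightarrow> aug F k = qmap A (a k)" using augmentation_lift[OF A F] by blast
  obtain D where D: "\<And>i k l. k < rank F i \<Longrightarrow> l < rank F (Suc i) \<Longrightarrow> diff F i k l = ev (D i k l)"
    and res: "res_with NN (pre A) (cplx (rank F) (\<lambda>_ _. 0) D) (\<lambda>(i, k). a k)"
    using matrix_of_resolution[OF A F a, of "\<lambda>_ _. 0"] by blast
  let ?F = "cplx (rank F) (\<lambda>_ _. 0) D"
  show ?thesis
  proof (rule exact_modulo_transfer[OF NN_ideal pre_ideal[OF A] pre_ideal[OF B] res_with_UNIV[OF res] res_with_UNIV[OF cyc_res_with[OF NN_ideal C]]])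
    fix n v assume v: "\<And>k. k \<in> lvl ?F n \<Longrightarrow> dif ?F v k \<in> pre B"
    have "\<exists>u. \<forall>k<rank F (Suc n). v (Suc n, k) - (\<Sum>l<rank F (Suc (Suc n)). u l * D (Suc n) k l) \<in> pre B"
    proof (rule tor_vanishing[OF B F_def D])
      show "trivial_group (Tor R ?M (quot_module R B) (Suc n))" using T by (simp add: tor_independent_def)
      fix k assume "k < rank F n"
      hence "(n, k) \<in> lvl ?F n" by (simp add: lvl_cplx)
      from v[OF this] show "(\<Sum>l<rank F (Suc n). v (Suc n, l) * D n k l) \<in> pre B" by (simp add: cplx_simps)
    qed
    then obtain u where "\<forall>k<rank F (Suc n). v (Suc n, k) - (\<Sum>l<rank F (Suc (Suc n)). u l * D (Suc n) k l) \<in> pre B" by (rule exE)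
    thus "\<exists>w. \<forall>k\<in>lvl ?F (Suc n). v k - dif ?F w k \<in> pre B"
      by (intro exI[of _ "\<lambda>(n, p). u p"]) (simp add: lvl_cplx cplx_simps)
  qed
qed

lemma cplx_minimal:
  assumes m: "is_ideal (pre \<mm>)" and D: "\<And>i k l. k < r i \<Longrightarrow> l < r (Suc i) \<Longrightarrow> ev (D i k l) \<in> \<mm>"
  shows "minimal_cpx (pre \<mm>) (cplx r sh D)"
  unfolding minimal_cpx_def
proof (intro allI ballI)
  fix v k assume "k \<in> basis (cplx r sh D)"
  then obtain i j where [simp]: "k = (i, j)" "j < r i" by (auto simp: cplx_simps)
  show "dif (cplx r sh D) v k \<in> pre \<mm>" unfolding \<open>k = (i, j)\<close> cplx_simps
    by (rule is_ideal_sum[OF m], rule is_ideal_mult[OF m]) (simp add: pre_def D)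
qed

lemma ent_minimal: "minimal_cpx (pre \<mm>) C \<Longrightarrow> k \<in> basis C \<Longrightarrow> ev (ent C k l) \<in> \<mm>"
  by (auto simp: minimal_cpx_def ent_def pre_def)

text \<open>The numbered version of \<open>C\<close> shows that a minimal resolution exists, so the chosen one is minimal; by uniqueness
  of ranks it has the ranks of \<open>C\<close>. The graded statement below follows the same pattern.\<close>

lemma betti_eq:
  fixes C :: "('i, 's) based"
  assumes A: "ideal A R" and m: "ideal \<mm> R" "1 \<notin> pre \<mm>" "\<And>x. x \<notin> pre \<mm> \<Longrightarrow> \<exists>y. x * y - 1 \<in> pre \<mm>"
    and C: "cyc_res NN (pre A) C e" "minimal_cpx (pre \<mm>) C"
  shows "betti R \<mm> (quot_module R A) i = card (lvl C i)"
proof -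
  let ?M = "quot_module R A"
  obtain \<beta> where b: "\<And>n. bij_betw (\<beta> n) {..<card (lvl C n)} (lvl C n)" using level_enumeration[OF cyc_resD(1)[OF C(1)]] by blast
  have bl: "\<beta> n k \<in> basis C" if "k < card (lvl C n)" for n k using b[of n] that by (auto simp: bij_betw_def lvl_def)
  define F0 :: "('a, 'a set) free_res" where "F0 = \<lparr>rank = (\<lambda>n. card (lvl C n)),
     diff = (\<lambda>i k l. ev (ent C (\<beta> i k) (\<beta> (Suc i) l))), aug = (\<lambda>_. qmap A 1)\<rparr>"
  have "free_resolution R ?M F0" by (rule resolution_of_complex[OF A C(1) b]) (simp_all add: F0_def)
  hence F0: "minimal_free_resolution R \<mm> ?M F0"
    using ent_minimal[OF C(2)] bl by (simp add: minimal_free_resolution_def F0_def)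
  define F where "F = (SOME F :: ('a, 'a set) free_res. minimal_free_resolution R \<mm> ?M F)"
  have "minimal_free_resolution R \<mm> ?M F" unfolding F_def by (rule someI) (rule F0)
  hence F: "free_resolution R ?M F" and Fm: "\<And>i k l. k < rank F i \<Longrightarrow> l < rank F (Suc i) \<Longrightarrow> diff F i k l \<in> \<mm>"
    by (auto simp: minimal_free_resolution_def)
  obtain a where a: "\<And>k. k < rank F 0 \<Longrightarrow> aug F k = qmap A (a k)" using augmentation_lift[OF A F] by blast
  obtain D where D: "\<And>i k l. k < rank F i \<Longrightarrow> l < rank F (Suc i) \<Longrightarrow> diff F i k l = ev (D i k l)"
    and res: "res_with NN (pre A) (cplx (rank F) (\<lambda>_ _. 0) D) (\<lambda>(i, k). a k)"
    using matrix_of_resolution[OF A F a, of "\<lambda>_ _. 0"] by blast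
  let ?F = "cplx (rank F) (\<lambda>_ _. 0) D"
  have mF: "minimal_cpx (pre \<mm>) ?F" using Fm D by (intro cplx_minimal pre_ideal[OF m(1)]) simp
  note gF = res_with_UNIV[OF res] and gC = res_with_UNIV[OF cyc_res_with[OF NN_ideal C(1)]]
  note le = minimal_rank_le[OF NN_ideal pre_ideal[OF A] gcat_UNIV pre_ideal[OF m(1)] m(2,3), of "\<lambda>_. 0", where d = 0 and n = i]
  have "card {k \<in> lvl C i. (0::nat) = 0} = card {k \<in> lvl ?F i. (0::nat) = 0}"
    by (rule antisym[OF le[OF _ _ gC C(2) gF mF] le[OF _ _ gF mF gC C(2)]]) auto
  moreover have "card (lvl ?F i) = rank F i" unfolding lvl_cplx by (simp add: card_image inj_on_def)
  ultimately show ?thesis unfolding betti_def F_def[symmetric] by simp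
qed

lemma graded_betti_eq:
  fixes C :: "('i, 's) based"
  assumes G: "graded_ring R G" and gq: "graded_quot NN (\<lambda>d. pre (G d)) (pre \<mm>)"
    and A: "ideal A R" and mi: "ideal \<mm> R"
    and C: "cyc_res NN (pre A) C e" "minimal_cpx (pre \<mm>) C" "graded_cpx (graded_mod.Gs NN (\<lambda>d. pre (G d))) C"
  shows "graded_betti R G \<mm> (quot_module R A) (quot_grading R G A) i j = card {k \<in> lvl C i. ideg C k = j}"
proof -
  interpret graded_quot NN "\<lambda>d. pre (G d)" "pre \<mm>" by (rule gq)
  let ?M = "quot_module R A" and ?Mg = "quot_grading R G A"
  have hA: "hideal (pre A)" by (rule cyc_res_hideal[OF C(1,3)])
  obtain \<beta> where b: "\<And>n. bij_betw (\<beta> n) {..<card (lvl C n)} (lvl C n)" using level_enumeration[OF cyc_resD(1)[OF C(1)]] by blast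
  have bl: "\<beta> n k \<in> lvl C n" if "k < card (lvl C n)" for n k using b[of n] that by (auto simp: bij_betw_def)
  have Gmem: "ev x \<in> (if a \<le> b then G (b - a) else {\<zero>}) \<longleftrightarrow> x \<in> Gs b a" for x a b
    unfolding Gs_def by (auto simp: pre_def)
  define F0 :: "('a, 'a set) graded_free_res" where "F0 = \<lparr>rank = (\<lambda>n. card (lvl C n)),
     diff = (\<lambda>i k l. ev (ent C (\<beta> i k) (\<beta> (Suc i) l))), aug = (\<lambda>_. qmap A 1), shift = (\<lambda>n k. ideg C (\<beta> n k))\<rparr>"
  have fr: "free_resolution R ?M F0" by (rule resolution_of_complex[OF A C(1) b]) (simp_all add: F0_def)
  hence F0m: "minimal_free_resolution R \<mm> ?M F0"
    using ent_minimal[OF C(2)] lvl_basis[OF bl] by (simp add: minimal_free_resolution_def F0_def)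
  have F0g: "graded_free_resolution R G ?M ?Mg F0"
    unfolding graded_free_resolution_def
  proof (intro conjI allI impI fr)
    fix k assume "k < rank F0 0"
    hence "ideg C (\<beta> 0 k) = 0" using bl[of k 0] by (simp add: F0_def cyc_resD(3)[OF C(1)] cyc_resD(4)[OF C(1)])
    moreover have "ev 1 \<in> G 0" using graded_ringD(2)[OF G] by (simp add: ev_one)
    ultimately show "aug F0 k \<in> quot_grading R G A (shift F0 0 k)"
      by (simp add: F0_def quot_grading_def qmap_def)
  next
    fix i k l assume "k < rank F0 i" "l < rank F0 (Suc i)"
    hence "ent C (\<beta> i k) (\<beta> (Suc i) l) \<in> Gs (ideg C (\<beta> (Suc i) l)) (ideg C (\<beta> i k))"
      using bl by (intro graded_cpxD[OF C(3), of _ i]) (simp_all add: F0_def)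
    thus "diff F0 i k l \<in> (if shift F0 i k \<le> shift F0 (Suc i) l then G (shift F0 (Suc i) l - shift F0 i k) else {\<zero>})"
      by (simp only: F0_def graded_free_res.simps free_res.simps Gmem)
  qed
  define F where "F = (SOME F :: ('a, 'a set) graded_free_res. graded_free_resolution R G ?M ?Mg F \<and> minimal_free_resolution R \<mm> ?M F)"
  have FF: "graded_free_resolution R G ?M ?Mg F \<and> minimal_free_resolution R \<mm> ?M F"
    unfolding F_def by (rule someI[of _ F0]) (simp add: F0m F0g)
  hence F: "free_resolution R ?M F" and Fm: "\<And>i k l. k < rank F i \<Longrightarrow> l < rank F (Suc i) \<Longrightarrow> diff F i k l \<in> \<mm>"
    and Fg: "\<And>k. k < rank F 0 \<Longrightarrow> aug F k \<in> ?Mg (shift F 0 k)"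
    and Fd: "\<And>i k l. k < rank F i \<Longrightarrow> l < rank F (Suc i) \<Longrightarrow>
       diff F i k l \<in> (if shift F i k \<le> shift F (Suc i) l then G (shift F (Suc i) l - shift F i k) else {\<zero>})"
    by (auto simp: minimal_free_resolution_def graded_free_resolution_def)
  have "\<forall>k. \<exists>x. k < rank F 0 \<longrightarrow> x \<in> pre (G (shift F 0 k)) \<and> aug F k = qmap A x"
  proof
    fix k
    show "\<exists>x. k < rank F 0 \<longrightarrow> x \<in> pre (G (shift F 0 k)) \<and> aug F k = qmap A x"
    proof (cases "k < rank F 0")
      case True
      from Fg[OF this] obtain y where y: "y \<in> G (shift F 0 k)" "aug F k = A +> y" by (auto simp: quot_grading_def)
      have "y \<in> carrier R" using y(1) additive_subgroup.a_subset[OF graded_ringD(1)[OF G]] by blast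
      then obtain x where "ev x = y" using ev_surj by blast
      thus ?thesis using y by (auto simp: pre_def qmap_def)
    qed simp
  qed
  then obtain a where a: "\<And>k. k < rank F 0 \<Longrightarrow> aug F k = qmap A (a k)" "\<And>k. k < rank F 0 \<Longrightarrow> a k \<in> pre (G (shift F 0 k))" by metis
  obtain D where D: "\<And>i k l. k < rank F i \<Longrightarrow> l < rank F (Suc i) \<Longrightarrow> diff F i k l = ev (D i k l)"
    and res: "res_with NN (pre A) (cplx (rank F) (shift F) D) (\<lambda>(i, k). a k)"
    using matrix_of_resolution[OF A F a(1), of "shift F"] by blast
  let ?F = "cplx (rank F) (shift F) D"
  have mF: "minimal_cpx (pre \<mm>) ?F" using Fm D by (intro cplx_minimal pre_ideal[OF mi]) simp
  have grF: "graded_cpx Gs ?F" unfolding graded_cpx_def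
  proof (intro ballI)
    fix k l assume k: "k \<in> basis ?F" and l: "l \<in> lvl ?F (Suc (hdeg ?F k))"
    obtain i p q where [simp]: "k = (i, p)" "l = (Suc i, q)" and pq: "p < rank F i" "q < rank F (Suc i)"
      using k l by (cases k) (auto simp: cplx_simps lvl_cplx)
    have "D i p q \<in> Gs (shift F (Suc i) q) (shift F i p)" using Fd[OF pq] unfolding D[OF pq] Gmem .
    thus "ent ?F k l \<in> Gs (ideg ?F l) (ideg ?F k)" using pq by (simp add: ent_cplx cplx_simps)
  qed
  have gF: "gres NN Gs (pre A) ?F (\<lambda>(i, k). a k)"
    by (rule gres_graded[OF res grF hA]) (use a(2) in \<open>auto simp: lvl_cplx cplx_simps Gs_def\<close>)
  have gC: "gres NN Gs (pre A) C (\<lambda>_. 1)"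
    by (rule gres_graded[OF cyc_res_with[OF NN_ideal C(1)] C(3) hA])
       (use gcat_one[OF gcat_Gs, of 0] in \<open>auto simp: cyc_resD(3)[OF C(1)] cyc_resD(4)[OF C(1)]\<close>)
  have ne: "id x \<noteq> id y \<Longrightarrow> Gs y x \<subseteq> pre \<mm>" for x y using Gs_ne[of x y] by simp
  note le = minimal_rank_le[OF NN_ideal pre_ideal[OF A] gcat_Gs pre_ideal[OF mi] m(3) residue_field ne, where c = id and d = j and n = i]
  have "card {k \<in> lvl C i. id (ideg C k) = j} = card {k \<in> lvl ?F i. id (ideg ?F k) = j}"
    by (rule antisym[OF le[OF _ _ gC C(2) gF mF] le[OF _ _ gF mF gC C(2)]])
  moreover have "{k \<in> lvl ?F i. id (ideg ?F k) = j} = Pair i ` {k. k < rank F i \<and> shift F i k = j}"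
    by (auto simp: lvl_cplx cplx_simps)
  moreover have "card (Pair i ` {k. k < rank F i \<and> shift F i k = j}) = card {k. k < rank F i \<and> shift F i k = j}"
    by (rule card_image) (simp add: inj_on_def)
  ultimately show ?thesis unfolding graded_betti_def Let_def F_def[symmetric] by simp
qed

lemma pre_ideal_prod_least:
  assumes I: "ideal I R" and J: "ideal J R" and B: "is_ideal B" "NN \<subseteq> B"
    and prods: "\<And>a b. a \<in> pre I \<Longrightarrow> b \<in> pre J \<Longrightarrow> a * b \<in> B"
  shows "pre (ideal_prod R I J) \<subseteq> B"
proof -
  have c: "y \<in> ev ` B" if "y \<in> ideal_prod R I J" for y
    using that
  proof (induction rule: ideal_prod.induct)
    case (prod i j)
    obtain a b where ab: "ev a = i" "ev b = j" using prod ev_surj ideal.Icarr[OF I] ideal.Icarr[OF J] by metis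
    have "a * b \<in> B" using prod ab by (intro prods) (auto simp: pre_def)
    thus ?case unfolding ab[symmetric] ev_mult[symmetric] by (rule imageI)
  next
    case (sum s1 s2)
    then obtain a b where ab: "s1 = ev a" "a \<in> B" "s2 = ev b" "b \<in> B" by auto
    show ?case unfolding ab(1,3) ev_add[symmetric] by (rule imageI) (rule is_ideal_add[OF B(1) ab(2,4)])
  qed
  have "pre (ideal_prod R I J) \<subseteq> pre (ev ` B)" using c by (auto simp: pre_def)
  thus ?thesis by (simp add: pre_image[OF B])
qed

lemma pre_ideal_prod_mem: "a \<in> pre I \<Longrightarrow> b \<in> pre J \<Longrightarrow> a * b \<in> pre (ideal_prod R I J)"
  by (auto simp: pre_def ev_mult intro: ideal_prod.prod)

end

section \<open>Counting bases and the Betti numbers of the quotient\<close>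

lemma cone_count:
  assumes K: "is_cone inl inr \<theta> C Q K" and fin: "finite (lvl C n)" "finite (lvl Q n)"
  shows "card {k \<in> lvl K n. p (ideg K k)} = card {k \<in> lvl C n. p (ideg C k)} + card {k \<in> lvl Q n. p (ideg Q k)}"
proof -
  have "{k \<in> lvl K n. p (ideg K k)} = inl ` {k \<in> lvl C n. p (ideg C k)} \<union> inr ` {k \<in> lvl Q n. p (ideg Q k)}"
    unfolding cone_lvl[OF K] using lvl_basis[of _ C n] lvl_basis[of _ Q n] by (auto simp: is_coneD[OF K])
  also have "card \<dots> = card (inl ` {k \<in> lvl C n. p (ideg C k)}) + card (inr ` {k \<in> lvl Q n. p (ideg Q k)})"
    using fin is_coneD(3)[OF K] by (intro card_Un_disjoint) auto
  also have "\<dots> = card {k \<in> lvl C n. p (ideg C k)} + card {k \<in> lvl Q n. p (ideg Q k)}"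
    using is_coneD(1,2)[OF K] by (simp add: card_image inj_on_subset[of _ UNIV])
  finally show ?thesis .
qed

lemma tensor_rank:
  assumes F: "is_complex N F" and Y: "is_complex N Y" and bn: "b \<le> n"
  shows "card {(s, y). s \<in> basis F \<and> y \<in> basis Y \<and> 1 \<le> hdeg F s \<and> b \<le> hdeg Y y \<and> hdeg F s + hdeg Y y = n} =
    (\<Sum>i = 1..n - b. card (lvl F i) * card (lvl Y (n - i)))"
proof -
  have "{(s, y). s \<in> basis F \<and> y \<in> basis Y \<and> 1 \<le> hdeg F s \<and> b \<le> hdeg Y y \<and> hdeg F s + hdeg Y y = n} =
      (\<Union>i\<in>{1..n - b}. lvl F i \<times> lvl Y (n - i))" using bn by (auto simp: lvl_def)
  also have "card \<dots> = (\<Sum>i\<in>{1..n - b}. card (lvl F i \<times> lvl Y (n - i)))"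
    using is_complex_finite[OF F] is_complex_finite[OF Y]
    by (intro card_UN_disjoint) (auto simp: lvl_def)
  finally show ?thesis by (simp add: card_cartesian_product)
qed

lemma tensor_graded_rank:
  assumes F: "is_complex N F" and Y: "is_complex N Y"
  shows "card {(s, y). s \<in> basis F \<and> y \<in> basis Y \<and> 1 \<le> hdeg F s \<and> hdeg F s + hdeg Y y = n \<and> ideg F s + ideg Y y = d} =
    (\<Sum>i = 1..n. \<Sum>j = 0..d. card {k \<in> lvl F i. ideg F k = j} * card {k \<in> lvl Y (n - i). ideg Y k = d - j})"
proof -
  let ?S = "\<lambda>(i, j). {k \<in> lvl F i. ideg F k = j} \<times> {k \<in> lvl Y (n - i). ideg Y k = d - j}"
  have fin: "finite (?S q)" for q
    using is_complex_finite[OF F, of "fst q"] is_complex_finite[OF Y, of "n - fst q"] by (simp add: split_def)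
  have disj: "?S q \<inter> ?S q' = {}" if "q \<noteq> q'" for q q'
  proof (rule ccontr)
    assume "?S q \<inter> ?S q' \<noteq> {}"
    then obtain s y where "(s, y) \<in> ?S q" "(s, y) \<in> ?S q'" by auto
    hence "fst q = fst q' \<and> snd q = snd q'" by (simp add: split_def lvl_def)
    thus False using that by (simp add: prod_eq_iff)
  qed
  have "{(s, y). s \<in> basis F \<and> y \<in> basis Y \<and> 1 \<le> hdeg F s \<and> hdeg F s + hdeg Y y = n \<and> ideg F s + ideg Y y = d} =
      (\<Union>q\<in>{1..n} \<times> {0..d}. ?S q)" (is "?L = _")
    by (auto simp: lvl_def)
  moreover have "card (\<Union>q\<in>{1..n} \<times> {0..d}. ?S q) = (\<Sum>q\<in>{1..n} \<times> {0..d}. card (?S q))"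
  proof (rule card_UN_disjoint)
    show "finite ({1..n} \<times> {0..d})" by simp
    show "\<forall>q\<in>{1..n} \<times> {0..d}. finite (?S q)" by (rule ballI) (rule fin)
    show "\<forall>q\<in>{1..n} \<times> {0..d}. \<forall>q'\<in>{1..n} \<times> {0..d}. q \<noteq> q' \<longrightarrow> ?S q \<inter> ?S q' = {}"
      using disj by blast
  qed
  moreover have "(\<Sum>q\<in>{1..n} \<times> {0..d}. card (?S q)) = (\<Sum>(i, j)\<in>{1..n} \<times> {0..d}.
      card {k \<in> lvl F i. ideg F k = j} * card {k \<in> lvl Y (n - i). ideg Y k = d - j})"
    by (rule sum.cong[OF refl]) (simp add: split_def card_cartesian_product)
  ultimately show ?thesis by (simp only: sum.cartesian_product)
qed

text \<open>Vandermonde's identity without its two outer terms.\<close>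

lemma vandermonde_inner:
  fixes l m n :: nat assumes "1 \<le> l"
  shows "int (\<Sum>i = 1..l. (m choose i) * (n choose (Suc l - i))) =
     int ((m + n) choose (l + 1)) - int (m choose (l + 1)) - int (n choose (l + 1))"
proof -
  have "(m + n) choose (l + 1) = (\<Sum>k\<le>Suc l. (m choose k) * (n choose (Suc l - k)))"
    using vandermonde[of m n "Suc l"] by simp
  also have "\<dots> = (\<Sum>k\<le>l. (m choose k) * (n choose (Suc l - k))) + (m choose Suc l)" by simp
  also have "(\<Sum>k\<le>l. (m choose k) * (n choose (Suc l - k))) = (n choose Suc l) + (\<Sum>i = 1..l. (m choose i) * (n choose (Suc l - i)))"
    by (simp add: atMost_atLeast0 sum.atLeast_Suc_atMost)
  finally show ?thesis by simp
qed

context product_data begin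

lemma PW_count: "card {k \<in> lvl PW n. p (ideg PW k)} = (if n = 0 \<and> p 0 then 1 else 0) + card {k \<in> lvl W n. p (ideg W k)}"
proof -
  have "{k \<in> lvl (unit_cpx :: (unit, 's) based) n. p (ideg (unit_cpx :: (unit, 's) based) k)} = (if n = 0 \<and> p 0 then {()} else {})" by auto
  thus ?thesis using cone_count[OF is_cone_PW _ is_complex_finite[OF W_complex], of n p] by simp
qed

lemma W_rank: "card (lvl W l) = (\<Sum>i = 1..l. card (lvl Z i) * card (lvl Y (Suc l - i)))"
  unfolding lvl_W using tensor_rank[OF Zc Yc, of 1 "Suc l"] by simp

end

context resolution_data begin

lemma P_count: "card {k \<in> lvl P n. p (ideg P k)} =
   card {k \<in> lvl PW n. p (ideg PW k)} + card {k \<in> lvl U n. p (ideg U k)} + card {k \<in> lvl V n. p (ideg V k)}"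
  using cone_count[OF is_cone_P is_complex_finite[OF PU_complex] is_complex_finite[OF V_complex], of n p]
    cone_count[OF is_cone_PU is_complex_finite[OF PW_complex] is_complex_finite[OF U_complex], of n p] by simp

lemma P_rank: assumes "1 \<le> l"
  shows "card (lvl P l) = (\<Sum>i = 1..l. card (lvl Z i) * card (lvl Y (Suc l - i))) +
    (\<Sum>i = 1..l. card (lvl S i) * card (lvl Y (l - i))) + (\<Sum>i = 1..l. card (lvl T i) * card (lvl Z (l - i)))"
proof -
  have 1: "card (lvl PW l) = card (lvl W l)" using PW_count[of l "\<lambda>_. True"] assms by simp
  have 2: "card (lvl U l) = (\<Sum>i = 1..l. card (lvl S i) * card (lvl Y (l - i)))"
    unfolding lvl_U using tensor_rank[OF Sc Yc, of 0 l] by simp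
  have 3: "card (lvl V l) = (\<Sum>i = 1..l. card (lvl T i) * card (lvl Z (l - i)))"
    unfolding lvl_V using tensor_rank[OF Tc Zc, of 0 l] by simp
  show ?thesis using P_count[of l "\<lambda>_. True"] by (simp add: 1 2 3 W_rank)
qed

lemma P_graded_rank:
  "card {k \<in> lvl P l. ideg P k = d} = card {k \<in> lvl PW l. ideg PW k = d} +
    (\<Sum>i = 1..l. \<Sum>j = 0..d. card {k \<in> lvl S i. ideg S k = j} * card {k \<in> lvl Y (l - i). ideg Y k = d - j}) +
    (\<Sum>i = 1..l. \<Sum>j = 0..d. card {k \<in> lvl T i. ideg T k = j} * card {k \<in> lvl Z (l - i). ideg Z k = d - j})"
proof -
  have 1: "{k \<in> lvl U l. ideg U k = d} = {(s, y). s \<in> basis S \<and> y \<in> basis Y \<and> 1 \<le> hdeg S s \<and> hdeg S s + hdeg Y y = l \<and> ideg S s + ideg Y y = d}"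
    unfolding lvl_U by (auto simp: U_def)
  have 2: "{k \<in> lvl V l. ideg V k = d} = {(s, y). s \<in> basis T \<and> y \<in> basis Z \<and> 1 \<le> hdeg T s \<and> hdeg T s + hdeg Z y = l \<and> ideg T s + ideg Z y = d}"
    unfolding lvl_V by (auto simp: V_def)
  show ?thesis using P_count[of l "\<lambda>x. x = d"] unfolding 1 2 tensor_graded_rank[OF Sc Yc] tensor_graded_rank[OF Tc Zc] by simp
qed

end

context ring_cover begin

lemma homogeneous_regular_sequence:
  assumes G: "graded_ring R G" and gen: "generated_by_regular_sequence R (homogeneous_elements G) A n"
  shows "A \<noteq> carrier R" "\<exists>ys ds. length ys = n \<and> length ds = n \<and> nzd_seq NN ys \<and> pre A = gid NN ys \<and>
     list_all2 (\<lambda>x d. x \<in> graded_mod.Gs NN (\<lambda>d. pre (G d)) d 0) ys ds"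
proof -
  interpret graded_mod NN "\<lambda>d. pre (G d)" by (rule graded_mod_pre[OF G])
  show "A \<noteq> carrier R" using gen by (auto simp: generated_by_regular_sequence_def regular_sequence_def)
  have "homogeneous_elements G \<subseteq> carrier R"
    unfolding homogeneous_elements_def using additive_subgroup.a_subset[OF graded_ringD(1)[OF G]] by blast
  from regular_sequence_pre[OF gen this] obtain ys where
    ys: "length ys = n" "\<forall>y\<in>set ys. ev y \<in> homogeneous_elements G" "nzd_seq NN ys" "pre A = gid NN ys" by blast
  have "\<forall>y\<in>set ys. \<exists>d. y \<in> Gs d 0" 
  proof
    fix y assume "y \<in> set ys"
    then obtain d where "ev y \<in> G d" using ys(2) by (auto simp: homogeneous_elements_def)
    hence "y \<in> Gs d 0" unfolding Gs_def by (simp add: pre_def[of "G d"])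
    thus "\<exists>d. y \<in> Gs d 0" ..
  qed
  then obtain f where f: "\<And>y. y \<in> set ys \<Longrightarrow> y \<in> Gs (f y) 0" by metis
  have "list_all2 (\<lambda>x d. x \<in> Gs d 0) ys (map f ys)" using f by (auto simp: list_all2_conv_all_nth)
  thus "\<exists>ys ds. length ys = n \<and> length ds = n \<and> nzd_seq NN ys \<and> pre A = gid NN ys \<and>
     list_all2 (\<lambda>x d. x \<in> Gs d 0) ys ds" using ys by (intro exI[of _ ys] exI[of _ "map f ys"]) simp
qed

text \<open>Both formulas are read off from the bases of the resolution \<open>P\<close>, formed with the Koszul complexes of \<open>I\<close> and \<open>J\<close> and with
  minimal resolutions of the quotients by \<open>I'\<close> and \<open>J'\<close>. The homogeneous maximal ideal is described by its
  uniqueness, a form that a local ring with the trivial grading satisfies too.\<close>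

theorem betti_numbers_graded:
  assumes noR: "noetherian_ring R" and G: "graded_ring R G"
    and mx: "maximalideal \<mm> R" "homogeneous_ideal R G \<mm>"
    and u: "\<And>\<nn>. maximalideal \<nn> R \<Longrightarrow> homogeneous_ideal R G \<nn> \<Longrightarrow> \<nn> = \<mm>"
    and hom: "homogeneous_ideal R G I" "homogeneous_ideal R G I'" "homogeneous_ideal R G J" "homogeneous_ideal R G J'"
    and gen: "generated_by_regular_sequence R (homogeneous_elements G) I m"
      "generated_by_regular_sequence R (homogeneous_elements G) J n"
    and sub: "I' \<subseteq> I" "J' \<subseteq> J"
    and tor: "tor_independent R I J" "tor_independent R I' J" "tor_independent R I J'"
    and sq: "I' \<subseteq> ideal_prod R I I" "J' \<subseteq> ideal_prod R J J"
  defines "K \<equiv> Idl (I' \<union> ideal_prod R I J \<union> J')"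
    and "\<beta> \<equiv> \<lambda>A. betti R \<mm> (quot_module R A)"
    and "\<beta>g \<equiv> \<lambda>A. graded_betti R G \<mm> (quot_module R A) (quot_grading R G A)"
  shows "\<forall>l \<ge> 1. int (\<beta> K l) =
       (\<Sum>t = 1..l. int (\<beta> I' t * (n choose (l - t)) + (m choose (l - t)) * \<beta> J' t))
         + int ((m + n) choose (l + 1)) - int (m choose (l + 1)) - int (n choose (l + 1))" (is ?A)
    and "(\<forall>d. \<beta>g K 0 d = \<beta>g (ideal_prod R I J) 0 d) \<and>
       (\<forall>l > 0. \<forall>d. \<beta>g K l d = \<beta>g (ideal_prod R I J) l d
           + (\<Sum>i = 1..l. \<Sum>j = 0..d. \<beta>g I' i j * \<beta>g J (l - i) (d - j))
           + (\<Sum>i = 1..l. \<Sum>j = 0..d. \<beta>g I (l - i) (d - j) * \<beta>g J' i j))" (is ?B)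
proof -
  note gq = graded_quot_pre[OF G noR mx u]
  interpret graded_quot NN "\<lambda>d. pre (G d)" "pre \<mm>" by (rule gq)
  have mi: "ideal \<mm> R" using mx(1) by (rule maximalideal.axioms(1))
  have I: "ideal I R" "ideal I' R" "ideal J R" "ideal J' R" using hom by (auto simp: homogeneous_ideal_def)
  obtain xs ds where xs: "length xs = m" "length ds = m" "nzd_seq NN xs" "pre I = gid NN xs"
    "list_all2 (\<lambda>x d. x \<in> Gs d 0) xs ds" using homogeneous_regular_sequence(2)[OF G gen(1)] by blast
  obtain ys es where ys: "length ys = n" "length es = n" "nzd_seq NN ys" "pre J = gid NN ys"
    "list_all2 (\<lambda>x d. x \<in> Gs d 0) ys es" using homogeneous_regular_sequence(2)[OF G gen(2)] by blast
  have leI: "pre I \<subseteq> pre \<mm>" by (rule proper_homogeneous_le[OF G mx u hom(1) homogeneous_regular_sequence(1)[OF G gen(1)]])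
  have leJ: "pre J \<subseteq> pre \<mm>" by (rule proper_homogeneous_le[OF G mx u hom(3) homogeneous_regular_sequence(1)[OF G gen(2)]])
  have subI: "pre I' \<subseteq> pre I" and subJ: "pre J' \<subseteq> pre J" using sub by (auto simp: pre_def)
  define Z where "Z = koszul xs ds"
  define Y where "Y = koszul ys es"
  let ?eZ = "replicate m False" and ?eY = "replicate n False"
  have Z: "cyc_res NN (pre I) Z ?eZ" using koszul_res[OF NN_ideal xs(3), of ds] xs by (simp add: Z_def)
  have Y: "cyc_res NN (pre J) Y ?eY" using koszul_res[OF NN_ideal ys(3), of es] ys by (simp add: Y_def)
  have gZ: "graded_cpx Gs Z" unfolding Z_def by (rule koszul_graded[OF NN_ideal gcat_Gs gmon_Gs xs(5)])
  have gY: "graded_cpx Gs Y" unfolding Y_def by (rule koszul_graded[OF NN_ideal gcat_Gs gmon_Gs ys(5)])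
  have mZ: "minimal_cpx (pre \<mm>) Z"
    unfolding minimal_cpx_def Z_def using gid_ideal[OF NN_ideal, of xs] xs(4) leI
    by (auto intro!: koszul_minimal pre_ideal[OF mi])
  have mY: "minimal_cpx (pre \<mm>) Y"
    unfolding minimal_cpx_def Y_def using gid_ideal[OF NN_ideal, of ys] ys(4) leJ
    by (auto intro!: koszul_minimal pre_ideal[OF mi])
  obtain S :: "(nat \<times> nat, 's) based" where S: "cyc_res NN (pre I') S (0, 0)" "graded_cpx Gs S" "minimal_cpx (pre \<mm>) S"
    using minimal_resolution_ex[OF homogeneous_ideal_pre[OF G hom(2)] order_trans[OF subI leI]] by blast
  obtain T :: "(nat \<times> nat, 's) based" where T: "cyc_res NN (pre J') T (0, 0)" "graded_cpx Gs T" "minimal_cpx (pre \<mm>) T"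
    using minimal_resolution_ex[OF homogeneous_ideal_pre[OF G hom(4)] order_trans[OF subJ leJ]] by blast
  have gresZ: "gres NN Gs (pre I) Z (\<lambda>_. 1)" and gresY: "gres NN Gs (pre J) Y (\<lambda>_. 1)"
    using gcat_one[OF gcat_Gs, of 0] cyc_resD(3,4)[OF Z] cyc_resD(3,4)[OF Y]
    by (auto intro!: gres_graded cyc_res_with[OF NN_ideal Z] cyc_res_with[OF NN_ideal Y] gZ gY homogeneous_ideal_pre[OF G] hom)
  obtain \<phi> where phi: "chain_map NN S Z \<phi>" "hom_map Gs S Z \<phi>" "\<phi> (0, 0) ?eZ = 1"
    using cyc_comparison[OF NN_ideal gcat_Gs S(1,2) Z gresZ subI] by blast
  obtain \<psi> where psi: "chain_map NN T Y \<psi>" "hom_map Gs T Y \<psi>" "\<psi> (0, 0) ?eY = 1"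
    using cyc_comparison[OF NN_ideal gcat_Gs T(1,2) Y gresY subJ] by blast
  have exZY: "exact NN (ttens 0 0 0 Z Y)"
    by (rule tensor_exact[OF NN_ideal cyc_resD(1)[OF Z] tor_independent_exact[OF I(1,3) tor(1) Z] Y])
  have exSY: "exact NN (ttens 0 0 0 S Y)"
    by (rule tensor_exact[OF NN_ideal cyc_resD(1)[OF S(1)] tor_independent_exact[OF I(2,3) tor(2) S(1)] Y])
  have exTZ: "exact NN (ttens 0 0 0 T Z)"
    by (rule tens_flip[OF NN_ideal cyc_resD(1)[OF Z] cyc_resD(1)[OF T(1)]],
        rule tensor_exact[OF NN_ideal cyc_resD(1)[OF Z] tor_independent_exact[OF I(1,4) tor(3) Z] T(1)])
  interpret rd: resolution_data NN Z Y "pre I" "pre J" ?eZ ?eY S T "pre I'" "pre J'" "(0, 0)" "(0, 0)" \<phi> \<psi>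
    by unfold_locales (use Z Y exZY S(1) T(1) exSY exTZ phi(1,3) psi(1,3) subI subJ NN_ideal in auto)
  have sqI: "pre I' \<subseteq> sq_ideal NN xs"
  proof -
    have "pre (ideal_prod R I I) \<subseteq> sq_ideal NN xs"
      by (rule pre_ideal_prod_least[OF I(1,1) sq_ideal_products[OF NN_ideal xs(3)]]) (simp_all add: xs(4))
    thus ?thesis using sq(1) by (auto simp: pre_def)
  qed
  have sqJ: "pre J' \<subseteq> sq_ideal NN ys"
  proof -
    have "pre (ideal_prod R J J) \<subseteq> sq_ideal NN ys"
      by (rule pre_ideal_prod_least[OF I(3,3) sq_ideal_products[OF NN_ideal ys(3)]]) (simp_all add: ys(4))
    thus ?thesis using sq(2) by (auto simp: pre_def)
  qed
  have phim: "\<phi> s x \<in> pre \<mm>" if "s \<in> basis S" "x \<in> lvl Z (hdeg S s)" "1 \<le> hdeg S s" for s x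
    by (rule koszul_comparison_minimal[OF NN_ideal xs(3) _ _ _ S(1,3) sqI, where ds = ds and \<phi> = \<phi>])
       (use that xs leI phi pre_ideal[OF mi] in \<open>auto simp: Z_def\<close>)
  have psim: "\<psi> s x \<in> pre \<mm>" if "s \<in> basis T" "x \<in> lvl Y (hdeg T s)" "1 \<le> hdeg T s" for s x
    by (rule koszul_comparison_minimal[OF NN_ideal ys(3) _ _ _ T(1,3) sqJ, where ds = es and \<phi> = \<psi>])
       (use that ys leJ psi pre_ideal[OF mi] in \<open>auto simp: Y_def\<close>)
  have mP: "minimal_cpx (pre \<mm>) rd.P"
    by (rule rd.P_minimal[OF pre_ideal(1)[OF mi] mZ mY S(3) T(3) phim psim])
  have mPW: "minimal_cpx (pre \<mm>) rd.PW" by (rule rd.PW_minimal[OF pre_ideal(1)[OF mi] mZ mY])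
  have gP: "graded_cpx Gs rd.P" by (rule rd.P_graded[OF gcat_Gs gmon_Gs gZ gY S(2) T(2) phi(2) psi(2)])
  have gPW: "graded_cpx Gs rd.PW" by (rule rd.PW_graded[OF gcat_Gs gmon_Gs gZ gY])
  have IJi: "ideal (ideal_prod R I J) R" by (rule ideal_prod_is_ideal[OF I(1,3)])
  have IJ: "pre (ideal_prod R I J) = rd.IJ"
    by (intro antisym pre_ideal_prod_least[OF I(1,3)] rd.IJ_ideal rd.IJ_products rd.IJ_least pre_ideal[OF IJi] pre_ideal_prod_mem)
  have Kc: "I' \<union> ideal_prod R I J \<union> J' \<subseteq> carrier R"
    using ideal.Icarr[OF I(2)] ideal.Icarr[OF I(4)] ideal.Icarr[OF IJi] by blast
  have Ki: "ideal K R" unfolding K_def by (rule genideal_ideal[OF Kc])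
  have K: "pre K = rd.K"
  proof
    have "pre (I' \<union> ideal_prod R I J \<union> J') = pre I' \<union> rd.IJ \<union> pre J'" unfolding IJ[symmetric] by (auto simp: pre_def)
    hence "pre (I' \<union> ideal_prod R I J \<union> J') \<subseteq> rd.K" using rd.K_contains by simp
    thus "pre K \<subseteq> rd.K" unfolding K_def by (intro pre_Idl_least[OF Kc] rd.K_ideal)
    have "I' \<union> ideal_prod R I J \<union> J' \<subseteq> K" unfolding K_def by (rule genideal_self[OF Kc])
    hence "rd.IJ \<subseteq> pre K" "pre I' \<subseteq> pre K" "pre J' \<subseteq> pre K" unfolding IJ[symmetric] by (auto simp: pre_def)
    thus "rd.K \<subseteq> pre K" by (intro rd.K_least pre_ideal[OF Ki])
  qed
  note one = maximalideal_one[OF mx(1)]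
  have resP: "cyc_res NN (pre K) rd.P (Inl (Inl (Inl ())))" unfolding K by (rule rd.P_res)
  have resPW: "cyc_res NN (pre (ideal_prod R I J)) rd.PW (Inl ())" unfolding IJ by (rule rd.PW_res)
  have bK: "\<beta> K l = card (lvl rd.P l)" for l unfolding \<beta>_def by (rule betti_eq[OF Ki mi one residue_field resP mP])
  have bI': "\<beta> I' l = card (lvl S l)" for l unfolding \<beta>_def by (rule betti_eq[OF I(2) mi one residue_field S(1,3)])
  have bJ': "\<beta> J' l = card (lvl T l)" for l unfolding \<beta>_def by (rule betti_eq[OF I(4) mi one residue_field T(1,3)])
  have cZ: "card (lvl Z i) = m choose i" and cY: "card (lvl Y i) = n choose i" for i
    using koszul_rank[of ds xs i] koszul_rank[of es ys i] xs ys by (simp_all add: Z_def Y_def)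
  show ?A
  proof (intro allI impI)
    fix l :: nat assume l: "1 \<le> l"
    show "int (\<beta> K l) = (\<Sum>t = 1..l. int (\<beta> I' t * (n choose (l - t)) + (m choose (l - t)) * \<beta> J' t))
         + int ((m + n) choose (l + 1)) - int (m choose (l + 1)) - int (n choose (l + 1))"
      using vandermonde_inner[OF l, of m n] unfolding bK bI' bJ' rd.P_rank[OF l] cZ cY
      by (simp add: sum.distrib mult.commute)
  qed
  have gK: "\<beta>g K l d = card {k \<in> lvl rd.P l. ideg rd.P k = d}" for l d
    unfolding \<beta>g_def by (rule graded_betti_eq[OF G gq Ki mi resP mP gP])
  have gIJ: "\<beta>g (ideal_prod R I J) l d = card {k \<in> lvl rd.PW l. ideg rd.PW k = d}" for l d
    unfolding \<beta>g_def by (rule graded_betti_eq[OF G gq IJi mi resPW mPW gPW])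
  have gI: "\<beta>g I l d = card {k \<in> lvl Z l. ideg Z k = d}" for l d
    unfolding \<beta>g_def by (rule graded_betti_eq[OF G gq I(1) mi Z mZ gZ])
  have gJ: "\<beta>g J l d = card {k \<in> lvl Y l. ideg Y k = d}" for l d
    unfolding \<beta>g_def by (rule graded_betti_eq[OF G gq I(3) mi Y mY gY])
  have gI': "\<beta>g I' l d = card {k \<in> lvl S l. ideg S k = d}" for l d
    unfolding \<beta>g_def by (rule graded_betti_eq[OF G gq I(2) mi S(1,3,2)])
  have gJ': "\<beta>g J' l d = card {k \<in> lvl T l. ideg T k = d}" for l d
    unfolding \<beta>g_def by (rule graded_betti_eq[OF G gq I(4) mi T(1,3,2)])
  show ?B
    unfolding gK gIJ gI gJ gI' gJ' rd.P_graded_rank by (simp add: mult.commute)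
qed

end

theorem corollary5p4:
  fixes R :: "('a, 'r) ring_scheme"
    and G :: "nat \<Rightarrow> 'a set"
    and \<mm> I I' J J' :: "'a set"
    and m n :: nat
  defines "local_case \<equiv>
      local_ring R \<mm> \<and>
      generated_by_regular_sequence R (carrier R) I m \<and>
      generated_by_regular_sequence R (carrier R) J n"
    and "graded_case \<equiv>
      standard_graded_ring R G \<mm> \<and>
      homogeneous_ideal R G I \<and> homogeneous_ideal R G I' \<and>
      homogeneous_ideal R G J \<and> homogeneous_ideal R G J' \<and>
      generated_by_regular_sequence R (homogeneous_elements G) I m \<and>
      generated_by_regular_sequence R (homogeneous_elements G) J n"
    and "K \<equiv> Idl\<^bsub>R\<^esub> (I' \<union> ideal_prod R I J \<union> J')"
    and "\<beta> \<equiv> \<lambda>A. betti R \<mm> (quot_module R A)"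
    and "\<beta>g \<equiv> \<lambda>A. graded_betti R G \<mm> (quot_module R A) (quot_grading R G A)"
  assumes "cring R" and "noetherian_ring R"
    and "local_case \<or> graded_case"
    and "ideal I R" and "ideal I' R" and "ideal J R" and "ideal J' R"
    and "I' \<subseteq> I" and "J' \<subseteq> J"
    and "tor_independent R I J" and "tor_independent R I' J" and "tor_independent R I J'"
    and "I' \<subseteq> ideal_prod R I I" and "J' \<subseteq> ideal_prod R J J"
  shows "(\<forall>l \<ge> 1.
            int (\<beta> K l) =
              (\<Sum>t = 1..l. int (\<beta> I' t * (n choose (l - t)) + (m choose (l - t)) * \<beta> J' t))
              + int ((m + n) choose (l + 1)) - int (m choose (l + 1)) - int (n choose (l + 1))) \<and>
         (graded_case \<longrightarrow>
            (\<forall>d. \<beta>g K 0 d = \<beta>g (ideal_prod R I J) 0 d) \<and>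
            (\<forall>l > 0. \<forall>d.
               \<beta>g K l d =
                 \<beta>g (ideal_prod R I J) l d
                 + (\<Sum>i = 1..l. \<Sum>j = 0..d. \<beta>g I' i j * \<beta>g J (l - i) (d - j))
                 + (\<Sum>i = 1..l. \<Sum>j = 0..d. \<beta>g I (l - i) (d - j) * \<beta>g J' i j)))"
proof -
  interpret rc: ring_cover R "sect_at R :: ('a, 'r) sect \<Rightarrow> 'a"
    by (intro ring_cover.intro ring_cover_axioms.intro assms(6) sect_at[OF assms(6)] sect_at_surj[OF assms(6)])
  note main = rc.betti_numbers_graded[OF assms(7) _ _ _ _ _ _ _ _ _ _ assms(13-19)]
  show ?thesis
  proof (cases graded_case)
    case True
    hence g: "graded_ring R G" "maximalideal \<mm> R" "homogeneous_ideal R G \<mm>"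
      "\<And>\<nn>. maximalideal \<nn> R \<Longrightarrow> homogeneous_ideal R G \<nn> \<Longrightarrow> \<nn> = \<mm>"
      "homogeneous_ideal R G I" "homogeneous_ideal R G I'" "homogeneous_ideal R G J" "homogeneous_ideal R G J'"
      "generated_by_regular_sequence R (homogeneous_elements G) I m"
      "generated_by_regular_sequence R (homogeneous_elements G) J n"
      by (auto simp: graded_case_def standard_graded_ring_def)
    show ?thesis unfolding K_def \<beta>_def \<beta>g_def by (intro conjI impI main(1)[OF g] main(2)[OF g])
  next
    case False
    hence l: "local_ring R \<mm>" "generated_by_regular_sequence R (carrier R) I m"
      "generated_by_regular_sequence R (carrier R) J n" using assms(8) by (auto simp: local_case_def)
    \<comment> \<open>The grading concentrated in degree zero.\<close>
    define G' where "G' = (\<lambda>d::nat. if d = 0 then carrier R else {\<zero>\<^bsub>R\<^esub>})"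
    have H: "homogeneous_elements G' = carrier R"
      by (auto simp: homogeneous_elements_def G'_def split: if_splits)
    have mm: "maximalideal \<mm> R" "\<And>\<nn>. maximalideal \<nn> R \<Longrightarrow> \<nn> = \<mm>" using l(1) by (auto simp: local_ring_def)
    note h = rc.trivial_homogeneous[folded G'_def]
    have "\<forall>l \<ge> 1. int (\<beta> K l) =
              (\<Sum>t = 1..l. int (\<beta> I' t * (n choose (l - t)) + (m choose (l - t)) * \<beta> J' t))
              + int ((m + n) choose (l + 1)) - int (m choose (l + 1)) - int (n choose (l + 1))"
      unfolding K_def \<beta>_def
      by (rule main(1)[OF rc.trivial_grading[folded G'_def] mm(1) h[OF maximalideal.axioms(1)[OF mm(1)]] mm(2)
            h[OF assms(9)] h[OF assms(10)] h[OF assms(11)] h[OF assms(12)] l(2)[folded H] l(3)[folded H]])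
    from conjI[OF this] show ?thesis using False by simp
  qed
qed

end
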